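(* There exist algorithms and an absolute constant $C>0$ such that, for all sufficiently large integers $N$: \begin{enumerate} \item all primes $p\leq N$ can be constructed (listed) using space at most $C\, N^{1/3}(\log N)^{2/3}$ and time at most $C\, N\log N$; \item all integers $n\leq N$ can be factored (i.e., for each $n\leq N$ the list of pairs $(p,v_p(n))$ over primes $p\mid n$ is produced) using space at most $C\, N^{1/3}(\log N)^{5/3}$ and time at most $C\, N\log N$; \item for every integer $\Delta$ with $N^{1/3}(\log N)^{2/3}\leq \Delta\leq N$, all primes in the interval $[N-\Delta,N+\Delta]$ can be constructed using space at most $C\,\Delta$ and time at most $C\,\Delta\log N$; \item for every integer $\Delta$ with $N^{1/3}(\log N)^{2/3}\leq \Delta\leq N$, all integers in the interval $[N-\Delta,N+\Delta]$ can be factored using space at most $C\,\Delta\log N$ and time at most $C\,\Delta\log N$. \end{enumerate}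
   Context: Model of computation: arithmetic operations on integers (and rationals with numerator and denominator) of size $O(N)$ — addition, multiplication, division with remainder, comparison, etc. — each count as one time step; time is the number of such word operations. Space is measured in bits of working memory. The output (the list of primes, or the factorizations) may be written sequentially to a separate output stream (slow memory, or handed in batches to another program) and is not counted toward the space bound. For a nonzero integer $n$ and a prime $p$, $v_p(n)$ denotes the largest $k$ with $p^k\mid n$. The implied constants in the bounds are absolute (in particular, independent of $\Delta$). *)

theory Defs
  imports Complex_Main "HOL-Computational_Algebra.Primes" "HOL-Library.Log_Nat"
begin

text \<open>
  The model of computation is a structured three-address language over finitely many registers
  and a bit-addressed working memory. A register holds one rational number (an integer being a
  rational with denominator 1) whose numerator and denominator are at most the word bound \<open>W\<close> in
  absolute value; on an input of magnitude \<open>N\<close> one takes \<open>W = K * N\<close> for a constant \<open>K\<close>. There is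
  no overflow behaviour: an execution that would leave the word bound does not exist.
\<close>

datatype operand = Reg nat | Lit int

datatype arith_op =
    Add | Sub | Mul
  | Ratio  \<comment> \<open>exact division of rationals\<close>
  | Quot | Rem  \<comment> \<open>division with remainder\<close>

datatype cmp_op = Less | Leq | Equal

datatype com =
    Skip
  | Arith nat arith_op operand operand  \<comment> \<open>target register, operation, arguments\<close>
  | Load nat operand operand            \<comment> \<open>target register, bit address, field width\<close>
  | Store operand operand operand       \<comment> \<open>bit address, field width, value\<close>
  | Emit operand                        \<comment> \<open>append a number to the output stream\<close>
  | Seq com com
  | Cond cmp_op operand operand com com
  | Loop cmp_op operand operand com

record state =
  regs :: "nat \<Rightarrow> rat"
  mem :: "nat \<Rightarrow> bool"
  outp :: "nat list"

fun arith :: "arith_op \<Rightarrow> rat \<Rightarrow> rat \<Rightarrow> rat" where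
  "arith Add a b = a + b"
| "arith Sub a b = a - b"
| "arith Mul a b = a * b"
| "arith Ratio a b = a / b"
| "arith Quot a b = of_int \<lfloor>a / b\<rfloor>"
| "arith Rem a b = a - b * of_int \<lfloor>a / b\<rfloor>"

fun compare :: "cmp_op \<Rightarrow> rat \<Rightarrow> rat \<Rightarrow> bool" where
  "compare Less a b \<longleftrightarrow> a < b"
| "compare Leq a b \<longleftrightarrow> a \<le> b"
| "compare Equal a b \<longleftrightarrow> a = b"

fun val :: "state \<Rightarrow> operand \<Rightarrow> rat" where
  "val s (Reg x) = regs s x"
| "val s (Lit c) = of_int c"

definition fits :: "nat \<Rightarrow> rat \<Rightarrow> bool" where
  "fits W q \<longleftrightarrow> \<bar>fst (quotient_of q)\<bar> \<le> int W \<and> \<bar>snd (quotient_of q)\<bar> \<le> int W"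

definition read_field :: "(nat \<Rightarrow> bool) \<Rightarrow> nat \<Rightarrow> nat \<Rightarrow> nat" where
  "read_field M i k = (\<Sum>j<k. if M (i + j) then 2 ^ j else 0)"

definition write_field :: "(nat \<Rightarrow> bool) \<Rightarrow> nat \<Rightarrow> nat \<Rightarrow> nat \<Rightarrow> (nat \<Rightarrow> bool)" where
  "write_field M i k v = (\<lambda>j. if i \<le> j \<and> j < i + k then odd (v div 2 ^ (j - i)) else M j)"

text \<open>
  \<open>exec W c s t m s'\<close>: with word bound \<open>W\<close>, the program \<open>c\<close> started in \<open>s\<close> halts in \<open>s'\<close> after \<open>t\<close>
  word operations, and every memory bit it has accessed has address below \<open>m\<close>. The premises
  \<open>2 ^ k \<le> W\<close> restrict a single memory access to a field of at most one word.
\<close>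

inductive exec :: "nat \<Rightarrow> com \<Rightarrow> state \<Rightarrow> nat \<Rightarrow> nat \<Rightarrow> state \<Rightarrow> bool" for W :: nat where
  Skip: "exec W Skip s 0 0 s"
| Arith: "fits W (arith f (val s a) (val s b)) \<Longrightarrow>
    exec W (Arith x f a b) s 1 0 (s\<lparr>regs := (regs s)(x := arith f (val s a) (val s b))\<rparr>)"
| Load: "val s a = of_nat i \<Longrightarrow> val s w = of_nat k \<Longrightarrow> 2 ^ k \<le> W \<Longrightarrow>
    exec W (Load x a w) s 1 (i + k) (s\<lparr>regs := (regs s)(x := of_nat (read_field (mem s) i k))\<rparr>)"
| Store: "val s a = of_nat i \<Longrightarrow> val s w = of_nat k \<Longrightarrow> 2 ^ k \<le> W \<Longrightarrow>
    val s b = of_nat v \<Longrightarrow> v < 2 ^ k \<Longrightarrow>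
    exec W (Store a w b) s 1 (i + k) (s\<lparr>mem := write_field (mem s) i k v\<rparr>)"
| Emit: "val s a = of_nat v \<Longrightarrow> exec W (Emit a) s 1 0 (s\<lparr>outp := outp s @ [v]\<rparr>)"
| Seq: "exec W c s t m s' \<Longrightarrow> exec W d s' t' m' s'' \<Longrightarrow>
    exec W (Seq c d) s (t + t') (max m m') s''"
| CondTrue: "compare r (val s a) (val s b) \<Longrightarrow> exec W c s t m s' \<Longrightarrow>
    exec W (Cond r a b c d) s (1 + t) m s'"
| CondFalse: "\<not> compare r (val s a) (val s b) \<Longrightarrow> exec W d s t m s' \<Longrightarrow>
    exec W (Cond r a b c d) s (1 + t) m s'"
| LoopFalse: "\<not> compare r (val s a) (val s b) \<Longrightarrow> exec W (Loop r a b c) s 1 0 s"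
| LoopTrue: "compare r (val s a) (val s b) \<Longrightarrow> exec W c s t m s' \<Longrightarrow>
    exec W (Loop r a b c) s' t' m' s'' \<Longrightarrow>
    exec W (Loop r a b c) s (1 + t + t') (max m m') s''"

inductive_cases exec_SkipE: "exec W Skip s t m s'"
inductive_cases exec_ArithE: "exec W (Arith x f a b) s t m s'"
inductive_cases exec_LoadE: "exec W (Load x a w) s t m s'"
inductive_cases exec_StoreE: "exec W (Store a w b) s t m s'"
inductive_cases exec_EmitE: "exec W (Emit a) s t m s'"
inductive_cases exec_SeqE: "exec W (Seq c d) s t m s'"
inductive_cases exec_CondE: "exec W (Cond r a b c d) s t m s'"
inductive_cases exec_LoopE: "exec W (Loop r a b c) s t m s'"

lemma exec_deterministic:
  "exec W c s t m s' \<Longrightarrow> exec W c s u l r' \<Longrightarrow> t = u \<and> m = l \<and> s' = r'"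
proof (induction arbitrary: u l r' rule: exec.induct)
  case (Skip s)
  from Skip.prems show ?case by (rule exec_SkipE) simp
next
  case (Arith f s a b x)
  from Arith.prems show ?case by (rule exec_ArithE) simp
next
  case (Load s a i w k x)
  from Load.prems show ?case by (rule exec_LoadE) (use Load.hyps in simp)
next
  case (Store s a i w k b v)
  from Store.prems show ?case by (rule exec_StoreE) (use Store.hyps in simp)
next
  case (Emit s a v)
  from Emit.prems show ?case by (rule exec_EmitE) (use Emit.hyps in simp)
next
  case (Seq c s t m s' d t' m' s'')
  from Seq.prems show ?case
  proof (rule exec_SeqE)
    fix t1 m1 r t2 m2
    assume *: "u = t1 + t2" "l = max m1 m2" "exec W c s t1 m1 r" "exec W d r t2 m2 r'"
    from Seq.IH(1)[OF *(3)] have e: "t = t1 \<and> m = m1 \<and> s' = r" .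
    from Seq.IH(2)[of t2 m2 r'] *(4) e have "t' = t2 \<and> m' = m2 \<and> s'' = r'" by simp
    with e *(1,2) show ?thesis by simp
  qed
next
  case (CondTrue r s a b c t m s' d)
  from CondTrue.prems show ?case
  proof (rule exec_CondE)
    fix t1
    assume *: "u = Suc t1" "exec W c s t1 l r'"
    from CondTrue.IH[OF *(2)] *(1) show ?thesis by simp
  qed (use CondTrue.hyps in simp)
next
  case (CondFalse r s a b d t m s' c)
  from CondFalse.prems show ?case
  proof (rule exec_CondE)
    fix t1
    assume *: "u = Suc t1" "exec W d s t1 l r'"
    from CondFalse.IH[OF *(2)] *(1) show ?thesis by simp
  qed (use CondFalse.hyps in simp)
next
  case (LoopFalse r s a b c)
  from LoopFalse.prems show ?case by (rule exec_LoopE) (use LoopFalse.hyps in simp_all)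
next
  case (LoopTrue r s a b c t m s' t' m' s'')
  from LoopTrue.prems show ?case
  proof (rule exec_LoopE)
    fix t1 m1 q t2 m2
    assume *: "u = Suc (t1 + t2)" "l = max m1 m2" "exec W c s t1 m1 q"
      "exec W (Loop r a b c) q t2 m2 r'"
    from LoopTrue.IH(1)[OF *(3)] have e: "t = t1 \<and> m = m1 \<and> s' = q" .
    from LoopTrue.IH(2)[of t2 m2 r'] *(4) e have "t' = t2 \<and> m' = m2 \<and> s'' = r'" by simp
    with e *(1,2) show ?thesis by simp
  qed (use LoopTrue.hyps in simp)
qed

fun operand_regs :: "operand \<Rightarrow> nat set" where
  "operand_regs (Reg x) = {x}"
| "operand_regs (Lit c) = {}"

fun com_regs :: "com \<Rightarrow> nat set" where
  "com_regs Skip = {}"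
| "com_regs (Arith x f a b) = {x} \<union> operand_regs a \<union> operand_regs b"
| "com_regs (Load x a w) = {x} \<union> operand_regs a \<union> operand_regs w"
| "com_regs (Store a w b) = operand_regs a \<union> operand_regs w \<union> operand_regs b"
| "com_regs (Emit a) = operand_regs a"
| "com_regs (Seq c d) = com_regs c \<union> com_regs d"
| "com_regs (Cond r a b c d) = operand_regs a \<union> operand_regs b \<union> com_regs c \<union> com_regs d"
| "com_regs (Loop r a b c) = operand_regs a \<union> operand_regs b \<union> com_regs c"

text \<open>
  Space in bits: the whole memory up to the highest accessed bit, plus, for every register, a
  numerator and a denominator of \<open>floorlog 2 W\<close> bits and a sign each. The output stream is free.
\<close>

definition space_bits :: "nat \<Rightarrow> com \<Rightarrow> nat \<Rightarrow> nat" where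
  "space_bits W c m = m + card (com_regs c) * (2 * (floorlog 2 W + 1))"

definition init_state :: "nat list \<Rightarrow> state" where
  "init_state xs = \<lparr>regs = (\<lambda>i. if i < length xs then of_nat (xs ! i) else 0),
     mem = (\<lambda>_. False), outp = []\<rparr>"

definition performs ::
    "nat \<Rightarrow> com \<Rightarrow> nat list \<Rightarrow> (nat list \<Rightarrow> bool) \<Rightarrow> real \<Rightarrow> real \<Rightarrow> bool" where
  "performs W c xs P S T \<longleftrightarrow>
     (\<exists>t m s'. exec W c (init_state xs) t m s' \<and> P (outp s') \<and>
        real (space_bits W c m) \<le> S \<and> real t \<le> T)"

definition lists_primes :: "nat set \<Rightarrow> nat list \<Rightarrow> bool" where
  "lists_primes A ys \<longleftrightarrow> distinct ys \<and> set ys = {p \<in> A. prime p}"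

text \<open>
  The factorization of \<open>n\<close> is written as \<open>n, p\<^sub>1, v\<^sub>1, \<dots>, p\<^sub>k, v\<^sub>k, 0\<close>, where the final \<open>0\<close>
  (which is not a prime) makes the stream uniquely decodable.
\<close>

definition factor_record :: "nat \<Rightarrow> nat list \<Rightarrow> nat list" where
  "factor_record n ps = n # concat (map (\<lambda>p. [p, multiplicity p n]) ps) @ [0]"

definition lists_factorizations :: "nat set \<Rightarrow> nat list \<Rightarrow> bool" where
  "lists_factorizations A ys \<longleftrightarrow>
     (\<exists>ns ps. distinct ns \<and> set ns = A \<and>
        (\<forall>n\<in>A. distinct (ps n) \<and> set (ps n) = {p. prime p \<and> p dvd n}) \<and>
        ys = concat (map (\<lambda>n. factor_record n (ps n)) ns))"

end

theory Submission
  imports Defs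
begin

text \<open>
  All four tasks are split into windows \<open>[A, A + L)\<close> of length \<open>L\<close> about \<open>N\<^bsup>1/3\<^esup> (log N)\<^bsup>2/3\<^esup>\<close>, and a
  window is processed in time \<open>O(L log N)\<close>. Multiples of \<open>d \<le> L\<close> are enumerated directly.
  A larger \<open>d \<le> sqrt (A + L)\<close> has at most one multiple \<open>d k\<close> in the window, and it is too expensive to
  try every \<open>d\<close>: one has to find the lattice points \<open>(d, k)\<close> in the hyperbolic strip
  \<open>A \<le> d k < A + L\<close>.

  For \<open>d\<close> between \<open>M\<close> and \<open>2 M\<close> this is done in blocks of length \<open>R\<close> about \<open>M sqrt (L / N)\<close>. In a block
  starting at \<open>d\<^sub>0\<close>, take a fraction \<open>a / q\<close> with \<open>q \<le> R\<close> within \<open>1 / (q R)\<close> of the slope \<open>A / d\<^sub>0\<^sup>2\<close>. By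
  Taylor expansion the lattice points of the strip lie on \<open>O(1 + q L / M)\<close> consecutive lines
  \<open>a d + q k = c\<close>, and each line fixes \<open>d\<close> modulo \<open>q\<close>. The block therefore costs
  \<open>O(R / q + R L / M)\<close>. The fractions are found by walking down the Farey sequence of order \<open>R\<close>, which has
  \<open>O(L)\<close> terms in the relevant range. Since the slopes of consecutive blocks are separated, a fraction
  \<open>a / q\<close> serves few blocks, and the terms \<open>R / q\<close> also add up to \<open>O(L)\<close>.

  For primes a bit per integer records whether a proper divisor was found. For factorizations one records,
  six times in succession, the largest divisor at most \<open>L\<close> of what is left of \<open>n\<close>. Two such divisors have
  product more than \<open>L\<close> as long as a prime factor at most \<open>L\<close> remains, so after six rounds only prime
  factors above \<open>L\<close> are left, at most two of them. This takes a constant number of words per integer,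
  unlike a list of the prime factors.
\<close>

section \<open>Programs and time credits\<close>

text \<open>The length of a window is dictated by the blocks. The curvature of \<open>A / d\<close>
  may move a point of a block by at most \<open>L / M\<close>, which forces the block length down to
  \<open>R = M div s\<close> with \<open>s\<close> about sqrt (N / L). If \<open>S\<close> is the
  slope at \<open>M\<close>, the terms \<open>R / q\<close> of all blocks between \<open>M\<close>
  and \<open>2 M\<close> add up to a multiple of \<open>S * R^2 + (M / R) * l\<close>, where
  \<open>l\<close> is the bit length of \<open>N\<close> and comes from a harmonic sum over
  denominators. The first summand is at most \<open>L\<close> by the choice of \<open>R\<close>, the
  second is about \<open>s * l\<close>. So the balance is \<open>s * l = O(L)\<close>, that is,
  \<open>L^3\<close> at least of order \<open>N * l^2\<close>: this is the origin of the exponents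
  1/3 and 2/3. With O(l) dyadic ranges a window costs O(L l).

  The Farey walk also yields the inverse of \<open>a\<close> modulo \<open>q\<close>, because two
  neighbours satisfy a determinant equation; no Euclidean algorithm is run for a block.

  Time is amortised through invariants that hold credits for the remaining work: fractions still
  below, blocks still ahead, bits still left in a cofactor.\<close>

primrec opv :: "(nat \<Rightarrow> rat) \<Rightarrow> operand \<Rightarrow> rat" where
  "opv \<rho> (Reg x) = \<rho> x"
| "opv \<rho> (Lit c) = of_int c"

lemma val_eq_opv: "val s a = opv (regs s) a"
  by (cases a) auto

text \<open>
  Weakest preconditions with time credits: \<open>\<tau>\<close> is the number of credits left, one of which is
  consumed by every word operation.
\<close>

definition wp :: "nat \<Rightarrow> nat \<Rightarrow> com \<Rightarrow> (real \<Rightarrow> (nat \<Rightarrow> rat) \<Rightarrow> (nat \<Rightarrow> bool) \<Rightarrow> nat list \<Rightarrow> bool) \<Rightarrow>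
    real \<Rightarrow> (nat \<Rightarrow> rat) \<Rightarrow> (nat \<Rightarrow> bool) \<Rightarrow> nat list \<Rightarrow> bool" where
  "wp W B c Q \<tau> \<rho> \<mu> z \<longleftrightarrow>
     (\<exists>t m s'. exec W c \<lparr>regs = \<rho>, mem = \<mu>, outp = z\<rparr> t m s' \<and> m \<le> B \<and>
        Q (\<tau> - real t) (regs s') (mem s') (outp s'))"

lemma wpI:
  "exec W c \<lparr>regs = \<rho>, mem = \<mu>, outp = z\<rparr> t m s' \<Longrightarrow> m \<le> B \<Longrightarrow>
    Q (\<tau> - real t) (regs s') (mem s') (outp s') \<Longrightarrow> wp W B c Q \<tau> \<rho> \<mu> z"
  by (auto simp: wp_def)

lemma state_eta [simp]: "\<lparr>regs = regs s, mem = mem s, outp = outp s\<rparr> = s"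
  by (cases s) simp

section \<open>Effects that can be read off the program text\<close>

primrec writes :: "com \<Rightarrow> nat set" where
  "writes Skip = {}"
| "writes (Arith x f a b) = {x}"
| "writes (Load x a w) = {x}"
| "writes (Store a w b) = {}"
| "writes (Emit a) = {}"
| "writes (Seq c d) = writes c \<union> writes d"
| "writes (Cond r a b c d) = writes c \<union> writes d"
| "writes (Loop r a b c) = writes c"

primrec stores :: "com \<Rightarrow> bool" where
  "stores Skip = False"
| "stores (Arith x f a b) = False"
| "stores (Load x a w) = False"
| "stores (Store a w b) = True"
| "stores (Emit a) = False"
| "stores (Seq c d) = (stores c \<or> stores d)"
| "stores (Cond r a b c d) = (stores c \<or> stores d)"
| "stores (Loop r a b c) = stores c"

primrec emits :: "com \<Rightarrow> bool" where
  "emits Skip = False"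
| "emits (Arith x f a b) = False"
| "emits (Load x a w) = False"
| "emits (Store a w b) = False"
| "emits (Emit a) = True"
| "emits (Seq c d) = (emits c \<or> emits d)"
| "emits (Cond r a b c d) = (emits c \<or> emits d)"
| "emits (Loop r a b c) = emits c"

text \<open>This is why later invariants mention so few registers: what the text of a command cannot
  change is supplied by \<open>wp_use\<close> and \<open>wp_Loop\<close>.\<close>

lemma exec_frame:
  "exec W c s t m s' \<Longrightarrow>
    (\<forall>x. x \<notin> writes c \<longrightarrow> regs s' x = regs s x) \<and>
    (\<not> stores c \<longrightarrow> mem s' = mem s) \<and> (\<not> emits c \<longrightarrow> outp s' = outp s)"
  by (induction rule: exec.induct) auto

text \<open>A synonym of \<open>of_nat\<close> that the simplifier does not unfold. Register
  contents keep the normal form \<open>nr n\<close>, and \<open>arith_nr\<close> and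
  \<open>compare_nr\<close> move arithmetic and tests to natural numbers.\<close>

definition nr :: "nat \<Rightarrow> rat" where "nr n = of_nat n"

definition isnr :: "rat \<Rightarrow> bool" where "isnr q \<longleftrightarrow> (\<exists>n. q = nr n)"

definition unr :: "rat \<Rightarrow> nat" where "unr q = nat \<lfloor>q\<rfloor>"

definition lit :: "nat \<Rightarrow> operand" where "lit n = Lit (int n)"

lemma opv_lit: "opv \<rho> (lit n) = nr n"
  by (simp add: lit_def nr_def)

lemma isnr_nr [simp]: "isnr (nr n)" and unr_nr [simp]: "unr (nr n) = n"
  by (auto simp: isnr_def unr_def nr_def)

lemma nr_eq_iff [simp]: "nr a = nr b \<longleftrightarrow> a = b"
  and nr_le_iff [simp]: "nr a \<le> nr b \<longleftrightarrow> a \<le> b"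
  and nr_less_iff [simp]: "nr a < nr b \<longleftrightarrow> a < b"
  by (simp_all add: nr_def)

lemma arith_nr:
  "arith Add (nr a) (nr b) = nr (a + b)"
  "b \<le> a \<Longrightarrow> arith Sub (nr a) (nr b) = nr (a - b)"
  "arith Mul (nr a) (nr b) = nr (a * b)"
  "arith Quot (nr a) (nr b) = nr (a div b)"
  "arith Rem (nr a) (nr b) = nr (a mod b)"
proof -
  have f: "\<lfloor>nr a / nr b\<rfloor> = int (a div b)"
    using floor_divide_of_int_eq[of "int a" "int b", where ?'a = rat]
    by (simp add: nr_def zdiv_int)
  then show "arith Quot (nr a) (nr b) = nr (a div b)"
    by (simp add: nr_def)
  have "nr (a mod b) = nr a - nr b * nr (a div b)"
    unfolding nr_def by (metis add_diff_cancel_left' mult_div_mod_eq of_nat_add of_nat_mult)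
  then show "arith Rem (nr a) (nr b) = nr (a mod b)"
    using f by (simp add: nr_def)
qed (simp_all add: nr_def)

lemma compare_nr:
  "compare Less (nr a) (nr b) \<longleftrightarrow> a < b"
  "compare Leq (nr a) (nr b) \<longleftrightarrow> a \<le> b"
  "compare Equal (nr a) (nr b) \<longleftrightarrow> a = b"
  by simp_all

declare arith.simps [simp del] compare.simps [simp del]

lemma fits_nr: "1 \<le> W \<Longrightarrow> fits W (nr n) \<longleftrightarrow> n \<le> W"
  by (simp add: fits_def nr_def)

text \<open>Reduction to lowest terms divides numerator and denominator by their gcd, so neither of
  them grows.\<close>

lemma fits_nr_divide:
  assumes "a \<le> W" "b \<le> W" "0 < b"
  shows "fits W (nr a / nr b)"
proof -
  let ?g = "gcd (int a) (int b)"
  have "nr a / nr b = Fract (int a) (int b)"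
    by (simp add: nr_def Fract_of_int_quotient)
  then have q: "quotient_of (nr a / nr b) = (int a div ?g, int b div ?g)"
    using assms by (simp add: quotient_of_Fract Rat.normalize_def Let_def)
  have "int a div ?g \<le> int a" "int b div ?g \<le> int b"
    by (metis div_by_1 gcd_ge_0_int of_nat_0_le_iff pos_imp_zdiv_nonneg_iff zdiv_mono2 int_one_le_iff_zero_less
        le_less div_by_0)+
  moreover have "0 \<le> int a div ?g" "0 \<le> int b div ?g"
    by (simp_all add: pos_imp_zdiv_nonneg_iff assms)
  ultimately show ?thesis
    using assms by (auto simp: fits_def q)
qed

section \<open>Proof rules for the commands\<close>

lemma wp_Skip: "wp W B Skip Q \<tau> \<rho> \<mu> z \<longleftrightarrow> Q \<tau> \<rho> \<mu> z"
proof
  show "Q \<tau> \<rho> \<mu> z" if "wp W B Skip Q \<tau> \<rho> \<mu> z"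
    using that by (auto simp: wp_def elim: exec_SkipE)
  show "wp W B Skip Q \<tau> \<rho> \<mu> z" if "Q \<tau> \<rho> \<mu> z"
    by (rule wpI[OF exec.Skip]) (use that in auto)
qed

text \<open>Being an equivalence, like the rules for the other commands except loops, it lets the
  simplifier run straight-line code on a symbolic state; the word bound becomes a side
  condition.\<close>

lemma wp_Arith:
  "wp W B (Arith x f a b) Q \<tau> \<rho> \<mu> z \<longleftrightarrow>
    fits W (arith f (opv \<rho> a) (opv \<rho> b)) \<and>
    Q (\<tau> - 1) (\<rho>(x := arith f (opv \<rho> a) (opv \<rho> b))) \<mu> z" (is "?l \<longleftrightarrow> ?r")
proof
  show ?r if ?l
    using that by (auto simp: wp_def val_eq_opv elim!: exec_ArithE)
  assume r: ?r
  show ?l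
    by (rule wpI[OF exec.Arith]) (use r in \<open>auto simp: val_eq_opv\<close>)
qed

lemma wp_Load:
  "wp W B (Load x a w) Q \<tau> \<rho> \<mu> z \<longleftrightarrow>
    isnr (opv \<rho> a) \<and> isnr (opv \<rho> w) \<and> 2 ^ unr (opv \<rho> w) \<le> W \<and>
    unr (opv \<rho> a) + unr (opv \<rho> w) \<le> B \<and>
    Q (\<tau> - 1) (\<rho>(x := nr (read_field \<mu> (unr (opv \<rho> a)) (unr (opv \<rho> w))))) \<mu> z" (is "?l \<longleftrightarrow> ?r")
proof
  show ?r if ?l
    using that by (auto simp: wp_def val_eq_opv isnr_def unr_def nr_def elim!: exec_LoadE)
  assume r: ?r
  then have n: "opv \<rho> a = of_nat (unr (opv \<rho> a))" "opv \<rho> w = of_nat (unr (opv \<rho> w))"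
    by (auto simp: isnr_def unr_def nr_def)
  show ?l
    by (rule wpI[OF exec.Load[where i = "unr (opv \<rho> a)" and k = "unr (opv \<rho> w)"]]) (use r n in \<open>auto simp: val_eq_opv nr_def\<close>)
qed

lemma wp_Store:
  "wp W B (Store a w b) Q \<tau> \<rho> \<mu> z \<longleftrightarrow>
    isnr (opv \<rho> a) \<and> isnr (opv \<rho> w) \<and> isnr (opv \<rho> b) \<and> 2 ^ unr (opv \<rho> w) \<le> W \<and>
    unr (opv \<rho> a) + unr (opv \<rho> w) \<le> B \<and> unr (opv \<rho> b) < 2 ^ unr (opv \<rho> w) \<and>
    Q (\<tau> - 1) \<rho> (write_field \<mu> (unr (opv \<rho> a)) (unr (opv \<rho> w)) (unr (opv \<rho> b))) z" (is "?l \<longleftrightarrow> ?r")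
proof
  show ?r if ?l
    using that by (auto simp: wp_def val_eq_opv isnr_def unr_def nr_def elim!: exec_StoreE)
  assume r: ?r
  then have n: "opv \<rho> a = of_nat (unr (opv \<rho> a))" "opv \<rho> w = of_nat (unr (opv \<rho> w))"
    "opv \<rho> b = of_nat (unr (opv \<rho> b))"
    by (auto simp: isnr_def unr_def nr_def)
  show ?l
    by (rule wpI[OF exec.Store[where i = "unr (opv \<rho> a)" and k = "unr (opv \<rho> w)" and v = "unr (opv \<rho> b)"]]) (use r n in \<open>auto simp: val_eq_opv nr_def\<close>)
qed

lemma wp_Emit:
  "wp W B (Emit a) Q \<tau> \<rho> \<mu> z \<longleftrightarrow>
    isnr (opv \<rho> a) \<and> Q (\<tau> - 1) \<rho> \<mu> (z @ [unr (opv \<rho> a)])" (is "?l \<longleftrightarrow> ?r")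
proof
  show ?r if ?l
    using that by (auto simp: wp_def val_eq_opv isnr_def unr_def nr_def elim!: exec_EmitE)
  assume r: ?r
  then have n: "opv \<rho> a = of_nat (unr (opv \<rho> a))"
    by (auto simp: isnr_def unr_def nr_def)
  show ?l
    by (rule wpI[OF exec.Emit[where v = "unr (opv \<rho> a)"]]) (use r n in \<open>auto simp: val_eq_opv\<close>)
qed

lemma wp_Seq:
  "wp W B (Seq c d) Q \<tau> \<rho> \<mu> z \<longleftrightarrow> wp W B c (wp W B d Q) \<tau> \<rho> \<mu> z" (is "?l \<longleftrightarrow> ?r")
proof
  assume ?l
  then obtain t m s' where e: "exec W (Seq c d) \<lparr>regs = \<rho>, mem = \<mu>, outp = z\<rparr> t m s'" and m: "m \<le> B"
    and q: "Q (\<tau> - real t) (regs s') (mem s') (outp s')"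
    by (auto simp: wp_def)
  from e obtain t1 m1 s1 t2 m2 where *: "exec W c \<lparr>regs = \<rho>, mem = \<mu>, outp = z\<rparr> t1 m1 s1"
    "exec W d s1 t2 m2 s'" "t = t1 + t2" "m = max m1 m2"
    by (auto elim!: exec_SeqE)
  have "exec W d \<lparr>regs = regs s1, mem = mem s1, outp = outp s1\<rparr> t2 m2 s'"
    using *(2) by simp
  then have "wp W B d Q (\<tau> - real t1) (regs s1) (mem s1) (outp s1)"
    unfolding wp_def using m q *(3,4) by (intro exI[of _ t2] exI[of _ m2] exI[of _ s']) (auto simp: algebra_simps)
  then show ?r
    unfolding wp_def[of W B c] using * m by auto
next
  assume ?r
  then obtain t m s' t2 m2 s'' where *: "exec W c \<lparr>regs = \<rho>, mem = \<mu>, outp = z\<rparr> t m s'" "m \<le> B"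
    "exec W d s' t2 m2 s''" "m2 \<le> B" "Q (\<tau> - real t - real t2) (regs s'') (mem s'') (outp s'')"
    by (auto simp: wp_def)
  show ?l
    unfolding wp_def by (intro exI conjI, rule exec.Seq, rule *(1), rule *(3))
      (use * in \<open>auto simp: algebra_simps\<close>)
qed

lemma wp_Cond:
  "wp W B (Cond r a b c d) Q \<tau> \<rho> \<mu> z \<longleftrightarrow>
    (if compare r (opv \<rho> a) (opv \<rho> b) then wp W B c Q (\<tau> - 1) \<rho> \<mu> z
     else wp W B d Q (\<tau> - 1) \<rho> \<mu> z)" (is "?l \<longleftrightarrow> ?r")
proof
  assume ?l
  then obtain t m s' where e: "exec W (Cond r a b c d) \<lparr>regs = \<rho>, mem = \<mu>, outp = z\<rparr> t m s'"
    and m: "m \<le> B" and q: "Q (\<tau> - real t) (regs s') (mem s') (outp s')"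
    by (auto simp: wp_def)
  from e show ?r
    by (rule exec_CondE) (use m q in \<open>auto simp: val_eq_opv wp_def algebra_simps\<close>)
next
  assume r: ?r
  show ?l
  proof (cases "compare r (opv \<rho> a) (opv \<rho> b)")
    case True
    then obtain t m s' where *: "exec W c \<lparr>regs = \<rho>, mem = \<mu>, outp = z\<rparr> t m s'" "m \<le> B"
      "Q (\<tau> - 1 - real t) (regs s') (mem s') (outp s')"
      using r by (auto simp: wp_def)
    show ?thesis
      unfolding wp_def by (intro exI conjI, rule exec.CondTrue[OF _ *(1)])
        (use True * in \<open>auto simp: val_eq_opv algebra_simps\<close>)
  next
    case False
    then obtain t m s' where *: "exec W d \<lparr>regs = \<rho>, mem = \<mu>, outp = z\<rparr> t m s'" "m \<le> B"
      "Q (\<tau> - 1 - real t) (regs s') (mem s') (outp s')"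
      using r by (auto simp: wp_def)
    show ?thesis
      unfolding wp_def by (intro exI conjI, rule exec.CondFalse[OF _ *(1)])
        (use False * in \<open>auto simp: val_eq_opv algebra_simps\<close>)
  qed
qed

text \<open>Rule of consequence and frame rule in one: whatever \<open>c\<close> cannot touch is
  handed on to the new postcondition. It fits the specification of a subprogram into a longer
  run.\<close>

lemma wp_use:
  assumes "wp W B c Q' \<tau> \<rho> \<mu> z"
    and "\<And>\<tau>' \<rho>' \<mu>' z'. Q' \<tau>' \<rho>' \<mu>' z' \<Longrightarrow> \<tau>' \<le> \<tau> \<Longrightarrow> \<forall>x. x \<notin> writes c \<longrightarrow> \<rho>' x = \<rho> x \<Longrightarrow>
      \<not> stores c \<longrightarrow> \<mu>' = \<mu> \<Longrightarrow> \<not> emits c \<longrightarrow> z' = z \<Longrightarrow> Q \<tau>' \<rho>' \<mu>' z'"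
  shows "wp W B c Q \<tau> \<rho> \<mu> z"
proof -
  obtain t m s' where e: "exec W c \<lparr>regs = \<rho>, mem = \<mu>, outp = z\<rparr> t m s'" and m: "m \<le> B"
    and q: "Q' (\<tau> - real t) (regs s') (mem s') (outp s')"
    using assms(1) by (auto simp: wp_def)
  from exec_frame[OF e] have "Q (\<tau> - real t) (regs s') (mem s') (outp s')"
    by (intro assms(2) q) auto
  with e m show ?thesis
    unfolding wp_def by auto
qed

text \<open>The credits serve as the termination measure: every round of a loop consumes at least one.\<close>

lemma wp_Loop:
  assumes "I \<tau> \<rho> \<mu> z"
    and step: "\<And>\<tau>' \<rho>' \<mu>' z'. I \<tau>' \<rho>' \<mu>' z' \<Longrightarrow> \<forall>x. x \<notin> writes c \<longrightarrow> \<rho>' x = \<rho> x \<Longrightarrow>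
      \<not> stores c \<longrightarrow> \<mu>' = \<mu> \<Longrightarrow> \<not> emits c \<longrightarrow> z' = z \<Longrightarrow>
      compare r (opv \<rho>' a) (opv \<rho>' b) \<Longrightarrow> 1 \<le> \<tau>' \<and> wp W B c I (\<tau>' - 1) \<rho>' \<mu>' z'"
    and exit: "\<And>\<tau>' \<rho>' \<mu>' z'. I \<tau>' \<rho>' \<mu>' z' \<Longrightarrow> \<forall>x. x \<notin> writes c \<longrightarrow> \<rho>' x = \<rho> x \<Longrightarrow>
      \<not> stores c \<longrightarrow> \<mu>' = \<mu> \<Longrightarrow> \<not> emits c \<longrightarrow> z' = z \<Longrightarrow>
      \<not> compare r (opv \<rho>' a) (opv \<rho>' b) \<Longrightarrow> Q (\<tau>' - 1) \<rho>' \<mu>' z'"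
  shows "wp W B (Loop r a b c) Q \<tau> \<rho> \<mu> z"
proof -
  define J where "J = (\<lambda>\<tau>' \<rho>' \<mu>' z'. I \<tau>' \<rho>' \<mu>' z' \<and> (\<forall>x. x \<notin> writes c \<longrightarrow> \<rho>' x = \<rho> x) \<and>
    (\<not> stores c \<longrightarrow> \<mu>' = \<mu>) \<and> (\<not> emits c \<longrightarrow> z' = z))"
  have "J \<tau>' \<rho>' \<mu>' z' \<Longrightarrow> wp W B (Loop r a b c) Q \<tau>' \<rho>' \<mu>' z'" for \<tau>' \<rho>' \<mu>' z'
  proof (induction "nat \<lfloor>\<tau>'\<rfloor>" arbitrary: \<tau>' \<rho>' \<mu>' z' rule: less_induct)
    case less
    show ?case
    proof (cases "compare r (opv \<rho>' a) (opv \<rho>' b)")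
      case False
      then have q: "Q (\<tau>' - 1) \<rho>' \<mu>' z'"
        using exit less.prems by (auto simp: J_def)
      show ?thesis
        by (rule wpI[OF exec.LoopFalse]) (use False q in \<open>auto simp: val_eq_opv\<close>)
    next
      case True
      then have 1: "1 \<le> \<tau>'" and w: "wp W B c I (\<tau>' - 1) \<rho>' \<mu>' z'"
        using step less.prems by (auto simp: J_def)
      from w obtain t m s' where e: "exec W c \<lparr>regs = \<rho>', mem = \<mu>', outp = z'\<rparr> t m s'" and m: "m \<le> B"
        and q: "I (\<tau>' - 1 - real t) (regs s') (mem s') (outp s')"
        by (auto simp: wp_def)
      from exec_frame[OF e] q less.prems have j: "J (\<tau>' - 1 - real t) (regs s') (mem s') (outp s')"
        by (auto simp: J_def)
      have "nat \<lfloor>\<tau>' - 1 - real t\<rfloor> < nat \<lfloor>\<tau>'\<rfloor>"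
        using 1 by linarith
      from less.hyps[OF this j] obtain t2 m2 s'' where *: "exec W (Loop r a b c) s' t2 m2 s''" "m2 \<le> B"
        "Q (\<tau>' - 1 - real t - real t2) (regs s'') (mem s'') (outp s'')"
        by (auto simp: wp_def)
      show ?thesis
        unfolding wp_def by (intro exI conjI, rule exec.LoopTrue, use True in \<open>simp add: val_eq_opv\<close>,
            rule e, rule *(1)) (use * m in \<open>auto simp: algebra_simps\<close>)
    qed
  qed
  from this[of \<tau> \<rho> \<mu> z] assms(1) show ?thesis
    by (simp add: J_def)
qed

text \<open>As a congruence rule it keeps the simplifier out of the postcondition, which holds the
  rest of the program; only the current state is rewritten.\<close>

lemma wp_weak_cong:
  "c = c' \<Longrightarrow> \<tau> = \<tau>' \<Longrightarrow> \<rho> = \<rho>' \<Longrightarrow> \<mu> = \<mu>' \<Longrightarrow> z = z' \<Longrightarrow>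
    wp W B c Q \<tau> \<rho> \<mu> z = wp W B c' Q \<tau>' \<rho>' \<mu>' z'"
  by simp

lemmas wp_simps = wp_Skip wp_Arith wp_Load wp_Store wp_Emit wp_Seq wp_Cond
  opv_lit arith_nr compare_nr fits_nr

abbreviation seq_com (infixr ";;" 55) where "c ;; d \<equiv> Seq c d"

section \<open>Lattice points near a hyperbola\<close>

text \<open>The terms from \<open>2 ^ l\<close> to \<open>2 ^ (l + 1) - 1\<close> add up to at most
  1. The bound is a bit length because that is the quantity the programs compute.\<close>

lemma harmonic_sum_le: "n < 2 ^ l \<Longrightarrow> (\<Sum>q=1..n. 1 / real q) \<le> real l"
proof (induction l arbitrary: n)
  case 0
  then show ?case by simp
next
  case (Suc l)
  define k where "k = (2::nat) ^ l"
  have k: "1 \<le> k" "n < 2 * k"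
    using Suc.prems by (auto simp: k_def)
  show ?case
  proof (cases "n < k")
    case True
    then show ?thesis using Suc.IH[of n] by (simp add: k_def)
  next
    case False
    then have split: "{1..n} = {1..k - 1} \<union> {k..n}" using k by auto
    have "(\<Sum>q=1..n. 1 / real q) = (\<Sum>q=1..k - 1. 1 / real q) + (\<Sum>q=k..n. 1 / real q)"
      unfolding split using k by (intro sum.union_disjoint) auto
    moreover have "(\<Sum>q=1..k - 1. 1 / real q) \<le> real l"
      using Suc.IH[of "k - 1"] k by (simp add: k_def)
    moreover have "(\<Sum>q=k..n. 1 / real q) \<le> (\<Sum>q=k..n. 1 / real k)"
      using k by (intro sum_mono) (auto simp: field_simps)
    moreover have "\<dots> \<le> 1"
      using k by (simp add: field_simps)
    ultimately show ?thesis by simp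
  qed
qed

text \<open>A Dirichlet approximation of order \<open>R\<close> to the absolute slope of
  \<open>A / x\<close> at \<open>d\<close>. Coprimality of \<open>a\<close> and \<open>q\<close> is
  left out here; where it matters, an inverse of \<open>a\<close> modulo \<open>q\<close> is given
  explicitly.\<close>

definition slope_approx :: "nat \<Rightarrow> nat \<Rightarrow> nat \<Rightarrow> nat \<Rightarrow> nat \<Rightarrow> bool" where
  "slope_approx A R d a q \<longleftrightarrow> 1 \<le> q \<and> q \<le> R \<and>
     \<bar>real A / (real d)\<^sup>2 - real a / real q\<bar> \<le> 1 / (real q * real R)"

text \<open>
  A lattice point \<open>(d, k)\<close> with \<open>d = d\<^sub>0 + r\<close> lies on the line \<open>a r + q (k - k\<^sub>0) = c\<close>, where
  \<open>k\<^sub>0 = A div d\<^sub>0\<close>. If it also lies in the hyperbolic strip \<open>A \<le> d k < A + L\<close>, then expanding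
  \<open>A / d\<close> to second order around \<open>d\<^sub>0\<close> confines \<open>c\<close> to a short interval.
\<close>

lemma strip_point_residue:
  fixes A L M R s d\<^sub>0 r k a q i :: nat
  assumes M: "0 < M" "M \<le> d\<^sub>0" and R: "r < R" "R * s \<le> M" and A: "A \<le> s\<^sup>2 * L"
    and strip: "A \<le> (d\<^sub>0 + r) * k" "(d\<^sub>0 + r) * k < A + L"
    and approx: "slope_approx A R d\<^sub>0 a q" and inv: "(a * i) mod q = 1 mod q"
  shows "\<exists>c. (A mod d\<^sub>0) * q div d\<^sub>0 \<le> c \<and> c \<le> (A mod d\<^sub>0) * q div d\<^sub>0 + 2 + 2 * q * L div M \<and>
    (i * c) mod q = r mod q"
proof -
  define d where "d = d\<^sub>0 + r"
  define \<sigma> where "\<sigma> = real A / (real d\<^sub>0)\<^sup>2"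
  \<comment> \<open>The value of the linear form at the point, taken as an integer until it is known
    to be non-negative.\<close>
  define C :: int where "C = int a * int r + int q * (int k - int (A div d\<^sub>0))"
  \<comment> \<open>This is \<open>q\<close> times the fractional part of
    \<open>A / d\<^sub>0\<close>; it enters because \<open>k\<close> is measured from
    \<open>A div d\<^sub>0\<close>.\<close>
  define f where "f = real ((A mod d\<^sub>0) * q) / real d\<^sub>0"
  define F where "F = (A mod d\<^sub>0) * q div d\<^sub>0"
  have d0: "0 < d\<^sub>0" and d: "0 < d" "d\<^sub>0 \<le> d" using M by (auto simp: d_def)
  have q: "1 \<le> q" "q \<le> R" and ap: "\<bar>\<sigma> - real a / real q\<bar> \<le> 1 / (real q * real R)"
    using approx by (auto simp: slope_approx_def \<sigma>_def)
  define \<theta> where "\<theta> = real k - real A / real d"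
  have "real A \<le> real d * real k" "real d * real k < real A + real L"
    using strip unfolding d_def[symmetric] by (metis of_nat_mult of_nat_le_iff, metis of_nat_mult of_nat_less_iff of_nat_add)
  then have th: "0 \<le> \<theta>" "\<theta> \<le> real L / real d"
    using d by (auto simp: \<theta>_def pos_divide_le_eq pos_le_divide_eq left_diff_distrib right_diff_distrib mult.commute)
  have th2: "\<theta> \<le> real L / real M"
    using th(2) M d by (smt (verit) frac_le of_nat_0_le_iff of_nat_0_less_iff of_nat_le_iff)
  have dr: "real d = real d\<^sub>0 + real r" by (simp add: d_def)
  \<comment> \<open>An exact identity: putting \<open>d\<close> into the denominator of the
    quadratic term leaves no further remainder to estimate.\<close>
  have taylor: "real A / real d = real A / real d\<^sub>0 - \<sigma> * real r + \<sigma> * (real r)\<^sup>2 / real d"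
  proof -
    have "A / y = A / x - A / x\<^sup>2 * (y - x) + A / x\<^sup>2 * (y - x)\<^sup>2 / y" if "0 < x" "0 < y" for A x y :: real
    proof -
      have "x\<^sup>2 / y = x - (y - x) + (y - x)\<^sup>2 / y"
        using that by (simp add: add_divide_distrib diff_divide_distrib power2_eq_square algebra_simps)
      then have "A / x\<^sup>2 * (x\<^sup>2 / y) = A / x\<^sup>2 * (x - (y - x) + (y - x)\<^sup>2 / y)" by simp
      moreover have "A / x\<^sup>2 * (x\<^sup>2 / y) = A / y" "A / x\<^sup>2 * x = A / x"
        using that by (simp_all add: power2_eq_square)
      ultimately show ?thesis unfolding distrib_left right_diff_distrib times_divide_eq_right by linarith
    qed
    from this[of "real d\<^sub>0" "real d" "real A"] show ?thesis using d d0 unfolding \<sigma>_def dr by simp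
  qed
  have fA: "f = real q * (real A / real d\<^sub>0 - real (A div d\<^sub>0))"
  proof -
    have "real A = real (A div d\<^sub>0) * real d\<^sub>0 + real (A mod d\<^sub>0)"
      by (metis div_mult_mod_eq of_nat_add of_nat_mult)
    then show ?thesis using d0 by (simp add: f_def field_simps)
  qed
  \<comment> \<open>Besides \<open>f\<close> there remain the error of the slope, the curvature, and
    the height \<open>\<theta>\<close> of the point above the hyperbola. The last two are
    non-negative, so only the first can lower \<open>C\<close>.\<close>
  have Ceq: "real_of_int C = f + real r * real q * (real a / real q - \<sigma>)
      + real q * (\<sigma> * (real r)\<^sup>2 / real d) + real q * \<theta>"
  proof -
    have k: "real k = \<theta> + (real A / real d\<^sub>0 - \<sigma> * real r + \<sigma> * (real r)\<^sup>2 / real d)"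
      using taylor by (simp add: \<theta>_def)
    show ?thesis
      using q unfolding C_def fA by (simp add: k algebra_simps)
  qed
  \<comment> \<open>Strict because \<open>r < R\<close>. Strictness gives \<open>C > F - 1\<close>,
    hence \<open>C \<ge> F\<close> for the integer \<open>C\<close>.\<close>
  have t1: "\<bar>real r * real q * (real a / real q - \<sigma>)\<bar> < 1"
  proof -
    have "\<bar>real r * real q * (real a / real q - \<sigma>)\<bar> = real r * real q * \<bar>\<sigma> - real a / real q\<bar>"
      by (simp add: abs_mult abs_minus_commute)
    also have "\<dots> \<le> real r * real q * (1 / (real q * real R))"
      by (intro mult_left_mono ap) auto
    also have "\<dots> = real r / real R" using q by simp
    also have "\<dots> < 1" using R by simp
    finally show ?thesis .
  qed
  \<comment> \<open>The block length is chosen for this: \<open>r * s \<le> M\<close> and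
    \<open>A \<le> s\<^sup>2 * L\<close> give
    \<open>A * r\<^sup>2 \<le> L * M\<^sup>2\<close>.\<close>
  have t2: "0 \<le> \<sigma> * (real r)\<^sup>2 / real d" "\<sigma> * (real r)\<^sup>2 / real d \<le> real L / real M"
  proof -
    show "0 \<le> \<sigma> * (real r)\<^sup>2 / real d" by (simp add: \<sigma>_def)
    have "real A \<le> (real s)\<^sup>2 * real L" using A by (metis of_nat_le_iff of_nat_mult of_nat_power)
    moreover have "real r * real s \<le> real M"
    proof -
      have "r * s \<le> R * s" using R by (simp add: mult_right_mono)
      then have "r * s \<le> M" using R by linarith
      then show ?thesis by (metis of_nat_le_iff of_nat_mult)
    qed
    ultimately have "real A * (real r)\<^sup>2 \<le> (real s)\<^sup>2 * real L * (real r)\<^sup>2" "(real r * real s)\<^sup>2 \<le> (real M)\<^sup>2"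
      by (auto intro!: mult_right_mono power_mono)
    then have "real A * (real r)\<^sup>2 \<le> real L * (real M)\<^sup>2"
      by (smt (verit, ccfv_SIG) mult.commute mult.left_commute mult_left_mono of_nat_0_le_iff power_mult_distrib)
    also have "\<dots> \<le> real L * (real d\<^sub>0)\<^sup>2" using M by (intro mult_left_mono power_mono) auto
    finally have "\<sigma> * (real r)\<^sup>2 \<le> real L" using d0 by (simp add: \<sigma>_def field_simps)
    then have "\<sigma> * (real r)\<^sup>2 / real d \<le> real L / real M"
      using M d by (intro frac_le) auto
    then show "\<sigma> * (real r)\<^sup>2 / real d \<le> real L / real M" .
  qed
  have F: "real F \<le> f" "f < real F + 1"
  proof -
    have "(A mod d\<^sub>0) * q = F * d\<^sub>0 + (A mod d\<^sub>0) * q mod d\<^sub>0" by (simp add: F_def)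
    then have "real ((A mod d\<^sub>0) * q) = real F * real d\<^sub>0 + real ((A mod d\<^sub>0) * q mod d\<^sub>0)"
      by (metis of_nat_add of_nat_mult)
    moreover have "real ((A mod d\<^sub>0) * q mod d\<^sub>0) < real d\<^sub>0" using d0 by simp
    ultimately show "real F \<le> f" "f < real F + 1"
      unfolding f_def using d0 by (auto simp: field_simps)
  qed
  have qpos: "0 \<le> real q * (\<sigma> * (real r)\<^sup>2 / real d)" "0 \<le> real q * \<theta>"
    using mult_nonneg_nonneg[OF of_nat_0_le_iff t2(1)] mult_nonneg_nonneg[OF of_nat_0_le_iff th(1)] by auto
  have qup: "real q * (\<sigma> * (real r)\<^sup>2 / real d) \<le> real q * (real L / real M)" "real q * \<theta> \<le> real q * (real L / real M)"
    using mult_left_mono[OF t2(2) of_nat_0_le_iff] mult_left_mono[OF th2 of_nat_0_le_iff] by auto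
  have "real_of_int C > real F - 1" using Ceq t1 F qpos by linarith
  then have lo: "int F \<le> C" by linarith
  define E where "E = 2 * q * L div M"
  have E: "2 * (real q * (real L / real M)) < real E + 1"
  proof -
    have "2 * q * L < (E + 1) * M" unfolding E_def using M dividend_less_div_times[of M "2*q*L"]
      by (simp add: algebra_simps)
    then have "real (2 * q * L) < real ((E + 1) * M)" by (simp only: of_nat_less_iff)
    then have "2 * real q * real L < (real E + 1) * real M" by (simp only: of_nat_mult of_nat_add of_nat_1 of_nat_numeral)
    then show ?thesis using M by (simp add: field_simps)
  qed
  \<comment> \<open>One unit for rounding \<open>f\<close> down, one for the slope error, and less
    than \<open>E + 1\<close> for curvature and height together.\<close>
  have "real_of_int C < real F + 1 + 1 + real E + 1"
  proof -
    define y where "y = real q * (real L / real M)"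
    have "real q * (\<sigma> * (real r)\<^sup>2 / real d) \<le> y" "real q * \<theta> \<le> y" "2 * y < real E + 1"
      using qup E unfolding y_def by auto
    then show ?thesis using Ceq t1 F by linarith
  qed
  then have hi: "C \<le> int (F + 2 + E)" by linarith
  define c where "c = nat C"
  have c: "int c = C" using lo by (simp add: c_def)
  \<comment> \<open>Modulo \<open>q\<close> the form equals \<open>a * r\<close>, and the inverse
    \<open>i\<close> of \<open>a\<close> recovers \<open>r\<close>.\<close>
  have "int ((i * c) mod q) = int (r mod q)"
  proof -
    have "int ((i * c) mod q) = (int i * C) mod int q" by (simp add: zmod_int c)
    also have "int i * C = int (a * i) * int r + int q * (int i * (int k - int (A div d\<^sub>0)))"
      by (simp add: C_def algebra_simps)
    also have "\<dots> mod int q = (int (a * i) * int r) mod int q" by simp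
    also have "\<dots> = (int (a * i) mod int q * int r) mod int q" by (simp add: mod_mult_left_eq)
    also have "int (a * i) mod int q = 1 mod int q" using inv by (metis of_nat_1 zmod_int)
    also have "(1 mod int q * int r) mod int q = int (r mod q)"
      by (simp add: mod_mult_left_eq zmod_int)
    finally show ?thesis .
  qed
  then have "(i * c) mod q = r mod q" by (simp only: of_nat_eq_iff)
  then show ?thesis using lo hi c unfolding F_def E_def by (intro exI[of _ c]) linarith
qed

text \<open>The determinant equation makes \<open>a / q\<close> exceed the mediant by
  \<open>1 / (q * (q + q'))\<close>, and \<open>q + q' > R\<close>. With
  \<open>mediant_below\<close>, every slope between two Farey neighbours is approximated by one of
  them, and the mediant decides by which.\<close>

lemma mediant_above:
  fixes a q a' q' R :: nat
  assumes "a * q' = a' * q + 1" "R < q + q'" "1 \<le> q" "1 \<le> R" "q \<le> R"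
    and "\<sigma> \<le> real a / real q" "real (a + a') / real (q + q') \<le> \<sigma>"
  shows "\<bar>\<sigma> - real a / real q\<bar> \<le> 1 / (real q * real R)"
proof -
  have e: "real a * real q' = real a' * real q + 1"
    using assms(1) by (metis of_nat_1 of_nat_add of_nat_mult)
  have "real a / real q - real (a + a') / real (q + q') = 1 / (real q * real (q + q'))"
    using assms(3) e by (simp add: field_simps)
  moreover have "1 / (real q * real (q + q')) \<le> 1 / (real q * real R)"
    using assms(2-5) by (intro divide_left_mono mult_left_mono mult_pos_pos) auto
  ultimately show ?thesis using assms(6,7) by linarith
qed

lemma mediant_below:
  fixes a q a' q' R :: nat
  assumes "a * q' = a' * q + 1" "R < q + q'" "1 \<le> q'" "1 \<le> R" "q' \<le> R"
    and "real a' / real q' \<le> \<sigma>" "\<sigma> \<le> real (a + a') / real (q + q')"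
  shows "\<bar>\<sigma> - real a' / real q'\<bar> \<le> 1 / (real q' * real R)"
proof -
  have e: "real a * real q' = real a' * real q + 1"
    using assms(1) by (metis of_nat_1 of_nat_add of_nat_mult)
  have "real (a + a') / real (q + q') - real a' / real q' = 1 / (real q' * real (q + q'))"
    using assms(3) e by (simp add: field_simps)
  moreover have "1 / (real q' * real (q + q')) \<le> 1 / (real q' * real R)"
    using assms(2-5) by (intro divide_left_mono mult_left_mono mult_pos_pos) auto
  ultimately show ?thesis using assms(6,7) by linarith
qed

text \<open>The termination measure of the Farey walk. It counts pairs and not reduced fractions, so
  that its size is bounded by that of a rectangle.\<close>

definition fractions_below :: "nat \<Rightarrow> nat \<Rightarrow> nat \<Rightarrow> (nat \<times> nat) set" where
  "fractions_below R a q = {(x, y). 1 \<le> y \<and> y \<le> R \<and> x * q < a * y}"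

lemma fractions_below_subset:
  assumes "a \<le> b * q"
  shows "fractions_below R a q \<subseteq> {..<b * R} \<times> {1..R}"
proof
  fix z assume "z \<in> fractions_below R a q"
  then obtain x y where z: "z = (x, y)" and y: "1 \<le> y" "y \<le> R" and x: "x * q < a * y"
    by (auto simp: fractions_below_def)
  have "a * y \<le> (b * q) * y" using assms by (rule mult_right_mono) simp
  also have "\<dots> \<le> (b * R) * q" using y by (simp add: mult_mono mult.commute mult.left_commute)
  finally have "x < b * R" using x by (metis le_trans linorder_not_less mult_le_mono1 order.strict_trans1)
  then show "z \<in> {..<b * R} \<times> {1..R}" using y z by simp
qed

lemma card_fractions_below:
  assumes "a \<le> b * q"
  shows "finite (fractions_below R a q)" "card (fractions_below R a q) \<le> b * R * R"
  using finite_subset[OF fractions_below_subset[OF assms]] card_mono[OF _ fractions_below_subset[OF assms, of R]]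
  by simp_all

text \<open>The pair \<open>(a', q')\<close> lies below \<open>a / q\<close> but not below itself,
  so one step of the walk strictly lowers the measure.\<close>

lemma card_fractions_below_step:
  assumes "a * q' = a' * q + 1" "1 \<le> q'" "q' \<le> R" "a \<le> b * q" "1 \<le> q"
  shows "card (fractions_below R a' q') < card (fractions_below R a q)"
proof (rule psubset_card_mono)
  show "finite (fractions_below R a q)" using card_fractions_below(1)[OF assms(4)] .
  have "fractions_below R a' q' \<subseteq> fractions_below R a q"
  proof
    fix z assume "z \<in> fractions_below R a' q'"
    then obtain x y where z: "z = (x, y)" and y: "1 \<le> y" "y \<le> R" and x: "x * q' < a' * y"
      by (auto simp: fractions_below_def)
    have "x * q * q' \<le> a' * q * y" using x by (metis less_imp_le mult.assoc mult.commute mult_le_mono1)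
    also have "\<dots> < a * q' * y" using assms(1) y by simp
    finally have "(x * q) * q' < (a * y) * q'" by (simp add: mult_ac)
    then show "z \<in> fractions_below R a q" using y z by (auto simp: fractions_below_def)
  qed
  moreover have "(a', q') \<in> fractions_below R a q" "(a', q') \<notin> fractions_below R a' q'"
    using assms by (auto simp: fractions_below_def)
  ultimately show "fractions_below R a' q' \<subset> fractions_below R a q" by blast
qed

text \<open>Taking the smallest admissible denominator makes the cost of a block independent of the
  Farey neighbour that the program picks: by \<open>approx_weight_ge\<close> it dominates
  \<open>1 / q\<close> for every admissible \<open>q\<close>. The value 0 is only a default.\<close>

definition approx_weight :: "nat \<Rightarrow> nat \<Rightarrow> nat \<Rightarrow> real" where
  "approx_weight A R d = (if \<exists>q a. slope_approx A R d a q
     then 1 / real (LEAST q. \<exists>a. slope_approx A R d a q) else 0)"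

lemma approx_weight_nonneg: "0 \<le> approx_weight A R d"
  by (simp add: approx_weight_def)

lemma approx_weight_ge:
  assumes "slope_approx A R d a q"
  shows "1 / real q \<le> approx_weight A R d"
proof -
  let ?m = "LEAST q. \<exists>a. slope_approx A R d a q"
  have "?m \<le> q" using assms by (intro Least_le) auto
  moreover have "\<exists>a. slope_approx A R d a ?m" by (rule LeastI[of _ q]) (use assms in auto)
  then have "1 \<le> ?m" by (auto simp: slope_approx_def)
  ultimately show ?thesis using assms by (auto simp: approx_weight_def field_simps)
qed

text \<open>Only the smallest and the largest index matter: their values differ by at most
  \<open>2 * \<delta>\<close>, while every unit of index costs at least \<open>g\<close>.\<close>

lemma card_separated_le:
  fixes f :: "nat \<Rightarrow> real"
  assumes "finite S" "0 < g" "0 \<le> \<delta>"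
    and sep: "\<And>b b'. b \<in> S \<Longrightarrow> b' \<in> S \<Longrightarrow> b \<le> b' \<Longrightarrow> g * (real b' - real b) \<le> f b - f b'"
    and near: "\<And>b. b \<in> S \<Longrightarrow> \<bar>f b - x\<bar> \<le> \<delta>"
  shows "real (card S) \<le> 1 + 2 * \<delta> / g"
proof (cases "S = {}")
  case True
  then show ?thesis using assms by simp
next
  case False
  let ?a = "Min S" and ?b = "Max S"
  have ab: "?a \<in> S" "?b \<in> S" "?a \<le> ?b" using assms(1) False by auto
  have "S \<subseteq> {?a..?b}" using assms(1) by auto
  then have "card S \<le> ?b + 1 - ?a" by (metis card_atLeastAtMost card_mono finite_atLeastAtMost Suc_eq_plus1)
  then have "real (card S) \<le> 1 + (real ?b - real ?a)" using ab(3) by linarith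
  moreover have "g * (real ?b - real ?a) \<le> 2 * \<delta>"
    using sep[OF ab] near[OF ab(1)] near[OF ab(2)] by linarith
  then have "real ?b - real ?a \<le> 2 * \<delta> / g" using assms(2) by (simp add: field_simps)
  ultimately show ?thesis by linarith
qed

text \<open>The difference factors as \<open>d' - d\<close> times
  \<open>1 / (d * d'^2) + 1 / (d^2 * d')\<close>, and each of these summands is at least
  \<open>1 / (8 * M^3)\<close>.\<close>

lemma inverse_square_gap:
  fixes d d' M A :: real
  assumes "0 < d" "d \<le> d'" "d' \<le> 2 * M" "0 \<le> A"
  shows "A / (4 * M ^ 3) * (d' - d) \<le> A / d\<^sup>2 - A / d'\<^sup>2"
proof -
  have e: "A / d\<^sup>2 - A / d'\<^sup>2 = A * (d' - d) * (1 / (d * d'\<^sup>2) + 1 / (d\<^sup>2 * d'))"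
  proof -
    have "1 / d\<^sup>2 - 1 / d'\<^sup>2 = (1 / d - 1 / d') * (1 / d + 1 / d')"
      by (simp add: power2_eq_square algebra_simps)
    moreover have "1 / d - 1 / d' = (d' - d) * (1 / (d * d'))"
      using assms by (simp add: field_simps)
    moreover have "1 / (d * d') * (1 / d + 1 / d') = 1 / (d * d'\<^sup>2) + 1 / (d\<^sup>2 * d')"
      by (simp add: power2_eq_square distrib_left mult_ac)
    ultimately have "1 / d\<^sup>2 - 1 / d'\<^sup>2 = (d' - d) * (1 / (d * d'\<^sup>2) + 1 / (d\<^sup>2 * d'))"
      by (metis mult.assoc)
    then have "A * (1 / d\<^sup>2 - 1 / d'\<^sup>2) = A * ((d' - d) * (1 / (d * d'\<^sup>2) + 1 / (d\<^sup>2 * d')))" by simp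
    then show ?thesis by (simp add: right_diff_distrib mult.assoc)
  qed
  have "d * d'\<^sup>2 \<le> 2 * M * (2 * M)\<^sup>2" using assms by (intro mult_mono power_mono) auto
  moreover have "d\<^sup>2 * d' \<le> (2 * M)\<^sup>2 * (2 * M)" using assms by (intro mult_mono power_mono) auto
  ultimately have "d * d'\<^sup>2 \<le> 8 * M ^ 3" "d\<^sup>2 * d' \<le> 8 * M ^ 3"
    by (simp_all add: power2_eq_square power3_eq_cube algebra_simps)
  then have "1 / (8 * M ^ 3) \<le> 1 / (d * d'\<^sup>2)" "1 / (8 * M ^ 3) \<le> 1 / (d\<^sup>2 * d')"
    using assms by (auto intro!: divide_left_mono)
  then have "1 / (4 * M ^ 3) \<le> 1 / (d * d'\<^sup>2) + 1 / (d\<^sup>2 * d')" by simp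
  then have "A * (d' - d) * (1 / (4 * M ^ 3)) \<le> A * (d' - d) * (1 / (d * d'\<^sup>2) + 1 / (d\<^sup>2 * d'))"
    using assms by (intro mult_left_mono) auto
  then show ?thesis unfolding e by (simp add: algebra_simps)
qed

text \<open>
  Each fraction \<open>a / q\<close> is the approximation of only few blocks, because consecutive blocks have
  slopes that differ by at least \<open>A R / (4 M\<^sup>3)\<close>.
\<close>

lemma sum_approx_weight_le:
  fixes A M R B l :: nat
  assumes M: "0 < M" and A: "M * M \<le> 2 * A" and R: "1 \<le> R" "R < 2 ^ l" and B: "\<And>b. b < B \<Longrightarrow> M + b * R < 2 * M"
  shows "(\<Sum>b<B. approx_weight A R (M + b * R)) \<le>
    5 * (real A / (real M)\<^sup>2) * (real R + 8 * real M ^ 3 / (real A * (real R)\<^sup>2) * real l)"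
proof -
  define f where "f b = real A / (real (M + b * R))\<^sup>2" for b
  define S where "S = real A / (real M)\<^sup>2"
  \<comment> \<open>A bound for numerators: a fraction near a block is at most the largest slope
    \<open>S\<close> plus \<open>1 / q\<close>.\<close>
  define N where "N q = nat \<lfloor>real q * S + 1\<rfloor>" for q
  define near where "near a q = {b. b < B \<and> \<bar>f b - real a / real q\<bar> \<le> 1 / (real q * real R)}" for a q :: nat
  \<comment> \<open>Then \<open>h / q\<close> is \<open>2 * \<delta> / g\<close> of
    \<open>card_separated_le\<close>, with \<open>\<delta> = 1 / (q * R)\<close> and
    \<open>g = A * R / (4 * M^3)\<close>.\<close>
  define h where "h = 8 * real M ^ 3 / (real A * (real R)\<^sup>2)"
  have Apos: "0 < A" using M A by (cases A) auto
  have "real (M * M) \<le> real (2 * A)" using A by (simp only: of_nat_le_iff)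
  then have S: "1 / 2 \<le> S" using M by (simp add: S_def field_simps power2_eq_square)
  have card_near: "real (card (near a q)) \<le> 1 + h / real q" if q: "1 \<le> q" for a q
  proof -
    have "real (card (near a q)) \<le> 1 + 2 * (1 / (real q * real R)) / (real A / (4 * real M ^ 3) * real R)"
    proof (rule card_separated_le[where f = f and x = "real a / real q"])
      show "0 < real A / (4 * real M ^ 3) * real R" using Apos M R by simp
      fix b b' assume b: "b \<in> near a q" "b' \<in> near a q" "b \<le> b'"
      have "real A / (4 * real M ^ 3) * (real (M + b' * R) - real (M + b * R)) \<le> f b - f b'"
        unfolding f_def
      proof (rule inverse_square_gap)
        have "M + b' * R \<le> 2 * M" using B[of b'] b by (simp add: near_def)
        then show "real (M + b' * R) \<le> 2 * real M" by linarith
        show "real (M + b * R) \<le> real (M + b' * R)" using b by (simp add: mult_right_mono)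
        show "0 < real (M + b * R)" using M by (metis of_nat_0_less_iff trans_less_add1)
      qed simp
      then show "real A / (4 * real M ^ 3) * real R * (real b' - real b) \<le> f b - f b'"
        by (simp add: algebra_simps)
    qed (auto simp: near_def)
    also have "2 * (1 / (real q * real R)) / (real A / (4 * real M ^ 3) * real R) = h / real q"
      using q R Apos M unfolding h_def by (simp add: power2_eq_square mult_ac)
    finally show ?thesis .
  qed
  \<comment> \<open>The weight of a block is one summand of a sum over all fractions near it; the
    other summands are non-negative.\<close>
  have "approx_weight A R (M + b * R) \<le>
      (\<Sum>q=1..R. \<Sum>a\<le>N q. if b \<in> near a q then 1 / real q else 0)" if b: "b < B" for b
  proof (cases "\<exists>q a. slope_approx A R (M + b * R) a q")
    case False
    then show ?thesis by (auto simp: approx_weight_def intro!: sum_nonneg)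
  next
    case True
    define q where "q = (LEAST q. \<exists>a. slope_approx A R (M + b * R) a q)"
    have "\<exists>a. slope_approx A R (M + b * R) a q" unfolding q_def using True by (rule LeastI_ex)
    then obtain a where a: "slope_approx A R (M + b * R) a q" ..
    then have q: "1 \<le> q" "q \<le> R" and bn: "b \<in> near a q"
      using b by (auto simp: slope_approx_def near_def f_def)
    have "0 < real M + real b * real R" using M by (simp add: add_pos_nonneg)
    then have fS: "f b \<le> S" unfolding f_def S_def using M by (intro divide_left_mono power_mono) auto
    have "real a / real q \<le> f b + 1 / (real q * real R)" using bn by (auto simp: near_def abs_le_iff)
    also have "1 / (real q * real R) \<le> 1 / real q" using q R by (simp add: field_simps)
    finally have "real a / real q \<le> S + 1 / real q" using fS by linarith
    then have "real a \<le> real q * S + 1" using q by (simp add: field_simps)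
    then have aN: "a \<le> N q" unfolding N_def by linarith
    have "approx_weight A R (M + b * R) = (if b \<in> near a q then 1 / real q else 0)"
      using True bn by (auto simp: approx_weight_def q_def)
    also have "\<dots> \<le> (\<Sum>a\<le>N q. if b \<in> near a q then 1 / real q else 0)"
      using aN by (intro member_le_sum[of a "{..N q}" "\<lambda>a. if b \<in> near a q then 1 / real q else 0"]) auto
    also have "\<dots> \<le> (\<Sum>q=1..R. \<Sum>a\<le>N q. if b \<in> near a q then 1 / real q else 0)"
      using q by (intro member_le_sum[of q "{1..R}" "\<lambda>q. \<Sum>a\<le>N q. if b \<in> near a q then 1 / real q else 0"])
        (auto intro!: sum_nonneg)
    finally show ?thesis .
  qed
  then have "(\<Sum>b<B. approx_weight A R (M + b * R)) \<le>
      (\<Sum>b<B. \<Sum>q=1..R. \<Sum>a\<le>N q. if b \<in> near a q then 1 / real q else 0)"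
    by (intro sum_mono) auto
  \<comment> \<open>Exchanging the sums turns the question into a count of the blocks near a fixed
    fraction, which \<open>card_near\<close> answers.\<close>
  also have "\<dots> = (\<Sum>q=1..R. \<Sum>b<B. \<Sum>a\<le>N q. if b \<in> near a q then 1 / real q else 0)"
    by (rule sum.swap)
  also have "\<dots> = (\<Sum>q=1..R. \<Sum>a\<le>N q. \<Sum>b<B. if b \<in> near a q then 1 / real q else 0)"
    by (rule sum.cong[OF refl], rule sum.swap)
  also have "\<dots> \<le> (\<Sum>q=1..R. \<Sum>a\<le>N q. (1 + h / real q) / real q)"
  proof (intro sum_mono)
    fix q a assume q: "q \<in> {1..R}"
    have "{..<B} \<inter> {b. b \<in> near a q} = near a q" by (auto simp: near_def)
    then have "(\<Sum>b<B. if b \<in> near a q then 1 / real q else 0) = real (card (near a q)) * (1 / real q)"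
      by (simp add: sum.If_cases)
    also have "\<dots> \<le> (1 + h / real q) * (1 / real q)"
      using q card_near by (intro mult_right_mono) auto
    finally show "(\<Sum>b<B. if b \<in> near a q then 1 / real q else 0) \<le> (1 + h / real q) / real q" by simp
  qed
  also have "\<dots> \<le> (\<Sum>q=1..R. 5 * S * (1 + h * (1 / real q)))"
  proof (intro sum_mono)
    fix q assume "q \<in> {1..R}"
    then have q: "1 \<le> real q" by simp
    have h: "0 \<le> h" by (simp add: h_def)
    \<comment> \<open>From \<open>S \<ge> 1 / 2\<close>. It absorbs the constants:
      \<open>N q + 1 \<le> q * S + 2 \<le> 5 * S * q\<close>.\<close>
    have qS: "1 \<le> 2 * (real q * S)" using mult_mono[OF q S] S q by simp
    have "real (N q) \<le> real q * S + 1" unfolding N_def using S q by (simp add: floor_le_iff)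
    then have N: "real (N q) + 1 \<le> 5 * S * real q" using qS by (simp add: algebra_simps)
    have "(\<Sum>a\<le>N q. (1 + h / real q) / real q) = (real (N q) + 1) * ((1 + h / real q) / real q)" by simp
    also have "\<dots> \<le> (5 * S * real q) * ((1 + h / real q) / real q)"
      using N h q by (intro mult_right_mono) auto
    also have "\<dots> = 5 * S * (1 + h * (1 / real q))" using q by simp
    finally show "(\<Sum>a\<le>N q. (1 + h / real q) / real q) \<le> 5 * S * (1 + h * (1 / real q))" .
  qed
  also have "\<dots> = 5 * S * (real R + h * (\<Sum>q=1..R. 1 / real q))"
    by (simp add: sum_distrib_left sum.distrib distrib_left)
  also have "\<dots> \<le> 5 * S * (real R + h * real l)"
    using harmonic_sum_le[OF R(2)] S by (intro mult_left_mono add_left_mono) (auto simp: h_def)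
  finally show ?thesis by (simp add: S_def h_def)
qed

section \<open>Sieving by small divisors\<close>

text \<open>Here \<open>u\<close> is about the cube root of \<open>N / l\<close>, so
  \<open>L\<close> is about \<open>N^(1/3) * l^(2/3)\<close>. The factor 4 in \<open>s\<close> makes
  \<open>s^2 * L = 16 * u^3 * l\<close> at least \<open>2 * N\<close>, a bound for all window
  starts, while \<open>s * l\<close> is still only \<open>4 * L\<close>. The factor 100 leaves room
  for the intermediate values of the programs.\<close>

locale sieve_params =
  fixes N l u L s W B :: nat
  assumes l: "20 \<le> l" "l \<le> u" and N: "2 ^ (l - 1) \<le> N" "N < 2 ^ l"
    and u: "u ^ 3 * l \<le> N" "N < (u + 1) ^ 3 * l"
    and L: "L = u * l" and s: "s = 4 * u" and W: "100 * N \<le> W"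
begin

lemma u_ge: "20 \<le> u" using l by simp

lemma L_ge: "400 \<le> L"
  using mult_mono[of 20 u 20 l] l u_ge by (simp add: L)

lemma L_square_le: "L * L \<le> N"
proof -
  have "L * L = u * u * l * l" by (simp add: L)
  also have "\<dots> \<le> u * u * l * u" using l by (intro mult_left_mono) auto
  also have "\<dots> = u ^ 3 * l" by (simp add: power3_eq_cube)
  finally show ?thesis using u by linarith
qed

lemma L_le: "400 * L \<le> N"
  using mult_right_mono[of 400 L L] L_ge L_square_le by linarith

lemma N_less: "N < 8 * (u ^ 3 * l)"
proof -
  have "(u + 1) ^ 3 * l \<le> (2 * u) ^ 3 * l" using u_ge by (intro mult_right_mono power_mono) auto
  also have "\<dots> = 8 * (u ^ 3 * l)" by (simp add: power_mult_distrib)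
  finally show ?thesis using u by linarith
qed

lemma N_le_s: "2 * N \<le> s\<^sup>2 * L"
proof -
  have "s\<^sup>2 * L = 16 * (u ^ 3 * l)" by (simp add: s L power2_eq_square power3_eq_cube)
  then show ?thesis using N_less by linarith
qed

lemma s_mult_l: "s * l = 4 * L" by (simp add: s L)

lemma s_le: "5 * s \<le> L" using l by (simp add: s L mult.commute)

lemma s_pos: "1 \<le> s" using u_ge by (simp add: s)

text \<open>Since \<open>L^3 = (u^3 * l) * l^2\<close> and \<open>l \<ge> 20\<close>. It excludes
  three factors above \<open>L\<close> in a number up to \<open>3 * N\<close>, which is what the
  factorization rests on.\<close>

lemma N_less_L_cube: "50 * N < L ^ 3"
proof -
  have "400 \<le> l * l" using mult_mono[of 20 l 20 l] l by simp
  then have "(u ^ 3 * l) * 400 \<le> (u ^ 3 * l) * (l * l)" by (rule mult_left_mono) simp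
  also have "\<dots> = L ^ 3" by (simp add: L power3_eq_cube)
  finally show ?thesis using N_less by linarith
qed

lemma W_pos: "1 \<le> W" using W L_le L_ge by linarith

lemma L_less: "L < 2 ^ l" using L_le N L_ge by linarith

end

text \<open>
  A visitor is a command that is run for pairs \<open>(d, j)\<close> with \<open>d dvd A + j\<close>, passed in the registers
  13 and 14. The registers below 13 are parameters, those from 15 to 18 are its scratch space.
  Throughout, registers 0 and 1 hold the input, 2 holds \<open>l\<close>, 4 holds \<open>L\<close>, 5 holds \<open>s\<close>, 6 holds the start \<open>A\<close>
  of the window, 7 the end of the whole range, 8 the width of a memory cell, 9 a lower bound for the
  cofactors \<open>(A + j) div d\<close> visited by the small sieve, and 10 the first cell of the current table.
\<close>

locale visitor = sieve_params +
  fixes A :: nat and V :: com and Inv :: "(nat \<times> nat) set \<Rightarrow> (nat \<Rightarrow> bool) \<Rightarrow> bool"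
    and \<rho>\<^sub>0 :: "nat \<Rightarrow> rat" and k :: real
  assumes writes_V: "writes V \<subseteq> {15, 16, 17, 18}" and emits_V: "\<not> emits V"
    and A: "1 \<le> A" "A \<le> 2 * N" and regs: "\<rho>\<^sub>0 4 = nr L" "\<rho>\<^sub>0 5 = nr s" "\<rho>\<^sub>0 6 = nr A" and k: "0 \<le> k"
    and V: "\<And>P \<tau> \<rho> \<mu> z d j. Inv P \<mu> \<Longrightarrow> \<forall>x<13. \<rho> x = \<rho>\<^sub>0 x \<Longrightarrow> \<rho> 13 = nr d \<Longrightarrow> \<rho> 14 = nr j \<Longrightarrow>
      2 \<le> d \<Longrightarrow> d * d \<le> 27 * N \<Longrightarrow> j < L \<Longrightarrow> d dvd A + j \<Longrightarrow>
      wp W B V (\<lambda>\<tau>' \<rho>' \<mu>' z'. \<tau> - k \<le> \<tau>' \<and> Inv (insert (d, j) P) \<mu>') \<tau> \<rho> \<mu> z"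
begin

lemma notin_writes_V: "x < 15 \<or> 18 < x \<Longrightarrow> x \<notin> writes V"
  using writes_V by auto

end

definition sieve_row :: "com \<Rightarrow> com" where
  "sieve_row V =
    Loop Less (Reg 14) (Reg 4) (V ;; Arith 14 Add (Reg 14) (Reg 13))"

text \<open>With 2 in register 9 only proper divisors are visited; with 1 also \<open>d\<close>
  itself. The starting point is the larger of the first multiple of \<open>d\<close> in the window
  and \<open>d\<close> times that register.\<close>

definition small_sieve :: "com \<Rightarrow> com" where
  "small_sieve V =
    Arith 13 Add (lit 2) (lit 0) ;;
    Loop Leq (Reg 13) (Reg 4) (
      Arith 19 Add (Reg 6) (Reg 13) ;;
      Arith 19 Sub (Reg 19) (lit 1) ;;
      Arith 19 Quot (Reg 19) (Reg 13) ;;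
      Arith 19 Mul (Reg 19) (Reg 13) ;;
      Arith 20 Mul (Reg 9) (Reg 13) ;;
      Cond Less (Reg 19) (Reg 20) (Arith 19 Add (Reg 20) (lit 0)) Skip ;;
      Arith 14 Sub (Reg 19) (Reg 6) ;;
      sieve_row V ;;
      Arith 13 Add (Reg 13) (lit 1))"

lemma first_multiple:
  fixes A d :: nat
  assumes "1 \<le> d"
  shows "d dvd (A + d - 1) div d * d" "A \<le> (A + d - 1) div d * d" "(A + d - 1) div d * d \<le> A + d - 1"
    "\<And>n. d dvd n \<Longrightarrow> A \<le> n \<Longrightarrow> (A + d - 1) div d * d \<le> n"
proof -
  show "d dvd (A + d - 1) div d * d" by simp
  have "A + d - 1 = (A + d - 1) div d * d + (A + d - 1) mod d" by simp
  moreover have "(A + d - 1) mod d < d" using assms by simp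
  ultimately show lo: "A \<le> (A + d - 1) div d * d" and hi: "(A + d - 1) div d * d \<le> A + d - 1"
    using assms by linarith+
  fix n assume "d dvd n" "A \<le> n"
  then obtain m where m: "n = m * d" by (metis dvdE mult.commute)
  show "(A + d - 1) div d * d \<le> n"
  proof (rule ccontr)
    assume "\<not> (A + d - 1) div d * d \<le> n"
    then have "m < (A + d - 1) div d" using m assms by simp
    then have "(m + 1) * d \<le> (A + d - 1) div d * d" by (intro mult_right_mono) auto
    moreover have "(m + 1) * d = n + d" using m by simp
    ultimately show False using \<open>A \<le> n\<close> hi assms by linarith
  qed
qed

context visitor
begin

lemma wp_sieve_row:
  assumes P: "Inv P \<mu>" and env: "\<forall>x<13. \<rho> x = \<rho>\<^sub>0 x" and r: "\<rho> 13 = nr d" "\<rho> 14 = nr j"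
    and d: "2 \<le> d" "d \<le> L" "d dvd A + j" "j \<le> N"
    and t: "(k + 2) * (real L / real d + 1) + 1 \<le> \<tau>"
  shows "wp W B (sieve_row V) (\<lambda>\<tau>' \<rho>' \<mu>' z'. \<tau> - ((k + 2) * (real L / real d + 1) + 1) \<le> \<tau>' \<and>
      Inv (P \<union> {(d, i) | i. j \<le> i \<and> i < L \<and> d dvd A + i}) \<mu>') \<tau> \<rho> \<mu> z"
proof -
  \<comment> \<open>The credit that has to be left at the end. The invariant holds it together with
    the price of the remaining rounds; the later loops follow the same pattern.\<close>
  define \<epsilon> where "\<epsilon> = \<tau> - (k + 2) * (real L / real d + 1)"
  \<comment> \<open>The start \<open>j\<close> may already lie beyond the window, and the last step
    may overshoot it, hence the bound by a maximum. By truncated subtraction the number of remaining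
    rounds is 0 once \<open>i \<ge> L\<close>.\<close>
  define I where "I = (\<lambda>\<tau>' (\<rho>' :: nat \<Rightarrow> rat) \<mu>' (z' :: nat list). \<exists>i. \<rho>' 14 = nr i \<and> j \<le> i \<and> i \<le> max j (2 * L) \<and> d dvd A + i \<and>
     Inv (P \<union> {(d, h) | h. j \<le> h \<and> h < i \<and> h < L \<and> d dvd A + h}) \<mu>' \<and>
     \<epsilon> + (k + 2) * real ((L + d - 1 - i) div d) \<le> \<tau>')"
  have dd: "d * d \<le> 27 * N"
    using mult_mono[OF d(2) d(2)] L_square_le by simp
  have "real ((L + d - 1 - j) div d) \<le> real L / real d + 1"
  proof -
    have "(L + d - 1 - j) div d \<le> (L + d) div d" by (intro div_le_mono) simp
    also have "\<dots> = L div d + 1" using d by simp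
    finally have "real ((L + d - 1 - j) div d) \<le> real (L div d) + 1" by linarith
    moreover have "real (L div d) \<le> real L / real d" by (rule of_nat_div_le_of_nat)
    ultimately show ?thesis by linarith
  qed
  then have "(k + 2) * real ((L + d - 1 - j) div d) \<le> (k + 2) * (real L / real d + 1)"
    using k by (intro mult_left_mono) auto
  moreover have "P \<union> {(d, h) | h. j \<le> h \<and> h < j \<and> h < L \<and> d dvd A + h} = P" by auto
  then have "Inv (P \<union> {(d, h) | h. j \<le> h \<and> h < j \<and> h < L \<and> d dvd A + h}) \<mu>" using P by (simp only:)
  ultimately have I0: "I \<tau> \<rho> \<mu> z"
    unfolding I_def using r d P by (intro exI[of _ j]) (auto simp: \<epsilon>_def)
  show ?thesis
    unfolding sieve_row_def
  proof (rule wp_Loop[where I = I, OF I0])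
    fix \<tau>' \<rho>' \<mu>' z'
    assume I: "I \<tau>' \<rho>' \<mu>' z'" and fr: "\<forall>x. x \<notin> writes (V ;; Arith 14 Add (Reg 14) (Reg 13)) \<longrightarrow> \<rho>' x = \<rho> x"
      and c: "compare Less (opv \<rho>' (Reg 14)) (opv \<rho>' (Reg 4))"
    from I obtain i where i: "\<rho>' 14 = nr i" "j \<le> i" "d dvd A + i"
      and P': "Inv (P \<union> {(d, h) | h. j \<le> h \<and> h < i \<and> h < L \<and> d dvd A + h}) \<mu>'"
      and t': "\<epsilon> + (k + 2) * real ((L + d - 1 - i) div d) \<le> \<tau>'"
      by (auto simp: I_def)
    have r': "\<forall>x<13. \<rho>' x = \<rho>\<^sub>0 x" "\<rho>' 13 = nr d"
      using fr env r notin_writes_V by auto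
    have iL: "i < L" using c i r' regs by (simp add: compare_nr)
    have div: "(L + d - 1 - i) div d = Suc ((L + d - 1 - (i + d)) div d)"
    proof -
      have "L + d - 1 - i = (L + d - 1 - (i + d)) + d" using iL d by simp
      then show ?thesis using d by (metis div_add_self2 not_numeral_le_zero Suc_eq_plus1)
    qed
    have eps: "0 \<le> \<epsilon>" using t by (simp add: \<epsilon>_def)
    have t'': "\<epsilon> + (k + 2) * real ((L + d - 1 - (i + d)) div d) + (k + 2) \<le> \<tau>'"
      using t' unfolding div by (simp add: algebra_simps)
    have ge: "0 \<le> (k + 2) * real ((L + d - 1 - (i + d)) div d)" using k by simp
    have "1 \<le> \<tau>'" using t'' eps k ge by linarith
    moreover have "wp W B (V ;; Arith 14 Add (Reg 14) (Reg 13)) I (\<tau>' - 1) \<rho>' \<mu>' z'"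
      unfolding wp_Seq
    proof (rule wp_use[OF V[OF P' r' i(1) d(1) dd iL i(3)]])
      fix \<tau>2 \<rho>2 \<mu>2 z2
      assume post: "\<tau>' - 1 - k \<le> \<tau>2 \<and>
          Inv (insert (d, i) (P \<union> {(d, h) |h. j \<le> h \<and> h < i \<and> h < L \<and> d dvd A + h})) \<mu>2"
        and fr2: "\<forall>x. x \<notin> writes V \<longrightarrow> \<rho>2 x = \<rho>' x"
      have r2: "\<rho>2 13 = nr d" "\<rho>2 14 = nr i" using fr2 r' i notin_writes_V by auto
      \<comment> \<open>Between \<open>i\<close> and \<open>i + d\<close> there is no other
        multiple, so the visited set grows by exactly one pair.\<close>
      have "insert (d, i) (P \<union> {(d, h) |h. j \<le> h \<and> h < i \<and> h < L \<and> d dvd A + h}) =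
          P \<union> {(d, h) |h. j \<le> h \<and> h < i + d \<and> h < L \<and> d dvd A + h}"
      proof -
        have "h = i" if "i \<le> h" "h < i + d" "d dvd A + h" for h
        proof -
          have "d dvd (A + h) - (A + i)" using that(3) i(3) by (rule dvd_diff_nat)
          then have "d dvd h - i" by simp
          then show ?thesis using that by (auto dest: dvd_imp_le)
        qed
        then show ?thesis using i iL d by (auto simp: not_less)
      qed
      moreover have "i + d \<le> W" using iL d L_le W by linarith
      moreover have "d dvd A + (i + d)" using i(3) by (metis add.assoc dvd_add_triv_right_iff)
      ultimately show "wp W B (Arith 14 Add (Reg 14) (Reg 13)) I \<tau>2 \<rho>2 \<mu>2 z2"
        using post t'' r2 W_pos i iL d
        by (auto simp: wp_simps I_def intro!: exI[of _ "i + d"])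
    qed
    ultimately show "1 \<le> \<tau>' \<and> wp W B (V ;; Arith 14 Add (Reg 14) (Reg 13)) I (\<tau>' - 1) \<rho>' \<mu>' z'" ..
  next
    fix \<tau>' \<rho>' \<mu>' z'
    assume I: "I \<tau>' \<rho>' \<mu>' z'" and fr: "\<forall>x. x \<notin> writes (V ;; Arith 14 Add (Reg 14) (Reg 13)) \<longrightarrow> \<rho>' x = \<rho> x"
      and c: "\<not> compare Less (opv \<rho>' (Reg 14)) (opv \<rho>' (Reg 4))"
    from I obtain i where i: "\<rho>' 14 = nr i" 
      and P': "Inv (P \<union> {(d, h) | h. j \<le> h \<and> h < i \<and> h < L \<and> d dvd A + h}) \<mu>'"
      and t': "\<epsilon> + (k + 2) * real ((L + d - 1 - i) div d) \<le> \<tau>'"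
      by (auto simp: I_def)
    have "\<rho>' 4 = nr L" using fr env regs notin_writes_V by auto
    then have "L \<le> i" using c i by (simp add: compare_nr)
    then have "{(d, h) | h. j \<le> h \<and> h < i \<and> h < L \<and> d dvd A + h} = {(d, h) | h. j \<le> h \<and> h < L \<and> d dvd A + h}"
      by auto
    moreover have "0 \<le> (k + 2) * real ((L + d - 1 - i) div d)" using k by simp
    ultimately show "\<tau> - ((k + 2) * (real L / real d + 1) + 1) \<le> \<tau>' - 1 \<and>
      Inv (P \<union> {(d, i) | i. j \<le> i \<and> i < L \<and> d dvd A + i}) \<mu>'"
      using P' t' by (auto simp: \<epsilon>_def)
  qed
qed

lemma wp_small_sieve:
  assumes P: "Inv P \<mu>" and env: "\<forall>x<13. \<rho> x = \<rho>\<^sub>0 x" and e: "\<rho>\<^sub>0 9 = nr e" "1 \<le> e" "e \<le> 2"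
    and t: "(k + 14) * (real L * real l + real L) + 2 \<le> \<tau>"
  shows "wp W B (small_sieve V) (\<lambda>\<tau>' \<rho>' \<mu>' z'. \<tau> - ((k + 14) * (real L * real l + real L) + 2) \<le> \<tau>' \<and>
      Inv (P \<union> {(d, j). 2 \<le> d \<and> d \<le> L \<and> j < L \<and> d dvd A + j \<and> e * d \<le> A + j}) \<mu>') \<tau> \<rho> \<mu> z"
proof -
  define \<epsilon> where "\<epsilon> = \<tau> - ((k + 14) * (real L * real l + real L) + 2)"
  \<comment> \<open>The 12 covers the operations of a round outside the visits. Summing
    \<open>L / d\<close> over all \<open>d\<close> produces the factor \<open>l\<close>.\<close>
  define cost where "cost d = (k + 2) * (real L / real d + 1) + 12" for d :: nat
  define S where "S i = {(d, j). 2 \<le> d \<and> d < i \<and> d \<le> L \<and> j < L \<and> d dvd A + j \<and> e * d \<le> A + j}" for i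
  define I where "I = (\<lambda>\<tau>' (\<rho>' :: nat \<Rightarrow> rat) \<mu>' (z' :: nat list). \<exists>i. \<rho>' 13 = nr i \<and> 2 \<le> i \<and> i \<le> L + 1 \<and>
     Inv (P \<union> S i) \<mu>' \<and> \<epsilon> + 1 + (\<Sum>d=i..L. cost d) \<le> \<tau>')"
  have cost_pos: "0 \<le> cost d" for d using k by (simp add: cost_def)
  have eps: "0 \<le> \<epsilon>" using t by (simp add: \<epsilon>_def)
  have sum: "(\<Sum>d=2..L. cost d) \<le> (k + 14) * (real L * real l + real L)"
  proof -
    have "(\<Sum>d=2..L. cost d) \<le> (\<Sum>d=1..L. cost d)"
      by (intro sum_mono2) (auto simp: cost_pos)
    also have "\<dots> = (k + 2) * (real L * (\<Sum>d=1..L. 1 / real d)) + (k + 14) * real L"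
      by (simp add: cost_def sum.distrib sum_distrib_left distrib_left algebra_simps)
    also have "\<dots> \<le> (k + 14) * (real L * real l) + (k + 14) * real L"
      using harmonic_sum_le[OF L_less] k by (intro add_right_mono mult_mono mult_left_mono) (auto intro!: mult_nonneg_nonneg sum_nonneg)
    finally show ?thesis by (simp add: algebra_simps)
  qed
  let ?body = "Arith 19 Add (Reg 6) (Reg 13) ;;
      Arith 19 Sub (Reg 19) (lit 1) ;;
      Arith 19 Quot (Reg 19) (Reg 13) ;;
      Arith 19 Mul (Reg 19) (Reg 13) ;;
      Arith 20 Mul (Reg 9) (Reg 13) ;;
      Cond Less (Reg 19) (Reg 20) (Arith 19 Add (Reg 20) (lit 0)) Skip ;;
      Arith 14 Sub (Reg 19) (Reg 6) ;;
      sieve_row V ;;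
      Arith 13 Add (Reg 13) (lit 1)"
  have loop: "wp W B (Loop Leq (Reg 13) (Reg 4) ?body) (\<lambda>\<tau>' \<rho>' \<mu>' z'. \<epsilon> \<le> \<tau>' \<and>
      Inv (P \<union> {(d, j). 2 \<le> d \<and> d \<le> L \<and> j < L \<and> d dvd A + j \<and> e * d \<le> A + j}) \<mu>') (\<tau> - 1) (\<rho>(13 := nr 2)) \<mu> z"
  proof (rule wp_Loop[where I = I])
    have "S 2 = {}" by (auto simp: S_def)
    then show "I (\<tau> - 1) (\<rho>(13 := nr 2)) \<mu> z"
      using P sum L_ge by (auto simp: I_def \<epsilon>_def intro!: exI[of _ 2])
  next
    fix \<tau>' \<rho>' \<mu>' z'
    assume I: "I \<tau>' \<rho>' \<mu>' z'" and fr: "\<forall>x. x \<notin> writes ?body \<longrightarrow> \<rho>' x = (\<rho>(13 := nr 2)) x"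
      and c: "compare Leq (opv \<rho>' (Reg 13)) (opv \<rho>' (Reg 4))"
    from I obtain d where d: "\<rho>' 13 = nr d" "2 \<le> d" and P': "Inv (P \<union> S d) \<mu>'"
      and t': "\<epsilon> + 1 + (\<Sum>d=d..L. cost d) \<le> \<tau>'"
      by (auto simp: I_def)
    have env': "\<forall>x<13. \<rho>' x = \<rho>\<^sub>0 x"
      using fr env notin_writes_V by (auto simp: sieve_row_def)
    then have r: "\<rho>' 4 = nr L" "\<rho>' 6 = nr A" "\<rho>' 9 = nr e" using regs e by auto
    have dL: "d \<le> L" using c d r by (simp add: compare_nr)
    then have t'': "\<epsilon> + 1 + cost d + (\<Sum>d=d+1..L. cost d) \<le> \<tau>'"
      using t' by (simp add: sum.atLeast_Suc_atMost)
    have pos: "0 \<le> (\<Sum>d=d+1..L. cost d)" by (intro sum_nonneg cost_pos)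
    define x where "x = max ((A + d - 1) div d * d) (e * d)"
    have ed: "e * d \<le> 2 * L" using mult_mono[OF e(3) dL] by simp
    have x: "d dvd x" "A \<le> x" "e * d \<le> x" "x \<le> A + 2 * L" "\<And>n. d dvd n \<Longrightarrow> A \<le> n \<Longrightarrow> e * d \<le> n \<Longrightarrow> x \<le> n"
    proof -
      define y where "y = (A + d - 1) div d * d"
      have y: "d dvd y" "A \<le> y" "y \<le> A + d - 1" "\<And>n. d dvd n \<Longrightarrow> A \<le> n \<Longrightarrow> y \<le> n"
        unfolding y_def using first_multiple(1-3)[of d A] first_multiple(4)[where A = A and d = d] d by auto
      have xy: "x = max y (e * d)" by (simp add: x_def y_def)
      show "d dvd x" "A \<le> x" "e * d \<le> x" "x \<le> A + 2 * L" "\<And>n. d dvd n \<Longrightarrow> A \<le> n \<Longrightarrow> e * d \<le> n \<Longrightarrow> x \<le> n"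
        unfolding xy using y dL ed by (auto simp: max_def)
    qed
    have f: "(A + d - 1) div d * d \<le> W" "e * d \<le> W" "A + d - 1 \<le> W" "(A + d - 1) div d \<le> W" "x \<le> W"
      "A + d \<le> W" "d + 1 \<le> W" "1 \<le> A + d" "x - A \<le> W"
      using first_multiple(3)[of d A] ed A L_le L_ge W dL d x(4) div_le_dividend[of "A + d - 1" d] by linarith+
    define \<tau>1 where "\<tau>1 = \<tau>' - 1 - (if (A + d - 1) div d * d < e * d then 8 else 7)"
    have tau1: "\<tau>' - 9 \<le> \<tau>1" by (simp add: \<tau>1_def)
    have Rset: "P \<union> S d \<union> {(d, i) |i. x - A \<le> i \<and> i < L \<and> d dvd A + i} = P \<union> S (d + 1)"
    proof -
      have "(x - A \<le> i \<and> i < L \<and> d dvd A + i) \<longleftrightarrow> (i < L \<and> d dvd A + i \<and> e * d \<le> A + i)" for i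
        using x(5)[of "A + i"] x(2,3) by auto
      then show ?thesis using d dL by (auto simp: S_def less_Suc_eq)
    qed
    define \<rho>1 where "\<rho>1 = \<rho>'(19 := nr x, 20 := nr (e * d), 14 := nr (x - A))"
    have t1: "(k + 2) * (real L / real d + 1) + 1 \<le> \<tau>1"
      using t'' pos eps tau1 by (simp add: cost_def)
    have row: "wp W B (sieve_row V) (wp W B (Arith 13 Add (Reg 13) (lit 1)) I) \<tau>1 \<rho>1 \<mu>' z'"
    proof (rule wp_use[OF wp_sieve_row[OF P' _ _ _ d(2) dL _ _ t1]])
      show "\<forall>x<13. \<rho>1 x = \<rho>\<^sub>0 x" using env' by (simp add: \<rho>1_def)
      show "\<rho>1 13 = nr d" using d by (simp add: \<rho>1_def)
      show "\<rho>1 14 = nr (x - A)" by (simp add: \<rho>1_def)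
      show "d dvd A + (x - A)" using x by simp
      show "x - A \<le> N" using x L_le by linarith
      fix \<tau>2 \<rho>2 \<mu>2 z2
      assume post: "\<tau>1 - ((k + 2) * (real L / real d + 1) + 1) \<le> \<tau>2 \<and>
        Inv (P \<union> S d \<union> {(d, i) |i. x - A \<le> i \<and> i < L \<and> d dvd A + i}) \<mu>2"
        and fr2: "\<forall>x. x \<notin> writes (sieve_row V) \<longrightarrow> \<rho>2 x = \<rho>1 x"
      have "\<rho>2 13 = nr d" using fr2 d notin_writes_V by (auto simp: sieve_row_def \<rho>1_def)
      then show "wp W B (Arith 13 Add (Reg 13) (lit 1)) I \<tau>2 \<rho>2 \<mu>2 z2"
        using post t'' tau1 f W_pos d dL unfolding Rset
        by (auto simp: wp_simps I_def cost_def intro!: exI[of _ "d + 1"])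
    qed
    have "wp W B ?body I (\<tau>' - 1) \<rho>' \<mu>' z'"
      using row f W_pos d r x(2) unfolding \<tau>1_def \<rho>1_def x_def
      by (auto simp: wp_simps max_def fun_upd_twist simp del: One_nat_def split: if_splits cong: wp_weak_cong)
    moreover have "1 \<le> \<tau>'" using t'' pos eps k by (simp add: cost_def) (smt (verit) divide_nonneg_nonneg mult_nonneg_nonneg of_nat_0_le_iff)
    ultimately show "1 \<le> \<tau>' \<and> wp W B ?body I (\<tau>' - 1) \<rho>' \<mu>' z'" by blast
  next
    fix \<tau>' \<rho>' \<mu>' z'
    assume I: "I \<tau>' \<rho>' \<mu>' z'" and fr: "\<forall>x. x \<notin> writes ?body \<longrightarrow> \<rho>' x = (\<rho>(13 := nr 2)) x"
      and c: "\<not> compare Leq (opv \<rho>' (Reg 13)) (opv \<rho>' (Reg 4))"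
    from I obtain d where d: "\<rho>' 13 = nr d" "2 \<le> d" and P': "Inv (P \<union> S d) \<mu>'"
      and t': "\<epsilon> + 1 + (\<Sum>d=d..L. cost d) \<le> \<tau>'"
      by (auto simp: I_def)
    have "\<rho>' 4 = nr L"
      using fr env regs notin_writes_V by (auto simp: sieve_row_def)
    then have "L < d" using c d by (simp add: compare_nr)
    then have "S d = {(d, j). 2 \<le> d \<and> d \<le> L \<and> j < L \<and> d dvd A + j \<and> e * d \<le> A + j}" "(\<Sum>d=d..L. cost d) = 0"
      by (auto simp: S_def)
    then show "\<epsilon> \<le> \<tau>' - 1 \<and> Inv (P \<union> {(d, j). 2 \<le> d \<and> d \<le> L \<and> j < L \<and> d dvd A + j \<and> e * d \<le> A + j}) \<mu>'"
      using P' t' by simp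
  qed
  have "2 \<le> W" using L_le L_ge W by linarith
  then show ?thesis
    using loop W_pos unfolding small_sieve_def \<epsilon>_def by (auto simp: wp_simps cong: wp_weak_cong)
qed

end

section \<open>Sieving by large divisors\<close>

text \<open>Registers of the large sieve: 20 holds \<open>M\<close>, 21 the start of the block, 22
  to 25 the Farey pair, 26 the block length \<open>R\<close>, 27 the slope, 29 and 30 the chosen
  denominator and the inverse, 31 and 32 the current and the last line, 33 the offset in the block,
  36 to 38 hold \<open>2 M\<close>, \<open>A + L\<close> and \<open>M^2\<close>.\<close>

definition visit_candidate :: "com \<Rightarrow> com" where
  "visit_candidate V =
    Arith 13 Add (Reg 21) (Reg 33) ;;
    Arith 34 Add (Reg 6) (Reg 13) ;;
    Arith 34 Sub (Reg 34) (lit 1) ;;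
    Arith 34 Quot (Reg 34) (Reg 13) ;;
    Arith 34 Mul (Reg 34) (Reg 13) ;;
    Arith 14 Sub (Reg 34) (Reg 6) ;;
    Cond Less (Reg 14) (Reg 4) V Skip"

definition visit_progression :: "com \<Rightarrow> com" where
  "visit_progression V =
    Loop Less (Reg 33) (Reg 26) (visit_candidate V ;; Arith 33 Add (Reg 33) (Reg 29))"

text \<open>The lines run through the interval of \<open>strip_point_residue\<close>; on line
  \<open>c\<close> the offsets congruent to \<open>i * c\<close> are the candidates.\<close>

definition sieve_block :: "com \<Rightarrow> com" where
  "sieve_block V =
    Arith 31 Rem (Reg 6) (Reg 21) ;;
    Arith 31 Mul (Reg 31) (Reg 29) ;;
    Arith 31 Quot (Reg 31) (Reg 21) ;;
    Arith 32 Mul (lit 2) (Reg 29) ;;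
    Arith 32 Mul (Reg 32) (Reg 4) ;;
    Arith 32 Quot (Reg 32) (Reg 20) ;;
    Arith 32 Add (Reg 32) (Reg 31) ;;
    Arith 32 Add (Reg 32) (lit 2) ;;
    Loop Leq (Reg 31) (Reg 32) (
      Arith 33 Mul (Reg 30) (Reg 31) ;;
      Arith 33 Rem (Reg 33) (Reg 29) ;;
      visit_progression V ;;
      Arith 31 Add (Reg 31) (lit 1))"

context visitor
begin

text \<open>An upper bound on the visits. A residue class also contains offsets that belong to no
  lattice point of the strip, and the last block may pass \<open>2 M\<close>, so the visited set is
  not determined exactly; it is enough that all visits are at proper divisors.\<close>

definition allowed :: "(nat \<times> nat) set" where
  "allowed = {(d, j). L \<le> d \<and> d * d \<le> 27 * N \<and> j < L \<and> d dvd A + j \<and> 2 * d \<le> A + j}"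

definition extends :: "(nat \<times> nat) set \<Rightarrow> (nat \<times> nat) set \<Rightarrow> bool" where
  "extends P P' \<longleftrightarrow> P \<subseteq> P' \<and> P' \<subseteq> P \<union> allowed"

definition covered :: "(nat \<times> nat) set \<Rightarrow> nat \<Rightarrow> bool" where
  "covered P d \<longleftrightarrow> (\<forall>j<L. d dvd A + j \<longrightarrow> (d, j) \<in> P)"

lemma extends_refl: "extends P P" by (auto simp: extends_def)

lemma extends_trans: "extends P P' \<Longrightarrow> extends P' P'' \<Longrightarrow> extends P P''"
  by (auto simp: extends_def)

lemma covered_extends: "covered P d \<Longrightarrow> extends P P' \<Longrightarrow> covered P' d"
  by (auto simp: covered_def extends_def)

lemma notin_writes_visit_candidate: "x < 13 \<or> 18 < x \<and> x \<noteq> 34 \<Longrightarrow> x \<notin> writes (visit_candidate V)"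
  using notin_writes_V by (auto simp: visit_candidate_def)

lemma notin_writes_visit_progression: "x < 13 \<or> 18 < x \<and> x \<noteq> 33 \<and> x \<noteq> 34 \<Longrightarrow> x \<notin> writes (visit_progression V)"
  using notin_writes_visit_candidate by (auto simp: visit_progression_def)

lemma notin_writes_sieve_block: "x < 13 \<or> 18 < x \<and> x < 31 \<or> 34 < x \<Longrightarrow> x \<notin> writes (sieve_block V)"
  using notin_writes_visit_progression by (auto simp: sieve_block_def)

lemma wp_visit_candidate:
  assumes P: "Inv P \<mu>" and env: "\<forall>x<13. \<rho> x = \<rho>\<^sub>0 x" and r: "\<rho> 21 = nr d\<^sub>0" "\<rho> 33 = nr r"
    and d: "d = d\<^sub>0 + r" "L \<le> d" "d * d \<le> 27 * N" "2 * d \<le> A"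
  shows "wp W B (visit_candidate V) (\<lambda>\<tau>' \<rho>' \<mu>' z'. \<tau> - (k + 7) \<le> \<tau>' \<and>
      (\<exists>P'. Inv P' \<mu>' \<and> extends P P' \<and> covered P' d)) \<tau> \<rho> \<mu> z"
proof -
  define x where "x = (A + d - 1) div d * d"
  have d1: "1 \<le> d" using d L_ge by linarith
  have x: "d dvd x" "A \<le> x" "x \<le> A + d - 1" "\<And>n. d dvd n \<Longrightarrow> A \<le> n \<Longrightarrow> x \<le> n"
    unfolding x_def using first_multiple(1-3)[of d A] first_multiple(4)[where A = A and d = d] d1 by auto
  have f: "A + d \<le> W" "d \<le> W" "A + d - 1 \<le> W" "(A + d - 1) div d \<le> W" "x \<le> W" "x - A \<le> W" "1 \<le> A + d"
    using A d d1 W x(3) div_le_dividend[of "A + d - 1" d] by linarith+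
  \<comment> \<open>Two multiples in the window would differ by less than
    \<open>L \<le> d\<close>.\<close>
  have uniq: "A + j = x" if "j < L" "d dvd A + j" for j
  proof -
    have "x \<le> A + j" using x(4)[of "A + j"] that by simp
    moreover have "d dvd (A + j) - x" using that x by (intro dvd_diff_nat)
    moreover have "(A + j) - x < d" using that x d by linarith
    ultimately show ?thesis by (metis diff_is_0_eq' dvd_imp_le le_antisym linorder_not_le neq0_conv zero_less_diff)
  qed
  define \<rho>1 where "\<rho>1 = \<rho>(13 := nr d, 34 := nr x, 14 := nr (x - A))"
  have r1: "\<forall>x<13. \<rho>1 x = \<rho>\<^sub>0 x" "\<rho>1 13 = nr d" "\<rho>1 14 = nr (x - A)" "\<rho>1 4 = nr L"
    using env regs by (auto simp: \<rho>1_def)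
  let ?Q = "\<lambda>\<tau>' \<rho>' \<mu>' z'. \<tau> - (k + 7) \<le> \<tau>' \<and> (\<exists>P'. Inv P' \<mu>' \<and> extends P P' \<and> covered P' d)"
  have visit: "wp W B V ?Q (\<tau> - 7) \<rho>1 \<mu> z" if xL: "x - A < L"
  proof (rule wp_use[OF V[OF P r1(1-3) _ d(3) xL]])
    show "2 \<le> d" using d L_ge by linarith
    show "d dvd A + (x - A)" using x by simp
    fix \<tau>' \<rho>' \<mu>' z'
    assume post: "\<tau> - 7 - k \<le> \<tau>' \<and> Inv (insert (d, x - A) P) \<mu>'"
    have "covered (insert (d, x - A) P) d"
      using uniq unfolding covered_def by (metis add_diff_cancel_left' insertI1)
    moreover have "extends P (insert (d, x - A) P)"
      using d x xL by (auto simp: extends_def allowed_def)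
    ultimately show "?Q \<tau>' \<rho>' \<mu>' z'" using post by auto
  qed
  have novisit: "?Q (\<tau> - 7) \<rho>1 \<mu> z" if xL: "\<not> x - A < L"
  proof -
    have "covered P d" using uniq xL unfolding covered_def by (metis add_diff_cancel_left')
    then show ?thesis using P extends_refl k by auto
  qed
  have "wp W B (Cond Less (Reg 14) (Reg 4) V Skip) ?Q (\<tau> - 6) \<rho>1 \<mu> z"
    using visit novisit r1 by (simp add: wp_simps)
  then show ?thesis
    unfolding visit_candidate_def using r env regs f W_pos x(2) d(1) unfolding \<rho>1_def x_def
    by (simp add: wp_simps fun_upd_twist del: One_nat_def cong: wp_weak_cong)
qed

lemma wp_visit_progression:
  assumes P: "Inv P \<mu>" and env: "\<forall>x<13. \<rho> x = \<rho>\<^sub>0 x" and r: "\<rho> 21 = nr d\<^sub>0" "\<rho> 33 = nr r\<^sub>0" "\<rho> 26 = nr R" "\<rho> 29 = nr p"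
    and d: "L \<le> d\<^sub>0" "(d\<^sub>0 + R) * (d\<^sub>0 + R) \<le> 27 * N" "2 * d\<^sub>0 + 2 * R \<le> A"
    and p: "1 \<le> p" "p \<le> R" "r\<^sub>0 < p"
    and t: "(k + 9) * (real R / real p + 1) + 1 \<le> \<tau>"
  shows "wp W B (visit_progression V) (\<lambda>\<tau>' \<rho>' \<mu>' z'. \<tau> - ((k + 9) * (real R / real p + 1) + 1) \<le> \<tau>' \<and>
      (\<exists>P'. Inv P' \<mu>' \<and> extends P P' \<and> (\<forall>r<R. r mod p = r\<^sub>0 \<longrightarrow> covered P' (d\<^sub>0 + r)))) \<tau> \<rho> \<mu> z"
proof -
  define \<epsilon> where "\<epsilon> = \<tau> - (k + 9) * (real R / real p + 1)"
  define I where "I = (\<lambda>\<tau>' (\<rho>' :: nat \<Rightarrow> rat) \<mu>' (z' :: nat list). \<exists>r P'. \<rho>' 33 = nr r \<and> r mod p = r\<^sub>0 \<and> r < R + p \<and>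
     Inv P' \<mu>' \<and> extends P P' \<and> (\<forall>r'<r. r' < R \<longrightarrow> r' mod p = r\<^sub>0 \<longrightarrow> covered P' (d\<^sub>0 + r')) \<and>
     \<epsilon> + (k + 9) * real ((R + p - 1 - r) div p) \<le> \<tau>')"
  let ?body = "visit_candidate V ;; Arith 33 Add (Reg 33) (Reg 29)"
  have eps: "1 \<le> \<epsilon>" using t by (simp add: \<epsilon>_def)
  have "real ((R + p - 1 - r\<^sub>0) div p) \<le> real R / real p + 1"
  proof -
    have "(R + p - 1 - r\<^sub>0) div p \<le> (R + p) div p" by (intro div_le_mono) simp
    also have "\<dots> = R div p + 1" using p by simp
    finally have "real ((R + p - 1 - r\<^sub>0) div p) \<le> real (R div p) + 1" by linarith
    moreover have "real (R div p) \<le> real R / real p" by (rule of_nat_div_le_of_nat)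
    ultimately show ?thesis by linarith
  qed
  then have "(k + 9) * real ((R + p - 1 - r\<^sub>0) div p) \<le> (k + 9) * (real R / real p + 1)"
    using k by (intro mult_left_mono) auto
  moreover have "\<forall>r'<r\<^sub>0. r' mod p \<noteq> r\<^sub>0" using p by auto
  ultimately have I0: "I \<tau> \<rho> \<mu> z"
    unfolding I_def using r p P extends_refl by (intro exI[of _ r\<^sub>0] exI[of _ P]) (auto simp: \<epsilon>_def)
  show ?thesis
    unfolding visit_progression_def
  proof (rule wp_Loop[where I = I, OF I0])
    fix \<tau>' \<rho>' \<mu>' z'
    assume I: "I \<tau>' \<rho>' \<mu>' z'" and fr: "\<forall>x. x \<notin> writes ?body \<longrightarrow> \<rho>' x = \<rho> x"
      and c: "compare Less (opv \<rho>' (Reg 33)) (opv \<rho>' (Reg 26))"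
    from I obtain i P1 where i: "\<rho>' 33 = nr i" "i mod p = r\<^sub>0" and P1: "Inv P1 \<mu>'" "extends P P1"
      and cov: "\<forall>r'<i. r' < R \<longrightarrow> r' mod p = r\<^sub>0 \<longrightarrow> covered P1 (d\<^sub>0 + r')"
      and t': "\<epsilon> + (k + 9) * real ((R + p - 1 - i) div p) \<le> \<tau>'"
      by (auto simp: I_def)
    have r': "\<forall>x<13. \<rho>' x = \<rho>\<^sub>0 x" "\<rho>' 21 = nr d\<^sub>0" "\<rho>' 26 = nr R" "\<rho>' 29 = nr p"
      using fr env r notin_writes_visit_candidate by auto
    have iR: "i < R" using c i r' by (simp add: compare_nr)
    have div: "(R + p - 1 - i) div p = Suc ((R + p - 1 - (i + p)) div p)"
    proof -
      have "R + p - 1 - i = (R + p - 1 - (i + p)) + p" using iR p by simp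
      then show ?thesis using p by (metis div_add_self2 not_one_le_zero Suc_eq_plus1)
    qed
    have t'': "\<epsilon> + (k + 9) * real ((R + p - 1 - (i + p)) div p) + (k + 9) \<le> \<tau>'"
      using t' unfolding div by (simp add: algebra_simps)
    have ge: "0 \<le> (k + 9) * real ((R + p - 1 - (i + p)) div p)" using k by simp
    have dd: "L \<le> d\<^sub>0 + i" "(d\<^sub>0 + i) * (d\<^sub>0 + i) \<le> 27 * N" "2 * (d\<^sub>0 + i) \<le> A"
    proof -
      have "(d\<^sub>0 + i) * (d\<^sub>0 + i) \<le> (d\<^sub>0 + R) * (d\<^sub>0 + R)" using iR by (intro mult_mono) auto
      then show "(d\<^sub>0 + i) * (d\<^sub>0 + i) \<le> 27 * N" using d(2) by (rule order_trans)
      show "L \<le> d\<^sub>0 + i" "2 * (d\<^sub>0 + i) \<le> A" using d(1,3) iR by auto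
    qed
    have "1 \<le> \<tau>'" using t'' eps k ge by linarith
    moreover have "wp W B ?body I (\<tau>' - 1) \<rho>' \<mu>' z'"
      unfolding wp_Seq
    proof (rule wp_use[OF wp_visit_candidate[OF P1(1) r'(1,2) i(1) refl dd]])
      fix \<tau>2 \<rho>2 \<mu>2 z2
      assume post: "\<tau>' - 1 - (k + 7) \<le> \<tau>2 \<and> (\<exists>P'. Inv P' \<mu>2 \<and> extends P1 P' \<and> covered P' (d\<^sub>0 + i))"
        and fr2: "\<forall>x. x \<notin> writes (visit_candidate V) \<longrightarrow> \<rho>2 x = \<rho>' x"
      from post obtain P2 where P2: "Inv P2 \<mu>2" "extends P1 P2" "covered P2 (d\<^sub>0 + i)" by blast
      have r2: "\<rho>2 33 = nr i" "\<rho>2 29 = nr p" using fr2 r' i notin_writes_visit_candidate by auto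
      have cov2: "covered P2 (d\<^sub>0 + h)" if h: "h < i + p" "h < R" "h mod p = r\<^sub>0" for h
      proof (cases "h < i")
        case True
        then show ?thesis using cov h covered_extends[OF _ P2(2)] by blast
      next
        case False
        have "h = i"
        proof (rule ccontr)
          assume "h \<noteq> i"
          then have lt: "0 < h - i" "h - i < p" using False h by auto
          have "p dvd h - i" using h(3) i(2) False by (metis mod_eq_dvd_iff_nat not_less)
          then show False using lt by (auto dest: dvd_imp_le)
        qed
        then show ?thesis using P2(3) by simp
      qed
      have "i + p \<le> W" using iR p d L_ge A W by linarith
      moreover have "extends P P2" using extends_trans[OF P1(2) P2(2)] .
      ultimately have "fits W (nr (i + p))" "I (\<tau>2 - 1) (\<rho>2(33 := nr (i + p))) \<mu>2 z2"
        unfolding I_def using post t'' i iR P2(1) cov2 W_pos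
        by (auto simp: fits_nr intro!: exI[of _ "i + p"] exI[of _ P2])
      then show "wp W B (Arith 33 Add (Reg 33) (Reg 29)) I \<tau>2 \<rho>2 \<mu>2 z2"
        using r2 by (simp add: wp_Arith arith_nr)
    qed
    ultimately show "1 \<le> \<tau>' \<and> wp W B ?body I (\<tau>' - 1) \<rho>' \<mu>' z'" ..
  next
    fix \<tau>' \<rho>' \<mu>' z'
    assume I: "I \<tau>' \<rho>' \<mu>' z'" and fr: "\<forall>x. x \<notin> writes ?body \<longrightarrow> \<rho>' x = \<rho> x"
      and c: "\<not> compare Less (opv \<rho>' (Reg 33)) (opv \<rho>' (Reg 26))"
    from I obtain i P1 where i: "\<rho>' 33 = nr i" and P1: "Inv P1 \<mu>'" "extends P P1"
      and cov: "\<forall>r'<i. r' < R \<longrightarrow> r' mod p = r\<^sub>0 \<longrightarrow> covered P1 (d\<^sub>0 + r')"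
      and t': "\<epsilon> + (k + 9) * real ((R + p - 1 - i) div p) \<le> \<tau>'"
      by (auto simp: I_def)
    have "\<rho>' 26 = nr R" using fr r notin_writes_visit_candidate by auto
    then have "R \<le> i" using c i by (simp add: compare_nr)
    moreover have "0 \<le> (k + 9) * real ((R + p - 1 - i) div p)" using k by simp
    ultimately show "\<tau> - ((k + 9) * (real R / real p + 1) + 1) \<le> \<tau>' - 1 \<and>
      (\<exists>P'. Inv P' \<mu>' \<and> extends P P' \<and> (\<forall>r<R. r mod p = r\<^sub>0 \<longrightarrow> covered P' (d\<^sub>0 + r)))"
      using P1 cov t' by (intro conjI exI[of _ P1]) (auto simp: \<epsilon>_def)
  qed
qed

end

text \<open>One dyadic range. The bound \<open>L \<le> M\<close> gives \<open>R \<ge> 5\<close>, so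
  rounding in \<open>M div s\<close> costs at most a factor 2; the bound on \<open>M * M\<close>
  stops the ranges near the square root of the window.\<close>

locale sieve_range = visitor +
  fixes M R :: nat
  assumes M: "L \<le> M" "M * M \<le> A + L" and R: "R = M div s"
begin

lemma M_ge: "400 \<le> M" using M L_ge by linarith

lemma M_square_le: "M * M \<le> 3 * N" using M A L_le by linarith

text \<open>It says that the slope at \<open>M\<close> is at least 1/2, which lets
  \<open>sum_approx_weight_le\<close> absorb additive constants.\<close>

lemma A_ge: "M * M \<le> 2 * A"
proof -
  have "2 * M \<le> M * M" using M_ge by (intro mult_right_mono) auto
  then show ?thesis using M by linarith
qed

lemma A_ge_M: "200 * M \<le> A"
proof -
  have "400 * M \<le> M * M" using M_ge by (intro mult_right_mono) auto
  then show ?thesis using A_ge by linarith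
qed

lemma R_mult_s: "R * s \<le> M" by (simp add: R)

lemma R_ge: "5 \<le> R"
  using s_le s_pos M unfolding R by (simp add: less_eq_div_iff_mult_less_eq)

lemma R_le: "R \<le> M" by (simp add: R)

lemma R_square_le: "R * R \<le> 3 * N" using mult_mono[OF R_le R_le] M_square_le by simp

lemma M_le_R: "M \<le> 2 * (R * s)"
proof -
  have "M < (R + 1) * s" using s_pos dividend_less_div_times[of s M] unfolding R by simp
  also have "\<dots> \<le> (2 * R) * s" using R_ge by (intro mult_right_mono) auto
  finally show ?thesis by simp
qed

lemma R_less: "R < 2 ^ l"
proof -
  have "M \<le> N"
  proof (rule ccontr)
    assume "\<not> M \<le> N"
    then have "400 * N \<le> M * M" using M_ge by (intro mult_mono) auto
    then show False using M_square_le L_le L_ge by linarith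
  qed
  then show ?thesis using R_le N by linarith
qed

lemma A_le_s: "A \<le> s\<^sup>2 * L" using A N_le_s by linarith

text \<open>There are \<open>E + 3\<close> lines with \<open>E \<le> 2 * p * L / M\<close>, and each
  has about \<open>R / p\<close> candidates. The product gives the two terms \<open>R / p\<close>
  and \<open>R * L / M\<close> of the bound.\<close>

lemma wp_sieve_block:
  assumes P: "Inv P \<mu>" and env: "\<forall>x<13. \<rho> x = \<rho>\<^sub>0 x"
    and r: "\<rho> 20 = nr M" "\<rho> 21 = nr d\<^sub>0" "\<rho> 26 = nr R" "\<rho> 29 = nr p" "\<rho> 30 = nr i"
    and d: "M \<le> d\<^sub>0" "d\<^sub>0 \<le> 2 * M"
    and p: "slope_approx A R d\<^sub>0 a p" "(a * i) mod p = 1 mod p" "i < p"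
    and t: "(k + 13) * (6 * (real R / real p) + 4 * (real R * real L / real M)) + 9 \<le> \<tau>"
  shows "wp W B (sieve_block V) (\<lambda>\<tau>' \<rho>' \<mu>' z'.
      \<tau> - ((k + 13) * (6 * (real R / real p) + 4 * (real R * real L / real M)) + 9) \<le> \<tau>' \<and>
      (\<exists>P'. Inv P' \<mu>' \<and> extends P P' \<and> (\<forall>r<R. covered P' (d\<^sub>0 + r)))) \<tau> \<rho> \<mu> z"
proof -
  define F where "F = (A mod d\<^sub>0) * p div d\<^sub>0"
  define E where "E = 2 * p * L div M"
  \<comment> \<open>Since \<open>R / p \<ge> 1\<close>, doubling it pays for rounding up, and
    passing from \<open>k + 9\<close> to \<open>k + 13\<close> pays for the overhead of a
    line.\<close>
  define cost where "cost = (k + 13) * (2 * (real R / real p))"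
  define \<epsilon> where "\<epsilon> = \<tau> - 9 - (k + 13) * (6 * (real R / real p) + 4 * (real R * real L / real M))"
  define cls where "cls P c \<longleftrightarrow> (\<forall>r<R. r mod p = (i * c) mod p \<longrightarrow> covered P (d\<^sub>0 + r))" for P c
  define I where "I = (\<lambda>\<tau>' (\<rho>' :: nat \<Rightarrow> rat) \<mu>' (z' :: nat list). \<exists>c P'. \<rho>' 31 = nr c \<and> F \<le> c \<and> c \<le> F + E + 3 \<and>
     Inv P' \<mu>' \<and> extends P P' \<and> (\<forall>c'. F \<le> c' \<longrightarrow> c' < c \<longrightarrow> cls P' c') \<and>
     \<epsilon> + 1 + cost * (real (F + E + 3) - real c) \<le> \<tau>')"
  let ?body = "Arith 33 Mul (Reg 30) (Reg 31) ;; Arith 33 Rem (Reg 33) (Reg 29) ;;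
      visit_progression V ;; Arith 31 Add (Reg 31) (lit 1)"
  have pR: "1 \<le> p" "p \<le> R" using p(1) by (auto simp: slope_approx_def)
  have Rp: "1 \<le> real R / real p" using pR by simp
  have cost: "0 \<le> cost" using k by (simp add: cost_def)
  have eps: "0 \<le> \<epsilon>" using t by (simp add: \<epsilon>_def)
  have d0: "1 \<le> d\<^sub>0" using d M_ge by linarith
  have FE: "cost * real (E + 3) \<le> (k + 13) * (6 * (real R / real p) + 4 * (real R * real L / real M))"
  proof -
    have "real E \<le> 2 * real p * real L / real M"
      unfolding E_def using of_nat_div_le_of_nat[of "2 * p * L" M, where ?'a = real] by simp
    then have "(real R / real p) * real E \<le> (real R / real p) * (2 * real p * real L / real M)"
      by (intro mult_left_mono) auto
    also have "\<dots> = 2 * (real R * real L / real M)" using pR by simp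
    finally have "(real R / real p) * real E \<le> 2 * (real R * real L / real M)" .
    moreover have "2 * (real R / real p) * real (E + 3) = 6 * (real R / real p) + 2 * ((real R / real p) * real E)"
      unfolding of_nat_add by (simp only: distrib_left)
    ultimately have "2 * (real R / real p) * real (E + 3) \<le> 6 * (real R / real p) + 4 * (real R * real L / real M)"
      by linarith
    then show ?thesis unfolding cost_def mult.assoc using k by (intro mult_left_mono) auto
  qed
  have F_less: "F < p" unfolding F_def using d0 pR by (simp add: div_less_iff_less_mult mult.commute)
  have E_le: "E \<le> 2 * p" unfolding E_def
  proof -
    have "2 * p * L \<le> 2 * p * M" using M by (intro mult_left_mono) auto
    then show "2 * p * L div M \<le> 2 * p" using M_ge
      by (metis div_le_mono nonzero_mult_div_cancel_right not_numeral_le_zero)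
  qed
  have pL: "2 * p * L \<le> W"
  proof -
    have "p * L \<le> M * M" using pR R_le M by (intro mult_mono) auto
    then show ?thesis using M_square_le W by simp
  qed
  have Ap: "(A mod d\<^sub>0) * p \<le> W"
  proof -
    have "A mod d\<^sub>0 \<le> 2 * M" using d d0 by (meson le_trans less_imp_le mod_less_divisor not_le less_le_trans zero_less_one)
    then have "(A mod d\<^sub>0) * p \<le> (2 * M) * M" using pR R_le by (intro mult_mono) auto
    then show ?thesis using M_square_le W by simp
  qed
  have MW: "M \<le> W" "R \<le> W" "d\<^sub>0 \<le> W" "p \<le> W" "5 * R \<le> W" using A_ge_M A W d R_le pR by linarith+
  \<comment> \<open>\<open>F\<close> is below \<open>p\<close> and \<open>E\<close> is at most
    \<open>2 * p\<close>, so \<open>c \<le> 6 * R\<close> and the product is at most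
    \<open>6 * R * R \<le> 18 * N\<close>.\<close>
  have step_fits: "i * c \<le> W" if "c \<le> F + E + 3" for c
  proof -
    have "c \<le> 6 * R" using that F_less E_le pR by linarith
    then have "i * c \<le> R * (6 * R)" using p(3) pR by (intro mult_mono) auto
    then show ?thesis using R_square_le W by simp
  qed
  \<comment> \<open>Here the 27 of \<open>visitor\<close> originates: candidates stay below
    \<open>3 * M\<close>, and \<open>M * M \<le> 3 * N\<close>.\<close>
  have dd: "L \<le> d\<^sub>0" "(d\<^sub>0 + R) * (d\<^sub>0 + R) \<le> 27 * N" "2 * d\<^sub>0 + 2 * R \<le> A"
  proof -
    show "L \<le> d\<^sub>0" using M d by linarith
    have "(d\<^sub>0 + R) * (d\<^sub>0 + R) \<le> (3 * M) * (3 * M)" using d R_le by (intro mult_mono) auto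
    then show "(d\<^sub>0 + R) * (d\<^sub>0 + R) \<le> 27 * N" using M_square_le by simp
    show "2 * d\<^sub>0 + 2 * R \<le> A" using A_ge_M d R_le by auto
  qed
  define \<rho>1 where "\<rho>1 = \<rho>(31 := nr F, 32 := nr (F + E + 2))"
  let ?Q = "\<lambda>\<tau>' \<rho>' \<mu>' z'. \<epsilon> \<le> \<tau>' \<and>
      (\<exists>P'. Inv P' \<mu>' \<and> extends P P' \<and> (\<forall>r<R. covered P' (d\<^sub>0 + r)))"
  have loop: "wp W B (Loop Leq (Reg 31) (Reg 32) ?body) ?Q (\<tau> - 8) \<rho>1 \<mu> z"
  proof (rule wp_Loop[where I = I])
    show "I (\<tau> - 8) \<rho>1 \<mu> z"
      unfolding I_def using P extends_refl FE
      by (intro exI[of _ F] exI[of _ P]) (auto simp: \<rho>1_def \<epsilon>_def)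
  next
    fix \<tau>' \<rho>' \<mu>' z'
    assume I: "I \<tau>' \<rho>' \<mu>' z'" and fr: "\<forall>x. x \<notin> writes ?body \<longrightarrow> \<rho>' x = \<rho>1 x"
      and cc: "compare Leq (opv \<rho>' (Reg 31)) (opv \<rho>' (Reg 32))"
    from I obtain c P1 where c: "\<rho>' 31 = nr c" "F \<le> c" and P1: "Inv P1 \<mu>'" "extends P P1"
      and cov: "\<forall>c'. F \<le> c' \<longrightarrow> c' < c \<longrightarrow> cls P1 c'"
      and t': "\<epsilon> + 1 + cost * (real (F + E + 3) - real c) \<le> \<tau>'"
      by (auto simp: I_def)
    have r': "\<forall>x<13. \<rho>' x = \<rho>\<^sub>0 x" "\<rho>' 21 = nr d\<^sub>0" "\<rho>' 26 = nr R" "\<rho>' 29 = nr p" "\<rho>' 30 = nr i" "\<rho>' 32 = nr (F + E + 2)"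
      using fr env r notin_writes_visit_progression by (auto simp: \<rho>1_def)
    have cle: "c \<le> F + E + 2" using cc c r' by (simp add: compare_nr)
    have "cost * 1 \<le> cost * (real (F + E + 3) - real c)" using cle cost by (intro mult_left_mono) auto
    then have t1: "\<epsilon> + 1 + cost \<le> \<tau>'" using t' by simp
    have tc: "\<epsilon> + 1 + cost * (real (F + E + 3) - real (c + 1)) + cost \<le> \<tau>'" using t' by (simp add: algebra_simps)
    have costge: "(k + 9) * (real R / real p + 1) + 7 \<le> cost"
    proof -
      have "(k + 9) * (real R / real p + 1) \<le> (k + 9) * (2 * (real R / real p))"
        using Rp k by (intro mult_left_mono) auto
      moreover have "(k + 13) * x = (k + 9) * x + 4 * x" for x :: real by (simp add: algebra_simps)
      then have "cost = (k + 9) * (2 * (real R / real p)) + 4 * (2 * (real R / real p))" unfolding cost_def .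
      ultimately show ?thesis using Rp by linarith
    qed
    have tt: "(k + 9) * (real R / real p + 1) + 1 \<le> \<tau>' - 3" using t1 costge eps by linarith
    have kR: "0 \<le> (k + 9) * (real R / real p + 1)" using k by simp
    define \<rho>2 where "\<rho>2 = \<rho>'(33 := nr ((i * c) mod p))"
    have "wp W B (visit_progression V) (wp W B (Arith 31 Add (Reg 31) (lit 1)) I) (\<tau>' - 3) \<rho>2 \<mu>' z'"
    proof (rule wp_use[OF wp_visit_progression[OF P1(1) _ _ _ _ _ dd pR _ tt]])
      show "\<forall>x<13. \<rho>2 x = \<rho>\<^sub>0 x" "\<rho>2 21 = nr d\<^sub>0" "\<rho>2 33 = nr ((i * c) mod p)" "\<rho>2 26 = nr R" "\<rho>2 29 = nr p"
        using r' by (auto simp: \<rho>2_def)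
      show "(i * c) mod p < p" using pR by simp
      fix \<tau>3 \<rho>3 \<mu>3 z3
      assume post: "\<tau>' - 3 - ((k + 9) * (real R / real p + 1) + 1) \<le> \<tau>3 \<and>
        (\<exists>P'. Inv P' \<mu>3 \<and> extends P1 P' \<and> (\<forall>r<R. r mod p = (i * c) mod p \<longrightarrow> covered P' (d\<^sub>0 + r)))"
        and fr3: "\<forall>x. x \<notin> writes (visit_progression V) \<longrightarrow> \<rho>3 x = \<rho>2 x"
      from post obtain P2 where P2: "Inv P2 \<mu>3" "extends P1 P2" "cls P2 c" by (auto simp: cls_def)
      have r3: "\<rho>3 31 = nr c" using fr3 c notin_writes_visit_progression by (auto simp: \<rho>2_def)
      have "cls P2 c'" if "F \<le> c'" "c' < c + 1" for c'
      proof (cases "c' < c")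
        case True
        then show ?thesis using cov that covered_extends[OF _ P2(2)] by (auto simp: cls_def)
      next
        case False
        then show ?thesis using P2(3) that by (simp add: less_Suc_eq)
      qed
      moreover have "c + 1 \<le> W" using cle F_less E_le pR MW R_ge by linarith
      moreover have "extends P P2" using extends_trans[OF P1(2) P2(2)] .
      moreover have "\<epsilon> + 1 + cost * (real (F + E + 3) - real (c + 1)) \<le> \<tau>3 - 1" using post tc costge by linarith
      ultimately have "fits W (nr (c + 1))" "I (\<tau>3 - 1) (\<rho>3(31 := nr (c + 1))) \<mu>3 z3"
        unfolding I_def using c cle P2(1) W_pos
        by (auto simp: fits_nr simp del: of_nat_add intro!: exI[of _ "c + 1"] exI[of _ P2])
      then show "wp W B (Arith 31 Add (Reg 31) (lit 1)) I \<tau>3 \<rho>3 \<mu>3 z3"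
        using r3 by (simp add: wp_Arith arith_nr opv_lit)
    qed
    then have "wp W B ?body I (\<tau>' - 1) \<rho>' \<mu>' z'"
      using step_fits[of c] cle r' c W_pos pR MW mod_less_divisor[of p "i * c"] unfolding \<rho>2_def
      by (simp add: wp_simps del: One_nat_def mod_less_divisor cong: wp_weak_cong)
    moreover have "1 \<le> \<tau>'" using t1 eps cost by linarith
    ultimately show "1 \<le> \<tau>' \<and> wp W B ?body I (\<tau>' - 1) \<rho>' \<mu>' z'" by blast
  next
    fix \<tau>' \<rho>' \<mu>' z'
    assume I: "I \<tau>' \<rho>' \<mu>' z'" and fr: "\<forall>x. x \<notin> writes ?body \<longrightarrow> \<rho>' x = \<rho>1 x"
      and cc: "\<not> compare Leq (opv \<rho>' (Reg 31)) (opv \<rho>' (Reg 32))"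
    from I obtain c P1 where c: "\<rho>' 31 = nr c" "c \<le> F + E + 3" and P1: "Inv P1 \<mu>'" "extends P P1"
      and cov: "\<forall>c'. F \<le> c' \<longrightarrow> c' < c \<longrightarrow> cls P1 c'"
      and t': "\<epsilon> + 1 + cost * (real (F + E + 3) - real c) \<le> \<tau>'"
      by (auto simp: I_def)
    have r': "\<rho>' 32 = nr (F + E + 2)"
      using fr r notin_writes_visit_progression by (auto simp: \<rho>1_def)
    have cle: "F + E + 2 < c" using cc c r' by (simp add: compare_nr)
    have "0 \<le> cost * (real (F + E + 3) - real c)" using cost c by simp
    then have "\<epsilon> \<le> \<tau>' - 1" using t' by linarith
    \<comment> \<open>The loop only knows which residue classes it has finished. A multiple in the
      window is a lattice point of the strip, so its offset lies in one of these classes.\<close>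
    moreover have "covered P1 (d\<^sub>0 + r)" if r: "r < R" for r
      unfolding covered_def
    proof (intro allI impI)
      fix j assume j: "j < L" "d\<^sub>0 + r dvd A + j"
      then obtain m where m: "A + j = (d\<^sub>0 + r) * m" by (auto elim: dvdE)
      obtain c' where c': "F \<le> c'" "c' \<le> F + 2 + E" "(i * c') mod p = r mod p"
        using strip_point_residue[OF _ d(1) r R_mult_s A_le_s _ _ p(1,2), of m] m j M_ge
        unfolding F_def E_def by fastforce
      then have "cls P1 c'" using cov cle by auto
      then have "covered P1 (d\<^sub>0 + r)" using c' r by (simp add: cls_def)
      then show "(d\<^sub>0 + r, j) \<in> P1" using j by (simp add: covered_def)
    qed
    ultimately show "?Q (\<tau>' - 1) \<rho>' \<mu>' z'" using P1 by auto
  qed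
  have f: "A mod d\<^sub>0 \<le> W" "F \<le> W" "2 * p \<le> W" "E \<le> W" "F + E + 2 \<le> W"
    using F_less E_le MW pR R_ge d mod_less_divisor[of d\<^sub>0 A] d0 by linarith+
  have eq: "\<tau> - ((k + 13) * (6 * (real R / real p) + 4 * (real R * real L / real M)) + 9) = \<epsilon>"
    by (simp add: \<epsilon>_def)
  have "\<rho> 6 = nr A" "\<rho> 4 = nr L" using env regs by auto
  then show ?thesis
    unfolding sieve_block_def eq using loop r f pL Ap W_pos unfolding \<rho>1_def F_def E_def
    by (simp add: wp_simps fun_upd_twist add_ac del: One_nat_def cong: wp_weak_cong)
qed

end

section \<open>Walking down the Farey sequence\<close>

lemma frac_le_iff:
  fixes a b c d :: nat
  assumes "0 < b" "0 < d"
  shows "real a / real b \<le> real c / real d \<longleftrightarrow> a * d \<le> c * b"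
proof -
  have "real a / real b \<le> real c / real d \<longleftrightarrow> real (a * d) \<le> real (c * b)"
    using assms by (simp add: divide_le_eq pos_le_divide_eq)
  then show ?thesis by (simp only: of_nat_le_iff)
qed

lemma compare_frac:
  fixes a b c d :: nat
  assumes "0 < b" "0 < d"
  shows "compare Less (nr a / nr b) (nr c / nr d) \<longleftrightarrow> a * d < c * b"
    "compare Leq (nr a / nr b) (nr c / nr d) \<longleftrightarrow> a * d \<le> c * b"
proof -
  have "nr a / nr b < nr c / nr d \<longleftrightarrow> nr (a * d) < nr (c * b)"
    using assms by (simp add: nr_def divide_less_eq pos_less_divide_eq)
  then show "compare Less (nr a / nr b) (nr c / nr d) \<longleftrightarrow> a * d < c * b"
    by (simp add: compare.simps)
  have "nr a / nr b \<le> nr c / nr d \<longleftrightarrow> nr (a * d) \<le> nr (c * b)"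
    using assms by (simp add: nr_def divide_le_eq pos_le_divide_eq)
  then show "compare Leq (nr a / nr b) (nr c / nr d) \<longleftrightarrow> a * d \<le> c * b"
    by (simp add: compare.simps)
qed

text \<open>Two neighbours \<open>a / q > a' / q'\<close> of a Farey sequence of order \<open>R\<close>.\<close>

definition farey_pair :: "nat \<Rightarrow> nat \<Rightarrow> nat \<Rightarrow> nat \<Rightarrow> nat \<Rightarrow> bool" where
  "farey_pair R a q a' q' \<longleftrightarrow>
     a * q' = a' * q + 1 \<and> R < q + q' \<and> 1 \<le> q \<and> q \<le> R \<and> 1 \<le> q' \<and> q' \<le> R"

text \<open>The classical recurrence for consecutive Farey fractions, run downwards. Adding a
  multiple of the second pair to the negated first preserves the determinant, and the maximal
  \<open>m\<close> makes the two denominators exceed \<open>R\<close> together. The assumption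
  \<open>1 \<le> a'\<close> keeps the walk above 0, so that no subtraction is truncated.\<close>

lemma farey_pair_next:
  assumes f: "farey_pair R a q a' q'" and a': "1 \<le> a'"
  defines "m \<equiv> (R + q) div q'"
  shows "farey_pair R a' q' (m * a' - a) (m * q' - q)" "a \<le> m * a'" "q \<le> m * q'"
    "m * q' \<le> R + q" "m * a' - a \<le> m * a'"
proof -
  have det: "a * q' = a' * q + 1" and R: "R < q + q'" and q: "1 \<le> q" "q \<le> R" "1 \<le> q'" "q' \<le> R"
    using f by (auto simp: farey_pair_def)
  show hi: "m * q' \<le> R + q" by (simp add: m_def)
  have lo: "R + q < m * q' + q'" using q dividend_less_div_times[of q' "R + q"] by (simp add: m_def)
  show qm: "q \<le> m * q'" using lo q by linarith
  have q'': "1 \<le> m * q' - q" using lo q by linarith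
  show am: "a \<le> m * a'"
  proof (rule ccontr)
    assume "\<not> a \<le> m * a'"
    then have "(m * a' + 1) * q' \<le> a * q'" by (intro mult_right_mono) auto
    then have "m * a' * q' + q' \<le> a' * q + 1" using det by simp
    moreover have "a' * (q + 1) \<le> a' * (m * q')" using q'' by (intro mult_left_mono) auto
    then have "a' * q + a' \<le> m * a' * q'" by (simp add: algebra_simps)
    ultimately have "a' + q' \<le> 1" by linarith
    then show False using a' q by linarith
  qed
  have "a' * (m * q' - q) = (m * a' - a) * q' + 1"
  proof -
    have "int (a' * (m * q' - q)) = int a' * (int m * int q' - int q)" using qm by (simp add: of_nat_diff)
    moreover have "int ((m * a' - a) * q' + 1) = (int m * int a' - int a) * int q' + 1" using am by (simp add: of_nat_diff)
    moreover have "int a * int q' = int a' * int q + 1" using det by (metis of_nat_1 of_nat_add of_nat_mult)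
    ultimately have "int (a' * (m * q' - q)) = int ((m * a' - a) * q' + 1)" by (simp add: algebra_simps)
    then show ?thesis by (simp only: of_nat_eq_iff)
  qed
  then show "farey_pair R a' q' (m * a' - a) (m * q' - q)"
    using q q'' hi lo qm unfolding farey_pair_def by (intro conjI) linarith+
qed simp

text \<open>Reduced modulo \<open>q\<close> the determinant equation says that \<open>q'\<close>
  inverts \<open>a\<close>; modulo \<open>q'\<close> it says that \<open>- q\<close> inverts
  \<open>a'\<close>, written as \<open>(q' - 1) * q\<close> to avoid negative numbers.\<close>

lemma farey_pair_inverse:
  assumes "farey_pair R a q a' q'"
  shows "(a * (q' mod q)) mod q = 1 mod q" "(a' * (((q' - 1) * q) mod q')) mod q' = 1 mod q'"
proof -
  have det: "a * q' = a' * q + 1" and q: "1 \<le> q" "1 \<le> q'"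
    using assms by (auto simp: farey_pair_def)
  show "(a * (q' mod q)) mod q = 1 mod q"
    by (simp only: mod_mult_right_eq det mod_mult_self3)
  have "int (a' * ((q' - 1) * q)) = (int q' - 1) * (int a' * int q)" using q by (simp add: of_nat_diff)
  also have "int a' * int q = int a * int q' - 1"
    using det by (metis add_diff_cancel_right' of_nat_1 of_nat_add of_nat_mult)
  also have "(int q' - 1) * (int a * int q' - 1) = 1 + int q' * (int a * (int q' - 1) - 1)"
    by (simp add: algebra_simps)
  finally have "int (a' * ((q' - 1) * q)) mod int q' = 1 mod int q'" by simp
  then have "(a' * ((q' - 1) * q)) mod q' = 1 mod q'"
    by (metis of_nat_1 of_nat_eq_iff zmod_int)
  then show "(a' * (((q' - 1) * q) mod q')) mod q' = 1 mod q'" by (simp add: mod_mult_right_eq)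
qed

definition farey_step :: com where
  "farey_step =
    Arith 34 Add (Reg 26) (Reg 23) ;;
    Arith 34 Quot (Reg 34) (Reg 25) ;;
    Arith 35 Mul (Reg 34) (Reg 24) ;;
    Arith 35 Sub (Reg 35) (Reg 22) ;;
    Arith 22 Add (Reg 24) (lit 0) ;;
    Arith 24 Add (Reg 35) (lit 0) ;;
    Arith 35 Mul (Reg 34) (Reg 25) ;;
    Arith 35 Sub (Reg 35) (Reg 23) ;;
    Arith 23 Add (Reg 25) (lit 0) ;;
    Arith 25 Add (Reg 35) (lit 0)"

text \<open>The upper neighbour is taken if the mediant is at most the slope, otherwise the lower
  one. The comparison is between rationals held in registers, because the cross products could
  exceed the word bound.\<close>

definition choose_fraction :: com where
  "choose_fraction =
    Arith 34 Add (Reg 22) (Reg 24) ;;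
    Arith 35 Add (Reg 23) (Reg 25) ;;
    Arith 28 Ratio (Reg 34) (Reg 35) ;;
    Cond Leq (Reg 28) (Reg 27)
      (Arith 29 Add (Reg 23) (lit 0) ;; Arith 30 Add (Reg 25) (lit 0))
      (Arith 29 Add (Reg 25) (lit 0) ;; Arith 30 Sub (Reg 25) (lit 1) ;; Arith 30 Mul (Reg 30) (Reg 23)) ;;
    Arith 30 Rem (Reg 30) (Reg 29)"

text \<open>A merge of two decreasing sequences, the slopes of the blocks and the Farey fractions. A
  round advances one of them, so the number of rounds is the sum of the lengths and not a search per
  block.\<close>

definition sieve_scan :: "com \<Rightarrow> com" where
  "sieve_scan V =
    Loop Less (Reg 21) (Reg 36) (
      Arith 34 Mul (Reg 21) (Reg 21) ;;
      Arith 27 Ratio (Reg 6) (Reg 34) ;;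
      Arith 28 Ratio (Reg 24) (Reg 25) ;;
      Cond Less (Reg 27) (Reg 28)
        farey_step
        (choose_fraction ;; sieve_block V ;; Arith 21 Add (Reg 21) (Reg 26)))"

text \<open>The walk through a range starts at the first integer \<open>a\<close> above
  \<open>A / M^2\<close>, as the fraction \<open>a / 1\<close>, and at
  \<open>(a * R - 1) / R\<close>, its lower neighbour in the Farey sequence of order
  \<open>R\<close>.\<close>

definition large_sieve :: "com \<Rightarrow> com" where
  "large_sieve V =
    Arith 20 Add (Reg 4) (lit 0) ;;
    Arith 37 Add (Reg 6) (Reg 4) ;;
    Arith 38 Mul (Reg 20) (Reg 20) ;;
    Loop Leq (Reg 38) (Reg 37) (
      Arith 26 Quot (Reg 20) (Reg 5) ;;
      Arith 21 Add (Reg 20) (lit 0) ;;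
      Arith 36 Mul (lit 2) (Reg 20) ;;
      Arith 22 Quot (Reg 6) (Reg 38) ;;
      Arith 22 Add (Reg 22) (lit 1) ;;
      Arith 23 Add (lit 1) (lit 0) ;;
      Arith 24 Mul (Reg 22) (Reg 26) ;;
      Arith 24 Sub (Reg 24) (lit 1) ;;
      Arith 25 Add (Reg 26) (lit 0) ;;
      sieve_scan V ;;
      Arith 20 Mul (lit 2) (Reg 20) ;;
      Arith 38 Mul (Reg 20) (Reg 20))"

lemma wp_farey_step:
  assumes f: "farey_pair R a q a' q'" "1 \<le> a'" and W: "1 \<le> W" "R + q \<le> W" "a' + (R + q) div q' * a' \<le> W"
    and r: "\<rho> 26 = nr R" "\<rho> 22 = nr a" "\<rho> 23 = nr q" "\<rho> 24 = nr a'" "\<rho> 25 = nr q'"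
  shows "wp W B farey_step (\<lambda>\<tau>' \<rho>' \<mu>' z'. \<tau>' = \<tau> - 10 \<and> \<rho>' 22 = nr a' \<and> \<rho>' 23 = nr q' \<and>
    \<rho>' 24 = nr ((R + q) div q' * a' - a) \<and> \<rho>' 25 = nr ((R + q) div q' * q' - q)) \<tau> \<rho> \<mu> z"
proof -
  have q: "q' \<le> R" using f by (simp add: farey_pair_def)
  have "(R + q) div q' \<le> W" using div_le_dividend[of "R + q" q'] W by linarith
  moreover have "(R + q) div q' * a' - a \<le> W" "a' \<le> W" "(R + q) div q' * q' \<le> W" "q' \<le> W" "(R + q) div q' * a' \<le> W"
    "(R + q) div q' * q' - q \<le> W"
    using W farey_pair_next(4,5)[OF f] q by linarith+
  ultimately show ?thesis
    unfolding farey_step_def using r W farey_pair_next(2,3)[OF f] by (simp add: wp_simps)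
qed

lemma writes_farey_step: "writes farey_step = {22, 23, 24, 25, 34, 35}"
  by (auto simp: farey_step_def)

lemma writes_choose_fraction: "writes choose_fraction = {28, 29, 30, 34, 35}"
  by (auto simp: choose_fraction_def)

lemma wp_choose_fraction:
  assumes f: "farey_pair R a q a' q'" and W: "1 \<le> W" "2 * R \<le> W" "a + a' \<le> W" "R * R \<le> W"
    and r: "\<rho> 22 = nr a" "\<rho> 23 = nr q" "\<rho> 24 = nr a'" "\<rho> 25 = nr q'" "\<rho> 27 = nr A / nr (d * d)"
    and d: "1 \<le> d" and up: "A * q \<le> a * (d * d)" and lo: "a' * (d * d) \<le> A * q'"
  shows "wp W B choose_fraction (\<lambda>\<tau>' \<rho>' \<mu>' z'. \<tau> - 8 \<le> \<tau>' \<and>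
    (\<exists>b p i. \<rho>' 29 = nr p \<and> \<rho>' 30 = nr i \<and> slope_approx A R d b p \<and> (b * i) mod p = 1 mod p \<and> i < p)) \<tau> \<rho> \<mu> z"
proof -
  have det: "a * q' = a' * q + 1" and R: "R < q + q'" and q: "1 \<le> q" "q \<le> R" "1 \<le> q'" "q' \<le> R"
    using f by (auto simp: farey_pair_def)
  have d2: "(real d)\<^sup>2 = real (d * d)" by (simp add: power2_eq_square)
  let ?c = "(a + a') * (d * d) \<le> A * (q + q')"
  have up': "real A / real (d * d) \<le> real a / real q" using up d q frac_le_iff[of "d * d" q A a] by auto
  have lo': "real a' / real q' \<le> real A / real (d * d)" using lo d q frac_le_iff[of q' "d * d" a' A] by auto
  have s1: "slope_approx A R d a q" if ?c
    unfolding slope_approx_def d2 using mediant_above[OF det R q(1) _ q(2) up'] that q d frac_le_iff[of "q + q'" "d * d" "a + a'" A] by auto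
  have s2: "slope_approx A R d a' q'" if "\<not> ?c"
    unfolding slope_approx_def d2 using mediant_below[OF det R q(3) _ q(4) lo'] that q d frac_le_iff[of "d * d" "q + q'" A "a + a'"] by auto
  have cmp: "compare Leq (nr (a + a') / nr (q + q')) (nr A / nr (d * d)) \<longleftrightarrow> ?c"
    using compare_frac(2)[of "q + q'" "d * d" "a + a'" A] q d by auto
  have "(q' - 1) * q \<le> R * R" using q by (intro mult_mono) auto
  then have f1: "(q' - 1) * q \<le> W" "q' - 1 \<le> W" "q \<le> W" "q' \<le> W" "q + q' \<le> W" using q W by linarith+
  have f2: "fits W (nr (a + a') / nr (q + q'))" using fits_nr_divide[OF W(3) f1(5)] q by simp
  have f3: "q' mod q \<le> W" "((q' - 1) * q) mod q' \<le> W"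
    using f1 mod_less_eq_dividend[of q' q] mod_less_eq_dividend[of "(q' - 1) * q" q'] by linarith+
  note inv = farey_pair_inverse[OF f]
  show ?thesis
  proof (cases ?c)
    case True
    show ?thesis
      unfolding choose_fraction_def using True r W f1 f2 f3 cmp s1[OF True] inv(1) q
      by (simp add: wp_simps arith.simps(4) del: One_nat_def) (rule exI[of _ a], simp)
  next
    case False
    show ?thesis
      unfolding choose_fraction_def using False r W f1 f2 f3 cmp s2[OF False] inv(2) q
      by (simp add: wp_simps arith.simps(4) del: One_nat_def) (intro exI[of _ a'], simp)
  qed
qed

section \<open>Total cost of one dyadic range\<close>

context sieve_range
begin

definition blocks :: nat where "blocks = (M + R - 1) div R"

lemma less_blocks_iff: "b < blocks \<longleftrightarrow> M + b * R < 2 * M"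
proof -
  have "b < blocks \<longleftrightarrow> b + 1 \<le> (M + R - 1) div R" by (simp add: blocks_def Suc_le_eq)
  also have "\<dots> \<longleftrightarrow> (b + 1) * R \<le> M + R - 1" using R_ge by (simp add: less_eq_div_iff_mult_less_eq)
  also have "\<dots> \<longleftrightarrow> M + b * R < 2 * M" using R_ge by (simp add: algebra_simps) linarith
  finally show ?thesis .
qed

text \<open>The blocks cover a stretch of length \<open>M\<close> up to one extra block. With
  \<open>M \<le> 2 * (R * s)\<close> there are O(s) of them, and
  \<open>5 * s \<le> L\<close>.\<close>

lemma blocks_bounds: "blocks \<le> L" "real R * real L / real M * real blocks \<le> 2 * real L"
proof -
  have bm: "blocks * R \<le> M + R" using div_times_less_eq_dividend[of "M + R - 1" R] unfolding blocks_def by linarith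
  show "blocks \<le> L"
  proof (rule ccontr)
    assume "\<not> blocks \<le> L"
    then have "5 * s < blocks" using s_le by linarith
    then have "5 * s * R \<le> blocks * R" by (intro mult_right_mono) auto
    moreover have "5 * (R * s) = 5 * s * R" by simp
    ultimately have "5 * (R * s) \<le> M + R" using bm by linarith
    then show False using M_le_R R_le M_ge by linarith
  qed
  have "real (blocks * R) \<le> real (M + R)" using bm by (simp only: of_nat_le_iff)
  then have "real blocks * real R \<le> 2 * real M" using R_le by simp
  then have "real L * (real blocks * real R) \<le> real L * (2 * real M)" by (intro mult_left_mono) auto
  then show "real R * real L / real M * real blocks \<le> 2 * real L" using M_ge by (simp add: field_simps)
qed

definition block_cost :: "nat \<Rightarrow> real" where
  "block_cost b = (k + 13) * (6 * (real R * approx_weight A R (M + b * R)) + 4 * (real R * real L / real M)) + 30"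

definition start_slope :: nat where "start_slope = A div (M * M) + 1"

text \<open>Both rest on \<open>S * R^2 \<le> L\<close>, which follows from
  \<open>R * s \<le> M\<close> and \<open>A \<le> s^2 * L\<close>. The first bounds the length of
  the Farey walk. In the second, \<open>5 * S * R^2\<close> contributes 5 and
  \<open>40 * (M / R) * l \<le> 80 * s * l\<close> contributes 320, by
  \<open>s * l = 4 * L\<close>.\<close>

lemma start_slope_bound: "real start_slope * real R * real R \<le> 3 * real L"
  and weight_bound: "real R * (\<Sum>b<blocks. approx_weight A R (M + b * R)) \<le> 325 * real L"
proof -
  have Mp: "0 < real M" "0 < real R" "0 < real A" using M_ge R_ge A by auto
  define S where "S = real A / (real M)\<^sup>2"
  have "real (M * M) \<le> real (2 * A)" using A_ge by (simp only: of_nat_le_iff)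
  then have S: "1 \<le> 2 * S" using Mp by (simp add: S_def field_simps power2_eq_square)
  have SR: "S * (real R)\<^sup>2 \<le> real L"
  proof -
    have "real (R * s) \<le> real M" using R_mult_s by (simp only: of_nat_le_iff)
    then have "(real R * real s)\<^sup>2 \<le> (real M)\<^sup>2" by (intro power_mono) auto
    then have "(real R)\<^sup>2 * (real s)\<^sup>2 * real L \<le> (real M)\<^sup>2 * real L" by (intro mult_right_mono) (auto simp: power_mult_distrib)
    moreover have "real A \<le> real (s\<^sup>2 * L)" using A_le_s by (simp only: of_nat_le_iff)
    then have "(real R)\<^sup>2 * real A \<le> (real R)\<^sup>2 * ((real s)\<^sup>2 * real L)" by (intro mult_left_mono) auto
    ultimately have "(real R)\<^sup>2 * real A \<le> (real M)\<^sup>2 * real L" by (simp add: mult.assoc)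
    then show ?thesis using Mp by (simp add: S_def field_simps)
  qed
  have "real (A div (M * M)) \<le> S"
    unfolding S_def using of_nat_div_le_of_nat[of A "M * M", where ?'a = real] by (simp add: power2_eq_square)
  then have "real start_slope \<le> 3 * S" using S by (simp add: start_slope_def)
  then have "real start_slope * (real R)\<^sup>2 \<le> 3 * S * (real R)\<^sup>2" by (intro mult_right_mono) auto
  then show "real start_slope * real R * real R \<le> 3 * real L" using SR by (simp add: power2_eq_square mult.assoc)
  have "real M \<le> real (2 * (R * s))" using M_le_R by (simp only: of_nat_le_iff)
  then have MR: "real M / real R \<le> 2 * real s" using Mp by (simp add: field_simps)
  have sl: "real s * real l = 4 * real L" using s_mult_l by (metis of_nat_mult of_nat_numeral)
  have "(\<Sum>b<blocks. approx_weight A R (M + b * R)) \<le>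
      5 * S * (real R + 8 * real M ^ 3 / (real A * (real R)\<^sup>2) * real l)"
    unfolding S_def using M_ge R_ge by (intro sum_approx_weight_le A_ge R_less) (auto simp: less_blocks_iff)
  then have "real R * (\<Sum>b<blocks. approx_weight A R (M + b * R)) \<le>
      real R * (5 * S * (real R + 8 * real M ^ 3 / (real A * (real R)\<^sup>2) * real l))"
    by (intro mult_left_mono) auto
  also have "\<dots> = 5 * (S * (real R)\<^sup>2) + 40 * (real M / real R) * real l"
  proof -
    have "real R * (S * (8 * real M ^ 3 / (real A * (real R)\<^sup>2))) = 8 * (real M / real R)"
      unfolding S_def using Mp by (simp add: power2_eq_square power3_eq_cube)
    moreover have "x * (5 * y * (x + z * w)) = 5 * (y * x\<^sup>2) + 5 * (x * (y * z)) * w" for x y z w :: real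
      by (simp add: algebra_simps power2_eq_square)
    ultimately have "real R * (5 * S * (real R + 8 * real M ^ 3 / (real A * (real R)\<^sup>2) * real l)) =
        5 * (S * (real R)\<^sup>2) + 5 * (8 * (real M / real R)) * real l" by (simp only:)
    then show ?thesis by simp
  qed
  also have "\<dots> \<le> 5 * real L + 40 * (2 * real s) * real l"
    using SR MR by (intro add_mono mult_left_mono mult_right_mono) auto
  also have "\<dots> = 5 * real L + 80 * (real s * real l)" by simp
  also have "\<dots> = 325 * real L" unfolding sl by simp
  finally show "real R * (\<Sum>b<blocks. approx_weight A R (M + b * R)) \<le> 325 * real L" .
qed

lemma sum_block_cost: "(\<Sum>b<blocks. block_cost b) \<le> (k + 13) * (1958 * real L) + 30 * real L"
proof -
  have "(\<Sum>b<blocks. block_cost b) = (k + 13) * (6 * (real R * (\<Sum>b<blocks. approx_weight A R (M + b * R)))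
      + 4 * (real R * real L / real M * real blocks)) + 30 * real blocks"
    by (simp add: block_cost_def sum.distrib sum_distrib_left distrib_left mult_ac)
  \<comment> \<open>The constant 1958 is \<open>6 * 325 + 4 * 2\<close>.\<close>
  also have "\<dots> \<le> (k + 13) * (6 * (325 * real L) + 4 * (2 * real L)) + 30 * real L"
    using weight_bound blocks_bounds k by (intro add_mono mult_left_mono) auto
  finally show ?thesis by simp
qed

lemma block_cost_nonneg: "0 \<le> block_cost b"
  using k by (auto simp: block_cost_def approx_weight_nonneg intro!: add_nonneg_nonneg mult_nonneg_nonneg)

text \<open>A round that moves the Farey pair is paid with the 20 credits of a fraction that leaves
  \<open>fractions_below\<close>; a round that processes a block is paid with its
  \<open>block_cost\<close>.\<close>

lemma wp_sieve_scan:
  assumes P: "Inv P \<mu>" and env: "\<forall>x<13. \<rho> x = \<rho>\<^sub>0 x"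
    and r: "\<rho> 20 = nr M" "\<rho> 21 = nr M" "\<rho> 26 = nr R" "\<rho> 36 = nr (2 * M)" "\<rho> 22 = nr start_slope" "\<rho> 23 = nr 1"
      "\<rho> 24 = nr (start_slope * R - 1)" "\<rho> 25 = nr R"
    and t: "(k + 13) * (2000 * real L) \<le> \<tau>"
  shows "wp W B (sieve_scan V) (\<lambda>\<tau>' \<rho>' \<mu>' z'. \<tau> - (k + 13) * (2000 * real L) \<le> \<tau>' \<and>
      (\<exists>P'. Inv P' \<mu>' \<and> extends P P' \<and> (\<forall>d. M \<le> d \<and> d < 2 * M \<longrightarrow> covered P' d))) \<tau> \<rho> \<mu> z"
proof -
  let ?a0 = start_slope
  define \<epsilon> where "\<epsilon> = \<tau> - (k + 13) * (2000 * real L)"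
  have eps: "0 \<le> \<epsilon>" using t by (simp add: \<epsilon>_def)
  \<comment> \<open>The inequality with \<open>A * q\<close> says that the upper neighbour is still
    at or above the slope. The bounds by the starting slope keep numerators at most
    \<open>3 * N\<close>, so that they fit into words.\<close>
  define I where "I = (\<lambda>\<tau>' (\<rho>' :: nat \<Rightarrow> rat) \<mu>' (z' :: nat list). \<exists>b a q a' q' P'. \<rho>' 21 = nr (M + b * R) \<and> b \<le> blocks \<and>
     \<rho>' 22 = nr a \<and> \<rho>' 23 = nr q \<and> \<rho>' 24 = nr a' \<and> \<rho>' 25 = nr q' \<and> farey_pair R a q a' q' \<and>
     a \<le> ?a0 * q \<and> a' \<le> ?a0 * q' \<and> A * q \<le> a * ((M + b * R) * (M + b * R)) \<and>
     Inv P' \<mu>' \<and> extends P P' \<and> (\<forall>d. M \<le> d \<longrightarrow> d < M + b * R \<longrightarrow> covered P' d) \<and>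
     \<epsilon> + 1 + 20 * real (card (fractions_below R a' q')) + (\<Sum>i=b..<blocks. block_cost i) \<le> \<tau>')"
  let ?body = "Arith 34 Mul (Reg 21) (Reg 21) ;;
      Arith 27 Ratio (Reg 6) (Reg 34) ;;
      Arith 28 Ratio (Reg 24) (Reg 25) ;;
      Cond Less (Reg 27) (Reg 28)
        farey_step
        (choose_fraction ;; sieve_block V ;; Arith 21 Add (Reg 21) (Reg 26))"
  have a0R: "?a0 * R \<le> 3 * N"
  proof -
    have "A div (M * M) * R \<le> A div (M * M) * (M * M)" using R_le M_ge by (intro mult_left_mono) (auto intro: order_trans[of _ M])
    also have "\<dots> \<le> A" by simp
    finally show ?thesis using R_le A_ge_M A L_le by (simp add: start_slope_def)
  qed
  have a0: "1 \<le> ?a0" by (simp add: start_slope_def)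
  have RW: "R \<le> 2 * N" using R_le A_ge_M A by linarith
  show ?thesis
    unfolding sieve_scan_def
  proof (rule wp_Loop[where I = I])
    have det: "?a0 * R = (?a0 * R - 1) * 1 + 1" using a0 R_ge by simp
    have fp: "farey_pair R ?a0 1 (?a0 * R - 1) R" using det R_ge by (simp add: farey_pair_def)
    have "A < ?a0 * (M * M)" unfolding start_slope_def using M_ge dividend_less_div_times[of "M * M" A] by simp
    moreover have "20 * real (card (fractions_below R (?a0 * R - 1) R)) + (\<Sum>i=0..<blocks. block_cost i) + 1 \<le> (k + 13) * (2000 * real L)"
    proof -
      have "real (card (fractions_below R (?a0 * R - 1) R)) \<le> real (?a0 * R * R)"
        using card_fractions_below(2)[of "?a0 * R - 1" ?a0 R R] by (simp only: of_nat_le_iff)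
      also have "\<dots> \<le> 3 * real L" using start_slope_bound by simp
      finally have c: "20 * real (card (fractions_below R (?a0 * R - 1) R)) \<le> 60 * real L" by simp
      \<comment> \<open>The Farey walk needs at most \<open>60 * L\<close> and the blocks another
        \<open>30 * L\<close> beyond the term with 1958; the remaining
        \<open>42 * (k + 13) * L\<close> is at least \<open>546 * L\<close>.\<close>
      have "13 * real L \<le> (k + 13) * real L" using k by (intro mult_right_mono) auto
      moreover have "(k + 13) * (2000 * real L) = (k + 13) * (1958 * real L) + 42 * ((k + 13) * real L)" by (simp add: algebra_simps)
      moreover have "400 \<le> real L" using L_ge by simp
      ultimately show ?thesis using c sum_block_cost unfolding atLeast0LessThan by linarith
    qed
    ultimately show "I \<tau> \<rho> \<mu> z"
      unfolding I_def using r P extends_refl fp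
      by - (rule exI[of _ 0], rule exI[of _ "?a0"], rule exI[of _ 1], rule exI[of _ "?a0 * R - 1"], rule exI[of _ R], rule exI[of _ P], auto simp: \<epsilon>_def)
  next
    fix \<tau>' \<rho>' \<mu>' z'
    assume I: "I \<tau>' \<rho>' \<mu>' z'" and fr: "\<forall>x. x \<notin> writes ?body \<longrightarrow> \<rho>' x = \<rho> x"
      and cc: "compare Less (opv \<rho>' (Reg 21)) (opv \<rho>' (Reg 36))"
    from I obtain b a q a' q' P1 where rr: "\<rho>' 21 = nr (M + b * R)" "\<rho>' 22 = nr a" "\<rho>' 23 = nr q" "\<rho>' 24 = nr a'" "\<rho>' 25 = nr q'"
      and f: "farey_pair R a q a' q'" and a: "a \<le> ?a0 * q" "a' \<le> ?a0 * q'"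
      and up: "A * q \<le> a * ((M + b * R) * (M + b * R))"
      and P1: "Inv P1 \<mu>'" "extends P P1" and cov: "\<forall>d. M \<le> d \<longrightarrow> d < M + b * R \<longrightarrow> covered P1 d"
      and t': "\<epsilon> + 1 + 20 * real (card (fractions_below R a' q')) + (\<Sum>i=b..<blocks. block_cost i) \<le> \<tau>'"
      unfolding I_def by blast
    define d where "d = M + b * R"
    have env': "\<forall>x<13. \<rho>' x = \<rho>\<^sub>0 x" "\<rho>' 20 = nr M" "\<rho>' 26 = nr R" "\<rho>' 36 = nr (2 * M)"
      using fr env r notin_writes_sieve_block by (auto simp: writes_farey_step writes_choose_fraction)
    have dM: "d < 2 * M" using cc rr env' by (simp add: compare_nr d_def)
    then have b: "b < blocks" by (simp add: less_blocks_iff d_def)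
    have d1: "M \<le> d" by (simp add: d_def)
    have dd: "d * d \<le> 12 * N" using mult_mono[of d "2 * M" d "2 * M"] dM M_square_le by simp
    have dd0: "0 < d * d" using d1 M_ge by simp
    have det: "a * q' = a' * q + 1" and q: "1 \<le> q" "q \<le> R" "1 \<le> q'" "q' \<le> R"
      using f by (auto simp: farey_pair_def)
    have aN: "a \<le> 3 * N" "a' \<le> 3 * N"
    proof -
      have "?a0 * q \<le> ?a0 * R" "?a0 * q' \<le> ?a0 * R" using q by simp_all
      then show "a \<le> 3 * N" "a' \<le> 3 * N" using a a0R by linarith+
    qed
    have fits1: "fits W (nr A / nr (d * d))" "fits W (nr a' / nr q')"
      using A W dd aN q RW dd0 by (auto intro!: fits_nr_divide)
    have f1: "d * d \<le> W" using dd W by linarith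
    have r6: "\<rho>' 6 = nr A" using env' regs by auto
    have cmp: "compare Less (nr A / nr (d * d)) (nr a' / nr q') \<longleftrightarrow> A * q' < a' * (d * d)"
      using compare_frac(1)[of "d * d" q' A a'] dd0 q by simp
    have csum: "(\<Sum>i=b..<blocks. block_cost i) = block_cost b + (\<Sum>i=b+1..<blocks. block_cost i)"
      using b by (simp add: sum.atLeast_Suc_lessThan)
    have sn: "0 \<le> (\<Sum>i=b+1..<blocks. block_cost i)" by (intro sum_nonneg block_cost_nonneg)
    define \<rho>1 where "\<rho>1 = \<rho>'(34 := nr (d * d), 27 := nr A / nr (d * d), 28 := nr a' / nr q')"
    have r1: "\<forall>x<13. \<rho>1 x = \<rho>\<^sub>0 x" "\<rho>1 20 = nr M" "\<rho>1 26 = nr R" "\<rho>1 21 = nr d" "\<rho>1 22 = nr a" "\<rho>1 23 = nr q" "\<rho>1 24 = nr a'" "\<rho>1 25 = nr q'"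
        "\<rho>1 27 = nr A / nr (d * d)"
      using env' rr by (auto simp: \<rho>1_def d_def)
    have step: "wp W B farey_step I (\<tau>' - 5) \<rho>1 \<mu>' z'" if lt: "A * q' < a' * (d * d)"
    proof -
      define m where "m = (R + q) div q'"
      \<comment> \<open>A fraction above the positive slope is not 0, so the walk has a next
        term.\<close>
      have a'1: "1 \<le> a'" using lt by (cases a') auto
      note nx = farey_pair_next[OF f a'1, folded m_def]
      have det': "a' * (m * q' - q) = (m * a' - a) * q' + 1" and q'': "1 \<le> m * q' - q" "m * q' - q \<le> R"
        using nx(1) by (auto simp: farey_pair_def)
      have a'': "m * a' - a \<le> ?a0 * (m * q' - q)"
      proof -
        have "(m * a' - a) * q' \<le> a' * (m * q' - q)" using det' by linarith
        also have "\<dots> \<le> ?a0 * q' * (m * q' - q)" using a by (intro mult_right_mono) auto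
        finally have "(m * a' - a) * q' \<le> ?a0 * (m * q' - q) * q'" by (simp add: mult_ac)
        then show ?thesis using q by simp
      qed
      have ma: "m * a' \<le> 6 * N"
      proof -
        have "?a0 * (m * q' - q) \<le> ?a0 * R" using q'' by (intro mult_left_mono) auto
        then show ?thesis using a'' a0R aN nx(2) by linarith
      qed
      have "card (fractions_below R (m * a' - a) (m * q' - q)) < card (fractions_below R a' q')"
        using card_fractions_below_step[OF det' q'' a(2) q(3)] .
      then have "20 * real (card (fractions_below R (m * a' - a) (m * q' - q))) + 20 \<le> 20 * real (card (fractions_below R a' q'))"
        by linarith
      then have tt: "\<epsilon> + 1 + 20 * real (card (fractions_below R (m * a' - a) (m * q' - q))) + (\<Sum>i=b..<blocks. block_cost i) \<le> \<tau>' - 5 - 10"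
        using t' by linarith
      show ?thesis
      proof (rule wp_use[OF wp_farey_step[OF f a'1 W_pos _ _ r1(3) r1(5-8)]])
        show "R + q \<le> W" using q RW W by linarith
        show "a' + (R + q) div q' * a' \<le> W" using ma aN W unfolding m_def by linarith
        fix \<tau>2 \<rho>2 \<mu>2 z2
        assume post: "\<tau>2 = \<tau>' - 5 - 10 \<and> \<rho>2 22 = nr a' \<and> \<rho>2 23 = nr q' \<and>
          \<rho>2 24 = nr ((R + q) div q' * a' - a) \<and> \<rho>2 25 = nr ((R + q) div q' * q' - q)"
          and fr2: "\<forall>x. x \<notin> writes farey_step \<longrightarrow> \<rho>2 x = \<rho>1 x" and st: "\<not> stores farey_step \<longrightarrow> \<mu>2 = \<mu>'"
        have "\<mu>2 = \<mu>'" using st by (simp add: farey_step_def)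
        moreover have "\<rho>2 21 = nr (M + b * R)" using fr2 r1(4) by (simp add: writes_farey_step d_def)
        ultimately show "I \<tau>2 \<rho>2 \<mu>2 z2"
          unfolding I_def using post b nx(1) a(2) a'' lt P1 cov tt unfolding d_def m_def
          by - (rule exI[of _ b], rule exI[of _ a'], rule exI[of _ q'], rule exI[of _ "(R + q) div q' * a' - a"], rule exI[of _ "(R + q) div q' * q' - q"], rule exI[of _ P1], simp)
      qed
    qed
    have block: "wp W B (choose_fraction ;; sieve_block V ;; Arith 21 Add (Reg 21) (Reg 26)) I (\<tau>' - 5) \<rho>1 \<mu>' z'"
      if ge: "\<not> A * q' < a' * (d * d)"
      unfolding wp_Seq
    proof (rule wp_use[OF wp_choose_fraction[OF f W_pos _ _ _ r1(5-9)]])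
      show "2 * R \<le> W" "a + a' \<le> W" "R * R \<le> W" using RW aN W R_square_le by linarith+
      show "1 \<le> d" using d1 M_ge by linarith
      show "A * q \<le> a * (d * d)" using up by (simp add: d_def)
      show "a' * (d * d) \<le> A * q'" using ge by simp
      fix \<tau>2 \<rho>2 \<mu>2 z2
      assume post: "\<tau>' - 5 - 8 \<le> \<tau>2 \<and> (\<exists>b p i. \<rho>2 29 = nr p \<and> \<rho>2 30 = nr i \<and>
          slope_approx A R d b p \<and> b * i mod p = 1 mod p \<and> i < p)"
        and fr2: "\<forall>x. x \<notin> writes choose_fraction \<longrightarrow> \<rho>2 x = \<rho>1 x" and st: "\<not> stores choose_fraction \<longrightarrow> \<mu>2 = \<mu>'"
      from post obtain c p i where p: "\<rho>2 29 = nr p" "\<rho>2 30 = nr i"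
          "slope_approx A R d c p" "c * i mod p = 1 mod p" "i < p" by blast
      have mu: "\<mu>2 = \<mu>'" using st by (simp add: choose_fraction_def)
      have r2: "\<forall>x<13. \<rho>2 x = \<rho>\<^sub>0 x" "\<rho>2 20 = nr M" "\<rho>2 21 = nr d" "\<rho>2 26 = nr R" "\<rho>2 22 = nr a" "\<rho>2 23 = nr q" "\<rho>2 24 = nr a'" "\<rho>2 25 = nr q'"
        using fr2 r1 by (auto simp: writes_choose_fraction)
      have "real R / real p \<le> real R * approx_weight A R d"
        using mult_left_mono[OF approx_weight_ge[OF p(3)], of "real R"] by simp
      then have "(k + 13) * (6 * (real R / real p) + 4 * (real R * real L / real M)) \<le>
          (k + 13) * (6 * (real R * approx_weight A R (M + b * R)) + 4 * (real R * real L / real M))"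
        unfolding d_def[symmetric] using k by (intro mult_left_mono) auto
      then have bc: "(k + 13) * (6 * (real R / real p) + 4 * (real R * real L / real M)) + 30 \<le> block_cost b"
        by (simp add: block_cost_def)
      have tt: "(k + 13) * (6 * (real R / real p) + 4 * (real R * real L / real M)) + 9 \<le> \<tau>2"
        using bc post t' csum sn eps by linarith
      show "wp W B (sieve_block V) (wp W B (Arith 21 Add (Reg 21) (Reg 26)) I) \<tau>2 \<rho>2 \<mu>2 z2"
        unfolding mu
      proof (rule wp_use[OF wp_sieve_block[OF P1(1) r2(1-4) p(1,2) d1 _ p(3-5) tt]])
        show "d \<le> 2 * M" using dM by simp
        fix \<tau>3 \<rho>3 \<mu>3 z3
        assume post3: "\<tau>2 - ((k + 13) * (6 * (real R / real p) + 4 * (real R * real L / real M)) + 9) \<le> \<tau>3 \<and>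
            (\<exists>P'. Inv P' \<mu>3 \<and> extends P1 P' \<and> (\<forall>r<R. covered P' (d + r)))"
          and fr3: "\<forall>x. x \<notin> writes (sieve_block V) \<longrightarrow> \<rho>3 x = \<rho>2 x"
        from post3 obtain P2 where P2: "Inv P2 \<mu>3" "extends P1 P2" and cv: "\<forall>r<R. covered P2 (d + r)" by blast
        have r3: "\<rho>3 21 = nr d" "\<rho>3 26 = nr R" "\<rho>3 22 = nr a" "\<rho>3 23 = nr q" "\<rho>3 24 = nr a'" "\<rho>3 25 = nr q'"
          using fr3 r2 notin_writes_sieve_block by auto
        have cov2: "covered P2 x" if "M \<le> x" "x < M + (b + 1) * R" for x
        proof (cases "x < d")
          case True
          then show ?thesis using cov that covered_extends[OF _ P2(2)] by (auto simp: d_def)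
        next
          case False
          then have "x - d < R" using that by (simp add: d_def)
          then show ?thesis using cv False by (metis le_add_diff_inverse not_less)
        qed
        have dW: "d + R \<le> W" using dM R_le A_ge_M A W by linarith
        have dR: "d + R = M + (b + 1) * R" by (simp add: d_def)
        \<comment> \<open>The next slope is smaller, so the upper neighbour needs no update when a
          block is finished.\<close>
        have up2: "A * q \<le> a * ((M + (b + 1) * R) * (M + (b + 1) * R))"
        proof -
          have "a * (d * d) \<le> a * ((d + R) * (d + R))" by (intro mult_left_mono mult_mono) auto
          then have "A * q \<le> a * ((d + R) * (d + R))" using up unfolding d_def by linarith
          then show ?thesis by (simp only: dR)
        qed
        have tt3: "\<epsilon> + 1 + 20 * real (card (fractions_below R a' q')) + (\<Sum>i=b+1..<blocks. block_cost i) \<le> \<tau>3 - 1"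
          using t' csum bc post post3 by linarith
        have "I (\<tau>3 - 1) (\<rho>3(21 := nr (d + R))) \<mu>3 z3"
          unfolding I_def using r3 b f a up2 P2(1) extends_trans[OF P1(2) P2(2)] cov2 tt3
          by - (rule exI[of _ "b + 1"], rule exI[of _ a], rule exI[of _ q], rule exI[of _ a'], rule exI[of _ q'], rule exI[of _ P2], auto simp: dR)
        then show "wp W B (Arith 21 Add (Reg 21) (Reg 26)) I \<tau>3 \<rho>3 \<mu>3 z3"
          using r3 dW W_pos by (simp add: wp_simps)
      qed
    qed
    have "wp W B ?body I (\<tau>' - 1) \<rho>' \<mu>' z'"
      using step block cmp f1 fits1 W_pos r6 rr unfolding \<rho>1_def d_def[symmetric]
      by (simp add: wp_Seq wp_Arith wp_Cond opv_lit arith_nr arith.simps(4) fits_nr cong: wp_weak_cong)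
    moreover have "1 \<le> \<tau>'" using t' eps csum sn block_cost_nonneg[of b] by linarith
    ultimately show "1 \<le> \<tau>' \<and> wp W B ?body I (\<tau>' - 1) \<rho>' \<mu>' z'" by blast
  next
    fix \<tau>' \<rho>' \<mu>' z'
    assume I: "I \<tau>' \<rho>' \<mu>' z'" and fr: "\<forall>x. x \<notin> writes ?body \<longrightarrow> \<rho>' x = \<rho> x"
      and cc: "\<not> compare Less (opv \<rho>' (Reg 21)) (opv \<rho>' (Reg 36))"
    from I obtain b a' q' P1 where rr: "\<rho>' 21 = nr (M + b * R)"
      and P1: "Inv P1 \<mu>'" "extends P P1" and cov: "\<forall>d. M \<le> d \<longrightarrow> d < M + b * R \<longrightarrow> covered P1 d"
      and t': "\<epsilon> + 1 + 20 * real (card (fractions_below R a' q')) + (\<Sum>i=b..<blocks. block_cost i) \<le> \<tau>'"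
      unfolding I_def by blast
    have "\<rho>' 36 = nr (2 * M)"
      using fr r notin_writes_sieve_block by (auto simp: writes_farey_step writes_choose_fraction)
    then have "2 * M \<le> M + b * R" using cc rr by (simp add: compare_nr)
    moreover have "0 \<le> (\<Sum>i=b..<blocks. block_cost i)" by (intro sum_nonneg block_cost_nonneg)
    ultimately show "\<tau> - (k + 13) * (2000 * real L) \<le> \<tau>' - 1 \<and>
      (\<exists>P'. Inv P' \<mu>' \<and> extends P P' \<and> (\<forall>d. M \<le> d \<and> d < 2 * M \<longrightarrow> covered P' d))"
      using P1 cov t' by (intro conjI exI[of _ P1]) (auto simp: \<epsilon>_def)
  qed
qed

end

section \<open>All dyadic ranges up to the square root\<close>

context visitor
begin

lemma wp_large_sieve:
  assumes P: "Inv P \<mu>" and env: "\<forall>x<13. \<rho> x = \<rho>\<^sub>0 x"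
    and t: "((k + 13) * (2000 * real L) + 13) * real (l + 2) + 4 \<le> \<tau>"
  shows "wp W B (large_sieve V) (\<lambda>\<tau>' \<rho>' \<mu>' z'. \<tau> - (((k + 13) * (2000 * real L) + 13) * real (l + 2) + 4) \<le> \<tau>' \<and>
      (\<exists>P'. Inv P' \<mu>' \<and> extends P P' \<and> (\<forall>d. L \<le> d \<and> d * d \<le> A + L \<longrightarrow> covered P' d))) \<tau> \<rho> \<mu> z"
proof -
  define c where "c = (k + 13) * (2000 * real L) + 13"
  define \<epsilon> where "\<epsilon> = \<tau> - (c * real (l + 2) + 4)"
  have eps: "0 \<le> \<epsilon>" using t by (simp add: \<epsilon>_def c_def)
  have c: "0 \<le> c" using k by (simp add: c_def)
  define I where "I = (\<lambda>\<tau>' (\<rho>' :: nat \<Rightarrow> rat) \<mu>' (z' :: nat list). \<exists>i M P'. M = 2 ^ i * L \<and> \<rho>' 20 = nr M \<and> \<rho>' 38 = nr (M * M) \<and>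
     i \<le> l + 2 \<and> Inv P' \<mu>' \<and> extends P P' \<and> (\<forall>d. L \<le> d \<longrightarrow> d < M \<longrightarrow> covered P' d) \<and>
     \<epsilon> + 1 + c * (real (l + 2) - real i) \<le> \<tau>')"
  let ?body = "Arith 26 Quot (Reg 20) (Reg 5) ;;
      Arith 21 Add (Reg 20) (lit 0) ;;
      Arith 36 Mul (lit 2) (Reg 20) ;;
      Arith 22 Quot (Reg 6) (Reg 38) ;;
      Arith 22 Add (Reg 22) (lit 1) ;;
      Arith 23 Add (lit 1) (lit 0) ;;
      Arith 24 Mul (Reg 22) (Reg 26) ;;
      Arith 24 Sub (Reg 24) (lit 1) ;;
      Arith 25 Add (Reg 26) (lit 0) ;;
      sieve_scan V ;;
      Arith 20 Mul (lit 2) (Reg 20) ;;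
      Arith 38 Mul (Reg 20) (Reg 20)"
  have nw: "x < 13 \<or> x = 20 \<or> 36 \<le> x \<Longrightarrow> x \<notin> writes (sieve_scan V)" for x
    using notin_writes_sieve_block by (auto simp: sieve_scan_def writes_farey_step writes_choose_fraction)
  define \<rho>1 where "\<rho>1 = \<rho>(20 := nr L, 37 := nr (A + L), 38 := nr (L * L))"
  let ?Q = "\<lambda>\<tau>' \<rho>' \<mu>' z'. \<epsilon> \<le> \<tau>' \<and>
      (\<exists>P'. Inv P' \<mu>' \<and> extends P P' \<and> (\<forall>d. L \<le> d \<and> d * d \<le> A + L \<longrightarrow> covered P' d))"
  have loop: "wp W B (Loop Leq (Reg 38) (Reg 37) ?body) ?Q (\<tau> - 3) \<rho>1 \<mu> z"
  proof (rule wp_Loop[where I = I])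
    show "I (\<tau> - 3) \<rho>1 \<mu> z"
      unfolding I_def using P extends_refl by - (rule exI[of _ 0], rule exI[of _ L], rule exI[of _ P], auto simp: \<rho>1_def \<epsilon>_def)
  next
    fix \<tau>' \<rho>' \<mu>' z'
    assume I: "I \<tau>' \<rho>' \<mu>' z'" and fr: "\<forall>x. x \<notin> writes ?body \<longrightarrow> \<rho>' x = \<rho>1 x"
      and cc: "compare Leq (opv \<rho>' (Reg 38)) (opv \<rho>' (Reg 37))"
    from I obtain i M P1 where Mi: "M = 2 ^ i * L" and rr: "\<rho>' 20 = nr M" "\<rho>' 38 = nr (M * M)"
      and P1: "Inv P1 \<mu>'" "extends P P1" and cov: "\<forall>d. L \<le> d \<longrightarrow> d < M \<longrightarrow> covered P1 d"
      and t': "\<epsilon> + 1 + c * (real (l + 2) - real i) \<le> \<tau>'"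
      unfolding I_def by blast
    have env': "\<forall>x<13. \<rho>' x = \<rho>\<^sub>0 x" "\<rho>' 37 = nr (A + L)"
      using fr env nw by (auto simp: \<rho>1_def)
    then have r': "\<rho>' 4 = nr L" "\<rho>' 5 = nr s" "\<rho>' 6 = nr A" using regs by auto
    have MM: "M * M \<le> A + L" using cc rr env' by (simp add: compare_nr)
    have LM: "L \<le> M" by (simp add: Mi)
    interpret sieve_range N l u L s W B A V Inv \<rho>\<^sub>0 k M "M div s"
      by unfold_locales (use MM LM in auto)
    let ?R = "M div s"
    \<comment> \<open>The range starts at \<open>2 ^ i * L\<close> and its square is at most
      \<open>3 * N < 2 ^ (l + 2)\<close>, which bounds the number of ranges.\<close>
    have il: "i < l + 2"
    proof -
      have "2 ^ i * 1 \<le> M" unfolding Mi using L_ge by (intro mult_left_mono) auto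
      also have "M \<le> M * M" by simp
      also have "\<dots> \<le> 3 * N" by (rule M_square_le)
      also have "\<dots> < 2 ^ (l + 2)" using N by simp
      finally have "(2::nat) ^ i < 2 ^ (l + 2)" by (simp only: mult_1_right)
      then show ?thesis by (rule power_less_imp_less_exp[rotated]) simp
    qed
    have ic: "c * 1 \<le> c * (real (l + 2) - real i)" using il c by (intro mult_left_mono) auto
    have tc: "\<epsilon> + 1 + c * (real (l + 2) - real (i + 1)) + c \<le> \<tau>'" using t' by (simp add: algebra_simps)
    have tt: "(k + 13) * (2000 * real L) \<le> \<tau>' - 10" using t' ic eps by (simp add: c_def)
    define \<rho>2 where "\<rho>2 = \<rho>'(26 := nr ?R, 21 := nr M, 36 := nr (2 * M), 22 := nr start_slope, 23 := nr 1,
        24 := nr (start_slope * ?R - 1), 25 := nr ?R)"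
    have MN: "2 * M \<le> N" using A_ge_M A by linarith
    have scan: "wp W B (sieve_scan V) (wp W B (Arith 20 Mul (lit 2) (Reg 20) ;; Arith 38 Mul (Reg 20) (Reg 20)) I)
        (\<tau>' - 10) \<rho>2 \<mu>' z'"
    proof (rule wp_use[OF wp_sieve_scan[OF P1(1) _ _ _ _ _ _ _ _ _ tt]])
      show "\<forall>x<13. \<rho>2 x = \<rho>\<^sub>0 x" "\<rho>2 20 = nr M" "\<rho>2 21 = nr M" "\<rho>2 26 = nr ?R" "\<rho>2 36 = nr (2 * M)"
        "\<rho>2 22 = nr start_slope" "\<rho>2 23 = nr 1" "\<rho>2 24 = nr (start_slope * ?R - 1)" "\<rho>2 25 = nr ?R"
        using env' rr by (auto simp: \<rho>2_def)
      fix \<tau>3 \<rho>3 \<mu>3 z3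
      assume post: "\<tau>' - 10 - (k + 13) * (2000 * real L) \<le> \<tau>3 \<and>
         (\<exists>P'. Inv P' \<mu>3 \<and> extends P1 P' \<and> (\<forall>d. M \<le> d \<and> d < 2 * M \<longrightarrow> covered P' d))"
        and fr3: "\<forall>x. x \<notin> writes (sieve_scan V) \<longrightarrow> \<rho>3 x = \<rho>2 x"
      from post obtain P2 where P2: "Inv P2 \<mu>3" "extends P1 P2" and cv: "\<forall>d. M \<le> d \<and> d < 2 * M \<longrightarrow> covered P2 d" by blast
      have r3: "\<rho>3 20 = nr M" using fr3 nw rr by (simp add: \<rho>2_def)
      have cov2: "covered P2 d" if "L \<le> d" "d < 2 * M" for d
        using that cv cov covered_extends[OF _ P2(2)] by (cases "d < M") auto
      have f: "2 * M \<le> W" "2 * M * (2 * M) \<le> W" using MN M_square_le W by auto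
      have "\<epsilon> + 1 + c * (real (l + 2) - real (i + 1)) \<le> \<tau>3 - 2" using tc post by (simp add: c_def)
      then have "I (\<tau>3 - 2) (\<rho>3(20 := nr (2 * M), 38 := nr (2 * M * (2 * M)))) \<mu>3 z3"
        unfolding I_def using il P2(1) extends_trans[OF P1(2) P2(2)] cov2
        by - (rule exI[of _ "i + 1"], rule exI[of _ "2 * M"], rule exI[of _ P2], auto simp: Mi)
      then show "wp W B (Arith 20 Mul (lit 2) (Reg 20) ;; Arith 38 Mul (Reg 20) (Reg 20)) I \<tau>3 \<rho>3 \<mu>3 z3"
        using r3 f W_pos by (simp add: wp_simps)
    qed
    have ar: "start_slope * ?R \<le> 3 * N"
    proof -
      have "A div (M * M) * ?R \<le> A div (M * M) * (M * M)" using R_le M_ge by (intro mult_left_mono) (auto intro: order_trans[of _ M])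
      also have "\<dots> \<le> A" by simp
      moreover have "start_slope * ?R = A div (M * M) * ?R + ?R" by (simp add: start_slope_def)
      ultimately show ?thesis using R_le MN A by linarith
    qed
    have s1: "1 \<le> start_slope * ?R" using R_ge by (simp add: start_slope_def)
    have "start_slope \<le> start_slope * ?R" using R_ge by simp
    then have f: "?R \<le> W" "M \<le> W" "2 * M \<le> W" "A div (M * M) \<le> W" "A div (M * M) + 1 \<le> W" "start_slope * ?R \<le> W" "start_slope * ?R - 1 \<le> W"
      using R_le MN W ar unfolding start_slope_def by linarith+
    have "wp W B ?body I (\<tau>' - 1) \<rho>' \<mu>' z'"
      using scan f s1 W_pos r' rr unfolding \<rho>2_def start_slope_def
      by (simp add: wp_simps fun_upd_twist del: One_nat_def cong: wp_weak_cong)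
    moreover have "1 \<le> \<tau>'" using t' eps ic c by linarith
    ultimately show "1 \<le> \<tau>' \<and> wp W B ?body I (\<tau>' - 1) \<rho>' \<mu>' z'" by blast
  next
    fix \<tau>' \<rho>' \<mu>' z'
    assume I: "I \<tau>' \<rho>' \<mu>' z'" and fr: "\<forall>x. x \<notin> writes ?body \<longrightarrow> \<rho>' x = \<rho>1 x"
      and cc: "\<not> compare Leq (opv \<rho>' (Reg 38)) (opv \<rho>' (Reg 37))"
    from I obtain i M P1 where rr: "\<rho>' 38 = nr (M * M)" and i: "i \<le> l + 2"
      and P1: "Inv P1 \<mu>'" "extends P P1" and cov: "\<forall>d. L \<le> d \<longrightarrow> d < M \<longrightarrow> covered P1 d"
      and t': "\<epsilon> + 1 + c * (real (l + 2) - real i) \<le> \<tau>'"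
      unfolding I_def by blast
    have "\<rho>' 37 = nr (A + L)" using fr nw by (auto simp: \<rho>1_def)
    then have MM: "A + L < M * M" using cc rr by (simp add: compare_nr)
    have "d < M" if "d * d \<le> A + L" for d
    proof (rule ccontr)
      assume "\<not> d < M"
      then have "M * M \<le> d * d" by (intro mult_mono) auto
      then show False using MM that by linarith
    qed
    moreover have "0 \<le> c * (real (l + 2) - real i)" using c i by simp
    ultimately show "?Q (\<tau>' - 1) \<rho>' \<mu>' z'" using P1 cov t' by auto
  qed
  have f: "A + L \<le> W" "L * L \<le> W" "L \<le> W" using A L_le L_square_le W by linarith+
  have "\<rho> 4 = nr L" "\<rho> 6 = nr A" using env regs by auto
  then show ?thesis
    unfolding large_sieve_def using loop f W_pos unfolding \<rho>1_def \<epsilon>_def c_def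
    by (simp add: wp_simps del: One_nat_def cong: wp_weak_cong)
qed

end

section \<open>Windows and primes\<close>

definition for_loop :: "nat \<Rightarrow> operand \<Rightarrow> com \<Rightarrow> com" where
  "for_loop x e c =
    Arith x Add (lit 0) (lit 0) ;;
    Loop Less (Reg x) e (c ;; Arith x Add (Reg x) (lit 1))"

lemma writes_for_loop: "writes (for_loop x e c) = insert x (writes c)"
  by (auto simp: for_loop_def)

lemma stores_for_loop: "stores (for_loop x e c) = stores c"
  by (simp add: for_loop_def)

lemma emits_for_loop: "emits (for_loop x e c) = emits c"
  by (simp add: for_loop_def)

text \<open>Reset and increment of the counter happen outside the body; \<open>Jx\<close> makes the
  invariant insensitive to them. Two credits per round pay for test and increment, two more for the
  reset and the final test.\<close>

lemma wp_for_loop_regs: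
  assumes e: "\<And>\<rho>'. \<forall>y. y \<notin> insert x (writes c) \<longrightarrow> \<rho>' y = \<rho> y \<Longrightarrow> opv \<rho>' e = nr n"
    and x: "x \<notin> writes c" and n: "n + 1 \<le> W" and J: "J 0 \<rho> \<mu> z" and Jx: "\<And>i \<rho>' \<mu>' z' v. J i \<rho>' \<mu>' z' \<Longrightarrow> J i (\<rho>'(x := v)) \<mu>' z'"
     and t: "0 \<le> t" "(t + 2) * real n + 2 \<le> \<tau>"
    and body: "\<And>i \<tau>' \<rho>' \<mu>' z'. i < n \<Longrightarrow> \<rho>' x = nr i \<Longrightarrow> \<forall>y. y \<notin> insert x (writes c) \<longrightarrow> \<rho>' y = \<rho> y \<Longrightarrow>
      J i \<rho>' \<mu>' z' \<Longrightarrow> t \<le> \<tau>' \<Longrightarrow> wp W B c (\<lambda>\<tau>2 \<rho>2 \<mu>2 z2. \<tau>' - t \<le> \<tau>2 \<and> J (Suc i) \<rho>2 \<mu>2 z2) \<tau>' \<rho>' \<mu>' z'"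
  shows "wp W B (for_loop x e c) (\<lambda>\<tau>' \<rho>' \<mu>' z'. \<tau> - ((t + 2) * real n + 2) \<le> \<tau>' \<and> J n \<rho>' \<mu>' z') \<tau> \<rho> \<mu> z"
proof -
  define \<epsilon> where "\<epsilon> = \<tau> - ((t + 2) * real n + 2)"
  have eps: "0 \<le> \<epsilon>" using t by (simp add: \<epsilon>_def)
  define I where "I = (\<lambda>\<tau>' (\<rho>' :: nat \<Rightarrow> rat) \<mu>' z'. \<exists>i. \<rho>' x = nr i \<and> i \<le> n \<and> J i \<rho>' \<mu>' z' \<and>
    \<epsilon> + 1 + (t + 2) * (real n - real i) \<le> \<tau>')"
  have W1: "1 \<le> W" using n by simp
  have "wp W B (Loop Less (Reg x) e (c ;; Arith x Add (Reg x) (lit 1))) (\<lambda>\<tau>' \<rho>' \<mu>' z'. \<epsilon> \<le> \<tau>' \<and> J n \<rho>' \<mu>' z')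
     (\<tau> - 1) (\<rho>(x := nr 0)) \<mu> z"
  proof (rule wp_Loop[where I = I])
    show "I (\<tau> - 1) (\<rho>(x := nr 0)) \<mu> z" using Jx[OF J, of "nr 0"] by (auto simp: I_def \<epsilon>_def intro!: exI[of _ 0])
  next
    fix \<tau>' \<rho>' \<mu>' z'
    assume I: "I \<tau>' \<rho>' \<mu>' z'" and fr: "\<forall>y. y \<notin> writes (c ;; Arith x Add (Reg x) (lit 1)) \<longrightarrow> \<rho>' y = (\<rho>(x := nr 0)) y"
      and cc: "compare Less (opv \<rho>' (Reg x)) (opv \<rho>' e)"
    from I obtain i where i: "\<rho>' x = nr i" and Ji: "J i \<rho>' \<mu>' z'" and t': "\<epsilon> + 1 + (t + 2) * (real n - real i) \<le> \<tau>'"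
      by (auto simp: I_def)
    have fr': "\<forall>y. y \<notin> insert x (writes c) \<longrightarrow> \<rho>' y = \<rho> y" using fr by auto
    have iN: "i < n" using cc i e[OF fr'] by (simp add: compare_nr)
    have "(t + 2) * 1 \<le> (t + 2) * (real n - real i)" using iN t by (intro mult_left_mono) auto
    then have t1: "\<epsilon> + 1 + (t + 2) \<le> \<tau>'" using t' by simp
    have t2: "\<epsilon> + 1 + (t + 2) * (real n - real (Suc i)) + (t + 2) \<le> \<tau>'" using t' by (simp add: algebra_simps)
    have tt: "t \<le> \<tau>' - 1" using t1 eps by simp
    have "wp W B (c ;; Arith x Add (Reg x) (lit 1)) I (\<tau>' - 1) \<rho>' \<mu>' z'"
      unfolding wp_Seq
    proof (rule wp_use[OF body[OF iN i fr' Ji tt]])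
      fix \<tau>2 \<rho>2 \<mu>2 z2
      assume post: "\<tau>' - 1 - t \<le> \<tau>2 \<and> J (Suc i) \<rho>2 \<mu>2 z2" and fr2: "\<forall>x. x \<notin> writes c \<longrightarrow> \<rho>2 x = \<rho>' x"
      have "\<rho>2 x = nr i" using fr2 x i by simp
      moreover have "I (\<tau>2 - 1) (\<rho>2(x := nr (Suc i))) \<mu>2 z2"
        unfolding I_def using post iN t2 Jx by (intro exI[of _ "Suc i"]) auto
      ultimately show "wp W B (Arith x Add (Reg x) (lit 1)) I \<tau>2 \<rho>2 \<mu>2 z2"
        using n iN W1 by (simp add: wp_simps)
    qed
    then show "1 \<le> \<tau>' \<and> wp W B (c ;; Arith x Add (Reg x) (lit 1)) I (\<tau>' - 1) \<rho>' \<mu>' z'"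
      using t1 eps t by auto
  next
    fix \<tau>' \<rho>' \<mu>' z'
    assume I: "I \<tau>' \<rho>' \<mu>' z'" and fr: "\<forall>y. y \<notin> writes (c ;; Arith x Add (Reg x) (lit 1)) \<longrightarrow> \<rho>' y = (\<rho>(x := nr 0)) y"
      and cc: "\<not> compare Less (opv \<rho>' (Reg x)) (opv \<rho>' e)"
    from I obtain i where i: "\<rho>' x = nr i" "i \<le> n" and Ji: "J i \<rho>' \<mu>' z'" and t': "\<epsilon> + 1 + (t + 2) * (real n - real i) \<le> \<tau>'"
      by (auto simp: I_def)
    have "\<forall>y. y \<notin> insert x (writes c) \<longrightarrow> \<rho>' y = \<rho> y" using fr by auto
    then have "n \<le> i" using cc i e by (simp add: compare_nr)
    then show "\<epsilon> \<le> \<tau>' - 1 \<and> J n \<rho>' \<mu>' z'" using i Ji t' by simp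
  qed
  then show ?thesis unfolding for_loop_def \<epsilon>_def using W1 by (simp add: wp_simps del: One_nat_def cong: wp_weak_cong)
qed

lemma wp_for_loop:
  assumes e: "\<And>\<rho>'. \<forall>y. y \<notin> insert x (writes c) \<longrightarrow> \<rho>' y = \<rho> y \<Longrightarrow> opv \<rho>' e = nr n"
    and x: "x \<notin> writes c" and n: "n + 1 \<le> W" and J: "J 0 \<mu> z" and t: "0 \<le> t" "(t + 2) * real n + 2 \<le> \<tau>"
    and body: "\<And>i \<tau>' \<rho>' \<mu>' z'. i < n \<Longrightarrow> \<rho>' x = nr i \<Longrightarrow> \<forall>y. y \<notin> insert x (writes c) \<longrightarrow> \<rho>' y = \<rho> y \<Longrightarrow>
      J i \<mu>' z' \<Longrightarrow> t \<le> \<tau>' \<Longrightarrow> wp W B c (\<lambda>\<tau>2 \<rho>2 \<mu>2 z2. \<tau>' - t \<le> \<tau>2 \<and> J (Suc i) \<mu>2 z2) \<tau>' \<rho>' \<mu>' z'"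
  shows "wp W B (for_loop x e c) (\<lambda>\<tau>' \<rho>' \<mu>' z'. \<tau> - ((t + 2) * real n + 2) \<le> \<tau>' \<and> J n \<mu>' z') \<tau> \<rho> \<mu> z"
  by (rule wp_for_loop_regs[where J = "\<lambda>i _. J i", OF e x n J _ t body]) auto

text \<open>The linear search for \<open>u\<close> needs no root extraction and takes O(u) steps,
  less than a single window. Register 13 holds the next candidate
  \<open>(v + 1)^3 * l\<close>.\<close>

definition setup_params :: com where
  "setup_params =
    Arith 2 Add (lit 0) (lit 0) ;;
    Arith 3 Add (lit 1) (lit 0) ;;
    Loop Leq (Reg 3) (Reg 0) (Arith 3 Mul (lit 2) (Reg 3) ;; Arith 2 Add (Reg 2) (lit 1)) ;;
    Arith 3 Add (lit 1) (lit 0) ;;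
    Arith 13 Mul (lit 8) (Reg 2) ;;
    Loop Leq (Reg 13) (Reg 0) (
      Arith 3 Add (Reg 3) (lit 1) ;;
      Arith 14 Add (Reg 3) (lit 1) ;;
      Arith 13 Mul (Reg 14) (Reg 14) ;;
      Arith 13 Mul (Reg 13) (Reg 14) ;;
      Arith 13 Mul (Reg 13) (Reg 2)) ;;
    Arith 4 Mul (Reg 3) (Reg 2) ;;
    Arith 5 Mul (lit 4) (Reg 3)"

context sieve_params
begin

lemma wp_setup_params:
  assumes r: "\<rho> 0 = nr N" and t: "3 * real l + 6 * real u + 8 \<le> \<tau>"
  shows "wp W B setup_params (\<lambda>\<tau>' \<rho>' \<mu>' z'. \<tau> - (3 * real l + 6 * real u + 8) \<le> \<tau>' \<and>
     \<rho>' 2 = nr l \<and> \<rho>' 4 = nr L \<and> \<rho>' 5 = nr s) \<tau> \<rho> \<mu> z"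
proof -
  define \<epsilon> where "\<epsilon> = \<tau> - (3 * real l + 6 * real u + 8)"
  have eps: "0 \<le> \<epsilon>" using t by (simp add: \<epsilon>_def)
  let ?b1 = "Arith 3 Mul (lit 2) (Reg 3) ;; Arith 2 Add (Reg 2) (lit 1)"
  let ?b2 = "Arith 3 Add (Reg 3) (lit 1) ;;
      Arith 14 Add (Reg 3) (lit 1) ;;
      Arith 13 Mul (Reg 14) (Reg 14) ;;
      Arith 13 Mul (Reg 13) (Reg 14) ;;
      Arith 13 Mul (Reg 13) (Reg 2)"
  have f: "l \<le> N" "8 * l \<le> W" "u * l \<le> W" "4 * u \<le> W" "8 \<le> W" "2 * N \<le> W"
  proof -
    have "l * 400 \<le> L * 400" using u_ge by (simp add: L)
    then show "l \<le> N" "8 * l \<le> W" using L_le W L_ge by linarith+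
    show "u * l \<le> W" "8 \<le> W" "2 * N \<le> W" "4 * u \<le> W" using L L_le s_le s W L_ge by linarith+
  qed
  define I1 where "I1 = (\<lambda>\<tau>' (\<rho>' :: nat \<Rightarrow> rat) (\<mu>' :: nat \<Rightarrow> bool) (z' :: nat list). \<exists>i. \<rho>' 2 = nr i \<and> \<rho>' 3 = nr (2 ^ i) \<and> i \<le> l \<and>
     \<epsilon> + 6 * real u + 6 + 3 * (real l - real i) \<le> \<tau>')"
  define I2 where "I2 = (\<lambda>\<tau>' (\<rho>' :: nat \<Rightarrow> rat) (\<mu>' :: nat \<Rightarrow> bool) (z' :: nat list). \<exists>v. \<rho>' 3 = nr v \<and> \<rho>' 13 = nr ((v + 1) ^ 3 * l) \<and> 1 \<le> v \<and> v \<le> u \<and>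
     \<epsilon> + 3 + 6 * (real u - real v) \<le> \<tau>')"
  let ?Q = "\<lambda>\<tau>' \<rho>' \<mu>' z'. \<epsilon> \<le> \<tau>' \<and> \<rho>' 2 = nr l \<and> \<rho>' 4 = nr L \<and> \<rho>' 5 = nr s"
  have loop2: "wp W B (Loop Leq (Reg 13) (Reg 0) ?b2) (wp W B (Arith 4 Mul (Reg 3) (Reg 2) ;; Arith 5 Mul (lit 4) (Reg 3)) ?Q)
      \<tau>2 \<rho>2 \<mu>2 z2"
    if i2: "I2 \<tau>2 \<rho>2 \<mu>2 z2" and r2: "\<rho>2 0 = nr N" "\<rho>2 2 = nr l" for \<tau>2 \<rho>2 \<mu>2 z2
  proof (rule wp_Loop[where I = I2, OF i2])
    fix \<tau>' \<rho>' \<mu>' z'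
    assume I: "I2 \<tau>' \<rho>' \<mu>' z'" and fr: "\<forall>y. y \<notin> writes ?b2 \<longrightarrow> \<rho>' y = \<rho>2 y"
      and cc: "compare Leq (opv \<rho>' (Reg 13)) (opv \<rho>' (Reg 0))"
    from I obtain v where v: "\<rho>' 3 = nr v" "\<rho>' 13 = nr ((v + 1) ^ 3 * l)" "1 \<le> v" "v \<le> u"
      and t': "\<epsilon> + 3 + 6 * (real u - real v) \<le> \<tau>'" by (auto simp: I2_def)
    have r': "\<rho>' 0 = nr N" "\<rho>' 2 = nr l" using fr r2 by auto
    have le: "(v + 1) ^ 3 * l \<le> N" using cc v r' by (simp add: compare_nr)
    have "v \<noteq> u" using le u by auto
    then have vu: "v < u" using v by simp
    \<comment> \<open>The next candidate is computed before it is compared with \<open>N\<close>;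
      being at most 8 times the present one, it stays below \<open>8 * N\<close>.\<close>
    have "(v + 2) ^ 3 * l \<le> (2 * (v + 1)) ^ 3 * l" by (intro mult_right_mono power_mono) auto
    also have "\<dots> = 8 * ((v + 1) ^ 3 * l)" by (simp only: power_mult_distrib) simp
    finally have c: "(v + 2) ^ 3 * l \<le> W" using le W by linarith
    have l1: "1 \<le> l" using l by simp
    have c3: "(v + 2) * (v + 2) * (v + 2) \<le> W"
      using c mult_left_mono[OF l1, of "(v + 2) ^ 3"] by (simp add: power3_eq_cube)
    have "(v + 2) * (v + 2) \<le> (v + 2) * (v + 2) * (v + 2)" by simp
    then have c2: "(v + 2) * (v + 2) \<le> W" using c3 by (rule order_trans)
    have "v + 2 \<le> (v + 2) * (v + 2)" by simp
    then have c1: "v + 2 \<le> W" using c2 by (rule order_trans)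
    have e: "(v + 2) * (v + 2) * (v + 2) * l = (v + 1 + 1) ^ 3 * l" by (simp add: power3_eq_cube)
    have "I2 (\<tau>' - 6) (\<rho>'(3 := nr (v + 1), 14 := nr (v + 2), 13 := nr ((v + 2) * (v + 2) * (v + 2) * l))) \<mu>' z'"
      unfolding I2_def e using t' vu by (intro exI[of _ "v + 1"]) auto
    then have "wp W B ?b2 I2 (\<tau>' - 1) \<rho>' \<mu>' z'"
      using c c1 c2 c3 r' v(1) W_pos by (simp add: wp_simps power3_eq_cube)
    then show "1 \<le> \<tau>' \<and> wp W B ?b2 I2 (\<tau>' - 1) \<rho>' \<mu>' z'" using t' eps vu by simp
  next
    fix \<tau>' \<rho>' \<mu>' z'
    assume I: "I2 \<tau>' \<rho>' \<mu>' z'" and fr: "\<forall>y. y \<notin> writes ?b2 \<longrightarrow> \<rho>' y = \<rho>2 y"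
      and cc: "\<not> compare Leq (opv \<rho>' (Reg 13)) (opv \<rho>' (Reg 0))"
    from I obtain v where v: "\<rho>' 3 = nr v" "\<rho>' 13 = nr ((v + 1) ^ 3 * l)" "1 \<le> v" "v \<le> u"
      and t': "\<epsilon> + 3 + 6 * (real u - real v) \<le> \<tau>'" by (auto simp: I2_def)
    have r': "\<rho>' 0 = nr N" "\<rho>' 2 = nr l" using fr r2 by auto
    have gt: "N < (v + 1) ^ 3 * l" using cc v r' by (simp add: compare_nr)
    have "v = u"
    proof (rule ccontr)
      assume "v \<noteq> u"
      then have "(v + 1) ^ 3 * l \<le> u ^ 3 * l" using v by (intro mult_right_mono power_mono) auto
      then show False using gt u by linarith
    qed
    then show "wp W B (Arith 4 Mul (Reg 3) (Reg 2) ;; Arith 5 Mul (lit 4) (Reg 3)) ?Q (\<tau>' - 1) \<rho>' \<mu>' z'"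
      using v(1) r' f t' W_pos by (simp add: wp_simps L s)
  qed
  have loop1: "wp W B (Loop Leq (Reg 3) (Reg 0) ?b1) (wp W B (
    Arith 3 Add (lit 1) (lit 0) ;;
    Arith 13 Mul (lit 8) (Reg 2) ;;
    Loop Leq (Reg 13) (Reg 0) ?b2 ;;
    Arith 4 Mul (Reg 3) (Reg 2) ;; Arith 5 Mul (lit 4) (Reg 3)) ?Q) (\<tau> - 2) (\<rho>(2 := nr 0, 3 := nr 1)) \<mu> z"
  proof (rule wp_Loop[where I = I1])
    show "I1 (\<tau> - 2) (\<rho>(2 := nr 0, 3 := nr 1)) \<mu> z" by (auto simp: I1_def \<epsilon>_def intro!: exI[of _ 0])
  next
    fix \<tau>' \<rho>' \<mu>' z'
    assume I: "I1 \<tau>' \<rho>' \<mu>' z'" and fr: "\<forall>y. y \<notin> writes ?b1 \<longrightarrow> \<rho>' y = (\<rho>(2 := nr 0, 3 := nr 1)) y"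
      and cc: "compare Leq (opv \<rho>' (Reg 3)) (opv \<rho>' (Reg 0))"
    from I obtain i where i: "\<rho>' 2 = nr i" "\<rho>' 3 = nr (2 ^ i)" "i \<le> l"
      and t': "\<epsilon> + 6 * real u + 6 + 3 * (real l - real i) \<le> \<tau>'" by (auto simp: I1_def)
    have "\<rho>' 0 = nr N" using fr r by auto
    then have le: "2 ^ i \<le> N" using cc i by (simp add: compare_nr)
    have "i \<noteq> l" using le N by auto
    then have il: "i < l" using i by simp
    have "I1 (\<tau>' - 3) (\<rho>'(3 := nr (2 * 2 ^ i), 2 := nr (i + 1))) \<mu>' z'"
      unfolding I1_def using t' il by (intro exI[of _ "i + 1"]) auto
    then have "wp W B ?b1 I1 (\<tau>' - 1) \<rho>' \<mu>' z'"
      using le f il i W_pos by (simp add: wp_simps)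
    then show "1 \<le> \<tau>' \<and> wp W B ?b1 I1 (\<tau>' - 1) \<rho>' \<mu>' z'" using t' eps il by simp
  next
    fix \<tau>' \<rho>' \<mu>' z'
    assume I: "I1 \<tau>' \<rho>' \<mu>' z'" and fr: "\<forall>y. y \<notin> writes ?b1 \<longrightarrow> \<rho>' y = (\<rho>(2 := nr 0, 3 := nr 1)) y"
      and cc: "\<not> compare Leq (opv \<rho>' (Reg 3)) (opv \<rho>' (Reg 0))"
    from I obtain i where i: "\<rho>' 2 = nr i" "\<rho>' 3 = nr (2 ^ i)" "i \<le> l"
      and t': "\<epsilon> + 6 * real u + 6 + 3 * (real l - real i) \<le> \<tau>'" by (auto simp: I1_def)
    have r0: "\<rho>' 0 = nr N" using fr r by auto
    then have gt: "N < 2 ^ i" using cc i by (simp add: compare_nr)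
    have il: "i = l"
    proof (rule ccontr)
      assume "i \<noteq> l"
      then have "(2::nat) ^ i \<le> 2 ^ (l - 1)" using i by (intro power_increasing) auto
      then show False using gt N by linarith
    qed
    have "I2 (\<tau>' - 3) (\<rho>'(3 := nr 1, 13 := nr (8 * l))) \<mu>' z'"
      unfolding I2_def using t' il u_ge by (intro exI[of _ 1]) (auto simp: power3_eq_cube)
    then have "wp W B (Loop Leq (Reg 13) (Reg 0) ?b2) (wp W B (Arith 4 Mul (Reg 3) (Reg 2) ;; Arith 5 Mul (lit 4) (Reg 3)) ?Q)
       (\<tau>' - 3) (\<rho>'(3 := nr 1, 13 := nr (8 * l))) \<mu>' z'"
      by (rule loop2) (use r0 i il in auto)
    then show "wp W B (Arith 3 Add (lit 1) (lit 0) ;;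
      Arith 13 Mul (lit 8) (Reg 2) ;;
      Loop Leq (Reg 13) (Reg 0) ?b2 ;;
      Arith 4 Mul (Reg 3) (Reg 2) ;; Arith 5 Mul (lit 4) (Reg 3)) ?Q (\<tau>' - 1) \<rho>' \<mu>' z'"
      using f W_pos i il by (simp add: wp_simps del: One_nat_def cong: wp_weak_cong)
  qed
  then show ?thesis
    unfolding setup_params_def \<epsilon>_def using W_pos by (simp add: wp_simps del: One_nat_def cong: wp_weak_cong)
qed

end

definition windows :: "com \<Rightarrow> com" where
  "windows c = Loop Leq (Reg 6) (Reg 7) (c ;; Arith 6 Add (Reg 6) (Reg 4))"

text \<open>\<open>Res\<close> is any description of output that is additive over disjoint sets of
  integers. \<open>G\<close> is what the memory must carry from one window to the next: nothing for
  primes, the divisor table for factorizations.\<close>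

locale window_body = sieve_params +
  fixes c :: com and Res :: "nat set \<Rightarrow> nat list \<Rightarrow> bool" and G :: "(nat \<Rightarrow> bool) \<Rightarrow> bool" and hi :: nat
    and \<rho>\<^sub>b :: "nat \<Rightarrow> rat" and T :: real
  assumes writes_body: "writes c \<inter> {..<10} = {}" and T: "0 \<le> T"
    and Res: "Res {} []" "\<And>S S' y y'. Res S y \<Longrightarrow> Res S' y' \<Longrightarrow> S \<inter> S' = {} \<Longrightarrow> Res (S \<union> S') (y @ y')"
    and hi: "hi \<le> 2 * N" and regs: "\<rho>\<^sub>b 4 = nr L" "\<rho>\<^sub>b 7 = nr hi"
    and body: "\<And>A \<tau> \<rho> \<mu> z. 1 \<le> A \<Longrightarrow> A \<le> hi \<Longrightarrow> \<forall>x<10. x \<noteq> 6 \<longrightarrow> \<rho> x = \<rho>\<^sub>b x \<Longrightarrow> \<rho> 6 = nr A \<Longrightarrow> G \<mu> \<Longrightarrow> T \<le> \<tau> \<Longrightarrow>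
      wp W B c (\<lambda>\<tau>' \<rho>' \<mu>' z'. \<tau> - T \<le> \<tau>' \<and> G \<mu>' \<and> (\<exists>y. z' = z @ y \<and> Res {n. A \<le> n \<and> n < A + L \<and> n \<le> hi} y)) \<tau> \<rho> \<mu> z"
begin

lemma notin_writes_body: "x < 10 \<Longrightarrow> x \<notin> writes c"
  using writes_body by auto

lemma wp_windows:
  assumes A: "1 \<le> A\<^sub>0" "A\<^sub>0 \<le> hi" and env: "\<forall>x<10. x \<noteq> 6 \<longrightarrow> \<rho> x = \<rho>\<^sub>b x" "\<rho> 6 = nr A\<^sub>0" and G: "G \<mu>"
    and t: "(T + 2) * real ((hi + L - A\<^sub>0) div L) + 1 \<le> \<tau>"
  shows "wp W B (windows c) (\<lambda>\<tau>' \<rho>' \<mu>' z'. \<tau> - ((T + 2) * real ((hi + L - A\<^sub>0) div L) + 1) \<le> \<tau>' \<and>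
     (\<exists>y. z' = z @ y \<and> Res {A\<^sub>0..hi} y)) \<tau> \<rho> \<mu> z"
proof -
  define \<epsilon> where "\<epsilon> = \<tau> - ((T + 2) * real ((hi + L - A\<^sub>0) div L) + 1)"
  have eps: "0 \<le> \<epsilon>" using t by (simp add: \<epsilon>_def)
  define I where "I = (\<lambda>\<tau>' (\<rho>' :: nat \<Rightarrow> rat) \<mu>' z'. \<exists>A y. \<rho>' 6 = nr A \<and> A\<^sub>0 \<le> A \<and> A \<le> hi + L \<and> G \<mu>' \<and> z' = z @ y \<and>
    Res {n. A\<^sub>0 \<le> n \<and> n < A \<and> n \<le> hi} y \<and> \<epsilon> + 1 + (T + 2) * real ((hi + L - A) div L) \<le> \<tau>')"
  let ?b = "c ;; Arith 6 Add (Reg 6) (Reg 4)"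
  show ?thesis
    unfolding windows_def
  proof (rule wp_Loop[where I = I])
    have "{n. A\<^sub>0 \<le> n \<and> n < A\<^sub>0 \<and> n \<le> hi} = {}" by auto
    then have "Res {n. A\<^sub>0 \<le> n \<and> n < A\<^sub>0 \<and> n \<le> hi} []" using Res(1) by (simp only:)
    then show "I \<tau> \<rho> \<mu> z" unfolding I_def using env G A by (intro exI[of _ A\<^sub>0] exI[of _ "[]"]) (auto simp: \<epsilon>_def)
  next
    fix \<tau>' \<rho>' \<mu>' z'
    assume I: "I \<tau>' \<rho>' \<mu>' z'" and fr: "\<forall>x. x \<notin> writes ?b \<longrightarrow> \<rho>' x = \<rho> x"
      and cc: "compare Leq (opv \<rho>' (Reg 6)) (opv \<rho>' (Reg 7))"
    from I obtain A y where r6: "\<rho>' 6 = nr A" and A1: "A\<^sub>0 \<le> A" and G1: "G \<mu>'" and z1: "z' = z @ y"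
      and R1: "Res {n. A\<^sub>0 \<le> n \<and> n < A \<and> n \<le> hi} y" and t': "\<epsilon> + 1 + (T + 2) * real ((hi + L - A) div L) \<le> \<tau>'"
      by (auto simp: I_def)
    have env': "\<forall>x<10. x \<noteq> 6 \<longrightarrow> \<rho>' x = \<rho>\<^sub>b x"
      using fr env notin_writes_body by auto
    have Ah: "A \<le> hi" using cc r6 env' regs by (simp add: compare_nr)
    have div: "(hi + L - A) div L = Suc ((hi + L - (A + L)) div L)"
    proof -
      have "hi + L - A = (hi + L - (A + L)) + L" using Ah by simp
      then show ?thesis using L_ge by (metis div_add_self2 not_numeral_le_zero Suc_eq_plus1)
    qed
    have t2: "\<epsilon> + 1 + (T + 2) * real ((hi + L - (A + L)) div L) + (T + 2) \<le> \<tau>'"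
      using t' unfolding div by (simp add: algebra_simps)
    have ge: "0 \<le> (T + 2) * real ((hi + L - (A + L)) div L)" using T by simp
    have tt: "T \<le> \<tau>' - 1" using t2 eps ge by linarith
    have "wp W B ?b I (\<tau>' - 1) \<rho>' \<mu>' z'"
      unfolding wp_Seq
    proof (rule wp_use[OF body[OF _ Ah env' r6 G1 tt]])
      show "1 \<le> A" using A A1 by simp
      fix \<tau>2 \<rho>2 \<mu>2 z2
      assume post: "\<tau>' - 1 - T \<le> \<tau>2 \<and> G \<mu>2 \<and> (\<exists>y. z2 = z' @ y \<and> Res {n. A \<le> n \<and> n < A + L \<and> n \<le> hi} y)"
        and fr2: "\<forall>x. x \<notin> writes c \<longrightarrow> \<rho>2 x = \<rho>' x"
      from post obtain y2 where z2: "z2 = z' @ y2" and R2: "Res {n. A \<le> n \<and> n < A + L \<and> n \<le> hi} y2" by blast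
      have "\<rho>2 6 = \<rho>' 6" "\<rho>2 4 = \<rho>' 4" using fr2 notin_writes_body by auto
      then have r2: "\<rho>2 6 = nr A" "\<rho>2 4 = nr L" using r6 env' regs by auto
      have "{n. A\<^sub>0 \<le> n \<and> n < A \<and> n \<le> hi} \<union> {n. A \<le> n \<and> n < A + L \<and> n \<le> hi} = {n. A\<^sub>0 \<le> n \<and> n < A + L \<and> n \<le> hi}"
        using A1 by auto
      moreover have "{n. A\<^sub>0 \<le> n \<and> n < A \<and> n \<le> hi} \<inter> {n. A \<le> n \<and> n < A + L \<and> n \<le> hi} = {}" by auto
      ultimately have "Res {n. A\<^sub>0 \<le> n \<and> n < A + L \<and> n \<le> hi} (y @ y2)" using Res(2)[OF R1 R2] by simp
      then have "I (\<tau>2 - 1) (\<rho>2(6 := nr (A + L))) \<mu>2 z2"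
        unfolding I_def using post z1 z2 A1 Ah t2 by (intro exI[of _ "A + L"] exI[of _ "y @ y2"]) auto
      moreover have "A + L \<le> W" using Ah hi L_le W by linarith
      ultimately show "wp W B (Arith 6 Add (Reg 6) (Reg 4)) I \<tau>2 \<rho>2 \<mu>2 z2"
        using r2 W_pos by (simp add: wp_simps)
    qed
    moreover have "1 \<le> \<tau>'" using t2 eps ge T by linarith
    ultimately show "1 \<le> \<tau>' \<and> wp W B ?b I (\<tau>' - 1) \<rho>' \<mu>' z'" by blast
  next
    fix \<tau>' \<rho>' \<mu>' z'
    assume I: "I \<tau>' \<rho>' \<mu>' z'" and fr: "\<forall>x. x \<notin> writes ?b \<longrightarrow> \<rho>' x = \<rho> x"
      and cc: "\<not> compare Leq (opv \<rho>' (Reg 6)) (opv \<rho>' (Reg 7))"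
    from I obtain A y where r6: "\<rho>' 6 = nr A" and z1: "z' = z @ y"
      and R1: "Res {n. A\<^sub>0 \<le> n \<and> n < A \<and> n \<le> hi} y" and t': "\<epsilon> + 1 + (T + 2) * real ((hi + L - A) div L) \<le> \<tau>'"
      by (auto simp: I_def)
    have "\<rho>' 7 = \<rho> 7" using fr notin_writes_body by auto
    then have "hi < A" using cc r6 env regs by (simp add: compare_nr)
    then have "{n. A\<^sub>0 \<le> n \<and> n < A \<and> n \<le> hi} = {A\<^sub>0..hi}" by auto
    moreover have "0 \<le> (T + 2) * real ((hi + L - A) div L)" using T by simp
    ultimately show "\<tau> - ((T + 2) * real ((hi + L - A\<^sub>0) div L) + 1) \<le> \<tau>' - 1 \<and> (\<exists>y. z' = z @ y \<and> Res {A\<^sub>0..hi} y)"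
      using z1 R1 t' by (auto simp: \<epsilon>_def)
  qed
qed

end

section \<open>Primes in one window\<close>

definition mark_bit :: com where "mark_bit = Store (Reg 14) (lit 1) (lit 1)"

text \<open>The two guards handle the ends of the range: the last window may pass its end, and in a
  window that starts at 1 the number 1 stays unmarked.\<close>

definition prime_window :: com where
  "prime_window =
    for_loop 12 (Reg 4) (Store (Reg 12) (lit 1) (lit 0)) ;;
    small_sieve mark_bit ;;
    large_sieve mark_bit ;;
    for_loop 12 (Reg 4) (
      Load 13 (Reg 12) (lit 1) ;;
      Arith 14 Add (Reg 6) (Reg 12) ;;
      Cond Equal (Reg 13) (lit 0)
        (Cond Leq (Reg 14) (Reg 7) (Cond Leq (lit 2) (Reg 14) (Emit (Reg 14)) Skip) Skip)
        Skip)"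

lemma write_field_bit: "write_field \<mu> j 1 1 = \<mu>(j := True)" "write_field \<mu> j 1 0 = \<mu>(j := False)"
  by (auto simp: write_field_def fun_eq_iff)

lemma read_field_bit: "read_field \<mu> j 1 = (if \<mu> j then 1 else 0)"
  by (simp add: read_field_def)

lemma writes_mark_bit: "writes mark_bit = {}" by (simp add: mark_bit_def)

text \<open>For the least prime divisor \<open>p\<close>, the cofactor is not 1 and has a prime
  divisor, which is at least \<open>p\<close>. The bound on \<open>2 * p\<close> shows that
  \<open>p\<close> passes the sieve for proper divisors.\<close>

lemma small_prime_divisor:
  fixes n :: nat
  assumes "2 \<le> n" "\<not> prime n"
  obtains p where "prime p" "p dvd n" "p * p \<le> n" "2 * p \<le> n"
proof -
  define p where "p = (LEAST p. prime p \<and> p dvd n)"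
  have "\<exists>p. prime p \<and> p dvd n" using assms prime_factor_nat[of n] by auto
  then have p: "prime p \<and> p dvd n" unfolding p_def by (rule LeastI_ex)
  then obtain m where m: "n = p * m" by (auto elim: dvdE)
  have "m \<noteq> 1" using m p assms by auto
  then obtain q where q: "prime q" "q dvd m" using prime_factor_nat by blast
  have "q dvd n" using q m by simp
  then have "p \<le> q" unfolding p_def using q by (intro Least_le) auto
  moreover have "0 < m" using m assms by (cases m) auto
  ultimately have pm: "p \<le> m" using q by (auto dest: dvd_imp_le)
  then have "p * p \<le> n" unfolding m by simp
  moreover have "2 * p \<le> n" using pm prime_ge_2_nat[of p] p m by (metis le_trans mult.commute mult_le_mono2)
  ultimately show ?thesis using that p by blast
qed

lemma lists_primes_union:
  "lists_primes S y \<Longrightarrow> lists_primes S' y' \<Longrightarrow> S \<inter> S' = {} \<Longrightarrow> lists_primes (S \<union> S') (y @ y')"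
  by (auto simp: lists_primes_def)

context sieve_params
begin

lemma wp_prime_window:
  assumes BL: "L \<le> B" and A: "1 \<le> A" "A \<le> 2 * N" and hi: "A \<le> hi"
    and r: "\<rho> 4 = nr L" "\<rho> 5 = nr s" "\<rho> 6 = nr A" "\<rho> 7 = nr hi" "\<rho> 9 = nr 2" and t: "40000 * (real L * real l) \<le> \<tau>"
  shows "wp W B prime_window (\<lambda>\<tau>' \<rho>' \<mu>' z'. \<tau> - 40000 * (real L * real l) \<le> \<tau>' \<and>
     (\<exists>y. z' = z @ y \<and> lists_primes {n. A \<le> n \<and> n < A + L \<and> n \<le> hi} y)) \<tau> \<rho> \<mu> z"
proof -
  have W2: "2 \<le> W" "L + 1 \<le> W" "3 * N \<le> W" using W L_le L_ge by linarith+
  define X where "X = real L * real l"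
  have X: "20 * real L \<le> X" "400 \<le> real L" "real l \<le> X"
  proof -
    show "20 * real L \<le> X" unfolding X_def using l mult_right_mono[of 20 "real l" "real L"] by (simp add: mult.commute)
    show "400 \<le> real L" using L_ge by simp
    then show "real l \<le> X" unfolding X_def using mult_right_mono[of 1 "real L" "real l"] by simp
  qed
  \<comment> \<open>Budgets for clearing the bits, the small sieve, the large sieve and the output;
    visits cost \<open>k = 1\<close>. The dominant term is \<open>14 * 2000 * L * l\<close>.\<close>
  define T1 T2 T3 T4 where "T1 = (1 + 2) * real L + 2" and "T2 = (1 + 14) * (real L * real l + real L) + 2"
    and "T3 = ((1 + 13) * (2000 * real L) + 13) * real (l + 2) + 4" and "T4 = (6 + 2) * real L + 2"
  have T: "T1 + T2 + T3 + T4 \<le> 40000 * X"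
  proof -
    have "T3 = 28000 * X + 56000 * real L + 13 * real l + 30" unfolding T3_def X_def by (simp add: algebra_simps)
    then show ?thesis unfolding T1_def T2_def T4_def X_def[symmetric] using X by simp
  qed
  have Tp: "0 \<le> T1" "0 \<le> T2" "0 \<le> T3" "0 \<le> T4" by (simp_all add: T1_def T2_def T3_def T4_def)
  define Inv where "Inv P \<mu> \<longleftrightarrow> (\<forall>j<L. \<mu> j \<longleftrightarrow> (\<exists>d. (d, j) \<in> P))" for P :: "(nat \<times> nat) set" and \<mu> :: "nat \<Rightarrow> bool"
  let ?c1 = "Store (Reg 12) (lit 1) (lit 0)"
  have clear: "wp W B (for_loop 12 (Reg 4) ?c1) (\<lambda>\<tau>' \<rho>' \<mu>' z'. \<tau> - T1 \<le> \<tau>' \<and> (\<forall>j<L. \<not> \<mu>' j)) \<tau> \<rho> \<mu> z"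
    unfolding T1_def
  proof (rule wp_for_loop[where J = "\<lambda>i \<mu>' z'. \<forall>j<i. \<not> \<mu>' j"])
    fix i \<tau>' z' and \<rho>' :: "nat \<Rightarrow> rat" and \<mu>' :: "nat \<Rightarrow> bool"
    assume "i < L" "\<rho>' 12 = nr i" "\<forall>j<i. \<not> \<mu>' j"
    then show "wp W B ?c1 (\<lambda>\<tau>2 \<rho>2 \<mu>2 z2. \<tau>' - 1 \<le> \<tau>2 \<and> (\<forall>j<Suc i. \<not> \<mu>2 j)) \<tau>' \<rho>' \<mu>' z'"
      using BL W2 by (simp add: wp_simps write_field_bit less_Suc_eq del: One_nat_def)
  qed (use r W2 T Tp t in \<open>auto simp: X_def[symmetric] T1_def\<close>)
  let ?c4 = "Load 13 (Reg 12) (lit 1) ;;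
      Arith 14 Add (Reg 6) (Reg 12) ;;
      Cond Equal (Reg 13) (lit 0)
        (Cond Leq (Reg 14) (Reg 7) (Cond Leq (lit 2) (Reg 14) (Emit (Reg 14)) Skip) Skip)
        Skip"
  show ?thesis
    unfolding prime_window_def wp_Seq[of W B "for_loop 12 (Reg 4) ?c1"]
  proof (rule wp_use[OF clear])
    fix \<tau>1 \<rho>1 \<mu>1 z1
    assume p1: "\<tau> - T1 \<le> \<tau>1 \<and> (\<forall>j<L. \<not> \<mu>1 j)" and fr1: "\<forall>x. x \<notin> writes (for_loop 12 (Reg 4) ?c1) \<longrightarrow> \<rho>1 x = \<rho> x"
      and em1: "\<not> emits (for_loop 12 (Reg 4) ?c1) \<longrightarrow> z1 = z"
    have r1: "\<rho>1 4 = nr L" "\<rho>1 5 = nr s" "\<rho>1 6 = nr A" "\<rho>1 7 = nr hi" "\<rho>1 9 = nr 2"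
      using fr1 r by (auto simp: writes_for_loop)
    interpret v: visitor N l u L s W B A mark_bit Inv \<rho>1 1
    proof
      fix P \<tau> \<mu> z d j and \<rho> :: "nat \<Rightarrow> rat"
      assume "Inv P \<mu>" "\<rho> 14 = nr j" "j < L"
      then show "wp W B mark_bit (\<lambda>\<tau>' \<rho>' \<mu>' z'. \<tau> - 1 \<le> \<tau>' \<and> Inv (insert (d, j) P) \<mu>') \<tau> \<rho> \<mu> z"
        using BL W2 by (auto simp: mark_bit_def wp_simps write_field_bit Inv_def simp del: One_nat_def)
    qed (use r1 A in \<open>auto simp: mark_bit_def\<close>)
    have i1: "Inv {} \<mu>1" using p1 by (simp add: Inv_def)
    define P2 where "P2 = {(d, j). 2 \<le> d \<and> d \<le> L \<and> j < L \<and> d dvd A + j \<and> 2 * d \<le> A + j}"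
    have t2: "T2 \<le> \<tau>1" using p1 T Tp t by (simp add: X_def)
    show "wp W B (small_sieve mark_bit ;; large_sieve mark_bit ;; for_loop 12 (Reg 4) ?c4)
        (\<lambda>\<tau>' \<rho>' \<mu>' z'. \<tau> - 40000 * (real L * real l) \<le> \<tau>' \<and>
     (\<exists>y. z' = z @ y \<and> lists_primes {n. A \<le> n \<and> n < A + L \<and> n \<le> hi} y)) \<tau>1 \<rho>1 \<mu>1 z1"
      unfolding wp_Seq[of W B "small_sieve mark_bit"]
    proof (rule wp_use[OF v.wp_small_sieve[OF i1 _ r1(5) _ _ t2[unfolded T2_def]]])
      fix \<tau>2 \<rho>2 \<mu>2 z2
      assume p2: "\<tau>1 - ((1 + 14) * (real L * real l + real L) + 2) \<le> \<tau>2 \<and>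
         Inv ({} \<union> {(d, j). 2 \<le> d \<and> d \<le> L \<and> j < L \<and> d dvd A + j \<and> 2 * d \<le> A + j}) \<mu>2"
        and fr2: "\<forall>x. x \<notin> writes (small_sieve mark_bit) \<longrightarrow> \<rho>2 x = \<rho>1 x"
        and em2: "\<not> emits (small_sieve mark_bit) \<longrightarrow> z2 = z1"
      have p2': "\<tau>1 - T2 \<le> \<tau>2" "Inv P2 \<mu>2" using p2 by (simp_all add: T2_def P2_def)
      have r2: "\<forall>x<13. \<rho>2 x = \<rho>1 x" using fr2 by (auto simp: small_sieve_def sieve_row_def writes_mark_bit)
      have t3: "T3 \<le> \<tau>2" using p1 p2' T Tp t by (simp add: X_def)
      show "wp W B (large_sieve mark_bit ;; for_loop 12 (Reg 4) ?c4)
        (\<lambda>\<tau>' \<rho>' \<mu>' z'. \<tau> - 40000 * (real L * real l) \<le> \<tau>' \<and>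
         (\<exists>y. z' = z @ y \<and> lists_primes {n. A \<le> n \<and> n < A + L \<and> n \<le> hi} y)) \<tau>2 \<rho>2 \<mu>2 z2"
        unfolding wp_Seq
      proof (rule wp_use[OF v.wp_large_sieve[OF p2'(2) r2 t3[unfolded T3_def]]])
        fix \<tau>3 \<rho>3 \<mu>3 z3
        assume p3: "\<tau>2 - (((1 + 13) * (2000 * real L) + 13) * real (l + 2) + 4) \<le> \<tau>3 \<and>
           (\<exists>P'. Inv P' \<mu>3 \<and> v.extends P2 P' \<and> (\<forall>d. L \<le> d \<and> d * d \<le> A + L \<longrightarrow> v.covered P' d))"
          and fr3: "\<forall>x. x \<notin> writes (large_sieve mark_bit) \<longrightarrow> \<rho>3 x = \<rho>2 x"
          and em3: "\<not> emits (large_sieve mark_bit) \<longrightarrow> z3 = z2"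
        from p3 obtain P3 where P3: "Inv P3 \<mu>3" "v.extends P2 P3" and cov: "\<forall>d. L \<le> d \<and> d * d \<le> A + L \<longrightarrow> v.covered P3 d"
          by blast
        have t4: "T4 \<le> \<tau>3" "\<tau> - (T1 + T2 + T3) \<le> \<tau>3"
          using p1 p2' p3[folded T3_def] T Tp t unfolding X_def by linarith+
        have z3: "z3 = z"
          using em1 em2 em3 by (simp add: emits_for_loop small_sieve_def sieve_row_def mark_bit_def large_sieve_def
              sieve_scan_def farey_step_def choose_fraction_def sieve_block_def visit_progression_def visit_candidate_def)
        have "x \<notin> writes (large_sieve mark_bit)" if "x < 13" for x
          using that by (auto simp: large_sieve_def sieve_scan_def farey_step_def choose_fraction_def sieve_block_def
              visit_progression_def visit_candidate_def writes_mark_bit)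
        then have r3: "\<forall>x<13. \<rho>3 x = \<rho>1 x" using fr3 r2 by auto
        then have r4: "\<rho>3 4 = nr L" "\<rho>3 6 = nr A" "\<rho>3 7 = nr hi" using r1 by auto
        \<comment> \<open>A composite number has a prime divisor up to its square root, which one of
          the two sieves visits. Conversely, every visited divisor is proper and at least 2.\<close>
        have bit: "\<not> \<mu>3 j \<longleftrightarrow> prime (A + j)" if j: "j < L" "2 \<le> A + j" for j
        proof
          assume "\<not> \<mu>3 j"
          then have no: "\<And>d. (d, j) \<notin> P3" using P3(1) j by (simp add: Inv_def)
          show "prime (A + j)"
          proof (rule ccontr)
            assume "\<not> prime (A + j)"
            then obtain p where p: "prime p" "p dvd A + j" "p * p \<le> A + j" "2 * p \<le> A + j"
              using small_prime_divisor j(2) by blast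
            show False
            proof (cases "p \<le> L")
              case True
              then have "(p, j) \<in> P2" using p j prime_ge_2_nat by (auto simp: P2_def)
              then show False using no P3(2) by (auto simp: v.extends_def)
            next
              case False
              then have "v.covered P3 p" using cov p j by auto
              then show False using no p j by (auto simp: v.covered_def)
            qed
          qed
        next
          assume pr: "prime (A + j)"
          show "\<not> \<mu>3 j"
          proof
            assume "\<mu>3 j"
            then obtain d where "(d, j) \<in> P3" using P3(1) j by (auto simp: Inv_def)
            then have "(d, j) \<in> P2 \<or> (d, j) \<in> v.allowed" using P3(2) by (auto simp: v.extends_def)
            then have "2 \<le> d" "d dvd A + j" "2 * d \<le> A + j" using L_ge by (auto simp: P2_def v.allowed_def)
            then show False using pr by (auto simp: prime_nat_iff)
          qed
        qed
        define J where "J i (\<mu>' :: nat \<Rightarrow> bool) z' \<longleftrightarrow> \<mu>' = \<mu>3 \<and>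
          (\<exists>y. z' = z @ y \<and> lists_primes {n. A \<le> n \<and> n < A + i \<and> n \<le> hi} y)" for i \<mu>' and z' :: "nat list"
        have "wp W B (for_loop 12 (Reg 4) ?c4) (\<lambda>\<tau>' \<rho>' \<mu>' z'. \<tau>3 - T4 \<le> \<tau>' \<and> J L \<mu>' z') \<tau>3 \<rho>3 \<mu>3 z3"
          unfolding T4_def
        proof (rule wp_for_loop[where J = J])
          show "J 0 \<mu>3 z3" by (simp add: J_def z3 lists_primes_def)
          fix i \<tau>' \<mu>' z' and \<rho>' :: "nat \<Rightarrow> rat"
          assume i: "i < L" "\<rho>' 12 = nr i" and fr': "\<forall>y. y \<notin> insert 12 (writes ?c4) \<longrightarrow> \<rho>' y = \<rho>3 y" and Ji: "J i \<mu>' z'"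
          from Ji obtain y where y: "z' = z @ y" "lists_primes {n. A \<le> n \<and> n < A + i \<and> n \<le> hi} y" and mu: "\<mu>' = \<mu>3"
            by (auto simp: J_def)
          have r': "\<rho>' 6 = nr A" "\<rho>' 7 = nr hi" using fr' r4 by auto
          have split: "{n. A \<le> n \<and> n < A + Suc i \<and> n \<le> hi} =
              {n. A \<le> n \<and> n < A + i \<and> n \<le> hi} \<union> (if A + i \<le> hi then {A + i} else {})" by auto
          have yes: "J (Suc i) \<mu>3 (z' @ [A + i])" if "\<not> \<mu>3 i" "A + i \<le> hi" "2 \<le> A + i"
          proof -
            have "lists_primes {A + i} [A + i]" using bit[OF i(1)] that by (auto simp: lists_primes_def)
            then have "lists_primes {n. A \<le> n \<and> n < A + Suc i \<and> n \<le> hi} (y @ [A + i])"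
              unfolding split using lists_primes_union[OF y(2), of "{A + i}" "[A + i]"] that by simp
            then show ?thesis using y by (simp add: J_def)
          qed
          have no: "J (Suc i) \<mu>3 z'" if "\<mu>3 i \<or> \<not> A + i \<le> hi \<or> \<not> 2 \<le> A + i"
          proof -
            have "lists_primes (if A + i \<le> hi then {A + i} else {}) []"
              using bit[OF i(1)] that prime_ge_2_nat[of "A + i"] by (auto simp: lists_primes_def)
            then have "lists_primes {n. A \<le> n \<and> n < A + Suc i \<and> n \<le> hi} (y @ [])"
              unfolding split by (intro lists_primes_union y(2)) auto
            then show ?thesis using y by (simp add: J_def)
          qed
          have "A + i \<le> W" using A i L_le W2 by linarith
          then show "wp W B ?c4 (\<lambda>\<tau>2 \<rho>2 \<mu>2 z2. \<tau>' - 6 \<le> \<tau>2 \<and> J (Suc i) \<mu>2 z2) \<tau>' \<rho>' \<mu>' z'"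
            using i r' yes no BL W2 unfolding mu by (simp add: wp_simps read_field_bit del: One_nat_def)
        qed (use r4 W2 t4 in \<open>auto simp: T4_def\<close>)
        then show "wp W B (for_loop 12 (Reg 4) ?c4) (\<lambda>\<tau>' \<rho>' \<mu>' z'. \<tau> - 40000 * (real L * real l) \<le> \<tau>' \<and>
           (\<exists>y. z' = z @ y \<and> lists_primes {n. A \<le> n \<and> n < A + L \<and> n \<le> hi} y)) \<tau>3 \<rho>3 \<mu>3 z3"
        proof (rule wp_use)
          fix \<tau>4 \<rho>4 \<mu>4 z4
          assume "\<tau>3 - T4 \<le> \<tau>4 \<and> J L \<mu>4 z4"
          then show "\<tau> - 40000 * (real L * real l) \<le> \<tau>4 \<and>
           (\<exists>y. z4 = z @ y \<and> lists_primes {n. A \<le> n \<and> n < A + L \<and> n \<le> hi} y)"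
            using t4 T by (auto simp: J_def X_def)
        qed
      qed
    qed auto
  qed
qed

end

section \<open>Factorizations\<close>

definition cell :: "nat \<Rightarrow> (nat \<Rightarrow> bool) \<Rightarrow> nat \<Rightarrow> nat" where
  "cell w \<mu> x = read_field \<mu> (x * w) w"

lemma binary_expansion: "(\<Sum>j<w. if odd (v div 2 ^ j) then 2 ^ j else 0) = (v :: nat) mod 2 ^ w"
proof (induction w)
  case (Suc w)
  have "v mod 2 ^ Suc w = 2 ^ w * (v div 2 ^ w mod 2) + v mod 2 ^ w"
    by (metis mod_mult2_eq mult.commute power_Suc)
  then show ?case using Suc by (simp add: odd_iff_mod_2_eq_one)
qed simp

lemma cell_write_field:
  assumes "v < 2 ^ w"
  shows "cell w (write_field \<mu> (x * w) w v) y = (if y = x then v else cell w \<mu> y)"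
proof (cases "y = x")
  case True
  have "cell w (write_field \<mu> (x * w) w v) x = (\<Sum>j<w. if odd (v div 2 ^ j) then 2 ^ j else 0)"
    by (auto simp: cell_def read_field_def write_field_def intro!: sum.cong)
  then show ?thesis using assms True by (simp add: binary_expansion)
next
  case False
  have "\<not> (x * w \<le> y * w + j \<and> y * w + j < x * w + w)" if "j < w" for j
  proof (cases "y < x")
    case True
    then have "(y + 1) * w \<le> x * w" by (intro mult_right_mono) auto
    then show ?thesis using that by simp
  next
    case False
    then have "(x + 1) * w \<le> y * w" using \<open>y \<noteq> x\<close> by (intro mult_right_mono) auto
    then show ?thesis by simp
  qed
  then show ?thesis using False by (auto simp: cell_def read_field_def write_field_def intro!: sum.cong)
qed

definition load_cell :: "nat \<Rightarrow> operand \<Rightarrow> operand \<Rightarrow> com" where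
  "load_cell x a b = Arith 15 Add a b ;; Arith 15 Mul (Reg 15) (Reg 8) ;; Load x (Reg 15) (Reg 8)"

definition store_cell :: "operand \<Rightarrow> operand \<Rightarrow> operand \<Rightarrow> com" where
  "store_cell a b v = Arith 15 Add a b ;; Arith 15 Mul (Reg 15) (Reg 8) ;; Store (Reg 15) (Reg 8) v"

lemma writes_load_cell: "writes (load_cell x a b) = {15, x}"
  and writes_store_cell: "writes (store_cell a b v) = {15}"
  by (auto simp: load_cell_def store_cell_def)

text \<open>Window elements are at most \<open>3 * N < 2 ^ (l + 2)\<close>, and
  \<open>2 ^ (l + 2) \<le> 8 * N\<close> is still a word. The factor 9 in \<open>B\<close> counts
  the tables of \<open>L\<close> cells: what is left, six divisors, a large prime, and the divisors
  of small numbers.\<close>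

locale factor_params = sieve_params +
  fixes w :: nat
  assumes w: "w = l + 2" and B: "B = 9 * L * w"
begin

lemma two_power_w: "2 ^ w \<le> W" "3 * N < 2 ^ w" "L < 2 ^ w"
proof -
  have "(2::nat) ^ l = 2 * 2 ^ (l - 1)" using l by (cases l) auto
  then show "2 ^ w \<le> W" "3 * N < 2 ^ w" using N W by (auto simp: w)
  then show "L < 2 ^ w" using L_le by linarith
qed

lemma address_le: "x < 9 * L \<Longrightarrow> x * w + w \<le> B" "x < 9 * L \<Longrightarrow> x * w \<le> W" "9 * L \<le> W" "L * l \<le> N"
proof -
  have "20 * (l * L) \<le> L * L" using u_ge by (simp add: L)
  then have Ll: "20 * (L * l) \<le> N" using L_square_le unfolding mult.commute[of l L] by (rule order_trans)
  then show "L * l \<le> N" by simp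
  have B': "B = 9 * (L * l) + 18 * L" by (simp add: B w algebra_simps)
  show b: "x * w + w \<le> B" if "x < 9 * L"
  proof -
    have "(x + 1) * w \<le> 9 * L * w" using that by (intro mult_right_mono) auto
    then show ?thesis by (simp add: B)
  qed
  show "x * w \<le> W" if "x < 9 * L" using b[OF that] B' Ll L_le W by linarith
  show "9 * L \<le> W" using L_le W by linarith
qed

lemma wp_load_cell:
  assumes "\<rho> 8 = nr w" "opv \<rho> a = nr i" "opv \<rho> b = nr j" "i + j < 9 * L"
  shows "wp W B (load_cell x a b) Q \<tau> \<rho> \<mu> z \<longleftrightarrow>
    Q (\<tau> - 3) (\<rho>(15 := nr ((i + j) * w), x := nr (cell w \<mu> (i + j)))) \<mu> z"
  using assms W_pos two_power_w address_le(1,2)[of "i + j"] address_le(3)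
  by (simp add: load_cell_def wp_simps cell_def cong: wp_weak_cong)

lemma wp_store_cell:
  assumes "\<rho> 8 = nr w" "opv \<rho> a = nr i" "opv \<rho> b = nr j" "i + j < 9 * L" "opv (\<rho>(15 := nr ((i + j) * w))) v = nr n" "n < 2 ^ w"
  shows "wp W B (store_cell a b v) Q \<tau> \<rho> \<mu> z \<longleftrightarrow>
    Q (\<tau> - 3) (\<rho>(15 := nr ((i + j) * w))) (write_field \<mu> ((i + j) * w) w n) z"
  using assms W_pos two_power_w address_le(1,2)[of "i + j"] address_le(3)
  by (simp add: store_cell_def wp_simps cong: wp_weak_cong)

end

section \<open>Factoring a number from its recorded divisors\<close>

definition partial_factorization :: "nat \<Rightarrow> nat list \<Rightarrow> nat \<Rightarrow> bool" where
  "partial_factorization n ps c \<longleftrightarrow> 1 \<le> c \<and> c dvd n \<and> distinct ps \<and> (\<forall>p\<in>set ps. prime p \<and> p dvd n) \<and>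
     (\<forall>p. prime p \<longrightarrow> multiplicity p c = (if p \<in> set ps then 0 else multiplicity p n))"

definition prime_powers :: "nat \<Rightarrow> nat list \<Rightarrow> nat list" where
  "prime_powers n ps = concat (map (\<lambda>p. [p, multiplicity p n]) ps)"

lemma partial_factorization_Nil: "1 \<le> n \<Longrightarrow> partial_factorization n [] n"
  by (simp add: partial_factorization_def)

text \<open>A prime that divides the cofactor \<open>c\<close> is not among \<open>ps\<close>, so
  its full power is still in \<open>c\<close>, and the exponent counted there is the one in
  \<open>n\<close>. The second conclusion justifies the emitted exponent.\<close>

lemma partial_factorization_snoc:
  assumes pf: "partial_factorization n ps c" and p: "prime p" "p dvd c" "c = d * p ^ v" "\<not> p dvd d"
  shows "partial_factorization n (ps @ [p]) d" "v = multiplicity p n"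
proof -
  have c: "1 \<le> c" "c dvd n" using pf by (auto simp: partial_factorization_def)
  have d: "1 \<le> d" using c p(3) by (cases d) auto
  have mult: "multiplicity q c = multiplicity q d + (if q = p then v else 0)" if "prime q" for q
  proof -
    have "multiplicity q c = multiplicity q d + multiplicity q (p ^ v)"
      unfolding p(3) using that d p(1) by (intro prime_elem_multiplicity_mult_distrib) auto
    moreover have "multiplicity q (p ^ v) = (if q = p then v else 0)"
    proof (cases "q = p")
      case True
      then show ?thesis using p(1) by (auto intro!: multiplicity_same_power simp: prime_nat_iff)
    next
      case False
      then have "\<not> q dvd p ^ v" using that p(1) by (metis prime_dvd_power primes_dvd_imp_eq)
      then show ?thesis using False by (simp add: not_dvd_imp_multiplicity_0)
    qed
    ultimately show ?thesis by simp
  qed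
  have pd: "multiplicity p d = 0" using p by (simp add: not_dvd_imp_multiplicity_0)
  have "multiplicity p c \<noteq> 0" using p c
    by (metis multiplicity_eq_zero_iff not_one_le_zero not_prime_unit)
  then have pn: "p \<notin> set ps" "multiplicity p c = multiplicity p n" using pf p by (auto simp: partial_factorization_def split: if_splits)
  show v: "v = multiplicity p n" using pn mult[OF p(1)] pd by simp
  have "d dvd c" using p by simp
  then have "d dvd n" using c by (meson dvd_trans)
  moreover have "p dvd n" using p c by (meson dvd_trans)
  moreover have "multiplicity q d = (if q \<in> set (ps @ [p]) then 0 else multiplicity q n)" if "prime q" for q
    using mult[OF that] pd pf that by (auto simp: partial_factorization_def)
  ultimately show "partial_factorization n (ps @ [p]) d"
    using pf d p pn by (auto simp: partial_factorization_def)
qed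

lemma partial_factorization_complete:
  assumes "partial_factorization n ps 1" "1 \<le> n"
  shows "distinct ps" "set ps = {p. prime p \<and> p dvd n}"
proof -
  have "p \<in> set ps" if "prime p" "p dvd n" for p
  proof (rule ccontr)
    assume "p \<notin> set ps"
    then have "multiplicity p n = 0" using assms(1) that by (auto simp: partial_factorization_def)
    then show False using that assms(2) by (metis multiplicity_eq_zero_iff not_one_le_zero not_prime_unit)
  qed
  then show "distinct ps" "set ps = {p. prime p \<and> p dvd n}"
    using assms by (auto simp: partial_factorization_def)
qed

definition strip_prime :: com where
  "strip_prime =
    Arith 19 Rem (Reg 13) (Reg 18) ;;
    Cond Equal (Reg 19) (lit 0) (
      Emit (Reg 18) ;;
      Arith 20 Add (lit 0) (lit 0) ;;
      Loop Equal (Reg 19) (lit 0) (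
        Arith 13 Quot (Reg 13) (Reg 18) ;;
        Arith 20 Add (Reg 20) (lit 1) ;;
        Arith 19 Rem (Reg 13) (Reg 18)) ;;
      Emit (Reg 20))
    Skip"

lemma writes_strip_prime: "writes strip_prime = {13, 19, 20}"
  by (auto simp: strip_prime_def)

lemma floorlog_div_less:
  assumes "2 \<le> p" "1 \<le> c"
  shows "floorlog 2 (c div p) + 1 \<le> floorlog 2 c"
proof -
  have "c div p \<le> c div 2" using assms by (intro div_le_mono2) auto
  then have "floorlog 2 (c div p) \<le> floorlog 2 (c div 2)" by (intro floorlog_mono)
  moreover have "floorlog 2 c = floorlog 2 (c div 2) + 1" using assms by (subst compute_floorlog) auto
  ultimately show ?thesis by simp
qed

text \<open>The bit length of the cofactor is a potential: every division by \<open>p\<close>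
  removes at least one bit. Up to 6 credits, the price of a call is 4 credits per bit
  removed.\<close>

lemma wp_strip_prime:
  assumes pf: "partial_factorization n ps c" and p: "prime p" and r: "\<rho> 13 = nr c" "\<rho> 18 = nr p"
    and W: "n + 1 \<le> W" "1 \<le> n" and t: "6 + 4 * real (floorlog 2 c) \<le> \<tau>"
  shows "wp W B strip_prime (\<lambda>\<tau>' \<rho>' \<mu>' z'. \<exists>c' qs. \<tau> - 6 - 4 * real (floorlog 2 c) + 4 * real (floorlog 2 c') \<le> \<tau>' \<and> \<rho>' 13 = nr c' \<and>
     partial_factorization n (ps @ qs) c' \<and> z' = z @ prime_powers n qs \<and> c' dvd c \<and> \<not> p dvd c') \<tau> \<rho> \<mu> z"
proof -
  have c: "1 \<le> c" "c dvd n" using pf by (auto simp: partial_factorization_def)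
  have cn: "c \<le> n" using c W by (auto dest: dvd_imp_le)
  have p2: "2 \<le> p" using p by (rule prime_ge_2_nat)
  have W1: "1 \<le> W" using W by simp
  have cW: "c mod p \<le> W" using mod_less_eq_dividend[of c p] cn W by linarith
  let ?Q = "\<lambda>\<tau>' \<rho>' \<mu>' z'. \<exists>c' qs. \<tau> - 6 - 4 * real (floorlog 2 c) + 4 * real (floorlog 2 c') \<le> \<tau>' \<and> \<rho>' 13 = nr c' \<and>
     partial_factorization n (ps @ qs) c' \<and> z' = z @ prime_powers n qs \<and> c' dvd c \<and> \<not> p dvd c'"
  show ?thesis
  proof (cases "p dvd c")
    case False
    then have "c mod p \<noteq> 0" by (simp add: dvd_eq_mod_eq_0)
    moreover have "?Q (\<tau> - 2) (\<rho>(19 := nr (c mod p))) \<mu> z"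
      using pf r False by (intro exI[of _ c] exI[of _ "[]"]) (auto simp: prime_powers_def)
    ultimately show ?thesis unfolding strip_prime_def using r cW W1 by (simp add: wp_simps)
  next
    case True
    let ?b = "Arith 13 Quot (Reg 13) (Reg 18) ;; Arith 20 Add (Reg 20) (lit 1) ;; Arith 19 Rem (Reg 13) (Reg 18)"
    define \<epsilon> where "\<epsilon> = \<tau> - 6 - 4 * real (floorlog 2 c)"
    have eps: "0 \<le> \<epsilon>" using t by (simp add: \<epsilon>_def)
    define I where "I = (\<lambda>\<tau>' (\<rho>' :: nat \<Rightarrow> rat) (\<mu>' :: nat \<Rightarrow> bool) (z' :: nat list). \<exists>d v. \<rho>' 13 = nr d \<and> \<rho>' 20 = nr v \<and> \<rho>' 19 = nr (d mod p) \<and>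
      c = d * p ^ v \<and> v \<le> n \<and> \<epsilon> + 2 + 4 * real (floorlog 2 d) \<le> \<tau>')"
    define \<rho>1 where "\<rho>1 = \<rho>(19 := nr 0, 20 := nr 0)"
    have "wp W B (Loop Equal (Reg 19) (lit 0) ?b) (wp W B (Emit (Reg 20)) ?Q) (\<tau> - 4) \<rho>1 \<mu> (z @ [p])"
    proof (rule wp_Loop[where I = I])
      show "I (\<tau> - 4) \<rho>1 \<mu> (z @ [p])" unfolding I_def
        using r True by (intro exI[of _ c] exI[of _ 0]) (auto simp: \<rho>1_def \<epsilon>_def)
    next
      fix \<tau>' \<rho>' \<mu>' z'
      assume I: "I \<tau>' \<rho>' \<mu>' z'" and fr: "\<forall>x. x \<notin> writes ?b \<longrightarrow> \<rho>' x = \<rho>1 x"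
        and cc: "compare Equal (opv \<rho>' (Reg 19)) (opv \<rho>' (lit 0))"
      from I obtain d v where d: "\<rho>' 13 = nr d" "\<rho>' 20 = nr v" "\<rho>' 19 = nr (d mod p)" "c = d * p ^ v"
        and t': "\<epsilon> + 2 + 4 * real (floorlog 2 d) \<le> \<tau>'" by (auto simp: I_def)
      have r18: "\<rho>' 18 = nr p" using fr r by (auto simp: \<rho>1_def)
      have pd: "p dvd d" using cc d by (simp add: wp_simps dvd_eq_mod_eq_0)
      then obtain e where e: "d = p * e" by (auto elim: dvdE)
      have d1: "1 \<le> d" using d c by (cases d) auto
      have de: "d div p = e" using e p2 by simp
      have ce: "c = e * p ^ (v + 1)" using d e by (simp add: mult_ac)
      have e1: "1 \<le> e" using d1 e by (cases e) auto
      \<comment> \<open>The exponent is smaller than the prime power, which divides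
        \<open>c\<close>; so the counter fits into a word.\<close>
      have "v + 1 < p ^ (v + 1)" using p2 by (metis less_exp order_less_le_trans power_mono zero_le_numeral)
      also have "\<dots> \<le> c" unfolding ce using e1 by simp
      finally have v: "v + 1 \<le> n" using cn by simp
      have "e \<le> c" unfolding ce using p2 by simp
      then have eW: "e \<le> W" "e mod p \<le> W" using cn W mod_less_eq_dividend[of e p] by linarith+
      have fl: "floorlog 2 e + 1 \<le> floorlog 2 d" using floorlog_div_less[OF p2 d1] de by simp
      then have "4 * real (floorlog 2 e) + 4 \<le> 4 * real (floorlog 2 d)" by linarith
      then have "I (\<tau>' - 4) (\<rho>'(13 := nr e, 20 := nr (v + 1), 19 := nr (e mod p))) \<mu>' z'"
        unfolding I_def using t' v ce by (intro exI[of _ e] exI[of _ "v + 1"]) auto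
      then have "wp W B ?b I (\<tau>' - 1) \<rho>' \<mu>' z'"
        using d r18 de eW v W W1 by (simp add: wp_simps)
      moreover have "1 \<le> \<tau>'" using t' eps by linarith
      ultimately show "1 \<le> \<tau>' \<and> wp W B ?b I (\<tau>' - 1) \<rho>' \<mu>' z'" by blast
    next
      fix \<tau>' \<rho>' \<mu>' z'
      assume I: "I \<tau>' \<rho>' \<mu>' z'" and em: "\<not> emits ?b \<longrightarrow> z' = z @ [p]"
        and cc: "\<not> compare Equal (opv \<rho>' (Reg 19)) (opv \<rho>' (lit 0))"
      from I obtain d v where d: "\<rho>' 13 = nr d" "\<rho>' 20 = nr v" "\<rho>' 19 = nr (d mod p)" "c = d * p ^ v"
        and t': "\<epsilon> + 2 + 4 * real (floorlog 2 d) \<le> \<tau>'" by (auto simp: I_def)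
      have pd: "\<not> p dvd d" using cc d by (simp add: wp_simps dvd_eq_mod_eq_0)
      note sn = partial_factorization_snoc[OF pf p True d(4) pd]
      have z': "z' = z @ [p]" using em by simp
      have "?Q (\<tau>' - 1 - 1) \<rho>' \<mu>' (z' @ [v])"
        using sn d pd t' by (intro exI[of _ d] exI[of _ "[p]"]) (auto simp: prime_powers_def z' \<epsilon>_def)
      then show "wp W B (Emit (Reg 20)) ?Q (\<tau>' - 1) \<rho>' \<mu>' z'"
        using d by (simp add: wp_simps)
    qed
    then show ?thesis
      unfolding strip_prime_def using r True cW W1 unfolding \<rho>1_def
      by (simp add: wp_simps dvd_eq_mod_eq_0 del: One_nat_def cong: wp_weak_cong)
  qed
qed

text \<open>The quotient of a number by its largest proper divisor is prime, so following the table
  from \<open>d\<close> down to 1 meets all prime factors of \<open>d\<close> without trial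
  division.\<close>

definition strip_divisor :: com where
  "strip_divisor =
    Loop Less (lit 1) (Reg 16) (
      Arith 17 Mul (lit 8) (Reg 4) ;;
      Arith 17 Sub (Reg 17) (lit 1) ;;
      load_cell 17 (Reg 17) (Reg 16) ;;
      Arith 18 Quot (Reg 16) (Reg 17) ;;
      Arith 16 Add (Reg 17) (lit 0) ;;
      strip_prime)"

lemma writes_strip_divisor: "writes strip_divisor = {13, 15, 16, 17, 18, 19, 20}"
  by (auto simp: strip_divisor_def writes_load_cell writes_strip_prime)

lemma prime_powers_append: "prime_powers n (ps @ qs) = prime_powers n ps @ prime_powers n qs"
  by (simp add: prime_powers_def)

context factor_params
begin

text \<open>The table is built like a window that starts at 1, where \<open>n\<close> has index
  \<open>n - 1\<close>; hence the address \<open>8 * L - 1 + n\<close>. Of the maximality of the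
  entries only the primality of the quotient is kept.\<close>

definition divisor_table :: "(nat \<Rightarrow> bool) \<Rightarrow> bool" where
  "divisor_table \<mu> \<longleftrightarrow> (\<forall>n. 2 \<le> n \<longrightarrow> n \<le> L \<longrightarrow> 1 \<le> cell w \<mu> (8 * L - 1 + n) \<and>
     cell w \<mu> (8 * L - 1 + n) dvd n \<and> prime (n div cell w \<mu> (8 * L - 1 + n)))"

text \<open>Each round at least halves the divisor, so 14 credits per bit of \<open>d\<close> pay
  for the walk; the divisions are paid by the bits of the cofactor. Throughout, a prime of
  \<open>d\<close> either divides what is left of \<open>d\<close> or is gone from the
  cofactor.\<close>

lemma wp_strip_divisor:
  assumes pf: "partial_factorization n ps c" and d: "1 \<le> d" "d \<le> L" and G: "divisor_table \<mu>"
    and r: "\<rho> 13 = nr c" "\<rho> 16 = nr d" "\<rho> 4 = nr L" "\<rho> 8 = nr w" and n: "1 \<le> n" "n \<le> 3 * N"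
    and t: "14 * real (floorlog 2 d) + 4 * real (floorlog 2 c) + 1 \<le> \<tau>"
  shows "wp W B strip_divisor (\<lambda>\<tau>' \<rho>' \<mu>' z'. \<exists>c' qs.
     \<tau> - 14 * real (floorlog 2 d) - 4 * real (floorlog 2 c) - 1 + 4 * real (floorlog 2 c') \<le> \<tau>' \<and> \<rho>' 13 = nr c' \<and>
     partial_factorization n (ps @ qs) c' \<and> z' = z @ prime_powers n qs \<and> c' dvd c \<and> (\<forall>q. prime q \<longrightarrow> q dvd d \<longrightarrow> \<not> q dvd c')) \<tau> \<rho> \<mu> z"
proof -
  let ?b = "Arith 17 Mul (lit 8) (Reg 4) ;;
      Arith 17 Sub (Reg 17) (lit 1) ;;
      load_cell 17 (Reg 17) (Reg 16) ;;
      Arith 18 Quot (Reg 16) (Reg 17) ;;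
      Arith 16 Add (Reg 17) (lit 0) ;;
      strip_prime"
  define \<epsilon> where "\<epsilon> = \<tau> - 14 * real (floorlog 2 d) - 4 * real (floorlog 2 c) - 1"
  have eps: "0 \<le> \<epsilon>" using t by (simp add: \<epsilon>_def)
  define I where "I = (\<lambda>\<tau>' (\<rho>' :: nat \<Rightarrow> rat) (\<mu>' :: nat \<Rightarrow> bool) z'. \<exists>e c' qs. \<rho>' 16 = nr e \<and> 1 \<le> e \<and> e \<le> L \<and> \<rho>' 13 = nr c' \<and>
     partial_factorization n (ps @ qs) c' \<and> z' = z @ prime_powers n qs \<and> c' dvd c \<and>
     (\<forall>q. prime q \<longrightarrow> q dvd d \<longrightarrow> q dvd e \<or> \<not> q dvd c') \<and>
     \<epsilon> + 1 + 14 * real (floorlog 2 e) + 4 * real (floorlog 2 c') \<le> \<tau>')"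
  have W9: "n + 1 \<le> W" "8 * L \<le> W" "L \<le> W" "1 \<le> 8 * L" using n W L_le L_ge by linarith+
  show ?thesis
    unfolding strip_divisor_def
  proof (rule wp_Loop[where I = I])
    show "I \<tau> \<rho> \<mu> z" unfolding I_def using pf d r
      by - (rule exI[of _ d], rule exI[of _ c], rule exI[of _ "[]"], auto simp: prime_powers_def \<epsilon>_def)
  next
    fix \<tau>' \<rho>' \<mu>' z'
    assume I: "I \<tau>' \<rho>' \<mu>' z'" and fr: "\<forall>x. x \<notin> writes ?b \<longrightarrow> \<rho>' x = \<rho> x" and st: "\<not> stores ?b \<longrightarrow> \<mu>' = \<mu>"
      and cc: "compare Less (opv \<rho>' (lit 1)) (opv \<rho>' (Reg 16))"
    from I obtain e c1 qs where e: "\<rho>' 16 = nr e" "e \<le> L" and c1: "\<rho>' 13 = nr c1" "c1 dvd c"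
      and pf1: "partial_factorization n (ps @ qs) c1" and z1: "z' = z @ prime_powers n qs"
      and dv: "\<forall>q. prime q \<longrightarrow> q dvd d \<longrightarrow> q dvd e \<or> \<not> q dvd c1"
      and t': "\<epsilon> + 1 + 14 * real (floorlog 2 e) + 4 * real (floorlog 2 c1) \<le> \<tau>'"
      by (auto simp: I_def)
    have e2: "2 \<le> e" using cc e by (simp add: wp_simps)
    have mu: "\<mu>' = \<mu>" using st by (simp add: load_cell_def strip_prime_def)
    have r': "\<rho>' 4 = nr L" "\<rho>' 8 = nr w" using fr r by (auto simp: writes_load_cell writes_strip_prime)
    define g where "g = cell w \<mu> (8 * L - 1 + e)"
    have g: "1 \<le> g" "g dvd e" "prime (e div g)" using G e e2 by (auto simp: divisor_table_def g_def)
    define p where "p = e div g"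
    have pg: "e = p * g" using g by (simp add: p_def)
    have p: "prime p" "2 \<le> p" using g prime_ge_2_nat by (auto simp: p_def)
    have gL: "g \<le> L" "p \<le> L" using pg e g p by (auto intro: order_trans[rotated])
    have "e div p = g" using pg p by simp
    then have fl: "floorlog 2 g + 1 \<le> floorlog 2 e" using floorlog_div_less[of p e] p e2 by simp
    define \<rho>1 where "\<rho>1 = \<rho>'(17 := nr g, 15 := nr ((8 * L - 1 + e) * w), 18 := nr p, 16 := nr g)"
    have t1: "6 + 4 * real (floorlog 2 c1) \<le> \<tau>' - 8"
      using t' fl eps by linarith
    have "wp W B strip_prime I (\<tau>' - 8) \<rho>1 \<mu>' z'"
    proof (rule wp_use[OF wp_strip_prime[OF pf1 p(1) _ _ W9(1) n(1) t1]])
      show "\<rho>1 13 = nr c1" "\<rho>1 18 = nr p" using c1 by (auto simp: \<rho>1_def)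
      fix \<tau>2 \<rho>2 \<mu>2 z2
      assume post: "\<exists>c' qs'. \<tau>' - 8 - 6 - 4 * real (floorlog 2 c1) + 4 * real (floorlog 2 c') \<le> \<tau>2 \<and> \<rho>2 13 = nr c' \<and>
         partial_factorization n ((ps @ qs) @ qs') c' \<and> z2 = z' @ prime_powers n qs' \<and> c' dvd c1 \<and> \<not> p dvd c'"
        and fr2: "\<forall>x. x \<notin> writes strip_prime \<longrightarrow> \<rho>2 x = \<rho>1 x"
      from post obtain c2 qs2 where c2: "\<tau>' - 8 - 6 - 4 * real (floorlog 2 c1) + 4 * real (floorlog 2 c2) \<le> \<tau>2" "\<rho>2 13 = nr c2"
         "partial_factorization n (ps @ (qs @ qs2)) c2" "z2 = z' @ prime_powers n qs2" "c2 dvd c1" "\<not> p dvd c2" by auto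
      have r16: "\<rho>2 16 = nr g" using fr2 by (simp add: writes_strip_prime \<rho>1_def)
      have "q dvd g \<or> \<not> q dvd c2" if q: "prime q" "q dvd d" for q
      proof (cases "q dvd c1")
        case True
        then have "q dvd p * g" using dv q pg by blast
        then have "q dvd p \<or> q dvd g" using q by (simp add: prime_dvd_mult_iff)
        then show ?thesis using q p c2(6) by (metis primes_dvd_imp_eq)
      next
        case False
        then show ?thesis using c2(5) by (meson dvd_trans)
      qed
      moreover have "c2 dvd c" using c2(5) c1(2) by (rule dvd_trans)
      moreover have "\<epsilon> + 1 + 14 * real (floorlog 2 g) + 4 * real (floorlog 2 c2) \<le> \<tau>2"
        using c2(1) t' fl by linarith
      ultimately show "I \<tau>2 \<rho>2 \<mu>2 z2" unfolding I_def using r16 g gL c2 z1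
        by - (rule exI[of _ g], rule exI[of _ c2], rule exI[of _ "qs @ qs2"], auto simp: prime_powers_append)
    qed
    moreover have "8 * L - 1 \<le> W" "g \<le> W" "p \<le> W" using W9 gL by linarith+
    moreover have "cell w \<mu> (8 * L + e - 1) = g" "e div g = p" using W9 by (simp_all add: g_def p_def)
    ultimately have "wp W B ?b I (\<tau>' - 1) \<rho>' \<mu>' z'"
      using e r' W9 W_pos gL unfolding \<rho>1_def mu
      by (simp add: wp_Seq wp_Arith opv_lit arith_nr fits_nr wp_load_cell fun_upd_twist
          del: One_nat_def cong: wp_weak_cong)
    moreover have "1 \<le> \<tau>'" using t' eps by linarith
    ultimately show "1 \<le> \<tau>' \<and> wp W B ?b I (\<tau>' - 1) \<rho>' \<mu>' z'" by blast
  next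
    fix \<tau>' \<rho>' \<mu>' z'
    assume I: "I \<tau>' \<rho>' \<mu>' z'" and cc: "\<not> compare Less (opv \<rho>' (lit 1)) (opv \<rho>' (Reg 16))"
    from I obtain e c1 qs where e: "\<rho>' 16 = nr e" "1 \<le> e" and c1: "\<rho>' 13 = nr c1" "c1 dvd c"
      and pf1: "partial_factorization n (ps @ qs) c1" and z1: "z' = z @ prime_powers n qs"
      and dv: "\<forall>q. prime q \<longrightarrow> q dvd d \<longrightarrow> q dvd e \<or> \<not> q dvd c1"
      and t': "\<epsilon> + 1 + 14 * real (floorlog 2 e) + 4 * real (floorlog 2 c1) \<le> \<tau>'"
      by (auto simp: I_def)
    have "e = 1" using cc e by (simp add: wp_simps)
    then have "\<forall>q. prime q \<longrightarrow> q dvd d \<longrightarrow> \<not> q dvd c1" using dv by (auto simp: prime_nat_iff)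
    then show "\<exists>c' qs.
     \<tau> - 14 * real (floorlog 2 d) - 4 * real (floorlog 2 c) - 1 + 4 * real (floorlog 2 c') \<le> \<tau>' - 1 \<and> \<rho>' 13 = nr c' \<and>
     partial_factorization n (ps @ qs) c' \<and> z' = z @ prime_powers n qs \<and> c' dvd c \<and> (\<forall>q. prime q \<longrightarrow> q dvd d \<longrightarrow> \<not> q dvd c')"
      using c1 pf1 z1 t' by (intro exI[of _ c1] exI[of _ qs]) (auto simp: \<epsilon>_def)
  qed
qed

end

text \<open>After the six recorded divisors and the recorded large prime are used up, the rest is 1
  or a single prime by \<open>prime_cofactor\<close>; hence the literal exponent 1.\<close>

definition emit_record :: com where
  "emit_record =
    Arith 13 Add (Reg 6) (Reg 12) ;;
    Cond Leq (Reg 13) (Reg 7) (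
      Emit (Reg 13) ;;
      for_loop 11 (lit 6) (
        Arith 14 Add (Reg 11) (lit 1) ;;
        Arith 14 Mul (Reg 14) (Reg 4) ;;
        load_cell 16 (Reg 14) (Reg 12) ;;
        strip_divisor) ;;
      Arith 14 Mul (lit 7) (Reg 4) ;;
      load_cell 18 (Reg 14) (Reg 12) ;;
      Cond Less (lit 1) (Reg 18) strip_prime Skip ;;
      Cond Less (lit 1) (Reg 13) (Emit (Reg 13) ;; Emit (lit 1)) Skip ;;
      Emit (lit 0))
    Skip"

lemma factor_record_eq: "factor_record n ps = n # prime_powers n ps @ [0]"
  by (simp add: factor_record_def prime_powers_def)

context factor_params
begin

text \<open>The interface between sieving and output. The last clause is restricted to
  \<open>p * p \<le> n\<close> because the large sieve stops at the square root; a lone larger prime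
  survives as the final cofactor.\<close>

definition sieved :: "(nat \<Rightarrow> bool) \<Rightarrow> nat \<Rightarrow> nat \<Rightarrow> bool" where
  "sieved \<mu> n j \<longleftrightarrow>
     (\<forall>i<6. 1 \<le> cell w \<mu> (Suc i * L + j) \<and> cell w \<mu> (Suc i * L + j) \<le> L) \<and>
     (\<forall>p. prime p \<longrightarrow> p \<le> L \<longrightarrow> p dvd n \<longrightarrow> (\<exists>i<6. p dvd cell w \<mu> (Suc i * L + j))) \<and>
     (cell w \<mu> (7 * L + j) = 1 \<or> prime (cell w \<mu> (7 * L + j)) \<and> cell w \<mu> (7 * L + j) dvd n \<and> L < cell w \<mu> (7 * L + j)) \<and>
     (\<forall>p. prime p \<longrightarrow> p dvd n \<longrightarrow> L < p \<longrightarrow> p * p \<le> n \<longrightarrow> cell w \<mu> (7 * L + j) \<noteq> 1)"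

text \<open>A composite \<open>c\<close> has a prime \<open>p > L\<close> with
  \<open>p * p \<le> c\<close>. Then \<open>t\<close> is not 1, hence a prime above \<open>L\<close>
  coprime to \<open>c\<close>, and \<open>t * c \<le> n\<close>. But \<open>t * p * p\<close> is at
  least \<open>L^3\<close>, too large for \<open>n\<close>.\<close>

lemma prime_cofactor:
  assumes n: "1 \<le> n" "n \<le> 3 * N" and pf: "partial_factorization n ps c" and big: "\<And>p. prime p \<Longrightarrow> p dvd c \<Longrightarrow> L < p"
    and t: "t = 1 \<or> prime t \<and> t dvd n \<and> L < t \<and> \<not> t dvd c"
      "\<And>p. prime p \<Longrightarrow> p dvd n \<Longrightarrow> L < p \<Longrightarrow> p * p \<le> n \<Longrightarrow> t \<noteq> 1"
    and c: "1 < c"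
  shows "prime c"
proof (rule ccontr)
  assume "\<not> prime c"
  then obtain p where p: "prime p" "p dvd c" "p * p \<le> c" using small_prime_divisor[of c] c by auto
  have cn: "c dvd n" "c \<le> n" using pf n by (auto simp: partial_factorization_def dest: dvd_imp_le)
  have Lp: "L < p" using big p by auto
  have "p dvd n" using p cn by (meson dvd_trans)
  then have "t \<noteq> 1" using t(2)[of p] p cn Lp by auto
  then have tt: "prime t" "t dvd n" "L < t" "\<not> t dvd c" using t(1) by auto
  then have "coprime t c" by (simp add: prime_imp_coprime)
  then have "t * c dvd n" using tt(2) cn(1) by (rule divides_mult[rotated -1])
  then have "t * c \<le> n" using n by (auto dest: dvd_imp_le)
  moreover have "L * (L * L) \<le> t * (p * p)" using tt(3) Lp by (intro mult_mono) auto
  moreover have "t * (p * p) \<le> t * c" using p(3) by (intro mult_left_mono) auto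
  moreover have "L ^ 3 = L * (L * L)" by (simp add: power3_eq_cube)
  ultimately have "L ^ 3 \<le> 3 * N" using n by linarith
  then show False using N_less_L_cube by linarith
qed

lemma floorlog_le_w: "c \<le> 3 * N \<Longrightarrow> floorlog 2 c \<le> w"
  using two_power_w(2) floorlog_leI[of c 2 w] by simp

lemma wp_emit_record:
  assumes sv: "sieved \<mu> n j" and G: "divisor_table \<mu>" and n: "n = A + j" "1 \<le> n" "n \<le> 3 * N" "j < L"
    and r: "\<rho> 4 = nr L" "\<rho> 6 = nr A" "\<rho> 7 = nr hi" "\<rho> 8 = nr w" "\<rho> 12 = nr j"
    and t: "112 * real w + 70 \<le> \<tau>"
  shows "wp W B emit_record (\<lambda>\<tau>' \<rho>' \<mu>' z'. \<tau> - (112 * real w + 70) \<le> \<tau>' \<and>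
     (if n \<le> hi then \<exists>ps. distinct ps \<and> set ps = {p. prime p \<and> p dvd n} \<and> z' = z @ factor_record n ps else z' = z)) \<tau> \<rho> \<mu> z"
proof -
  let ?T = "\<lambda>i. cell w \<mu> (Suc i * L + j)"
  let ?b = "Arith 14 Add (Reg 11) (lit 1) ;;
        Arith 14 Mul (Reg 14) (Reg 4) ;;
        load_cell 16 (Reg 14) (Reg 12) ;;
        strip_divisor"
  let ?Q = "\<lambda>\<tau>' \<rho>' \<mu>' z'. \<tau> - (112 * real w + 70) \<le> \<tau>' \<and>
     (\<exists>ps. distinct ps \<and> set ps = {p. prime p \<and> p dvd n} \<and> z' = z @ factor_record n ps)"
  let ?c3 = "Cond Less (lit 1) (Reg 13) (Emit (Reg 13) ;; Emit (lit 1)) Skip ;; Emit (lit 0)"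
  let ?c2 = "Arith 14 Mul (lit 7) (Reg 4) ;; load_cell 18 (Reg 14) (Reg 12) ;;
      Cond Less (lit 1) (Reg 18) strip_prime Skip ;; ?c3"
  define cofactor where "cofactor = cell w \<mu> (7 * L + j)"
  have nW: "n + 1 \<le> W" "n \<le> W" "7 * L \<le> W" "7 \<le> W" using n W L_ge L_le by linarith+
  have wr: "writes ?b = {13, 14, 15, 16, 17, 18, 19, 20}" by (auto simp: writes_load_cell writes_strip_divisor)
  have Lj: "Suc i * L \<le> 6 * L" if "i < 6" for i using that by (intro mult_right_mono) auto
  define J where "J i (\<rho>' :: nat \<Rightarrow> rat) (\<mu>' :: nat \<Rightarrow> bool) z' \<longleftrightarrow> \<mu>' = \<mu> \<and> (\<exists>c ps. \<rho>' 13 = nr c \<and> partial_factorization n ps c \<and>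
     z' = z @ n # prime_powers n ps \<and> (\<forall>h<i. \<forall>q. prime q \<longrightarrow> q dvd ?T h \<longrightarrow> \<not> q dvd c))" for i \<rho>' \<mu>' and z' :: "nat list"
  have last: "wp W B ?c3 ?Q \<tau>' \<rho>' \<mu>' z'" if pf: "partial_factorization n ps c" and c: "\<rho>' 13 = nr c" "1 < c \<longrightarrow> prime c"
      and z: "z' = z @ n # prime_powers n ps" and tt: "\<tau> - (112 * real w + 70) + 4 \<le> \<tau>'" for \<tau>' \<rho>' \<mu>' z' ps c
  proof (cases "1 < c")
    case False
    then have "c = 1" using pf by (auto simp: partial_factorization_def)
    then have "?Q (\<tau>' - 2) \<rho>' \<mu>' (z' @ [0])"
      using partial_factorization_complete[of n ps] pf n z tt by (auto simp: factor_record_eq)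
    then show ?thesis using False c by (simp add: wp_simps)
  next
    case True
    then have pc: "prime c" using c by simp
    then have "\<not> c dvd 1" "c dvd c" by (auto simp: prime_nat_iff)
    then have sn: "partial_factorization n (ps @ [c]) 1" "1 = multiplicity c n"
      using partial_factorization_snoc[OF pf pc, of 1 1] by auto
    then have "z' @ [c, 1, 0] = z @ factor_record n (ps @ [c])"
      using z by (simp add: factor_record_eq prime_powers_append prime_powers_def)
    moreover have "distinct (ps @ [c])" "set (ps @ [c]) = {p. prime p \<and> p dvd n}"
      using partial_factorization_complete[OF sn(1) n(2)] by blast+
    ultimately have "?Q (\<tau>' - 4) \<rho>' \<mu>' (z' @ [c, 1, 0])" using tt by (metis add_le_imp_le_diff)
    then show ?thesis using True c by (simp add: wp_simps)
  qed
  have mid: "wp W B ?c2 ?Q \<tau>' \<rho>' \<mu>' z'" if Jt: "J 6 \<rho>' \<mu>' z'" and r': "\<rho>' 4 = nr L" "\<rho>' 8 = nr w" "\<rho>' 12 = nr j"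
      and tt: "\<tau> - (112 * real w + 70) + 16 + 4 * real w \<le> \<tau>'" "16 + 4 * real w \<le> \<tau>'" for \<tau>' \<rho>' \<mu>' z'
  proof -
    from Jt obtain c ps where mu: "\<mu>' = \<mu>" and c: "\<rho>' 13 = nr c" and pf: "partial_factorization n ps c"
      and z': "z' = z @ n # prime_powers n ps" and nd: "\<forall>h<6. \<forall>q. prime q \<longrightarrow> q dvd ?T h \<longrightarrow> \<not> q dvd c"
      by (auto simp: J_def)
    have cn: "c dvd n" "c \<le> n" using pf n by (auto simp: partial_factorization_def dest: dvd_imp_le)
    have big: "L < p" if pp: "prime p" "p dvd c" for p
    proof (rule ccontr)
      assume "\<not> L < p"
      moreover have "p dvd n" using pp cn by (meson dvd_trans)
      ultimately obtain i where "i < 6" "p dvd ?T i" using sv pp unfolding sieved_def by (meson not_less)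
      then show False using nd pp by blast
    qed
    have cof: "cofactor = 1 \<or> prime cofactor \<and> cofactor dvd n \<and> L < cofactor"
      "\<And>p. prime p \<Longrightarrow> p dvd n \<Longrightarrow> L < p \<Longrightarrow> p * p \<le> n \<Longrightarrow> cofactor \<noteq> 1"
      using sv by (auto simp: sieved_def cofactor_def)
    define \<rho>1 where "\<rho>1 = \<rho>'(14 := nr (7 * L), 15 := nr ((7 * L + j) * w), 18 := nr cofactor)"
    have "wp W B (Cond Less (lit 1) (Reg 18) strip_prime Skip) (wp W B ?c3 ?Q) (\<tau>' - 4) \<rho>1 \<mu> z'"
    proof (cases "1 < cofactor")
      case False
      then have t1: "cofactor = 1" using cof(1) by (auto simp: prime_nat_iff)
      have "1 < c \<longrightarrow> prime c" using prime_cofactor[OF n(2,3) pf big, of cofactor] t1 cof(2) by blast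
      then have "wp W B ?c3 ?Q (\<tau>' - 5) \<rho>1 \<mu> z'"
        by (intro last[OF pf]) (use c z' tt in \<open>auto simp: \<rho>1_def\<close>)
      then show ?thesis using t1 by (simp add: wp_simps \<rho>1_def del: One_nat_def cong: wp_weak_cong)
    next
      case True
      then have pt: "prime cofactor" "cofactor dvd n" "L < cofactor" using cof by auto
      have fl: "real (floorlog 2 c) \<le> real w" using floorlog_le_w[of c] cn n by simp
      have "wp W B strip_prime (wp W B ?c3 ?Q) (\<tau>' - 5) \<rho>1 \<mu> z'"
      proof (rule wp_use[OF wp_strip_prime[OF pf pt(1) _ _ nW(1) n(2)]])
        show "\<rho>1 13 = nr c" "\<rho>1 18 = nr cofactor" using c by (auto simp: \<rho>1_def)
        show "6 + 4 * real (floorlog 2 c) \<le> \<tau>' - 5" using tt fl by linarith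
        fix \<tau>2 \<mu>2 z2 and \<rho>2 :: "nat \<Rightarrow> rat"
        assume "\<exists>c' qs. \<tau>' - 5 - 6 - 4 * real (floorlog 2 c) + 4 * real (floorlog 2 c') \<le> \<tau>2 \<and> \<rho>2 13 = nr c' \<and>
           partial_factorization n (ps @ qs) c' \<and> z2 = z' @ prime_powers n qs \<and> c' dvd c \<and> \<not> cofactor dvd c'"
        then obtain c' qs where c': "\<tau>' - 5 - 6 - 4 * real (floorlog 2 c) + 4 * real (floorlog 2 c') \<le> \<tau>2" "\<rho>2 13 = nr c'"
           "partial_factorization n (ps @ qs) c'" "z2 = z' @ prime_powers n qs" "c' dvd c" "\<not> cofactor dvd c'" by blast
        have "1 < c' \<longrightarrow> prime c'"
          using prime_cofactor[OF n(2,3) c'(3), of cofactor] big c'(5,6) pt cof(2) by (meson dvd_trans)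
        then show "wp W B ?c3 ?Q \<tau>2 \<rho>2 \<mu>2 z2"
          by (intro last[OF c'(3)]) (use c' z' tt fl in \<open>auto simp: prime_powers_append\<close>)
      qed
      then show ?thesis using True by (simp add: wp_simps \<rho>1_def del: One_nat_def cong: wp_weak_cong)
    qed
    then show ?thesis
      using r' n nW W_pos L_ge unfolding mu \<rho>1_def cofactor_def
      by (simp add: wp_Seq wp_Arith opv_lit arith_nr fits_nr wp_load_cell fun_upd_twist del: One_nat_def cong: wp_weak_cong)
  qed
  define \<rho>1 where "\<rho>1 = \<rho>(13 := nr n)"
  \<comment> \<open>In each round \<open>14 * w\<close> pays for the bits of the recorded divisor
    and \<open>4 * w\<close> for those of the cofactor.\<close>
  have loop: "wp W B (for_loop 11 (lit 6) ?b) (\<lambda>\<tau>' \<rho>' \<mu>' z'. \<tau> - 3 - ((18 * real w + 6 + 2) * real 6 + 2) \<le> \<tau>' \<and> J 6 \<rho>' \<mu>' z') (\<tau> - 3) \<rho>1 \<mu> (z @ [n])"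
  proof (rule wp_for_loop_regs[where J = J])
    show "J 0 \<rho>1 \<mu> (z @ [n])" unfolding J_def using partial_factorization_Nil[OF n(2)]
      by (intro conjI exI[of _ n] exI[of _ "[]"]) (auto simp: \<rho>1_def prime_powers_def)
    show "J i (\<rho>'(11 := v)) \<mu>' z'" if "J i \<rho>' \<mu>' z'" for i \<rho>' \<mu>' z' v using that by (simp add: J_def)
    fix i \<tau>' \<mu>' z' and \<rho>' :: "nat \<Rightarrow> rat"
    assume i: "i < 6" "\<rho>' 11 = nr i" and fr: "\<forall>y. y \<notin> insert 11 (writes ?b) \<longrightarrow> \<rho>' y = \<rho>1 y" and Ji: "J i \<rho>' \<mu>' z'"
      and tt: "18 * real w + 6 \<le> \<tau>'"
    from Ji obtain c ps where mu: "\<mu>' = \<mu>" and c: "\<rho>' 13 = nr c" and pf: "partial_factorization n ps c"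
      and z': "z' = z @ n # prime_powers n ps" and nd: "\<forall>h<i. \<forall>q. prime q \<longrightarrow> q dvd ?T h \<longrightarrow> \<not> q dvd c"
      by (auto simp: J_def)
    have cn: "c dvd n" "c \<le> n" using pf n by (auto simp: partial_factorization_def dest: dvd_imp_le)
    have r': "\<rho>' 4 = nr L" "\<rho>' 8 = nr w" "\<rho>' 12 = nr j" using fr r unfolding wr by (auto simp: \<rho>1_def)
    have T: "1 \<le> ?T i" "?T i \<le> L" using sv i by (auto simp: sieved_def)
    have fl: "real (floorlog 2 c) \<le> real w" "real (floorlog 2 (?T i)) \<le> real w"
      using floorlog_le_w[of c] floorlog_le_w[of "?T i"] cn n T L_le by auto
    define \<rho>2 where "\<rho>2 = \<rho>'(14 := nr (Suc i * L), 15 := nr ((Suc i * L + j) * w), 16 := nr (?T i))"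
    let ?R = "\<lambda>\<tau>2 \<rho>2 \<mu>2 z2. \<tau>' - (18 * real w + 6) \<le> \<tau>2 \<and> J (Suc i) \<rho>2 \<mu>2 z2"
    have "wp W B strip_divisor ?R (\<tau>' - 5) \<rho>2 \<mu> z'"
    proof (rule wp_use[OF wp_strip_divisor[OF pf T G _ _ _ _ n(2,3)]])
      show "\<rho>2 13 = nr c" "\<rho>2 16 = nr (?T i)" "\<rho>2 4 = nr L" "\<rho>2 8 = nr w" using c r' by (auto simp: \<rho>2_def)
      show "14 * real (floorlog 2 (?T i)) + 4 * real (floorlog 2 c) + 1 \<le> \<tau>' - 5" using fl tt by linarith
      fix \<tau>3 \<mu>3 z3 and \<rho>3 :: "nat \<Rightarrow> rat"
      assume post: "\<exists>c' qs. \<tau>' - 5 - 14 * real (floorlog 2 (?T i)) - 4 * real (floorlog 2 c) - 1 + 4 * real (floorlog 2 c') \<le> \<tau>3 \<and>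
         \<rho>3 13 = nr c' \<and> partial_factorization n (ps @ qs) c' \<and> z3 = z' @ prime_powers n qs \<and> c' dvd c \<and>
         (\<forall>q. prime q \<longrightarrow> q dvd ?T i \<longrightarrow> \<not> q dvd c')"
        and st: "\<not> stores strip_divisor \<longrightarrow> \<mu>3 = \<mu>"
      from post obtain c' qs where c': "\<tau>' - 5 - 14 * real (floorlog 2 (?T i)) - 4 * real (floorlog 2 c) - 1 + 4 * real (floorlog 2 c') \<le> \<tau>3"
         "\<rho>3 13 = nr c'" "partial_factorization n (ps @ qs) c'" "z3 = z' @ prime_powers n qs" "c' dvd c"
         "\<forall>q. prime q \<longrightarrow> q dvd ?T i \<longrightarrow> \<not> q dvd c'" by blast
      have mu3: "\<mu>3 = \<mu>" using st by (simp add: strip_divisor_def load_cell_def strip_prime_def)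
      have "\<not> q dvd c'" if "h < Suc i" "prime q" "q dvd ?T h" for h q
        using that nd c'(5,6) by (cases "h = i") (auto simp: less_Suc_eq dest: dvd_trans)
      then have "J (Suc i) \<rho>3 \<mu>3 z3" unfolding J_def using mu3 c' z'
        by (intro conjI exI[of _ c'] exI[of _ "ps @ qs"]) (auto simp: prime_powers_append)
      then show "?R \<tau>3 \<rho>3 \<mu>3 z3" using c'(1) fl by auto
    qed
    moreover have "Suc i * L \<le> W" "i + 1 \<le> W" "Suc i * L + j < 9 * L" using Lj[OF i(1)] nW i n by linarith+
    ultimately show "wp W B ?b ?R \<tau>' \<rho>' \<mu>' z'"
      using r' i W_pos unfolding mu \<rho>2_def
      by (simp add: wp_Seq wp_Arith opv_lit arith_nr fits_nr wp_load_cell fun_upd_twist Suc_eq_plus1[symmetric] del: One_nat_def mult_Suc cong: wp_weak_cong)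
  qed (use t nW in \<open>auto simp: opv_lit writes_load_cell writes_strip_divisor\<close>)
  have "wp W B (for_loop 11 (lit 6) ?b) (wp W B ?c2 ?Q) (\<tau> - 3) \<rho>1 \<mu> (z @ [n])"
  proof (rule wp_use[OF loop])
    fix \<tau>2 \<mu>2 z2 and \<rho>2 :: "nat \<Rightarrow> rat"
    assume post: "\<tau> - 3 - ((18 * real w + 6 + 2) * real 6 + 2) \<le> \<tau>2 \<and> J 6 \<rho>2 \<mu>2 z2"
      and fr: "\<forall>x. x \<notin> writes (for_loop 11 (lit 6) ?b) \<longrightarrow> \<rho>2 x = \<rho>1 x"
    have r2: "\<rho>2 4 = nr L" "\<rho>2 8 = nr w" "\<rho>2 12 = nr j" using fr r unfolding writes_for_loop wr by (auto simp: \<rho>1_def)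
    show "wp W B ?c2 ?Q \<tau>2 \<rho>2 \<mu>2 z2" by (rule mid) (use post r2 t in auto)
  qed
  then have main: "wp W B emit_record ?Q \<tau> \<rho> \<mu> z" if "n \<le> hi"
    unfolding emit_record_def using r n(1) nW W_pos that unfolding \<rho>1_def
    by (simp add: wp_Seq wp_Arith wp_Cond wp_Emit compare_nr opv_lit arith_nr fits_nr del: One_nat_def cong: wp_weak_cong)
  show ?thesis
  proof (cases "n \<le> hi")
    case True
    show ?thesis unfolding if_P[OF True] using main[OF True] .
  next
    case False
    then show ?thesis unfolding emit_record_def using r n(1) nW W_pos t by (simp add: wp_simps)
  qed
qed

end

text \<open>The visited \<open>d\<close> divides \<open>A + j\<close> but perhaps no longer what is
  left of it, so divisibility is tested again. Keeping the maximum makes the order of visits and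
  repeated visits harmless.\<close>

definition record_divisor :: com where
  "record_divisor =
    load_cell 16 (Reg 14) (lit 0) ;;
    Arith 16 Rem (Reg 16) (Reg 13) ;;
    Cond Equal (Reg 16) (lit 0) (
      load_cell 17 (Reg 10) (Reg 14) ;;
      Cond Less (Reg 17) (Reg 13) (store_cell (Reg 10) (Reg 14) (Reg 13)) Skip)
    Skip"

lemma writes_record_divisor: "writes record_divisor = {15, 16, 17}"
  by (auto simp: record_divisor_def writes_load_cell writes_store_cell)

section \<open>Recording divisors and dividing them out\<close>

definition init_table :: com where
  "init_table = for_loop 12 (Reg 4) (store_cell (Reg 10) (Reg 12) (lit 1))"

definition table_sieve :: com where
  "table_sieve = init_table ;; small_sieve record_divisor"

definition divide_out :: com where
  "divide_out = for_loop 12 (Reg 4) (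
    load_cell 16 (Reg 12) (lit 0) ;;
    load_cell 17 (Reg 10) (Reg 12) ;;
    Arith 16 Quot (Reg 16) (Reg 17) ;;
    store_cell (Reg 12) (lit 0) (Reg 16))"

text \<open>
  Cell \<open>j < L\<close> holds what is left of \<open>A + j\<close>. For \<open>i < 6\<close>, cell \<open>(i + 1) L + j\<close> holds the divisor removed in
  round \<open>i\<close>, and cell \<open>7 L + j\<close> a prime factor above \<open>L\<close>, or 1. Cell \<open>8 L - 1 + n\<close> holds the largest proper
  divisor of \<open>n \<le> L\<close>; these are never overwritten.
\<close>

definition factor_window :: com where
  "factor_window =
    for_loop 12 (Reg 4) (Arith 16 Add (Reg 6) (Reg 12) ;; store_cell (Reg 12) (lit 0) (Reg 16)) ;;
    for_loop 11 (lit 6) (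
      Arith 10 Add (Reg 11) (lit 1) ;;
      Arith 10 Mul (Reg 10) (Reg 4) ;;
      table_sieve ;;
      divide_out) ;;
    Arith 10 Mul (lit 7) (Reg 4) ;;
    init_table ;;
    large_sieve record_divisor ;;
    for_loop 12 (Reg 4) emit_record"

lemma cell_less: "cell w \<mu> x < 2 ^ w"
proof -
  have "(\<Sum>j<v. if P j then 2 ^ j else (0::nat)) < 2 ^ v" for v and P :: "nat \<Rightarrow> bool"
    by (induction v) auto
  then show ?thesis by (simp add: cell_def read_field_def)
qed

lemma lists_factorizations_union:
  assumes "lists_factorizations S y" "lists_factorizations S' y'" "S \<inter> S' = {}"
  shows "lists_factorizations (S \<union> S') (y @ y')"
proof -
  obtain ns ps where 1: "distinct ns" "set ns = S" "\<forall>n\<in>S. distinct (ps n) \<and> set (ps n) = {p. prime p \<and> p dvd n}"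
    "y = concat (map (\<lambda>n. factor_record n (ps n)) ns)"
    using assms(1) unfolding lists_factorizations_def by blast
  obtain ns' ps' where 2: "distinct ns'" "set ns' = S'" "\<forall>n\<in>S'. distinct (ps' n) \<and> set (ps' n) = {p. prime p \<and> p dvd n}"
    "y' = concat (map (\<lambda>n. factor_record n (ps' n)) ns')"
    using assms(2) unfolding lists_factorizations_def by blast
  define qs where "qs n = (if n \<in> S then ps n else ps' n)" for n
  have e1: "map (\<lambda>n. factor_record n (ps n)) ns = map (\<lambda>n. factor_record n (qs n)) ns"
    using 1 by (auto simp: qs_def)
  have e2: "map (\<lambda>n. factor_record n (ps' n)) ns' = map (\<lambda>n. factor_record n (qs n)) ns'"
    using 2 assms(3) by (auto simp: qs_def)
  have "y @ y' = concat (map (\<lambda>n. factor_record n (qs n)) (ns @ ns'))"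
    by (simp only: 1(4) 2(4) e1 e2 map_append concat_append)
  moreover have "distinct (ns @ ns')" "set (ns @ ns') = S \<union> S'" using 1 2 assms(3) by auto
  moreover have "\<forall>n\<in>S \<union> S'. distinct (qs n) \<and> set (qs n) = {p. prime p \<and> p dvd n}"
    using 1(3) 2(3) by (auto simp: qs_def)
  ultimately show ?thesis unfolding lists_factorizations_def by blast
qed

lemma lists_factorizations_empty: "lists_factorizations {} []"
  by (auto simp: lists_factorizations_def)

lemma lists_factorizations_single:
  "distinct ps \<Longrightarrow> set ps = {p. prime p \<and> p dvd n} \<Longrightarrow> lists_factorizations {n} (factor_record n ps)"
  unfolding lists_factorizations_def by (rule exI[of _ "[n]"], rule exI[of _ "\<lambda>_. ps"]) auto

context factor_params
begin

text \<open>The visitor invariant of \<open>record_divisor\<close>. The old memory supplies in its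
  cells below \<open>L\<close> the numbers to be divided; 1 is the entry as long as no visited
  \<open>d\<close> divides.\<close>

definition max_divisors :: "nat \<Rightarrow> (nat \<Rightarrow> bool) \<Rightarrow> (nat \<times> nat) set \<Rightarrow> (nat \<Rightarrow> bool) \<Rightarrow> bool" where
  "max_divisors b \<mu>\<^sub>0 P \<mu> \<longleftrightarrow> (\<forall>x. x < b \<or> b + L \<le> x \<longrightarrow> cell w \<mu> x = cell w \<mu>\<^sub>0 x) \<and>
    (\<forall>j<L. (cell w \<mu> (b + j) = 1 \<or> (cell w \<mu> (b + j), j) \<in> P \<and> cell w \<mu> (b + j) dvd cell w \<mu>\<^sub>0 j) \<and>
      (\<forall>d. (d, j) \<in> P \<longrightarrow> d dvd cell w \<mu>\<^sub>0 j \<longrightarrow> d \<le> cell w \<mu> (b + j)))"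

lemma visitor_record_divisor:
  assumes b: "L \<le> b" "b + L \<le> 9 * L" and A: "1 \<le> A" "A \<le> 2 * N"
    and r: "\<rho>\<^sub>0 4 = nr L" "\<rho>\<^sub>0 5 = nr s" "\<rho>\<^sub>0 6 = nr A" "\<rho>\<^sub>0 8 = nr w" "\<rho>\<^sub>0 10 = nr b"
  shows "visitor N l u L s W B A record_divisor (max_divisors b \<mu>\<^sub>0) \<rho>\<^sub>0 12"
proof
  show "writes record_divisor \<subseteq> {15, 16, 17, 18}" "\<not> emits record_divisor"
    by (auto simp: writes_record_divisor) (simp add: record_divisor_def load_cell_def store_cell_def)
  fix P \<mu> z d j and \<tau> :: real and \<rho> :: "nat \<Rightarrow> rat"
  assume inv: "max_divisors b \<mu>\<^sub>0 P \<mu>" and env: "\<forall>x<13. \<rho> x = \<rho>\<^sub>0 x" and rr: "\<rho> 13 = nr d" "\<rho> 14 = nr j"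
    and d: "2 \<le> d" "d * d \<le> 27 * N" and j: "j < L"
  have r': "\<rho> 8 = nr w" "\<rho> 10 = nr b" using env r by auto
  define m where "m = cell w \<mu>\<^sub>0 j"
  have m: "cell w \<mu> j = m" using inv j b by (auto simp: max_divisors_def m_def)
  \<comment> \<open>The stored value must fit a cell: \<open>d * d \<le> 27 * N\<close> forces
    \<open>d \<le> 3 * N\<close> for \<open>N\<close> of this size.\<close>
  have dw: "d < 2 ^ w"
  proof (rule ccontr)
    assume "\<not> d < 2 ^ w"
    then have "3 * N < d" using two_power_w(2) by linarith
    then have "(3 * N) * (3 * N) \<le> d * d" by (intro mult_mono) auto
    moreover have "(3 * N) * (3 * N) = 9 * (N * N)" by simp
    ultimately have "9 * (N * N) \<le> 27 * N" using d(2) by linarith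
    moreover have "400 * N \<le> N * N" using L_le L_ge by (intro mult_right_mono) auto
    ultimately show False using L_le L_ge by linarith
  qed
  have mw: "m mod d \<le> W" using mod_less_eq_dividend[of m d] cell_less[of w \<mu> j] m two_power_w(1) by linarith
  have bj: "b + j < 9 * L" "j < 9 * L" using b j by linarith+
  let ?Q = "\<lambda>\<tau>' \<rho>' \<mu>' z'. \<tau> - 12 \<le> \<tau>' \<and> max_divisors b \<mu>\<^sub>0 (insert (d, j) P) \<mu>'"
  have keep: "max_divisors b \<mu>\<^sub>0 (insert (d, j) P) \<mu>" if "\<not> d dvd m \<or> d \<le> cell w \<mu> (b + j)"
    using inv that by (auto simp: max_divisors_def m_def)
  have upd: "max_divisors b \<mu>\<^sub>0 (insert (d, j) P) (write_field \<mu> ((b + j) * w) w d)" if dm: "d dvd m" and lt: "cell w \<mu> (b + j) < d"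
    unfolding max_divisors_def
  proof (intro conjI allI impI)
    let ?\<mu> = "write_field \<mu> ((b + j) * w) w d"
    have c: "cell w ?\<mu> x = (if x = b + j then d else cell w \<mu> x)" for x using cell_write_field[OF dw] .
    show "cell w ?\<mu> x = cell w \<mu>\<^sub>0 x" if "x < b \<or> b + L \<le> x" for x
      using that inv j unfolding c max_divisors_def by auto
    fix i assume i: "i < L"
    show "cell w ?\<mu> (b + i) = 1 \<or> (cell w ?\<mu> (b + i), i) \<in> insert (d, j) P \<and> cell w ?\<mu> (b + i) dvd cell w \<mu>\<^sub>0 i"
      using inv i dm unfolding c max_divisors_def m_def by auto
    fix e assume e: "(e, i) \<in> insert (d, j) P" "e dvd cell w \<mu>\<^sub>0 i"
    show "e \<le> cell w ?\<mu> (b + i)"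
    proof (cases "i = j")
      case True
      have "e = d \<or> e \<le> cell w \<mu> (b + j)" using e inv j True by (auto simp: max_divisors_def)
      then show ?thesis using True lt unfolding c by auto
    next
      case False
      then show ?thesis using e inv i unfolding c by (auto simp: max_divisors_def)
    qed
  qed
  show "wp W B record_divisor ?Q \<tau> \<rho> \<mu> z"
    unfolding record_divisor_def using r' rr mw bj W_pos keep upd dw m
    by (simp add: wp_Seq wp_Arith wp_Cond wp_Skip compare_nr opv_lit arith_nr fits_nr wp_load_cell wp_store_cell dvd_eq_mod_eq_0 not_less)
qed (use assms in auto)

lemma wp_init_table:
  assumes b: "L \<le> b" "b + L \<le> 9 * L" and r: "\<rho> 4 = nr L" "\<rho> 8 = nr w" "\<rho> 10 = nr b" and t: "(3 + 2) * real L + 2 \<le> \<tau>"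
  shows "wp W B init_table (\<lambda>\<tau>' \<rho>' \<mu>' z'. \<tau> - ((3 + 2) * real L + 2) \<le> \<tau>' \<and> max_divisors b \<mu> {} \<mu>') \<tau> \<rho> \<mu> z"
proof -
  define J where "J i \<mu>' (z' :: nat list) \<longleftrightarrow> (\<forall>x. cell w \<mu>' x = (if b \<le> x \<and> x < b + i then 1 else cell w \<mu> x))" for i \<mu>' z'
  have W1: "L + 1 \<le> W" using L_le L_ge W by linarith
  have w1: "1 < (2::nat) ^ w" by (rule one_less_power) (simp_all add: w)
  have "wp W B init_table (\<lambda>\<tau>' \<rho>' \<mu>' z'. \<tau> - ((3 + 2) * real L + 2) \<le> \<tau>' \<and> J L \<mu>' z') \<tau> \<rho> \<mu> z"
    unfolding init_table_def
  proof (rule wp_for_loop[where J = J])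
    show "J 0 \<mu> z" by (simp add: J_def)
    fix i \<tau>' \<mu>' z' and \<rho>' :: "nat \<Rightarrow> rat"
    assume i: "i < L" "\<rho>' 12 = nr i" and fr: "\<forall>y. y \<notin> insert 12 (writes (store_cell (Reg 10) (Reg 12) (lit 1))) \<longrightarrow> \<rho>' y = \<rho> y"
      and Ji: "J i \<mu>' z'"
    have r': "\<rho>' 8 = nr w" "\<rho>' 10 = nr b" using fr r by (auto simp: writes_store_cell)
    have "J (Suc i) (write_field \<mu>' ((b + i) * w) w 1) z'"
      using Ji unfolding J_def cell_write_field[OF w1] by auto
    then show "wp W B (store_cell (Reg 10) (Reg 12) (lit 1)) (\<lambda>\<tau>2 \<rho>2 \<mu>2 z2. \<tau>' - 3 \<le> \<tau>2 \<and> J (Suc i) \<mu>2 z2) \<tau>' \<rho>' \<mu>' z'"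
      using r' i b w1 by (subst wp_store_cell[where i = b and j = i and n = 1]) (auto simp: opv_lit)
  qed (use r t W1 in \<open>auto simp: writes_store_cell\<close>)
  then show ?thesis
    by (rule wp_use) (auto simp: J_def max_divisors_def)
qed

lemma writes_init_table: "writes init_table = {12, 15}"
  by (simp add: init_table_def writes_for_loop writes_store_cell)

lemma writes_table_sieve: "writes table_sieve = {12, 13, 14, 15, 16, 17, 19, 20}"
  by (auto simp: table_sieve_def writes_init_table small_sieve_def sieve_row_def writes_record_divisor)

lemma writes_divide_out: "writes divide_out = {12, 15, 16, 17}"
  by (auto simp: divide_out_def writes_for_loop writes_store_cell writes_load_cell)

lemma Ll_ge: "20 * real L \<le> real L * real l" "400 \<le> real L"
  using l mult_right_mono[of 20 "real l" "real L"] L_ge by (simp_all add: mult.commute)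

lemma wp_table_sieve:
  assumes b: "L \<le> b" "b + L \<le> 9 * L" and A: "1 \<le> A" "A \<le> 2 * N"
    and r: "\<rho> 4 = nr L" "\<rho> 5 = nr s" "\<rho> 6 = nr A" "\<rho> 8 = nr w" "\<rho> 10 = nr b" "\<rho> 9 = nr e" and e: "1 \<le> e" "e \<le> 2"
    and t: "30 * (real L * real l) \<le> \<tau>"
  shows "wp W B table_sieve (\<lambda>\<tau>' \<rho>' \<mu>' z'. \<tau> - 30 * (real L * real l) \<le> \<tau>' \<and>
    max_divisors b \<mu> {(d, j). 2 \<le> d \<and> d \<le> L \<and> j < L \<and> d dvd A + j \<and> e * d \<le> A + j} \<mu>') \<tau> \<rho> \<mu> z"
proof -
  have T: "(12 + 14) * (real L * real l + real L) + 2 + ((3 + 2) * real L + 2) \<le> 30 * (real L * real l)"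
  proof -
    have e: "(12 + 14) * (x + real L) + 2 + ((3 + 2) * real L + 2) = 26 * x + 31 * real L + 4" for x by simp
    show ?thesis unfolding e using Ll_ge by linarith
  qed
  have "0 \<le> (12 + 14) * (real L * real l + real L) + 2" by simp
  then have t0: "(3 + 2) * real L + 2 \<le> \<tau>" using t T by linarith
  show ?thesis
    unfolding table_sieve_def wp_Seq
  proof (rule wp_use[OF wp_init_table[OF b r(1,4,5) t0]])
    fix \<tau>1 \<mu>1 z1 and \<rho>1 :: "nat \<Rightarrow> rat"
    assume p1: "\<tau> - ((3 + 2) * real L + 2) \<le> \<tau>1 \<and> max_divisors b \<mu> {} \<mu>1"
      and fr1: "\<forall>x. x \<notin> writes init_table \<longrightarrow> \<rho>1 x = \<rho> x"
    have r1: "\<rho>1 4 = nr L" "\<rho>1 5 = nr s" "\<rho>1 6 = nr A" "\<rho>1 8 = nr w" "\<rho>1 10 = nr b" "\<rho>1 9 = nr e"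
      using fr1 r by (auto simp: writes_init_table)
    interpret v: visitor N l u L s W B A record_divisor "max_divisors b \<mu>" \<rho>1 12
      by (rule visitor_record_divisor[OF b A r1(1-5)])
    have p1': "max_divisors b \<mu> {} \<mu>1" using p1 by simp
    have t1: "(12 + 14) * (real L * real l + real L) + 2 \<le> \<tau>1" using p1 T t by linarith
    show "wp W B (small_sieve record_divisor) (\<lambda>\<tau>' \<rho>' \<mu>' z'. \<tau> - 30 * (real L * real l) \<le> \<tau>' \<and>
      max_divisors b \<mu> {(d, j). 2 \<le> d \<and> d \<le> L \<and> j < L \<and> d dvd A + j \<and> e * d \<le> A + j} \<mu>') \<tau>1 \<rho>1 \<mu>1 z1"
    proof (rule wp_use[OF v.wp_small_sieve[OF p1' _ r1(6) e t1]])
      fix \<tau>2 \<mu>2 z2 and \<rho>2 :: "nat \<Rightarrow> rat"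
      assume "\<tau>1 - ((12 + 14) * (real L * real l + real L) + 2) \<le> \<tau>2 \<and>
         max_divisors b \<mu> ({} \<union> {(d, j). 2 \<le> d \<and> d \<le> L \<and> j < L \<and> d dvd A + j \<and> e * d \<le> A + j}) \<mu>2"
      then show "\<tau> - 30 * (real L * real l) \<le> \<tau>2 \<and>
         max_divisors b \<mu> {(d, j). 2 \<le> d \<and> d \<le> L \<and> j < L \<and> d dvd A + j \<and> e * d \<le> A + j} \<mu>2"
        unfolding Un_empty_left using p1 T by linarith
    qed simp
  qed
qed

lemma wp_divide_out:
  assumes b: "L \<le> b" "b + L \<le> 9 * L" and r: "\<rho> 4 = nr L" "\<rho> 8 = nr w" "\<rho> 10 = nr b" and t: "(10 + 2) * real L + 2 \<le> \<tau>"
  shows "wp W B divide_out (\<lambda>\<tau>' \<rho>' \<mu>' z'. \<tau> - ((10 + 2) * real L + 2) \<le> \<tau>' \<and>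
    (\<forall>x. cell w \<mu>' x = (if x < L then cell w \<mu> x div cell w \<mu> (b + x) else cell w \<mu> x))) \<tau> \<rho> \<mu> z"
proof -
  let ?c = "load_cell 16 (Reg 12) (lit 0) ;;
    load_cell 17 (Reg 10) (Reg 12) ;;
    Arith 16 Quot (Reg 16) (Reg 17) ;;
    store_cell (Reg 12) (lit 0) (Reg 16)"
  define J where "J i \<mu>' (z' :: nat list) \<longleftrightarrow>
    (\<forall>x. cell w \<mu>' x = (if x < i then cell w \<mu> x div cell w \<mu> (b + x) else cell w \<mu> x))" for i \<mu>' z'
  have W1: "L + 1 \<le> W" using L_le L_ge W by linarith
  have wr: "writes ?c = {15, 16, 17}" by (auto simp: writes_load_cell writes_store_cell)
  have "wp W B divide_out (\<lambda>\<tau>' \<rho>' \<mu>' z'. \<tau> - ((10 + 2) * real L + 2) \<le> \<tau>' \<and> J L \<mu>' z') \<tau> \<rho> \<mu> z"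
    unfolding divide_out_def
  proof (rule wp_for_loop[where J = J])
    show "J 0 \<mu> z" by (simp add: J_def)
    fix i \<tau>' \<mu>' z' and \<rho>' :: "nat \<Rightarrow> rat"
    assume i: "i < L" "\<rho>' 12 = nr i" and fr: "\<forall>y. y \<notin> insert 12 (writes ?c) \<longrightarrow> \<rho>' y = \<rho> y"
      and Ji: "J i \<mu>' z'"
    have r': "\<rho>' 8 = nr w" "\<rho>' 10 = nr b" using fr r unfolding wr by auto
    have c: "cell w \<mu>' i = cell w \<mu> i" "cell w \<mu>' (b + i) = cell w \<mu> (b + i)" using Ji i b by (auto simp: J_def)
    define v where "v = cell w \<mu> i div cell w \<mu> (b + i)"
    have vw: "v < 2 ^ w" unfolding v_def using cell_less[of w \<mu> i] div_le_dividend[of "cell w \<mu> i" "cell w \<mu> (b + i)"] by linarith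
    then have vW: "v \<le> W" using two_power_w by linarith
    have "J (Suc i) (write_field \<mu>' (i * w) w v) z'"
      using Ji unfolding J_def cell_write_field[OF vw] by (auto simp: v_def less_Suc_eq)
    moreover have "b + i < 9 * L" "i < 9 * L" using b i by linarith+
    ultimately show "wp W B ?c (\<lambda>\<tau>2 \<rho>2 \<mu>2 z2. \<tau>' - 10 \<le> \<tau>2 \<and> J (Suc i) \<mu>2 z2) \<tau>' \<rho>' \<mu>' z'"
      using r' i vw vW W_pos c
      by (simp add: wp_Seq wp_Arith opv_lit arith_nr fits_nr wp_load_cell wp_store_cell v_def[symmetric])
  qed (use r t W1 in \<open>auto simp: writes_load_cell writes_store_cell\<close>)
  then show ?thesis by (rule wp_use) (auto simp: J_def)
qed

text \<open>The last clause records why an earlier choice was maximal: a prime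
  \<open>p \<le> L\<close> that is still present could have been chosen itself, or multiplied onto
  the chosen divisor, in every earlier round. It persists because the rest only shrinks.\<close>

definition smooth_part :: "nat \<Rightarrow> nat \<Rightarrow> (nat \<Rightarrow> bool) \<Rightarrow> nat \<Rightarrow> bool" where
  "smooth_part n i \<mu> j \<longleftrightarrow>
     cell w \<mu> j * (\<Prod>h<i. cell w \<mu> (Suc h * L + j)) = n \<and>
     (\<forall>h<i. 1 \<le> cell w \<mu> (Suc h * L + j) \<and> cell w \<mu> (Suc h * L + j) \<le> L) \<and>
     (\<forall>p. prime p \<longrightarrow> p \<le> L \<longrightarrow> p dvd cell w \<mu> j \<longrightarrow>
       (\<forall>h<i. p \<le> cell w \<mu> (Suc h * L + j) \<and> L < p * cell w \<mu> (Suc h * L + j)))"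

lemma smooth_part_step:
  assumes sp: "smooth_part (A + j) i \<mu> j" and i: "i < 6" and j: "j < L" and A: "1 \<le> A"
    and md: "max_divisors (Suc i * L) \<mu> {(d, j). 2 \<le> d \<and> d \<le> L \<and> j < L \<and> d dvd A + j \<and> 1 * d \<le> A + j} \<mu>1"
    and div: "\<forall>x. cell w \<mu>2 x = (if x < L then cell w \<mu>1 x div cell w \<mu>1 (Suc i * L + x) else cell w \<mu>1 x)"
  shows "smooth_part (A + j) (Suc i) \<mu>2 j"
proof -
  define t where "t = cell w \<mu>1 (Suc i * L + j)"
  define m where "m = cell w \<mu> j"
  have m1: "cell w \<mu>1 j = m" using md j by (simp add: max_divisors_def m_def)
  have prod: "m * (\<Prod>h<i. cell w \<mu> (Suc h * L + j)) = A + j" using sp by (simp add: smooth_part_def m_def)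
  have mn: "m dvd A + j" using prod by (metis dvd_triv_left)
  have mpos: "1 \<le> m" using prod A by (cases m) auto
  have tc: "t = 1 \<or> (2 \<le> t \<and> t \<le> L) \<and> t dvd m"
    using md j unfolding max_divisors_def t_def m_def by auto
  \<comment> \<open>With 1 in register 9 the side condition \<open>1 * d \<le> A + j\<close> holds
    for every divisor, so \<open>t\<close> is maximal among all divisors of \<open>m\<close> from 2
    to \<open>L\<close>.\<close>
  have tmax: "d \<le> t" if "2 \<le> d" "d \<le> L" "d dvd m" for d
  proof -
    have "d dvd A + j" using that mn by (meson dvd_trans)
    moreover have "d \<le> A + j" using calculation A by (auto dest: dvd_imp_le)
    ultimately show ?thesis using md j that unfolding max_divisors_def t_def m_def by auto
  qed
  have t: "1 \<le> t" "t \<le> L" "t dvd m" using tc L_ge by auto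
  obtain q where q: "m = t * q" using t(3) by (auto elim: dvdE)
  have "cell w \<mu>2 j = cell w \<mu>1 j div t" using div j by (simp add: t_def)
  then have c0: "cell w \<mu>2 j = q" using m1 q t(1) by simp
  have ci: "cell w \<mu>2 (Suc i * L + j) = t" using div by (simp add: t_def)
  have ch: "cell w \<mu>2 (Suc h * L + j) = cell w \<mu> (Suc h * L + j)" if "h < i" for h
  proof -
    have "Suc h * L + L \<le> Suc i * L" using mult_le_mono1[of "Suc (Suc h)" "Suc i" L] that by simp
    then have "Suc h * L + j < Suc i * L" using j by linarith
    moreover have "\<forall>x. x < Suc i * L \<or> Suc i * L + L \<le> x \<longrightarrow> cell w \<mu>1 x = cell w \<mu> x"
      using md unfolding max_divisors_def by (rule conjunct1)
    ultimately have "cell w \<mu>1 (Suc h * L + j) = cell w \<mu> (Suc h * L + j)" by blast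
    then show ?thesis using div by simp
  qed
  show ?thesis
    unfolding smooth_part_def
  proof (intro conjI allI impI)
    have "(\<Prod>h<Suc i. cell w \<mu>2 (Suc h * L + j)) = (\<Prod>h<i. cell w \<mu> (Suc h * L + j)) * t"
      unfolding prod.lessThan_Suc ci using ch by (intro arg_cong2[where f = times] prod.cong) auto
    then show "cell w \<mu>2 j * (\<Prod>h<Suc i. cell w \<mu>2 (Suc h * L + j)) = A + j"
      using prod unfolding c0 q by (simp add: mult_ac)
  next
    fix h assume "h < Suc i"
    then show "1 \<le> cell w \<mu>2 (Suc h * L + j)" "cell w \<mu>2 (Suc h * L + j) \<le> L"
      using ci ch[of h] t(1,2) sp by (cases "h = i", simp_all only: smooth_part_def less_Suc_eq) auto
  next
    fix p h assume p: "prime p" "p \<le> L" "p dvd cell w \<mu>2 j" and h: "h < Suc i"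
    have pt: "p * t dvd m" using p(3) unfolding c0 q by (simp add: mult.commute)
    have pm: "p dvd m" using p(3) unfolding c0 q by simp
    have p2: "2 \<le> p" using p(1) by (rule prime_ge_2_nat)
    have new: "p \<le> t" "L < p * t"
    proof -
      show "p \<le> t" using tmax p2 p(2) pm by blast
      \<comment> \<open>Otherwise \<open>p * t\<close> would be a larger divisor of \<open>m\<close>
        within the limit \<open>L\<close>.\<close>
      show "L < p * t"
      proof (rule ccontr)
        assume "\<not> L < p * t"
        moreover have "2 * 1 \<le> p * t" using p2 t(1) by (intro mult_mono) auto
        ultimately have "p * t \<le> t" using tmax[of "p * t"] pt by auto
        then show False using p2 t(1) by simp
      qed
    qed
    have old: "p \<le> cell w \<mu> (Suc h * L + j) \<and> L < p * cell w \<mu> (Suc h * L + j)" if "h < i"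
      using sp p(1,2) pm that unfolding smooth_part_def m_def by blast
    show "p \<le> cell w \<mu>2 (Suc h * L + j)" "L < p * cell w \<mu>2 (Suc h * L + j)"
      using h new old ci ch[of h] by (cases "h = i", simp_all only: less_Suc_eq) auto
  qed
qed

text \<open>If a prime \<open>p \<le> L\<close> were left, then each of the pairs (0, 1), (2, 3),
  (4, 5) of recorded divisors would have a product above \<open>L\<close>, because
  \<open>L < p * T (h + 1) \<le> T h * T (h + 1)\<close>. Three pairs exceed \<open>L^3\<close>,
  hence \<open>n\<close>; this is why there are six rounds.\<close>

lemma smooth_part_complete:
  assumes sp: "smooth_part n 6 \<mu> j" and n: "1 \<le> n" "n \<le> 3 * N" and p: "prime p" "p dvd cell w \<mu> j"
  shows "L < p"
proof (rule ccontr)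
  assume "\<not> L < p"
  then have pL: "p \<le> L" by simp
  define T where "T h = cell w \<mu> (Suc h * L + j)" for h
  have T: "p \<le> T h" "L < p * T h" if "h < 6" for h
    using sp p pL that unfolding smooth_part_def T_def by blast+
  have pair: "L < T h * T (Suc h)" if "Suc h < 6" for h
  proof -
    have "L < p * T (Suc h)" using T(2)[OF that] .
    also have "\<dots> \<le> T h * T (Suc h)" using T(1)[of h] that by (intro mult_right_mono) auto
    finally show ?thesis .
  qed
  have "{..<6::nat} = {0, 1, 2, 3, 4, 5}" by auto
  then have "(\<Prod>h<6. T h) = (T 0 * T 1) * ((T 2 * T 3) * (T 4 * T 5))" by (simp add: mult_ac)
  moreover have "L * (L * L) \<le> (T 0 * T 1) * ((T 2 * T 3) * (T 4 * T 5))"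
    using pair[of 0] pair[of 2] pair[of 4] by (intro mult_mono) (auto simp: numeral_eq_Suc)
  ultimately have big: "L ^ 3 \<le> (\<Prod>h<6. T h)" by (simp add: power3_eq_cube)
  have e: "cell w \<mu> j * (\<Prod>h<6. T h) = n" using sp by (simp add: smooth_part_def T_def)
  then have "1 \<le> cell w \<mu> j" using n by (cases "cell w \<mu> j") auto
  then have "1 * (\<Prod>h<6. T h) \<le> cell w \<mu> j * (\<Prod>h<6. T h)" by (rule mult_right_mono) simp
  then have "L ^ 3 \<le> n" using big e by linarith
  then show False using N_less_L_cube n by linarith
qed

end

context factor_params
begin

text \<open>In blank memory the cells below \<open>L\<close> hold 0, which every \<open>d\<close>
  divides. The divisibility test of \<open>record_divisor\<close> is then vacuous, and the sieve
  from 1 over proper divisors stores the largest proper divisor of each number, or 1.\<close>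

lemma divisor_table_init:
  assumes z: "\<And>x. cell w \<mu> x = 0"
    and md: "max_divisors (8 * L) \<mu> {(d, j). 2 \<le> d \<and> d \<le> L \<and> j < L \<and> d dvd 1 + j \<and> 2 * d \<le> 1 + j} \<mu>'"
  shows "divisor_table \<mu>'"
  unfolding divisor_table_def
proof (intro allI impI)
  fix n assume n: "2 \<le> n" "n \<le> L"
  define t where "t = cell w \<mu>' (8 * L - 1 + n)"
  define i where "i = n - 1"
  have ni: "n = 1 + i" "i < L" using n by (auto simp: i_def)
  have e: "8 * L - 1 + n = 8 * L + i" using ni L_ge by simp
  let ?P = "{(d, j). 2 \<le> d \<and> d \<le> L \<and> j < L \<and> d dvd 1 + j \<and> 2 * d \<le> 1 + j}"
  have mi: "(t = 1 \<or> (t, i) \<in> ?P \<and> t dvd cell w \<mu> i) \<and> (\<forall>d. (d, i) \<in> ?P \<longrightarrow> d dvd cell w \<mu> i \<longrightarrow> d \<le> t)"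
    using md ni(2) unfolding max_divisors_def t_def e by blast
  then have tc: "t = 1 \<or> (2 \<le> t \<and> t dvd n \<and> 2 * t \<le> n)" unfolding ni(1) by auto
  have tmax: "d \<le> t" if "2 \<le> d" "d dvd n" "2 * d \<le> n" for d
  proof -
    have "(d, i) \<in> ?P" using that n(2) ni by simp
    then show ?thesis using mi z by simp
  qed
  have t1: "1 \<le> t" "t dvd n" "t < n" using tc n by auto
  then obtain q where q: "n = t * q" by (auto elim: dvdE)
  have nq: "n div t = q" using q t1 by simp
  have "q \<noteq> 0" "q \<noteq> 1" using q t1 n by auto
  then have q2: "2 \<le> q" by linarith
  have "prime q"
  proof (rule ccontr)
    assume "\<not> prime q"
    \<comment> \<open>A prime \<open>p\<close> with \<open>2 * p \<le> q\<close> would make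
      \<open>t * p\<close> a larger proper divisor of \<open>n\<close>.\<close>
    then obtain p where p: "prime p" "p dvd q" "2 * p \<le> q" using small_prime_divisor q2 by blast
    have p2: "2 \<le> p" using p(1) by (rule prime_ge_2_nat)
    have "t * p dvd n" unfolding q using p(2) by simp
    moreover have "2 * (t * p) \<le> n" unfolding q using mult_le_mono2[OF p(3), of t] by (simp add: mult_ac)
    moreover have "2 \<le> t * p" using mult_le_mono[OF t1(1) p2] by simp
    ultimately have "t * p \<le> t" using tmax by blast
    then show False using p2 t1(1) by simp
  qed
  then show "1 \<le> cell w \<mu>' (8 * L - 1 + n) \<and> cell w \<mu>' (8 * L - 1 + n) dvd n \<and> prime (n div cell w \<mu>' (8 * L - 1 + n))"
    using t1 nq unfolding t_def by simp
qed

lemma divisor_table_cong: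
  assumes "divisor_table \<mu>" "\<And>x. 8 * L \<le> x \<Longrightarrow> cell w \<mu>' x = cell w \<mu> x"
  shows "divisor_table \<mu>'"
proof -
  have "8 * L \<le> 8 * L - 1 + n" if "2 \<le> n" for n using that by simp
  then show ?thesis using assms unfolding divisor_table_def by (metis (no_types, lifting))
qed

text \<open>After six rounds the rest \<open>m\<close> has only prime factors above
  \<open>L\<close>. A prime above \<open>L\<close> therefore divides no recorded divisor and must
  divide \<open>m\<close>; up to the square root it is also visited, so the entry for it is not
  1.\<close>

lemma sieved_intro:
  assumes sp: "smooth_part (A + j) 6 \<mu> j" and j: "j < L" and A: "1 \<le> A" "A \<le> 2 * N"
    and md: "max_divisors (7 * L) \<mu> P \<mu>'" and P: "\<And>d j. (d, j) \<in> P \<Longrightarrow> L \<le> d \<and> d * d \<le> 27 * N"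
    and cov: "\<And>d. L \<le> d \<Longrightarrow> d * d \<le> A + L \<Longrightarrow> d dvd A + j \<Longrightarrow> (d, j) \<in> P"
  shows "sieved \<mu>' (A + j) j"
proof -
  define n where "n = A + j"
  define m where "m = cell w \<mu> j"
  define t where "t = cell w \<mu>' (7 * L + j)"
  have n: "1 \<le> n" "n \<le> 3 * N" "n < A + L" using A j L_le by (auto simp: n_def)
  have same: "cell w \<mu>' (Suc i * L + j) = cell w \<mu> (Suc i * L + j)" if "i < 6" for i
  proof -
    have "Suc i * L \<le> 6 * L" using that by (intro mult_right_mono) auto
    then have "Suc i * L + j < 7 * L" using j by linarith
    moreover have "\<forall>x. x < 7 * L \<or> 7 * L + L \<le> x \<longrightarrow> cell w \<mu>' x = cell w \<mu> x"
      using md unfolding max_divisors_def by (rule conjunct1)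
    ultimately show ?thesis by blast
  qed
  have big: "L < p" if "prime p" "p dvd m" for p
    using smooth_part_complete[OF sp] n that unfolding n_def m_def by blast
  have prod: "m * (\<Prod>h<6. cell w \<mu> (Suc h * L + j)) = n" using sp by (simp add: smooth_part_def m_def n_def)
  have T: "1 \<le> cell w \<mu> (Suc h * L + j)" "cell w \<mu> (Suc h * L + j) \<le> L" if "h < 6" for h
    using sp that unfolding smooth_part_def by blast+
  have split: "p dvd m \<or> (\<exists>i<6. p dvd cell w \<mu> (Suc i * L + j))" if "prime p" "p dvd n" for p
  proof -
    have "p dvd m \<or> p dvd (\<Prod>h<6. cell w \<mu> (Suc h * L + j))" using that prod by (metis prime_dvd_mult_iff)
    moreover have "\<exists>i\<in>{..<6}. p dvd cell w \<mu> (Suc i * L + j)" if "p dvd (\<Prod>h<6. cell w \<mu> (Suc h * L + j))"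
      using prime_dvd_prod_iff[of "{..<6}" p "\<lambda>h. cell w \<mu> (Suc h * L + j)"] \<open>prime p\<close> that by blast
    ultimately show ?thesis by auto
  qed
  have tc: "t = 1 \<or> (t, j) \<in> P \<and> t dvd m" using md j unfolding max_divisors_def t_def m_def by auto
  have tmax: "d \<le> t" if "(d, j) \<in> P" "d dvd m" for d using md j that unfolding max_divisors_def t_def m_def by auto
  \<comment> \<open>A composite entry would have a prime factor \<open>p > L\<close> with
    \<open>p * p \<le> t\<close>, so \<open>t * t \<ge> L^4\<close>, against
    \<open>t * t \<le> 27 * N\<close>.\<close>
  have prime_t: "prime t \<and> t dvd n \<and> L < t" if t1: "t \<noteq> 1"
  proof -
    have tP: "(t, j) \<in> P" "t dvd m" using tc t1 by auto
    then have tt: "L \<le> t" "t * t \<le> 27 * N" using P by auto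
    have "prime t"
    proof (rule ccontr)
      assume "\<not> prime t"
      then obtain p where p: "prime p" "p dvd t" "p * p \<le> t" using small_prime_divisor[of t] tt L_ge by auto
      have "L < p" using big p tP by (meson dvd_trans)
      then have "L * L \<le> p * p" by (intro mult_mono) auto
      then have "L * L \<le> t" using p by linarith
      then have "(L * L) * (L * L) \<le> t * t" by (intro mult_mono) auto
      moreover have "L ^ 3 * 1 \<le> L ^ 3 * L" using L_ge by (intro mult_left_mono) auto
      moreover have "L ^ 3 * L = (L * L) * (L * L)" by (simp add: power3_eq_cube)
      ultimately show False using N_less_L_cube tt by linarith
    qed
    moreover have "t dvd n" using tP(2) prod by (metis dvd_mult2)
    ultimately show ?thesis using big tP(2) by blast
  qed
  have t_ne: "t \<noteq> 1" if p: "prime p" "p dvd n" "L < p" "p * p \<le> n" for p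
  proof -
    have "\<not> p dvd cell w \<mu> (Suc i * L + j)" if "i < 6" for i
      using T[OF that] p(3) by (auto dest: dvd_imp_le)
    then have "p dvd m" using split p by blast
    moreover have "(p, j) \<in> P" using cov[of p] p n unfolding n_def by auto
    ultimately have "p \<le> t" using tmax by blast
    then show ?thesis using prime_ge_2_nat[OF p(1)] by auto
  qed
  have small: "\<exists>i<6. p dvd cell w \<mu>' (Suc i * L + j)" if p: "prime p" "p \<le> L" "p dvd n" for p
  proof -
    have "\<not> p dvd m" using big[of p] p by linarith
    then obtain i where "i < 6" "p dvd cell w \<mu> (Suc i * L + j)" using split p by blast
    then show ?thesis using same[of i] by auto
  qed
  have "1 \<le> cell w \<mu>' (Suc i * L + j) \<and> cell w \<mu>' (Suc i * L + j) \<le> L" if "i < 6" for i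
    using T[OF that] unfolding same[OF that] by blast
  then show ?thesis
    unfolding sieved_def n_def[symmetric] t_def[symmetric] using small prime_t t_ne by blast
qed

lemma notin_writes_large_sieve: "x < 13 \<Longrightarrow> x \<notin> writes (large_sieve record_divisor)"
  by (auto simp: large_sieve_def sieve_scan_def farey_step_def choose_fraction_def sieve_block_def
      visit_progression_def visit_candidate_def writes_record_divisor)

lemma writes_emit_record: "writes emit_record = {11, 13, 14, 15, 16, 17, 18, 19, 20}"
  by (auto simp: emit_record_def writes_for_loop writes_load_cell writes_strip_divisor writes_strip_prime)

lemma wp_factor_window_init:
  assumes A: "1 \<le> A" "A \<le> 2 * N" and r: "\<rho> 4 = nr L" "\<rho> 6 = nr A" "\<rho> 8 = nr w" and t: "(4 + 2) * real L + 2 \<le> \<tau>"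
  shows "wp W B (for_loop 12 (Reg 4) (Arith 16 Add (Reg 6) (Reg 12) ;; store_cell (Reg 12) (lit 0) (Reg 16)))
    (\<lambda>\<tau>' \<rho>' \<mu>' z'. \<tau> - ((4 + 2) * real L + 2) \<le> \<tau>' \<and> (\<forall>x. cell w \<mu>' x = (if x < L then A + x else cell w \<mu> x))) \<tau> \<rho> \<mu> z"
proof -
  let ?c = "Arith 16 Add (Reg 6) (Reg 12) ;; store_cell (Reg 12) (lit 0) (Reg 16)"
  define J where "J i \<mu>' (z' :: nat list) \<longleftrightarrow> (\<forall>x. cell w \<mu>' x = (if x < i then A + x else cell w \<mu> x))" for i \<mu>' z'
  have W1: "L + 1 \<le> W" using L_le L_ge W by linarith
  have "wp W B (for_loop 12 (Reg 4) ?c) (\<lambda>\<tau>' \<rho>' \<mu>' z'. \<tau> - ((4 + 2) * real L + 2) \<le> \<tau>' \<and> J L \<mu>' z') \<tau> \<rho> \<mu> z"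
  proof (rule wp_for_loop[where J = J])
    show "J 0 \<mu> z" by (simp add: J_def)
    fix i \<tau>' \<mu>' z' and \<rho>' :: "nat \<Rightarrow> rat"
    assume i: "i < L" "\<rho>' 12 = nr i" and fr: "\<forall>y. y \<notin> insert 12 (writes ?c) \<longrightarrow> \<rho>' y = \<rho> y" and Ji: "J i \<mu>' z'"
    have r': "\<rho>' 8 = nr w" "\<rho>' 6 = nr A" using fr r by (auto simp: writes_store_cell)
    have v: "A + i < 2 ^ w" "A + i \<le> W" "i < 9 * L" using A i L_le two_power_w W by linarith+
    have "J (Suc i) (write_field \<mu>' (i * w) w (A + i)) z'"
      using Ji unfolding J_def cell_write_field[OF v(1)] by auto
    then show "wp W B ?c (\<lambda>\<tau>2 \<rho>2 \<mu>2 z2. \<tau>' - 4 \<le> \<tau>2 \<and> J (Suc i) \<mu>2 z2) \<tau>' \<rho>' \<mu>' z'"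
      using r' i v W_pos by (simp add: wp_Seq wp_Arith opv_lit arith_nr fits_nr wp_store_cell)
  qed (use r t W1 in \<open>auto simp: writes_store_cell\<close>)
  then show ?thesis by (rule wp_use) (auto simp: J_def)
qed

lemma wp_factor_passes:
  assumes A: "1 \<le> A" "A \<le> 2 * N" and r: "\<rho> 4 = nr L" "\<rho> 5 = nr s" "\<rho> 6 = nr A" "\<rho> 8 = nr w" "\<rho> 9 = nr 1"
    and m: "\<And>j. j < L \<Longrightarrow> cell w \<mu> j = A + j" and G: "divisor_table \<mu>"
    and t: "(30 * (real L * real l) + 12 * real L + 4 + 2) * real 6 + 2 \<le> \<tau>"
  shows "wp W B (for_loop 11 (lit 6) (Arith 10 Add (Reg 11) (lit 1) ;; Arith 10 Mul (Reg 10) (Reg 4) ;; table_sieve ;; divide_out))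
    (\<lambda>\<tau>' \<rho>' \<mu>' z'. \<tau> - ((30 * (real L * real l) + 12 * real L + 4 + 2) * real 6 + 2) \<le> \<tau>' \<and>
       divisor_table \<mu>' \<and> (\<forall>j<L. smooth_part (A + j) 6 \<mu>' j)) \<tau> \<rho> \<mu> z"
proof (rule wp_for_loop[where J = "\<lambda>i \<mu>' z'. divisor_table \<mu>' \<and> (\<forall>j<L. smooth_part (A + j) i \<mu>' j)"])
  let ?c = "Arith 10 Add (Reg 11) (lit 1) ;; Arith 10 Mul (Reg 10) (Reg 4) ;; table_sieve ;; divide_out"
  show "divisor_table \<mu> \<and> (\<forall>j<L. smooth_part (A + j) 0 \<mu> j)" using m G by (simp add: smooth_part_def)
  show "11 \<notin> writes ?c" by (simp add: writes_table_sieve writes_divide_out)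
  show "6 + 1 \<le> W" using L_le L_ge W by linarith
  fix i \<tau>' \<mu>' z' and \<rho>' :: "nat \<Rightarrow> rat"
  assume i: "i < 6" "\<rho>' 11 = nr i" and fr: "\<forall>y. y \<notin> insert 11 (writes ?c) \<longrightarrow> \<rho>' y = \<rho> y"
    and Ji: "divisor_table \<mu>' \<and> (\<forall>j<L. smooth_part (A + j) i \<mu>' j)" and tt: "30 * (real L * real l) + 12 * real L + 4 \<le> \<tau>'"
  let ?Q = "\<lambda>\<tau>2 \<rho>2 \<mu>2 z2. \<tau>' - (30 * (real L * real l) + 12 * real L + 4) \<le> \<tau>2 \<and> divisor_table \<mu>2 \<and> (\<forall>j<L. smooth_part (A + j) (Suc i) \<mu>2 j)"
  have r': "\<rho>' 4 = nr L" "\<rho>' 5 = nr s" "\<rho>' 6 = nr A" "\<rho>' 8 = nr w" "\<rho>' 9 = nr 1"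
    using fr r by (auto simp: writes_table_sieve writes_divide_out)
  have "Suc i * L \<le> 6 * L" using i by (intro mult_right_mono) auto
  then have b: "L \<le> Suc i * L" "Suc i * L + L \<le> 9 * L" "Suc i * L \<le> W" "Suc i * L + L \<le> 8 * L" "Suc i \<le> W"
    using L_le W L_ge i by (simp, linarith+)
  define \<rho>1 where "\<rho>1 = \<rho>'(10 := nr (Suc i * L))"
  have r1: "\<rho>1 4 = nr L" "\<rho>1 5 = nr s" "\<rho>1 6 = nr A" "\<rho>1 8 = nr w" "\<rho>1 10 = nr (Suc i * L)" "\<rho>1 9 = nr 1"
    using r' by (auto simp: \<rho>1_def)
  have t1: "30 * (real L * real l) \<le> \<tau>' - 2" using tt L_ge by linarith
  have "wp W B table_sieve (wp W B divide_out ?Q) (\<tau>' - 2) \<rho>1 \<mu>' z'"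
  proof (rule wp_use[OF wp_table_sieve[OF b(1,2) A r1 _ _ t1]])
    fix \<tau>2 \<mu>2 z2 and \<rho>2 :: "nat \<Rightarrow> rat"
    assume p2: "\<tau>' - 2 - 30 * (real L * real l) \<le> \<tau>2 \<and>
       max_divisors (Suc i * L) \<mu>' {(d, j). 2 \<le> d \<and> d \<le> L \<and> j < L \<and> d dvd A + j \<and> 1 * d \<le> A + j} \<mu>2"
      and fr2: "\<forall>x. x \<notin> writes table_sieve \<longrightarrow> \<rho>2 x = \<rho>1 x"
    have r2: "\<rho>2 4 = nr L" "\<rho>2 8 = nr w" "\<rho>2 10 = nr (Suc i * L)" using fr2 r1 by (auto simp: writes_table_sieve)
    have "(10 + 2) * real L = 12 * real L" by simp
    then have t2: "(10 + 2) * real L + 2 \<le> \<tau>2" using p2 tt by linarith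
    show "wp W B divide_out ?Q \<tau>2 \<rho>2 \<mu>2 z2"
    proof (rule wp_use[OF wp_divide_out[OF b(1,2) r2 t2]])
      fix \<tau>3 \<mu>3 z3 and \<rho>3 :: "nat \<Rightarrow> rat"
      assume p3: "\<tau>2 - ((10 + 2) * real L + 2) \<le> \<tau>3 \<and>
        (\<forall>x. cell w \<mu>3 x = (if x < L then cell w \<mu>2 x div cell w \<mu>2 (Suc i * L + x) else cell w \<mu>2 x))"
      \<comment> \<open>The rounds change only cells below \<open>8 * L\<close>, so the divisor
        table survives.\<close>
      have "cell w \<mu>3 x = cell w \<mu>' x" if x: "8 * L \<le> x" for x
      proof -
        have "cell w \<mu>3 x = cell w \<mu>2 x" using p3 x by simp
        moreover have "\<forall>x. x < Suc i * L \<or> Suc i * L + L \<le> x \<longrightarrow> cell w \<mu>2 x = cell w \<mu>' x"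
          using p2 unfolding max_divisors_def by blast
        then have "cell w \<mu>2 x = cell w \<mu>' x" using b(4) x by (meson le_trans)
        ultimately show ?thesis by simp
      qed
      then have "divisor_table \<mu>3" using Ji divisor_table_cong by blast
      moreover have "smooth_part (A + j) (Suc i) \<mu>3 j" if "j < L" for j
        using smooth_part_step[of A j i \<mu>' \<mu>2 \<mu>3] Ji i that A(1) p2 p3 by blast
      moreover have "\<tau>' - (30 * (real L * real l) + 12 * real L + 4) \<le> \<tau>3" using p2 p3 by simp
      ultimately show "?Q \<tau>3 \<rho>3 \<mu>3 z3" by blast
    qed
  qed auto
  then show "wp W B ?c ?Q \<tau>' \<rho>' \<mu>' z'"
    using r' i b(3,5) W_pos unfolding \<rho>1_def
    by (simp add: wp_Seq wp_Arith opv_lit arith_nr fits_nr Suc_eq_plus1[symmetric] del: One_nat_def mult_Suc cong: wp_weak_cong)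
qed (use t in \<open>auto simp: opv_lit\<close>)

lemma wp_factor_window:
  assumes A: "1 \<le> A" "A \<le> 2 * N" and G: "divisor_table \<mu>"
    and r: "\<rho> 4 = nr L" "\<rho> 5 = nr s" "\<rho> 6 = nr A" "\<rho> 7 = nr hi" "\<rho> 8 = nr w" "\<rho> 9 = nr 1" and t: "100000 * (real L * real l) \<le> \<tau>"
  shows "wp W B factor_window (\<lambda>\<tau>' \<rho>' \<mu>' z'. \<tau> - 100000 * (real L * real l) \<le> \<tau>' \<and> divisor_table \<mu>' \<and>
     (\<exists>y. z' = z @ y \<and> lists_factorizations {n. A \<le> n \<and> n < A + L \<and> n \<le> hi} y)) \<tau> \<rho> \<mu> z"
proof -
  define X where "X = real L * real l"
  \<comment> \<open>Budgets for loading the window, the six rounds, resetting the table, the large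
    sieve and the output. The largest is \<open>25 * 2000 * L * l\<close>, with 12 credits per
    visit.\<close>
  define T1 T2 T3 T4 T5 where "T1 = (4 + 2) * real L + 2" and "T2 = (30 * (real L * real l) + 12 * real L + 4 + 2) * real 6 + 2"
    and "T3 = (3 + 2) * real L + 2" and "T4 = ((12 + 13) * (2000 * real L) + 13) * real (l + 2) + 4"
    and "T5 = (112 * real w + 70 + 2) * real L + 2"
  have Xl: "real l \<le> X" unfolding X_def using Ll_ge(2) mult_right_mono[of 1 "real L" "real l"] by simp
  have T: "T1 + T2 + T3 + 1 + T4 + T5 \<le> 100000 * X"
  proof -
    have "T4 = 50000 * X + 100000 * real L + 13 * real l + 30" unfolding T4_def X_def by (simp add: algebra_simps)
    moreover have "T5 = 112 * X + 296 * real L + 2" unfolding T5_def X_def w by (simp add: algebra_simps)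
    moreover have "T2 = 180 * X + 72 * real L + 38" unfolding T2_def X_def by (simp add: algebra_simps)
    moreover have "T1 = 6 * real L + 2" "T3 = 5 * real L + 2" by (simp_all add: T1_def T3_def)
    ultimately show ?thesis using Ll_ge[folded X_def] Xl by linarith
  qed
  have Tp: "0 \<le> T1" "0 \<le> T2" "0 \<le> T3" "0 \<le> T4" "0 \<le> T5" by (simp_all add: T1_def T2_def T3_def T4_def T5_def)
  have t0: "100000 * X \<le> \<tau>" using t by (simp add: X_def)
  let ?c1 = "for_loop 12 (Reg 4) (Arith 16 Add (Reg 6) (Reg 12) ;; store_cell (Reg 12) (lit 0) (Reg 16))"
  let ?c2 = "for_loop 11 (lit 6) (Arith 10 Add (Reg 11) (lit 1) ;; Arith 10 Mul (Reg 10) (Reg 4) ;; table_sieve ;; divide_out)"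
  let ?c5 = "for_loop 12 (Reg 4) emit_record"
  let ?Q = "\<lambda>\<tau>' \<rho>' \<mu>' z'. \<tau> - 100000 * (real L * real l) \<le> \<tau>' \<and> divisor_table \<mu>' \<and>
     (\<exists>y. z' = z @ y \<and> lists_factorizations {n. A \<le> n \<and> n < A + L \<and> n \<le> hi} y)"
  have st5: "\<not> stores emit_record"
    by (simp add: emit_record_def stores_for_loop load_cell_def strip_divisor_def strip_prime_def)
  have out5: "wp W B ?c5 ?Q \<tau>5 \<rho>5 \<mu>5 z"
    if sv: "\<forall>j<L. sieved \<mu>5 (A + j) j" and G5: "divisor_table \<mu>5"
      and r5: "\<rho>5 4 = nr L" "\<rho>5 6 = nr A" "\<rho>5 7 = nr hi" "\<rho>5 8 = nr w" and t5: "\<tau> - (T1 + T2 + T3 + 1 + T4) \<le> \<tau>5"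
    for \<tau>5 \<rho>5 \<mu>5
  proof -
    define J where "J i \<mu>' z' \<longleftrightarrow> \<mu>' = \<mu>5 \<and> (\<exists>y. z' = z @ y \<and> lists_factorizations {n. A \<le> n \<and> n < A + i \<and> n \<le> hi} y)"
      for i and \<mu>' :: "nat \<Rightarrow> bool" and z' :: "nat list"
    have tt: "T5 \<le> \<tau>5" using t5 T t0 by linarith
    have W1: "L + 1 \<le> W" using L_le L_ge W by linarith
    have "wp W B ?c5 (\<lambda>\<tau>' \<rho>' \<mu>' z'. \<tau>5 - T5 \<le> \<tau>' \<and> J L \<mu>' z') \<tau>5 \<rho>5 \<mu>5 z"
      unfolding T5_def
    proof (rule wp_for_loop[where J = J])
      have "{n. A \<le> n \<and> n < A + 0 \<and> n \<le> hi} = {}" by auto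
      then have "lists_factorizations {n. A \<le> n \<and> n < A + 0 \<and> n \<le> hi} []" using lists_factorizations_empty by (simp only:)
      then show "J 0 \<mu>5 z" unfolding J_def by auto
      fix i \<tau>' \<mu>' z' and \<rho>' :: "nat \<Rightarrow> rat"
      assume i: "i < L" "\<rho>' 12 = nr i" and fr: "\<forall>y. y \<notin> insert 12 (writes emit_record) \<longrightarrow> \<rho>' y = \<rho>5 y" and Ji: "J i \<mu>' z'"
        and ti: "112 * real w + 70 \<le> \<tau>'"
      from Ji obtain y where mu: "\<mu>' = \<mu>5" and y: "z' = z @ y" "lists_factorizations {n. A \<le> n \<and> n < A + i \<and> n \<le> hi} y"
        by (auto simp: J_def)
      have r': "\<rho>' 4 = nr L" "\<rho>' 6 = nr A" "\<rho>' 7 = nr hi" "\<rho>' 8 = nr w" using fr r5 unfolding writes_emit_record by auto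
      have n: "1 \<le> A + i" "A + i \<le> 3 * N" using A i L_le by linarith+
      have svi: "sieved \<mu>5 (A + i) i" using sv i by blast
      have spl: "{n. A \<le> n \<and> n < A + Suc i \<and> n \<le> hi} =
          {n. A \<le> n \<and> n < A + i \<and> n \<le> hi} \<union> (if A + i \<le> hi then {A + i} else {})" by auto
      show "wp W B emit_record (\<lambda>\<tau>2 \<rho>2 \<mu>2 z2. \<tau>' - (112 * real w + 70) \<le> \<tau>2 \<and> J (Suc i) \<mu>2 z2) \<tau>' \<rho>' \<mu>' z'"
        unfolding mu
      proof (rule wp_use[OF wp_emit_record[OF svi G5 refl n i(1) r' i(2) ti]])
        fix \<tau>2 \<mu>2 z2 and \<rho>2 :: "nat \<Rightarrow> rat"
        assume p: "\<tau>' - (112 * real w + 70) \<le> \<tau>2 \<and>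
          (if A + i \<le> hi then \<exists>ps. distinct ps \<and> set ps = {p. prime p \<and> p dvd A + i} \<and> z2 = z' @ factor_record (A + i) ps else z2 = z')"
          and st: "\<not> stores emit_record \<longrightarrow> \<mu>2 = \<mu>5"
        have "\<exists>y2. z2 = z' @ y2 \<and> lists_factorizations (if A + i \<le> hi then {A + i} else {}) y2"
          using p lists_factorizations_single lists_factorizations_empty by (cases "A + i \<le> hi") auto
        then obtain y2 where y2: "z2 = z' @ y2" "lists_factorizations (if A + i \<le> hi then {A + i} else {}) y2" by blast
        have "lists_factorizations {n. A \<le> n \<and> n < A + Suc i \<and> n \<le> hi} (y @ y2)"
          unfolding spl by (rule lists_factorizations_union[OF y(2) y2(2)]) auto
        then have "J (Suc i) \<mu>2 z2" unfolding J_def using st st5 y(1) y2(1) by auto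
        then show "\<tau>' - (112 * real w + 70) \<le> \<tau>2 \<and> J (Suc i) \<mu>2 z2" using p by blast
      qed
    qed (use r5 W1 tt in \<open>auto simp: T5_def writes_emit_record\<close>)
    then show ?thesis
    proof (rule wp_use)
      fix \<tau>2 \<mu>2 z2 and \<rho>2 :: "nat \<Rightarrow> rat"
      assume p: "\<tau>5 - T5 \<le> \<tau>2 \<and> J L \<mu>2 z2"
      then have "\<tau> - 100000 * (real L * real l) \<le> \<tau>2" using t5 T unfolding X_def by linarith
      then show "?Q \<tau>2 \<rho>2 \<mu>2 z2" using p G5 by (auto simp: J_def)
    qed
  qed
  have t1: "T1 \<le> \<tau>" using T Tp t0 by linarith
  show ?thesis
    unfolding factor_window_def wp_Seq[of W B ?c1]
  proof (rule wp_use[OF wp_factor_window_init[OF A r(1,3,5) t1[unfolded T1_def]]])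
    fix \<tau>1 \<mu>1 z1 and \<rho>1 :: "nat \<Rightarrow> rat"
    assume p1: "\<tau> - ((4 + 2) * real L + 2) \<le> \<tau>1 \<and> (\<forall>x. cell w \<mu>1 x = (if x < L then A + x else cell w \<mu> x))"
      and fr1: "\<forall>x. x \<notin> writes ?c1 \<longrightarrow> \<rho>1 x = \<rho> x" and em1: "\<not> emits ?c1 \<longrightarrow> z1 = z"
    have r1: "\<rho>1 4 = nr L" "\<rho>1 5 = nr s" "\<rho>1 6 = nr A" "\<rho>1 8 = nr w" "\<rho>1 9 = nr 1" "\<rho>1 7 = nr hi"
      using fr1 r by (auto simp: writes_for_loop writes_store_cell)
    have G1: "divisor_table \<mu>1" using G by (rule divisor_table_cong) (use p1 L_ge in simp)
    have m1: "cell w \<mu>1 j = A + j" if "j < L" for j using p1 that by simp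
    have t2: "T2 \<le> \<tau>1" using p1[folded T1_def] T Tp t0 by linarith
    show "wp W B (?c2 ;; Arith 10 Mul (lit 7) (Reg 4) ;; init_table ;; large_sieve record_divisor ;; ?c5) ?Q \<tau>1 \<rho>1 \<mu>1 z1"
      unfolding wp_Seq[of W B ?c2]
    proof (rule wp_use[OF wp_factor_passes[OF A r1(1-5) m1 G1 t2[unfolded T2_def]]])
      fix \<tau>2 \<mu>2 z2 and \<rho>2 :: "nat \<Rightarrow> rat"
      assume p2: "\<tau>1 - ((30 * (real L * real l) + 12 * real L + 4 + 2) * real 6 + 2) \<le> \<tau>2 \<and>
         divisor_table \<mu>2 \<and> (\<forall>j<L. smooth_part (A + j) 6 \<mu>2 j)"
        and fr2: "\<forall>x. x \<notin> writes ?c2 \<longrightarrow> \<rho>2 x = \<rho>1 x" and em2: "\<not> emits ?c2 \<longrightarrow> z2 = z1"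
      have r2: "\<rho>2 4 = nr L" "\<rho>2 5 = nr s" "\<rho>2 6 = nr A" "\<rho>2 8 = nr w" "\<rho>2 9 = nr 1" "\<rho>2 7 = nr hi"
        using fr2 r1 by (auto simp: writes_for_loop writes_table_sieve writes_divide_out)
      define \<rho>3 where "\<rho>3 = \<rho>2(10 := nr (7 * L))"
      have r3: "\<rho>3 4 = nr L" "\<rho>3 5 = nr s" "\<rho>3 6 = nr A" "\<rho>3 8 = nr w" "\<rho>3 10 = nr (7 * L)" "\<rho>3 7 = nr hi"
        using r2 by (auto simp: \<rho>3_def)
      have b: "L \<le> 7 * L" "7 * L + L \<le> 9 * L" "7 * L \<le> W" using L_le W by linarith+
      have t3: "T3 \<le> \<tau>2 - 1" using p1[folded T1_def] p2[folded T2_def] T Tp t0 by linarith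
      have "wp W B init_table (wp W B (large_sieve record_divisor ;; ?c5) ?Q) (\<tau>2 - 1) \<rho>3 \<mu>2 z2"
      proof (rule wp_use[OF wp_init_table[OF b(1,2) r3(1,4,5) t3[unfolded T3_def]]])
        fix \<tau>4 \<mu>4 z4 and \<rho>4 :: "nat \<Rightarrow> rat"
        assume p4: "\<tau>2 - 1 - ((3 + 2) * real L + 2) \<le> \<tau>4 \<and> max_divisors (7 * L) \<mu>2 {} \<mu>4"
          and fr4: "\<forall>x. x \<notin> writes init_table \<longrightarrow> \<rho>4 x = \<rho>3 x" and em4: "\<not> emits init_table \<longrightarrow> z4 = z2"
        have r4: "\<rho>4 4 = nr L" "\<rho>4 5 = nr s" "\<rho>4 6 = nr A" "\<rho>4 8 = nr w" "\<rho>4 10 = nr (7 * L)" "\<rho>4 7 = nr hi"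
          using fr4 r3 by (auto simp: writes_init_table)
        interpret v: visitor N l u L s W B A record_divisor "max_divisors (7 * L) \<mu>2" \<rho>4 12
          by (rule visitor_record_divisor[OF b(1,2) A r4(1-5)])
        have p4': "max_divisors (7 * L) \<mu>2 {} \<mu>4" using p4 by simp
        have t4: "T4 \<le> \<tau>4" using p1[folded T1_def] p2[folded T2_def] p4[folded T3_def] T Tp t0 by linarith
        show "wp W B (large_sieve record_divisor ;; ?c5) ?Q \<tau>4 \<rho>4 \<mu>4 z4"
          unfolding wp_Seq
        proof (rule wp_use[OF v.wp_large_sieve[OF p4' _ t4[unfolded T4_def]]])
          fix \<tau>5 \<mu>5 z5 and \<rho>5 :: "nat \<Rightarrow> rat"
          assume p5: "\<tau>4 - (((12 + 13) * (2000 * real L) + 13) * real (l + 2) + 4) \<le> \<tau>5 \<and>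
             (\<exists>P'. max_divisors (7 * L) \<mu>2 P' \<mu>5 \<and> v.extends {} P' \<and> (\<forall>d. L \<le> d \<and> d * d \<le> A + L \<longrightarrow> v.covered P' d))"
            and fr5: "\<forall>x. x \<notin> writes (large_sieve record_divisor) \<longrightarrow> \<rho>5 x = \<rho>4 x"
            and em5: "\<not> emits (large_sieve record_divisor) \<longrightarrow> z5 = z4"
          from p5 obtain P5 where P5: "max_divisors (7 * L) \<mu>2 P5 \<mu>5" "v.extends {} P5"
            and cov: "\<forall>d. L \<le> d \<and> d * d \<le> A + L \<longrightarrow> v.covered P5 d" by blast
          have z5: "z5 = z"
            using em1 em2 em4 em5 by (simp add: emits_for_loop init_table_def table_sieve_def divide_out_def small_sieve_def
                sieve_row_def large_sieve_def sieve_scan_def farey_step_def choose_fraction_def sieve_block_def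
                visit_progression_def visit_candidate_def record_divisor_def load_cell_def store_cell_def)
          have r5: "\<rho>5 4 = nr L" "\<rho>5 6 = nr A" "\<rho>5 7 = nr hi" "\<rho>5 8 = nr w"
            using fr5 r4 notin_writes_large_sieve by auto
          have "sieved \<mu>5 (A + j) j" if "j < L" for j
          proof (rule sieved_intro[OF _ that A P5(1)])
            show "smooth_part (A + j) 6 \<mu>2 j" using p2 that by blast
            show "L \<le> d \<and> d * d \<le> 27 * N" if "(d, h) \<in> P5" for d h
              using P5(2) that by (auto simp: v.extends_def v.allowed_def)
            show "(d, j) \<in> P5" if "L \<le> d" "d * d \<le> A + L" "d dvd A + j" for d
              using cov that \<open>j < L\<close> by (auto simp: v.covered_def)
          qed
          moreover have "divisor_table \<mu>5"
          proof (rule divisor_table_cong[of \<mu>2])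
            show "divisor_table \<mu>2" using p2 by blast
            show "cell w \<mu>5 x = cell w \<mu>2 x" if "8 * L \<le> x" for x using P5(1) that by (simp add: max_divisors_def)
          qed
          moreover have "\<tau> - (T1 + T2 + T3 + 1 + T4) \<le> \<tau>5"
            using p1[folded T1_def] p2[folded T2_def] p4[folded T3_def] p5[folded T4_def] by linarith
          ultimately show "wp W B ?c5 ?Q \<tau>5 \<rho>5 \<mu>5 z5" unfolding z5 using r5 by (intro out5) auto
        qed auto
      qed
      then show "wp W B (Arith 10 Mul (lit 7) (Reg 4) ;; init_table ;; large_sieve record_divisor ;; ?c5) ?Q \<tau>2 \<rho>2 \<mu>2 z2"
        using r2 b(3) W_pos unfolding \<rho>3_def
        by (simp add: wp_Seq[of W B "Arith _ _ _ _"] wp_Seq[of W B init_table] wp_Arith opv_lit arith_nr fits_nr cong: wp_weak_cong)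
    qed
  qed
qed

lemma writes_factor_window: "x < 10 \<Longrightarrow> x \<notin> writes factor_window"
  using notin_writes_large_sieve[of x]
  by (auto simp: factor_window_def writes_for_loop writes_store_cell writes_table_sieve writes_divide_out writes_init_table writes_emit_record)

end

section \<open>Complexity bounds\<close>

definition prime_program :: "com \<Rightarrow> com" where
  "prime_program c =
    setup_params ;;
    Arith 9 Add (lit 2) (lit 0) ;;
    c ;;
    windows prime_window"

text \<open>The divisor table is built once, with 2 in register 9 so that only proper divisors
  count. The windows then run with 1, since a number up to \<open>L\<close> may be removed as a
  whole.\<close>

definition factor_program :: "com \<Rightarrow> com" where
  "factor_program c =
    setup_params ;;
    Arith 8 Add (Reg 2) (lit 2) ;;
    Arith 9 Add (lit 2) (lit 0) ;;
    Arith 10 Mul (lit 8) (Reg 4) ;;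
    Arith 6 Add (lit 1) (lit 0) ;;
    table_sieve ;;
    Arith 9 Add (lit 1) (lit 0) ;;
    c ;;
    windows factor_window"

definition whole_range :: com where
  "whole_range = Arith 6 Add (lit 1) (lit 0) ;; Arith 7 Add (Reg 0) (lit 0)"

text \<open>For \<open>\<Delta> = N\<close> the interval begins at 0, while windows have to start at
  1 or later.\<close>

definition near_range :: com where
  "near_range =
    Arith 6 Sub (Reg 0) (Reg 1) ;;
    Cond Less (Reg 6) (lit 1) (Arith 6 Add (lit 1) (lit 0)) Skip ;;
    Arith 7 Add (Reg 0) (Reg 1)"

lemma writes_setup_params: "writes setup_params = {2, 3, 4, 5, 13, 14}"
  by (auto simp: setup_params_def)

lemma notin_writes_prime_window: "x < 10 \<Longrightarrow> x \<notin> writes prime_window"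
  by (auto simp: prime_window_def writes_for_loop small_sieve_def sieve_row_def large_sieve_def sieve_scan_def farey_step_def
      choose_fraction_def sieve_block_def visit_progression_def visit_candidate_def writes_mark_bit)

text \<open>The choice of the interval is the only difference between the global and the local
  programs, so it is abstracted from the proofs.\<close>

definition selects_range :: "nat \<Rightarrow> com \<Rightarrow> (nat \<Rightarrow> rat) \<Rightarrow> nat \<Rightarrow> nat \<Rightarrow> bool" where
  "selects_range W c \<rho>\<^sub>i lo hi \<longleftrightarrow> writes c \<subseteq> {6, 7} \<and> \<not> stores c \<and> \<not> emits c \<and>
     (\<forall>B \<tau> \<rho> \<mu> z. \<rho> 0 = \<rho>\<^sub>i 0 \<longrightarrow> \<rho> 1 = \<rho>\<^sub>i 1 \<longrightarrow>
       wp W B c (\<lambda>\<tau>' \<rho>' \<mu>' z'. \<tau> - 4 \<le> \<tau>' \<and> \<rho>' 6 = nr lo \<and> \<rho>' 7 = nr hi) \<tau> \<rho> \<mu> z)"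

lemma selects_whole_range:
  assumes "1 \<le> W" "N \<le> W" "\<rho>\<^sub>i 0 = nr N"
  shows "selects_range W whole_range \<rho>\<^sub>i 1 N"
  unfolding selects_range_def whole_range_def using assms by (auto simp: wp_simps)

lemma selects_near_range:
  assumes "2 * N \<le> W" "1 \<le> N" "D \<le> N" "\<rho>\<^sub>i 0 = nr N" "\<rho>\<^sub>i 1 = nr D"
  shows "selects_range W near_range \<rho>\<^sub>i (max 1 (N - D)) (N + D)"
  unfolding selects_range_def near_range_def using assms by (auto simp: wp_simps max_def)

text \<open>A non-negative balance of credits at the end is the time bound.\<close>

lemma wp_imp_performs:
  assumes "wp W B c (\<lambda>\<tau>' \<rho>' \<mu>' z'. 0 \<le> \<tau>' \<and> P z') T (regs (init_state xs)) (\<lambda>_. False) []"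
    and "real (B + card (com_regs c) * (2 * (floorlog 2 W + 1))) \<le> S" "T \<le> T'"
  shows "performs W c xs P S T'"
proof -
  have i: "\<lparr>regs = regs (init_state xs), mem = \<lambda>_. False, outp = []\<rparr> = init_state xs"
    by (simp add: init_state_def)
  obtain t m s' where e: "exec W c (init_state xs) t m s'" and m: "m \<le> B" and t: "0 \<le> T - real t" and P: "P (outp s')"
    using assms(1) unfolding wp_def i by auto
  have "space_bits W c m \<le> B + card (com_regs c) * (2 * (floorlog 2 W + 1))"
    using m by (simp add: space_bits_def)
  then have "real (space_bits W c m) \<le> S" using assms(2) by linarith
  then show ?thesis unfolding performs_def using e P t assms(3) by (intro exI[of _ t] exI[of _ m] exI[of _ s']) auto
qed

context sieve_params
begin

text \<open>The last window is paid in full even if it is cut off, hence the additional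
  \<open>L\<close>; the 2 per window is absorbed by \<open>L * l\<close>.\<close>

lemma window_count_bound:
  assumes "A \<le> hi" "0 \<le> a"
  shows "(a * (real L * real l) + 2) * real ((hi + L - A) div L) \<le> (a + 1) * (real (hi - A + L) * real l)"
proof -
  have "real ((hi + L - A) div L) \<le> real (hi + L - A) / real L" by (rule of_nat_div_le_of_nat)
  then have q: "real L * real ((hi + L - A) div L) \<le> real (hi - A + L)"
    using L_ge assms(1) by (simp add: field_simps)
  have l2: "2 \<le> real l" using l by simp
  have "2 * 1 \<le> real l * real L" using l2 L_ge by (intro mult_mono) auto
  then have "a * (real L * real l) + 2 \<le> (a + 1) * (real L * real l)" by (simp add: algebra_simps)
  then have "(a * (real L * real l) + 2) * real ((hi + L - A) div L) \<le> (a + 1) * (real L * real l) * real ((hi + L - A) div L)"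
    by (intro mult_right_mono) auto
  also have "\<dots> = (a + 1) * (real L * real ((hi + L - A) div L) * real l)" by (simp add: mult_ac)
  also have "\<dots> \<le> (a + 1) * (real (hi - A + L) * real l)"
    using q assms(2) by (intro mult_left_mono mult_right_mono) auto
  finally show ?thesis .
qed

lemma setup_cost: "3 * real l + 6 * real u + 30 \<le> real L * real l"
proof -
  have "real l \<le> real u" "20 \<le> real l" using l by simp_all
  moreover have "20 * real u \<le> real l * real u" using l by (intro mult_right_mono) auto
  then have "20 * real u \<le> real L" by (simp add: L mult.commute)
  moreover have "real L * 1 \<le> real L * real l" using l by (intro mult_left_mono) auto
  ultimately show ?thesis by linarith
qed

lemma wp_prime_program:
  assumes BL: "L \<le> B" and c: "selects_range W c \<rho>\<^sub>i lo hi" and lo: "1 \<le> lo" "lo \<le> hi" "hi \<le> 2 * N" and r: "\<rho>\<^sub>i 0 = nr N"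
    and t: "50000 * (real (hi - lo + L) * real l) \<le> \<tau>"
  shows "wp W B (prime_program c) (\<lambda>\<tau>' \<rho>' \<mu>' z'. 0 \<le> \<tau>' \<and> (\<exists>y. z' = z @ y \<and> lists_primes {lo..hi} y)) \<tau> \<rho>\<^sub>i \<mu> z"
proof -
  let ?Q = "\<lambda>\<tau>' \<rho>' \<mu>' z'. 0 \<le> \<tau>' \<and> (\<exists>y. z' = z @ y \<and> lists_primes {lo..hi} y)"
  define T where "T = 40000 * (real L * real l)"
  define K where "K = (T + 2) * real ((hi + L - lo) div L) + 1"
  define X Y where "X = real L * real l" and "Y = real (hi - lo + L) * real l"
  have "X \<le> Y" unfolding X_def Y_def by (intro mult_right_mono) auto
  moreover have "(T + 2) * real ((hi + L - lo) div L) \<le> (40000 + 1) * Y"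
    unfolding T_def Y_def using lo by (intro window_count_bound) auto
  then have "K \<le> 40001 * Y + 1" by (simp add: K_def)
  moreover have "50000 * Y \<le> \<tau>" "3 * real l + 6 * real u + 30 \<le> X" using t setup_cost by (simp_all add: X_def Y_def)
  ultimately have KT: "3 * real l + 6 * real u + 8 + 5 + K \<le> \<tau>" by linarith
  have K0: "0 \<le> K" by (simp add: K_def T_def)
  have t0: "3 * real l + 6 * real u + 8 \<le> \<tau>" using KT K0 by linarith
  have wc: "writes c \<subseteq> {6, 7}" "\<not> stores c" "\<not> emits c" using c by (auto simp: selects_range_def)
  have W2: "2 \<le> W" using W L_le L_ge by linarith
  show ?thesis
    unfolding prime_program_def wp_Seq[of W B setup_params]
  proof (rule wp_use[OF wp_setup_params[where \<rho> = \<rho>\<^sub>i, OF r t0]])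
    fix \<tau>1 z1 and \<mu>1 :: "nat \<Rightarrow> bool" and \<rho>1 :: "nat \<Rightarrow> rat"
    assume p1: "\<tau> - (3 * real l + 6 * real u + 8) \<le> \<tau>1 \<and> \<rho>1 2 = nr l \<and> \<rho>1 4 = nr L \<and> \<rho>1 5 = nr s"
      and fr1: "\<forall>x. x \<notin> writes setup_params \<longrightarrow> \<rho>1 x = \<rho>\<^sub>i x" and em1: "\<not> emits setup_params \<longrightarrow> z1 = z"
    have z1: "z1 = z" using em1 by (simp add: setup_params_def)
    define \<rho>2 where "\<rho>2 = \<rho>1(9 := nr 2)"
    have r2: "\<rho>2 0 = \<rho>\<^sub>i 0" "\<rho>2 1 = \<rho>\<^sub>i 1" using fr1 by (auto simp: \<rho>2_def writes_setup_params)
    have sel: "wp W B c (\<lambda>\<tau>' \<rho>' \<mu>' z'. \<tau>1 - 1 - 4 \<le> \<tau>' \<and> \<rho>' 6 = nr lo \<and> \<rho>' 7 = nr hi) (\<tau>1 - 1) \<rho>2 \<mu>1 z1"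
      using c r2 unfolding selects_range_def by blast
    have "wp W B c (wp W B (windows prime_window) ?Q) (\<tau>1 - 1) \<rho>2 \<mu>1 z1"
    proof (rule wp_use[OF sel])
      fix \<tau>3 z3 and \<mu>3 :: "nat \<Rightarrow> bool" and \<rho>3 :: "nat \<Rightarrow> rat"
      assume p3: "\<tau>1 - 1 - 4 \<le> \<tau>3 \<and> \<rho>3 6 = nr lo \<and> \<rho>3 7 = nr hi" and fr3: "\<forall>x. x \<notin> writes c \<longrightarrow> \<rho>3 x = \<rho>2 x"
        and em3: "\<not> emits c \<longrightarrow> z3 = z1"
      have nw: "x \<notin> writes c" if "x \<noteq> 6" "x \<noteq> 7" for x using wc(1) that by auto
      have r3: "\<rho>3 4 = nr L" "\<rho>3 5 = nr s" "\<rho>3 9 = nr 2" using fr3 nw p1 by (auto simp: \<rho>2_def)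
      have z3: "z3 = z" using em3 wc z1 by simp
      interpret wb: window_body N l u L s W B prime_window lists_primes "\<lambda>_. True" hi \<rho>3 T
      proof
        show "writes prime_window \<inter> {..<10} = {}" using notin_writes_prime_window by auto
        show "0 \<le> T" by (simp add: T_def)
        show "lists_primes {} []" by (simp add: lists_primes_def)
        show "\<rho>3 4 = nr L" "\<rho>3 7 = nr hi" using r3 p3 by auto
        fix A \<tau> \<mu> z and \<rho> :: "nat \<Rightarrow> rat"
        assume A: "1 \<le> A" "A \<le> hi" and env: "\<forall>x<10. x \<noteq> 6 \<longrightarrow> \<rho> x = \<rho>3 x" and r6: "\<rho> 6 = nr A" and tt: "T \<le> \<tau>"
        have r': "\<rho> 4 = nr L" "\<rho> 5 = nr s" "\<rho> 7 = nr hi" "\<rho> 9 = nr 2" using env r3 p3 by auto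
        have "wp W B prime_window (\<lambda>\<tau>' \<rho>' \<mu>' z'. \<tau> - 40000 * (real L * real l) \<le> \<tau>' \<and>
             (\<exists>y. z' = z @ y \<and> lists_primes {n. A \<le> n \<and> n < A + L \<and> n \<le> hi} y)) \<tau> \<rho> \<mu> z"
          by (rule wp_prime_window) (use BL A lo r' r6 tt in \<open>auto simp: T_def\<close>)
        then show "wp W B prime_window (\<lambda>\<tau>' \<rho>' \<mu>' z'. \<tau> - T \<le> \<tau>' \<and> True \<and>
             (\<exists>y. z' = z @ y \<and> lists_primes {n. A \<le> n \<and> n < A + L \<and> n \<le> hi} y)) \<tau> \<rho> \<mu> z"
          unfolding T_def by (simp only: simp_thms)
      qed (use lo lists_primes_union in auto)
      have tK: "K \<le> \<tau>3" using p1 p3 KT by linarith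
      show "wp W B (windows prime_window) ?Q \<tau>3 \<rho>3 \<mu>3 z3"
      proof (rule wp_use[OF wb.wp_windows[OF lo(1,2) _ _ _ tK[unfolded K_def]]])
        fix \<tau>4 z4 and \<mu>4 :: "nat \<Rightarrow> bool" and \<rho>4 :: "nat \<Rightarrow> rat"
        assume "\<tau>3 - ((T + 2) * real ((hi + L - lo) div L) + 1) \<le> \<tau>4 \<and> (\<exists>y. z4 = z3 @ y \<and> lists_primes {lo..hi} y)"
        then show "?Q \<tau>4 \<rho>4 \<mu>4 z4" using tK unfolding z3 K_def by auto
      qed (use p3 in auto)
    qed
    then show "wp W B (Arith 9 Add (lit 2) (lit 0) ;; c ;; windows prime_window) ?Q \<tau>1 \<rho>1 \<mu>1 z1"
      using W2 W_pos unfolding \<rho>2_def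
      by (simp add: wp_Seq[of W B "Arith _ _ _ _"] wp_Seq[of W B c] wp_Arith opv_lit arith_nr fits_nr cong: wp_weak_cong)
  qed
qed

end

context factor_params
begin

lemma wp_factor_program:
  assumes c: "selects_range W c \<rho>\<^sub>i lo hi" and lo: "1 \<le> lo" "lo \<le> hi" "hi \<le> 2 * N" and r: "\<rho>\<^sub>i 0 = nr N"
    and t: "110000 * (real (hi - lo + L) * real l) \<le> \<tau>"
  shows "wp W B (factor_program c) (\<lambda>\<tau>' \<rho>' \<mu>' z'. 0 \<le> \<tau>' \<and> (\<exists>y. z' = z @ y \<and> lists_factorizations {lo..hi} y)) \<tau> \<rho>\<^sub>i (\<lambda>_. False) z"
proof -
  let ?Q = "\<lambda>\<tau>' \<rho>' \<mu>' z'. 0 \<le> \<tau>' \<and> (\<exists>y. z' = z @ y \<and> lists_factorizations {lo..hi} y)"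
  define T where "T = 100000 * (real L * real l)"
  define K where "K = (T + 2) * real ((hi + L - lo) div L) + 1"
  define X Y where "X = real L * real l" and "Y = real (hi - lo + L) * real l"
  have "X \<le> Y" unfolding X_def Y_def by (intro mult_right_mono) auto
  moreover have "(T + 2) * real ((hi + L - lo) div L) \<le> (100000 + 1) * Y"
    unfolding T_def Y_def using lo by (intro window_count_bound) auto
  then have "K \<le> 100001 * Y + 1" by (simp add: K_def)
  moreover have "110000 * Y \<le> \<tau>" "3 * real l + 6 * real u + 30 \<le> X" using t setup_cost by (simp_all add: X_def Y_def)
  ultimately have KT: "3 * real l + 6 * real u + 8 + 4 + 30 * (real L * real l) + 5 + K \<le> \<tau>" unfolding X_def[symmetric] by linarith
  have K0: "0 \<le> K" "0 \<le> real L * real l" by (simp_all add: K_def T_def)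
  have t0: "3 * real l + 6 * real u + 8 \<le> \<tau>" using KT K0 by linarith
  have wc: "writes c \<subseteq> {6, 7}" "\<not> stores c" "\<not> emits c" using c by (auto simp: selects_range_def)
  have nw: "x \<notin> writes c" if "x \<noteq> 6" "x \<noteq> 7" for x using wc(1) that by auto
  have W8: "8 * L \<le> W" "l + 2 \<le> W" "2 \<le> W" using W L_le L_ge two_power_w address_le(4) l
    by (linarith, metis le_trans less_imp_le less_exp w, linarith)
  let ?c3 = "Arith 9 Add (lit 1) (lit 0) ;; c ;; windows factor_window"
  show ?thesis
    unfolding factor_program_def wp_Seq[of W B setup_params]
  proof (rule wp_use[OF wp_setup_params[where \<rho> = \<rho>\<^sub>i, OF r t0]])
    fix \<tau>1 z1 and \<mu>1 :: "nat \<Rightarrow> bool" and \<rho>1 :: "nat \<Rightarrow> rat"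
    assume p1: "\<tau> - (3 * real l + 6 * real u + 8) \<le> \<tau>1 \<and> \<rho>1 2 = nr l \<and> \<rho>1 4 = nr L \<and> \<rho>1 5 = nr s"
      and fr1: "\<forall>x. x \<notin> writes setup_params \<longrightarrow> \<rho>1 x = \<rho>\<^sub>i x" and em1: "\<not> emits setup_params \<longrightarrow> z1 = z"
      and st1: "\<not> stores setup_params \<longrightarrow> \<mu>1 = (\<lambda>_. False)"
    have z1: "z1 = z" "\<mu>1 = (\<lambda>_. False)" using em1 st1 by (simp_all add: setup_params_def)
    define \<rho>2 where "\<rho>2 = \<rho>1(8 := nr w, 9 := nr 2, 10 := nr (8 * L), 6 := nr 1)"
    have r2: "\<rho>2 4 = nr L" "\<rho>2 5 = nr s" "\<rho>2 6 = nr 1" "\<rho>2 8 = nr w" "\<rho>2 10 = nr (8 * L)" "\<rho>2 9 = nr 2"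
      using p1 by (auto simp: \<rho>2_def)
    have r2i: "\<rho>2 0 = \<rho>\<^sub>i 0" "\<rho>2 1 = \<rho>\<^sub>i 1" using fr1 by (auto simp: \<rho>2_def writes_setup_params)
    have t2: "30 * (real L * real l) \<le> \<tau>1 - 4" using p1 KT K0 by linarith
    have b: "L \<le> 8 * L" "8 * L + L \<le> 9 * L" "1 \<le> (1::nat)" "1 \<le> 2 * N" using L_le L_ge by linarith+
    have "wp W B table_sieve (wp W B ?c3 ?Q) (\<tau>1 - 4) \<rho>2 \<mu>1 z1"
    proof (rule wp_use[OF wp_table_sieve[OF b r2 _ _ t2]])
      fix \<tau>3 z3 and \<mu>3 :: "nat \<Rightarrow> bool" and \<rho>3 :: "nat \<Rightarrow> rat"
      assume p3: "\<tau>1 - 4 - 30 * (real L * real l) \<le> \<tau>3 \<and>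
          max_divisors (8 * L) \<mu>1 {(d, j). 2 \<le> d \<and> d \<le> L \<and> j < L \<and> d dvd 1 + j \<and> 2 * d \<le> 1 + j} \<mu>3"
        and fr3: "\<forall>x. x \<notin> writes table_sieve \<longrightarrow> \<rho>3 x = \<rho>2 x" and em3: "\<not> emits table_sieve \<longrightarrow> z3 = z1"
      have z3: "z3 = z" using em3 z1 by (simp add: table_sieve_def init_table_def emits_for_loop small_sieve_def sieve_row_def
            record_divisor_def load_cell_def store_cell_def)
      have G: "divisor_table \<mu>3"
        by (rule divisor_table_init[of \<mu>1]) (use p3 in \<open>auto simp: z1 cell_def read_field_def\<close>)
      define \<rho>4 where "\<rho>4 = \<rho>3(9 := nr 1)"
      have r4: "\<rho>4 4 = nr L" "\<rho>4 5 = nr s" "\<rho>4 8 = nr w" "\<rho>4 9 = nr 1" "\<rho>4 0 = \<rho>\<^sub>i 0" "\<rho>4 1 = \<rho>\<^sub>i 1"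
        using fr3 r2 r2i by (auto simp: \<rho>4_def writes_table_sieve)
      have sel: "wp W B c (\<lambda>\<tau>' \<rho>' \<mu>' z'. \<tau>3 - 1 - 4 \<le> \<tau>' \<and> \<rho>' 6 = nr lo \<and> \<rho>' 7 = nr hi) (\<tau>3 - 1) \<rho>4 \<mu>3 z3"
        using c r4 unfolding selects_range_def by blast
      have "wp W B c (wp W B (windows factor_window) ?Q) (\<tau>3 - 1) \<rho>4 \<mu>3 z3"
      proof (rule wp_use[OF sel])
        fix \<tau>5 z5 and \<mu>5 :: "nat \<Rightarrow> bool" and \<rho>5 :: "nat \<Rightarrow> rat"
        assume p5: "\<tau>3 - 1 - 4 \<le> \<tau>5 \<and> \<rho>5 6 = nr lo \<and> \<rho>5 7 = nr hi" and fr5: "\<forall>x. x \<notin> writes c \<longrightarrow> \<rho>5 x = \<rho>4 x"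
          and em5: "\<not> emits c \<longrightarrow> z5 = z3" and st5: "\<not> stores c \<longrightarrow> \<mu>5 = \<mu>3"
        have r5: "\<rho>5 4 = nr L" "\<rho>5 5 = nr s" "\<rho>5 8 = nr w" "\<rho>5 9 = nr 1" using fr5 nw r4 by auto
        have z5: "z5 = z" "\<mu>5 = \<mu>3" using em5 st5 wc z3 by simp_all
        interpret wb: window_body N l u L s W B factor_window lists_factorizations divisor_table hi \<rho>5 T
        proof
          show "writes factor_window \<inter> {..<10} = {}" using writes_factor_window by auto
          show "0 \<le> T" by (simp add: T_def)
          show "lists_factorizations {} []" by (rule lists_factorizations_empty)
          show "\<rho>5 4 = nr L" "\<rho>5 7 = nr hi" using r5 p5 by auto
          fix A \<tau> \<mu> z and \<rho> :: "nat \<Rightarrow> rat"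
          assume A: "1 \<le> A" "A \<le> hi" and env: "\<forall>x<10. x \<noteq> 6 \<longrightarrow> \<rho> x = \<rho>5 x" and r6: "\<rho> 6 = nr A" and G': "divisor_table \<mu>" and tt: "T \<le> \<tau>"
          have r': "\<rho> 4 = nr L" "\<rho> 5 = nr s" "\<rho> 7 = nr hi" "\<rho> 8 = nr w" "\<rho> 9 = nr 1" using env r5 p5 by auto
          show "wp W B factor_window (\<lambda>\<tau>' \<rho>' \<mu>' z'. \<tau> - T \<le> \<tau>' \<and> divisor_table \<mu>' \<and>
             (\<exists>y. z' = z @ y \<and> lists_factorizations {n. A \<le> n \<and> n < A + L \<and> n \<le> hi} y)) \<tau> \<rho> \<mu> z"
            unfolding T_def by (rule wp_factor_window) (use A lo r' r6 tt G' in \<open>auto simp: T_def\<close>)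
        qed (use lo lists_factorizations_union in auto)
        have tK: "K \<le> \<tau>5" using p1 p3 p5 KT by linarith
        show "wp W B (windows factor_window) ?Q \<tau>5 \<rho>5 \<mu>5 z5"
        proof (rule wp_use[OF wb.wp_windows[OF lo(1,2) _ _ _ tK[unfolded K_def]]])
          fix \<tau>6 z6 and \<mu>6 :: "nat \<Rightarrow> bool" and \<rho>6 :: "nat \<Rightarrow> rat"
          assume "\<tau>5 - ((T + 2) * real ((hi + L - lo) div L) + 1) \<le> \<tau>6 \<and> (\<exists>y. z6 = z5 @ y \<and> lists_factorizations {lo..hi} y)"
          then show "?Q \<tau>6 \<rho>6 \<mu>6 z6" using tK unfolding z5 K_def by auto
        qed (use p5 G z5 in auto)
      qed
      then show "wp W B ?c3 ?Q \<tau>3 \<rho>3 \<mu>3 z3"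
        using W_pos unfolding \<rho>4_def
        by (simp add: wp_Seq[of W B "Arith _ _ _ _"] wp_Seq[of W B c] wp_Arith opv_lit arith_nr fits_nr del: One_nat_def cong: wp_weak_cong)
    qed auto
    then show "wp W B (Arith 8 Add (Reg 2) (lit 2) ;;
      Arith 9 Add (lit 2) (lit 0) ;;
      Arith 10 Mul (lit 8) (Reg 4) ;;
      Arith 6 Add (lit 1) (lit 0) ;; table_sieve ;; ?c3) ?Q \<tau>1 \<rho>1 \<mu>1 z1"
      using W8 W_pos p1 unfolding \<rho>2_def w
      by (simp add: wp_Seq[of W B "Arith _ _ _ _"] wp_Seq[of W B table_sieve] wp_Arith opv_lit arith_nr fits_nr del: One_nat_def cong: wp_weak_cong)
  qed
qed

end

text \<open>From 20 on, one step multiplies the left side by at most \<open>(21 / 20)^4 < 2\<close>.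
  The purpose is \<open>l^3 * l \<le> N\<close>, which gives \<open>l \<le> u\<close>.\<close>

lemma fourth_power_le: "20 \<le> l \<Longrightarrow> l ^ 4 \<le> 2 ^ (l - 1)" for l :: nat
proof (induction l rule: dec_induct)
  case base
  show ?case by simp
next
  case (step l)
  have "(Suc l) ^ 4 \<le> 2 * l ^ 4"
  proof -
    have "20 * (l + 1) \<le> 21 * l" using step by simp
    then have "(20 * (l + 1)) ^ 4 \<le> (21 * l) ^ 4" by (intro power_mono) auto
    then have "20 ^ 4 * (l + 1) ^ 4 \<le> 21 ^ 4 * l ^ 4" by (simp only: power_mult_distrib)
    then show ?thesis by simp
  qed
  also have "\<dots> \<le> 2 * 2 ^ (l - 1)" using step by simp
  also have "\<dots> = 2 ^ (Suc l - 1)" using step by (cases l) auto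
  finally show ?case .
qed

section \<open>Existence of the parameters and comparison with real powers\<close>

lemma sieve_params_exist:
  assumes "2 ^ 20 \<le> N"
  obtains l u where "sieve_params N l u (u * l) (4 * u) (100 * N)"
proof -
  define l where "l = floorlog 2 N"
  have N0: "0 < N" using assms by (cases N) auto
  have lN: "2 ^ (l - 1) \<le> N" "N < 2 ^ l" using floorlog_bounds[of N 2] N0 by (auto simp: l_def)
  have "Suc 20 \<le> l" unfolding l_def by (rule floorlog_ge_SucI[OF assms]) simp
  then have l20: "20 \<le> l" by simp
  define u where "u = Max {v. v ^ 3 * l \<le> N}"
  have "v \<le> N" if "v ^ 3 * l \<le> N" for v
  proof (cases "v = 0")
    case False
    then have "1 \<le> v * v" by (cases v) auto
    then have "v * 1 \<le> v * (v * v)" by (intro mult_left_mono) auto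
    also have "\<dots> = v ^ 3 * 1" by (simp add: power3_eq_cube)
    also have "\<dots> \<le> v ^ 3 * l" using l20 by (intro mult_left_mono) auto
    finally have "v \<le> v ^ 3 * l" by simp
    then show ?thesis using that by simp
  qed simp
  then have "{v. v ^ 3 * l \<le> N} \<subseteq> {..N}" by auto
  then have fin: "finite {v. v ^ 3 * l \<le> N}" by (rule finite_subset) simp
  have "l ^ 3 * l = l ^ 4" by (simp add: power3_eq_cube power4_eq_xxxx)
  then have ll: "l ^ 3 * l \<le> N" using fourth_power_le[OF l20] lN by linarith
  have uin: "u \<in> {v. v ^ 3 * l \<le> N}" unfolding u_def using fin ll by (intro Max_in) auto
  have lu: "l \<le> u" unfolding u_def using fin ll by (intro Max_ge) auto
  have uN: "N < (u + 1) ^ 3 * l"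
  proof (rule ccontr)
    assume "\<not> N < (u + 1) ^ 3 * l"
    then have "u + 1 \<in> {v. v ^ 3 * l \<le> N}" by simp
    then have "u + 1 \<le> Max {v. v ^ 3 * l \<le> N}" by (rule Max_ge[OF fin])
    then show False unfolding u_def by linarith
  qed
  have "sieve_params N l u (u * l) (4 * u) (100 * N)"
    by (rule sieve_params.intro[OF l20 lu lN _ uN]) (use uin in \<open>simp_all only: mem_Collect_eq order_refl\<close>)
  then show ?thesis by (rule that)
qed

context sieve_params
begin

lemma l_le_ln: "real l \<le> 2 * ln (real N)"
proof -
  have N0: "0 < N" using L_le L_ge by linarith
  \<comment> \<open>Splitting 1/2 as 3/4 times 2/3 and using \<open>ln x \<le> x - 1\<close> gives
    \<open>ln 2 \<ge> 7 / 12\<close>. This exceeds 1/2 by enough to replace \<open>l - 1\<close> by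
    \<open>l\<close> when \<open>l \<ge> 20\<close>.\<close>
  have "ln (1 / 2 :: real) = ln (3 / 4) + ln (2 / 3)" by (subst ln_mult_pos[symmetric]) auto
  also have "\<dots> \<le> - (7 / 12)" using ln_le_minus_one[of "3 / 4 :: real"] ln_le_minus_one[of "2 / 3 :: real"] by simp
  finally have "7 / 12 \<le> ln (2::real)" by (simp add: ln_div)
  then have "real (l - 1) * (7 / 12) \<le> real (l - 1) * ln 2" by (intro mult_left_mono) auto
  also have "\<dots> = ln (2 ^ (l - 1))" by (simp add: ln_realpow)
  also have "\<dots> \<le> ln (real N)"
  proof -
    have "real (2 ^ (l - 1)) \<le> real N" using N(1) by (simp only: of_nat_le_iff)
    then show ?thesis using N0 by (simp del: of_nat_le_iff)
  qed
  finally have "real (l - 1) * (7 / 12) \<le> ln (real N)" .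
  moreover have "real (l - 1) = real l - 1" "20 \<le> real l" using l by auto
  ultimately show ?thesis by linarith
qed

definition scale :: real where "scale = real N powr (1/3) * ln (real N) powr (2/3)"

lemma ln_pos: "1 \<le> ln (real N)"
  using l_le_ln l by linarith

lemma scale_cube: "scale ^ 3 = real N * (ln (real N))\<^sup>2"
proof -
  have N0: "0 < real N" using L_le L_ge by auto
  have "(real N powr (1/3)) ^ 3 = real N" using N0 by (simp add: powr_power)
  moreover have "(ln (real N) powr (2/3)) ^ 3 = (ln (real N))\<^sup>2" using ln_pos by (simp add: powr_power)
  ultimately show ?thesis by (simp add: scale_def power_mult_distrib)
qed

text \<open>Compare cubes: \<open>L^3 = (u^3 * l) * l^2 \<le> N * l^2\<close>, and \<open>l\<close>
  is at most twice the natural logarithm.\<close>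

lemma L_le_scale: "real L \<le> 2 * scale"
proof -
  have s0: "0 \<le> scale" by (simp add: scale_def)
  have "L ^ 3 = (u ^ 3 * l) * (l * l)" by (simp add: L power3_eq_cube)
  also have "\<dots> \<le> N * (l * l)" using u by (intro mult_right_mono) auto
  finally have "real (L ^ 3) \<le> real (N * (l * l))" by (simp only: of_nat_le_iff)
  then have "real L ^ 3 \<le> real N * (real l)\<^sup>2" by (simp add: power2_eq_square)
  also have "\<dots> \<le> real N * (2 * ln (real N))\<^sup>2" using l_le_ln by (intro mult_left_mono power_mono) auto
  also have "\<dots> = 4 * scale ^ 3" by (simp add: scale_cube power_mult_distrib)
  also have "\<dots> \<le> (2 * scale) ^ 3" using s0 by (simp add: power_mult_distrib)
  finally show ?thesis using s0 by (intro power_le_imp_le_base[of "real L" 2 "2 * scale"]) (auto simp: numeral_3_eq_3)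
qed

lemma floorlog_W_le: "W = 100 * N \<Longrightarrow> 2 * (floorlog 2 W + 1) \<le> 4 * l"
proof -
  assume "W = 100 * N"
  then have "W < 2 ^ (l + 7)" using N by (simp add: power_add)
  then have "floorlog 2 W \<le> l + 7" by (intro floorlog_leI) auto
  then show ?thesis using l by auto
qed

lemma l_le_L: "l \<le> L" using u_ge by (simp add: L)

end

lemma prime_program_performs:
  assumes sp: "sieve_params N l u L s (100 * N)" and c: "selects_range (100 * N) c (regs (init_state (N # xs))) lo hi"
    and lo: "1 \<le> lo" "lo \<le> hi" "hi \<le> 2 * N"
    and S: "(1 + 4 * real (card (com_regs (prime_program c)))) * real L \<le> S"
    and T: "50000 * (real (hi - lo + L) * real l) \<le> T"
  shows "performs (100 * N) (prime_program c) (N # xs) (lists_primes {lo..hi}) S T"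
proof (rule wp_imp_performs)
  interpret sieve_params N l u L s "100 * N" L by (rule sp)
  have "regs (init_state (N # xs)) 0 = nr N" by (simp add: init_state_def nr_def)
  then show "wp (100 * N) L (prime_program c) (\<lambda>\<tau>' \<rho>' \<mu>' z'. 0 \<le> \<tau>' \<and> lists_primes {lo..hi} z')
     (50000 * (real (hi - lo + L) * real l)) (regs (init_state (N # xs))) (\<lambda>_. False) []"
    using wp_prime_program[OF order_refl c lo _ order_refl, of "[]"] by simp
  let ?r = "card (com_regs (prime_program c))"
  have "?r * (2 * (floorlog 2 (100 * N) + 1)) \<le> ?r * (4 * L)"
    using floorlog_W_le l_le_L by (intro mult_left_mono) auto
  then have "L + ?r * (2 * (floorlog 2 (100 * N) + 1)) \<le> L + ?r * (4 * L)" by simp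
  then have "real (L + ?r * (2 * (floorlog 2 (100 * N) + 1))) \<le> real (L + ?r * (4 * L))" by (simp only: of_nat_le_iff)
  also have "\<dots> = (1 + 4 * real ?r) * real L" by (simp add: algebra_simps)
  finally show "real (L + ?r * (2 * (floorlog 2 (100 * N) + 1))) \<le> S" using S by linarith
qed (rule T)

lemma factor_program_performs:
  assumes sp: "sieve_params N l u L s (100 * N)" and c: "selects_range (100 * N) c (regs (init_state (N # xs))) lo hi"
    and lo: "1 \<le> lo" "lo \<le> hi" "hi \<le> 2 * N"
    and S: "(18 + 4 * real (card (com_regs (factor_program c)))) * (real L * real l) \<le> S"
    and T: "110000 * (real (hi - lo + L) * real l) \<le> T"
  shows "performs (100 * N) (factor_program c) (N # xs) (lists_factorizations {lo..hi}) S T"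
proof (rule wp_imp_performs)
  interpret factor_params N l u L s "100 * N" "9 * L * (l + 2)" "l + 2"
    by (intro factor_params.intro sp factor_params_axioms.intro) auto
  have "regs (init_state (N # xs)) 0 = nr N" by (simp add: init_state_def nr_def)
  then show "wp (100 * N) (9 * L * (l + 2)) (factor_program c) (\<lambda>\<tau>' \<rho>' \<mu>' z'. 0 \<le> \<tau>' \<and> lists_factorizations {lo..hi} z')
     (110000 * (real (hi - lo + L) * real l)) (regs (init_state (N # xs))) (\<lambda>_. False) []"
    using wp_factor_program[OF c lo _ order_refl, of "[]"] by simp
  let ?r = "card (com_regs (factor_program c))"
  have "1 * l \<le> L * l" using L_ge by (intro mult_right_mono) auto
  then have "2 * (floorlog 2 (100 * N) + 1) \<le> 4 * (L * l)" using floorlog_W_le[OF refl] by linarith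
  then have "?r * (2 * (floorlog 2 (100 * N) + 1)) \<le> ?r * (4 * (L * l))"
    by (intro mult_left_mono) auto
  moreover have "9 * L * (l + 2) \<le> 9 * L * (2 * l)" using l by (intro mult_left_mono) auto
  moreover have "9 * L * (2 * l) = 18 * (L * l)" by simp
  ultimately have "9 * L * (l + 2) + ?r * (2 * (floorlog 2 (100 * N) + 1)) \<le> 18 * (L * l) + ?r * (4 * (L * l))" by linarith
  then have "real (9 * L * (l + 2) + ?r * (2 * (floorlog 2 (100 * N) + 1))) \<le> real (18 * (L * l) + ?r * (4 * (L * l)))"
    by (simp only: of_nat_le_iff)
  also have "\<dots> = (18 + 4 * real ?r) * (real L * real l)" by (simp add: algebra_simps)
  finally show "real (9 * L * (l + 2) + ?r * (2 * (floorlog 2 (100 * N) + 1))) \<le> S" using S by linarith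
qed (rule T)

theorem mainTheorem1:
  "\<exists>(list_primes :: com) (factor_all :: com) (list_primes_near :: com) (factor_near :: com)
      (K :: nat) (C :: real). C > 0 \<and>
    (\<exists>N\<^sub>0 :: nat. \<forall>N \<ge> N\<^sub>0.
      performs (K * N) list_primes [N] (lists_primes {1..N})
        (C * (real N powr (1/3) * ln (real N) powr (2/3))) (C * (real N * ln (real N))) \<and>
      performs (K * N) factor_all [N] (lists_factorizations {1..N})
        (C * (real N powr (1/3) * ln (real N) powr (5/3))) (C * (real N * ln (real N))) \<and>
      (\<forall>\<Delta> :: nat. real N powr (1/3) * ln (real N) powr (2/3) \<le> real \<Delta> \<and> \<Delta> \<le> N \<longrightarrow>
        performs (K * N) list_primes_near [N, \<Delta>] (lists_primes {N - \<Delta>..N + \<Delta>})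
          (C * real \<Delta>) (C * (real \<Delta> * ln (real N)))) \<and>
      (\<forall>\<Delta> :: nat. real N powr (1/3) * ln (real N) powr (2/3) \<le> real \<Delta> \<and> \<Delta> \<le> N \<longrightarrow>
        performs (K * N) factor_near [N, \<Delta>] (lists_factorizations ({N - \<Delta>..N + \<Delta>} - {0}))
          (C * (real \<Delta> * ln (real N))) (C * (real \<Delta> * ln (real N)))))"
proof -
  let ?p1 = "prime_program whole_range" and ?p2 = "factor_program whole_range"
  let ?p3 = "prime_program near_range" and ?p4 = "factor_program near_range"
  define R where "R = real (card (com_regs ?p1)) + real (card (com_regs ?p2)) + real (card (com_regs ?p3)) + real (card (com_regs ?p4))"
  \<comment> \<open>The largest time factor is \<open>110000 * 4 * 2 = 880000\<close>, the largest
    space factor \<open>(18 + 4 * R) * 2 * 2 = 72 + 16 * R\<close>.\<close>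
  define C where "C = 1000000 + 16 * R"
  have R: "real (card (com_regs ?p1)) \<le> R" "real (card (com_regs ?p2)) \<le> R" "real (card (com_regs ?p3)) \<le> R"
    "real (card (com_regs ?p4)) \<le> R" "0 \<le> R"
    by (simp_all add: R_def)
  have C: "0 < C" using R by (simp add: C_def)
  have main: "performs (100 * N) ?p1 [N] (lists_primes {1..N})
        (C * (real N powr (1/3) * ln (real N) powr (2/3))) (C * (real N * ln (real N))) \<and>
      performs (100 * N) ?p2 [N] (lists_factorizations {1..N})
        (C * (real N powr (1/3) * ln (real N) powr (5/3))) (C * (real N * ln (real N))) \<and>
      (\<forall>\<Delta> :: nat. real N powr (1/3) * ln (real N) powr (2/3) \<le> real \<Delta> \<and> \<Delta> \<le> N \<longrightarrow>
        performs (100 * N) ?p3 [N, \<Delta>] (lists_primes {N - \<Delta>..N + \<Delta>})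
          (C * real \<Delta>) (C * (real \<Delta> * ln (real N)))) \<and>
      (\<forall>\<Delta> :: nat. real N powr (1/3) * ln (real N) powr (2/3) \<le> real \<Delta> \<and> \<Delta> \<le> N \<longrightarrow>
        performs (100 * N) ?p4 [N, \<Delta>] (lists_factorizations ({N - \<Delta>..N + \<Delta>} - {0}))
          (C * (real \<Delta> * ln (real N))) (C * (real \<Delta> * ln (real N))))"
    if N: "2 ^ 20 \<le> N" for N
  proof -
    obtain l u where sp: "sieve_params N l u (u * l) (4 * u) (100 * N)" using sieve_params_exist[OF N] .
    define L where "L = u * l"
    have sp: "sieve_params N l u L (4 * u) (100 * N)" using sp by (simp add: L_def)
    interpret sieve_params N l u L "4 * u" "100 * N" 0 by (rule sp)
    define \<Lambda> where "\<Lambda> = ln (real N)"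
    have N1: "1 \<le> N" "real L \<le> real N" using L_ge L_le by auto
    have \<Lambda>: "1 \<le> \<Lambda>" "real l \<le> 2 * \<Lambda>" using ln_pos l_le_ln by (auto simp: \<Lambda>_def)
    have sz: "0 \<le> scale" "real L \<le> 2 * scale" using L_le_scale by (auto simp: scale_def)
    have sz5: "real N powr (1/3) * ln (real N) powr (5/3) = scale * \<Lambda>"
    proof -
      have "\<Lambda> powr (5/3) = \<Lambda> powr (2/3 + 1)" by simp
      also have "\<dots> = \<Lambda> powr (2/3) * \<Lambda>" using \<Lambda> by (simp only: powr_add) simp
      finally show ?thesis by (simp add: scale_def \<Lambda>_def)
    qed
    have space1: "(1 + 4 * r) * real L \<le> C * x" if "r \<le> R" "0 \<le> r" "real L \<le> 2 * x" "0 \<le> x" for r x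
    proof -
      have "(1 + 4 * r) * real L \<le> (1 + 4 * R) * (2 * x)" using that by (intro mult_mono) auto
      also have "\<dots> = (2 + 8 * R) * x" by (simp add: algebra_simps)
      also have "\<dots> \<le> C * x" using that R by (intro mult_right_mono) (auto simp: C_def)
      finally show ?thesis .
    qed
    have space2: "(18 + 4 * r) * (real L * real l) \<le> C * (x * \<Lambda>)" if "r \<le> R" "0 \<le> r" "real L \<le> 2 * x" "0 \<le> x" for r x
    proof -
      have "(18 + 4 * r) * (real L * real l) \<le> (18 + 4 * R) * ((2 * x) * (2 * \<Lambda>))" using that \<Lambda> R by (intro mult_mono) auto
      also have "\<dots> = (72 + 16 * R) * (x * \<Lambda>)" by (simp add: algebra_simps)
      also have "\<dots> \<le> C * (x * \<Lambda>)" using that R \<Lambda> by (intro mult_right_mono) (auto simp: C_def)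
      finally show ?thesis .
    qed
    have time: "k * (real (hi - lo + L) * real l) \<le> C * (x * \<Lambda>)"
      if "real (hi - lo + L) \<le> 4 * x" "0 \<le> x" "k \<le> 110000" "0 \<le> k" for hi lo :: nat and k x
    proof -
      have "k * (real (hi - lo + L) * real l) \<le> 110000 * ((4 * x) * (2 * \<Lambda>))" using that \<Lambda> by (intro mult_mono) auto
      also have "\<dots> = 880000 * (x * \<Lambda>)" by simp
      also have "\<dots> \<le> C * (x * \<Lambda>)" using that R \<Lambda> by (intro mult_right_mono) (auto simp: C_def)
      finally show ?thesis .
    qed
    have whole: "selects_range (100 * N) whole_range (regs (init_state [N])) 1 N"
      using N1 by (intro selects_whole_range) (auto simp: init_state_def nr_def)
    have t1: "real (N - 1 + L) \<le> 4 * real N" using N1 by (simp add: of_nat_diff)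
    have "performs (100 * N) ?p1 [N] (lists_primes {1..N}) (C * scale) (C * (real N * \<Lambda>))"
      by (rule prime_program_performs[OF sp whole order_refl N1(1) _ space1 time[OF t1]]) (use sz R in auto)
    moreover have "performs (100 * N) ?p2 [N] (lists_factorizations {1..N}) (C * (scale * \<Lambda>)) (C * (real N * \<Lambda>))"
      by (rule factor_program_performs[OF sp whole order_refl N1(1) _ space2 time[OF t1]]) (use sz R in auto)
    moreover have "performs (100 * N) ?p3 [N, \<Delta>] (lists_primes {N - \<Delta>..N + \<Delta>}) (C * real \<Delta>) (C * (real \<Delta> * \<Lambda>)) \<and>
      performs (100 * N) ?p4 [N, \<Delta>] (lists_factorizations ({N - \<Delta>..N + \<Delta>} - {0})) (C * (real \<Delta> * \<Lambda>)) (C * (real \<Delta> * \<Lambda>))"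
      if D: "scale \<le> real \<Delta>" "\<Delta> \<le> N" for \<Delta>
    proof -
      let ?lo = "max 1 (N - \<Delta>)" and ?hi = "N + \<Delta>"
      have near: "selects_range (100 * N) near_range (regs (init_state [N, \<Delta>])) ?lo ?hi"
        using N1 D by (intro selects_near_range) (auto simp: init_state_def nr_def)
      have L2: "real L \<le> 2 * real \<Delta>" using sz D by linarith
      \<comment> \<open>The lower bound on \<open>\<Delta>\<close> enters here: a whole window is
        not longer than \<open>2 * \<Delta>\<close>, so rounding up to full windows costs a constant
        factor only.\<close>
      have t2: "real (?hi - ?lo + L) \<le> 4 * real \<Delta>" using L2 D by (auto simp: max_def)
      have lo: "1 \<le> ?lo" "?lo \<le> ?hi" "?hi \<le> 2 * N" using N1 D by auto
      have "performs (100 * N) ?p3 [N, \<Delta>] (lists_primes {?lo..?hi}) (C * real \<Delta>) (C * (real \<Delta> * \<Lambda>))"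
        by (rule prime_program_performs[OF sp near lo space1 time[OF t2]]) (use L2 R in auto)
      \<comment> \<open>Raising the lower end from 0 to 1 loses no prime.\<close>
      moreover have "{p \<in> {?lo..?hi}. prime p} = {p \<in> {N - \<Delta>..?hi}. prime p}" by (auto simp: prime_nat_iff)
      then have "lists_primes {?lo..?hi} = lists_primes {N - \<Delta>..?hi}" unfolding lists_primes_def by simp
      moreover have "performs (100 * N) ?p4 [N, \<Delta>] (lists_factorizations {?lo..?hi}) (C * (real \<Delta> * \<Lambda>)) (C * (real \<Delta> * \<Lambda>))"
        by (rule factor_program_performs[OF sp near lo space2 time[OF t2]]) (use L2 R in auto)
      moreover have "{?lo..?hi} = {N - \<Delta>..?hi} - {0}" by auto
      ultimately show ?thesis by simp
    qed
    ultimately show ?thesis unfolding sz5 scale_def[symmetric] \<Lambda>_def by blast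
  qed
  show ?thesis
    by (rule exI[of _ ?p1], rule exI[of _ ?p2], rule exI[of _ ?p3], rule exI[of _ ?p4], rule exI[of _ 100], rule exI[of _ C],
        intro conjI C exI[of _ "2 ^ 20"] allI impI) (use main in blast)+
qed

end
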